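(* Let $\Lambda$ be a normal subshift. If $\Lambda$ is $\lambda$-transitive, then the $C^*$-algebra $\mathcal{O}_{\Lambda^{\min}}$ is simple. If moreover $\Lambda$ is $\lambda$-transitive and satisfies $\lambda$-condition (I), then $\mathcal{O}_{\Lambda^{\min}}$ is simple and purely infinite.
   Context: Subshifts. Let $\Sigma$ be a finite alphabet. A subshift is a closed set $\Lambda\subset\Sigma^{\mathbb Z}$ with $\sigma(\Lambda)=\Lambda$, where $\sigma((x_n)_{n})=(x_{n+1})_{n}$. $B_l(\Lambda)$ is the set of words of length $l$ occurring in elements of $\Lambda$, $B_*(\Lambda)=\bigcup_{l\ge 0}B_l(\Lambda)$. $\Lambda$ is irreducible if for all $\mu,\nu\in B_*(\Lambda)$ there is $\eta$ with $\mu\eta\nu\in B_*(\Lambda)$. The right one-sided subshift is $X_\Lambda=\{(x_n)_{n\in\mathbb N}:(x_n)_{n\in\mathbb Z}\in\Lambda\}$ with shift map $\sigma_\Lambda$. For $\mu\in B_*(\Lambda)$ put $\Gamma_l^-(\mu)=\{\nu\in B_l(\Lambda):\nu\mu\in B_*(\Lambda)\}$ and $\Gamma_*^+(\mu)=\{\nu\in B_*(\Lambda):\mu\nu\in B_*(\Lambda)\}$. A word $\mu$ is $l$-synchronizing if $\Gamma_l^-(\mu)=\Gamma_l^-(\mu\omega)$ for all $\omega\in\Gamma_*^+(\mu)$; $S_l(\Lambda)$ denotes the set of $l$-synchronizing words. Words $\mu,\nu$ are $l$-past equivalent, $\mu\sim_l\nu$, if $\Gamma_l^-(\mu)=\Gamma_l^-(\nu)$.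 $\Lambda$ is $\lambda$-synchronizing if it is irreducible and for every $l$, every $\eta\in B_l(\Lambda)$ and every $k>l$ there is $\nu\in S_k(\Lambda)$ with $\eta\nu\in S_{k-l}(\Lambda)$. $\Lambda$ is normal if it is $\lambda$-synchronizing and $\Lambda$ is an infinite set. $\lambda$-transitivity: a $\lambda$-synchronizing $\Lambda$ is $\lambda$-transitive if for any $\mu,\nu\in S_l(\Lambda)$ there is $k=k_{\mu,\nu}\in\mathbb N$ such that for every $\eta\in S_{l+k}(\Lambda)$ with $\nu\sim_l\eta$ there exists $\xi\in B_k(\Lambda)$ with $\mu\sim_l\xi\eta$. $\lambda$-condition (I): a normal $\Lambda$ satisfies $\lambda$-condition (I) if for every $l\in\mathbb N$ and $\mu\in S_l(\Lambda)$ there exist $K\in\mathbb N$, $\nu\in S_{l+K}(\Lambda)$ and $\xi_1\neq\xi_2$ in $B_K(\Lambda)$ with $\xi_1\nu,\xi_2\nu\in B_*(\Lambda)$ and $\xi_1\nu\sim_l\xi_2\nu\sim_l\mu$. $\lambda$-graph systems and their $C^*$-algebras. A $\lambda$-graph system over $\Sigma$ is $\mathfrak L=(V,E,\lambda,\iota)$ where $V=\bigsqcup_{l\ge0}V_l$ with $V_l$ finite, $E=\bigsqcup_{l\ge0}E_{l,l+1}$ with each $e\in E_{l,l+1}$ having source $s(e)\in V_l$ and terminal $t(e)\in V_{l+1}$, $\lambda:E\to\Sigma$ a labeling, $\iota:V_{l+1}\to V_l$ surjections, every vertex has an outgoing edge and every vertex of $V_{l+1}$ an incoming edge, and (local property)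 for $u\in V_{l-1}$, $v\in V_{l+1}$ there is a label-preserving bijection between $\{e\in E_{l,l+1}:t(e)=v,\ \iota(s(e))=u\}$ and $\{e\in E_{l-1,l}:s(e)=u,\ t(e)=\iota(v)\}$. It is left-resolving if $t(e)=t(f)$, $\lambda(e)=\lambda(f)$ imply $e=f$. Write $V_l=\{v_1^l,\dots,v_{m(l)}^l\}$, $A_{l,l+1}(i,\alpha,j)=1$ if there is an edge from $v_i^l$ to $v_j^{l+1}$ labeled $\alpha$ and $0$ otherwise, $I_{l,l+1}(i,j)=1$ if $\iota(v_j^{l+1})=v_i^l$ and $0$ otherwise. The presented subshift $\Lambda_{\mathfrak L}$ is the subshift whose admissible words are the label sequences of finite paths. For left-resolving $\mathfrak L$, $\mathcal O_{\mathfrak L}$ is the universal unital $C^*$-algebra generated by partial isometries $S_\alpha$ ($\alpha\in\Sigma$) and projections $E_i^l$ ($v_i^l\in V_l$, $l\ge0$) subject to $\sum_{\beta}S_\beta S_\beta^*=\sum_{i=1}^{m(l)}E_i^l=1$, $S_\alpha S_\alpha^*E_i^l=E_i^lS_\alpha S_\alpha^*$, $E_i^l=\sum_j I_{l,l+1}(i,j)E_j^{l+1}$, $S_\alpha^*E_i^lS_\alpha=\sum_jA_{l,l+1}(i,\alpha,j)E_j^{l+1}$. Minimal presentation. For a $\lambda$-synchronizing $\Lambda$, its minimal presentation $\mathfrak L_\Lambda^{\min}$ is the $\lambda$-graph system with $V_0$ a single vertex, $V_l=S_l(\Lambda)/\!\sim_l$ (classes $[\mu]_l$) for $l\ge1$,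 an edge labeled $\alpha$ from $[\alpha\nu]_l$ to $[\nu]_{l+1}$ for each $\nu\in S_{l+1}(\Lambda)$ and $\alpha\in\Sigma$ with $\alpha\nu\in B_*(\Lambda)$, and $\iota([\nu]_{l+1})=[\nu]_l$. It is left-resolving and presents $\Lambda$. Set $\mathcal O_{\Lambda^{\min}}:=\mathcal O_{\mathfrak L_\Lambda^{\min}}$. *)

theory Defs
  imports Complex_Main "HOL-Algebra.Ring"
begin

definition shift :: "(int \<Rightarrow> 's) \<Rightarrow> (int \<Rightarrow> 's)" where
  "shift x = (\<lambda>n. x (n + 1))"

text \<open>Closedness in the product topology of the discrete alphabet: a point all of whose
  central windows agree with points of the set belongs to the set.\<close>
definition shift_closed :: "(int \<Rightarrow> 's) set \<Rightarrow> bool" where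
  "shift_closed L \<longleftrightarrow>
     (\<forall>x. (\<forall>N::nat. \<exists>y\<in>L. \<forall>n. \<bar>n\<bar> \<le> int N \<longrightarrow> y n = x n) \<longrightarrow> x \<in> L)"

definition subshift :: "(int \<Rightarrow> 's::finite) set \<Rightarrow> bool" where
  "subshift L \<longleftrightarrow> shift_closed L \<and> shift ` L = L"

definition occurs_in :: "'s list \<Rightarrow> (int \<Rightarrow> 's) \<Rightarrow> bool" where
  "occurs_in w x \<longleftrightarrow> (\<exists>k::int. \<forall>i<length w. x (k + int i) = w ! i)"

definition Bstar :: "(int \<Rightarrow> 's) set \<Rightarrow> 's list set" where
  "Bstar L = {w. \<exists>x\<in>L. occurs_in w x}"

definition Bl :: "(int \<Rightarrow> 's) set \<Rightarrow> nat \<Rightarrow> 's list set" where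
  "Bl L l = {w \<in> Bstar L. length w = l}"

definition irreducible_shift :: "(int \<Rightarrow> 's) set \<Rightarrow> bool" where
  "irreducible_shift L \<longleftrightarrow>
     (\<forall>\<mu>\<in>Bstar L. \<forall>\<nu>\<in>Bstar L. \<exists>\<eta>. \<mu> @ \<eta> @ \<nu> \<in> Bstar L)"

definition Gamma_minus :: "(int \<Rightarrow> 's) set \<Rightarrow> nat \<Rightarrow> 's list \<Rightarrow> 's list set" where
  "Gamma_minus L l \<mu> = {\<nu> \<in> Bl L l. \<nu> @ \<mu> \<in> Bstar L}"

definition Gamma_plus :: "(int \<Rightarrow> 's) set \<Rightarrow> 's list \<Rightarrow> 's list set" where
  "Gamma_plus L \<mu> = {\<nu> \<in> Bstar L. \<mu> @ \<nu> \<in> Bstar L}"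

definition Sync :: "(int \<Rightarrow> 's) set \<Rightarrow> nat \<Rightarrow> 's list set" where
  "Sync L l = {\<mu> \<in> Bstar L. \<forall>\<omega>\<in>Gamma_plus L \<mu>. Gamma_minus L l \<mu> = Gamma_minus L l (\<mu> @ \<omega>)}"

definition past_eq :: "(int \<Rightarrow> 's) set \<Rightarrow> nat \<Rightarrow> 's list \<Rightarrow> 's list \<Rightarrow> bool" where
  "past_eq L l \<mu> \<nu> \<longleftrightarrow> Gamma_minus L l \<mu> = Gamma_minus L l \<nu>"

definition lambda_synchronizing :: "(int \<Rightarrow> 's) set \<Rightarrow> bool" where
  "lambda_synchronizing L \<longleftrightarrow> irreducible_shift L \<and>
     (\<forall>l \<eta> k. \<eta> \<in> Bl L l \<and> k > l \<longrightarrow> (\<exists>\<nu>\<in>Sync L k. \<eta> @ \<nu> \<in> Sync L (k - l)))"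

definition normal_subshift :: "(int \<Rightarrow> 's::finite) set \<Rightarrow> bool" where
  "normal_subshift L \<longleftrightarrow> subshift L \<and> lambda_synchronizing L \<and> infinite L"

definition lambda_transitive :: "(int \<Rightarrow> 's) set \<Rightarrow> bool" where
  "lambda_transitive L \<longleftrightarrow> lambda_synchronizing L \<and>
     (\<forall>l. \<forall>\<mu>\<in>Sync L l. \<forall>\<nu>\<in>Sync L l. \<exists>k::nat.
        \<forall>\<eta>\<in>Sync L (l + k). past_eq L l \<nu> \<eta> \<longrightarrow>
          (\<exists>\<xi>\<in>Bl L k. past_eq L l \<mu> (\<xi> @ \<eta>)))"

definition lambda_condition_I :: "(int \<Rightarrow> 's) set \<Rightarrow> bool" where
  "lambda_condition_I L \<longleftrightarrow>
     (\<forall>l. \<forall>\<mu>\<in>Sync L l. \<exists>K::nat. \<exists>\<nu>\<in>Sync L (l + K). \<exists>\<xi>1\<in>Bl L K. \<exists>\<xi>2\<in>Bl L K.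
        \<xi>1 \<noteq> \<xi>2 \<and> \<xi>1 @ \<nu> \<in> Bstar L \<and> \<xi>2 @ \<nu> \<in> Bstar L \<and>
        past_eq L l (\<xi>1 @ \<nu>) (\<xi>2 @ \<nu>) \<and> past_eq L l (\<xi>2 @ \<nu>) \<mu>)"

text \<open>The vertex \<open>[\<mu>]_l\<close> is represented by the \<open>\<sim>_l\<close>-class of \<open>\<mu>\<close> inside \<open>S_l(\<Lambda>)\<close>.
  For \<open>l = 0\<close> all admissible words are 0-synchronizing and 0-past equivalent,
  so \<open>V_0\<close> is the single vertex (for nonempty \<open>\<Lambda>\<close>).\<close>
definition vclass :: "(int \<Rightarrow> 's) set \<Rightarrow> nat \<Rightarrow> 's list \<Rightarrow> 's list set" where
  "vclass L l \<mu> = {\<nu> \<in> Sync L l. past_eq L l \<nu> \<mu>}"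

definition Vmin :: "(int \<Rightarrow> 's) set \<Rightarrow> nat \<Rightarrow> 's list set set" where
  "Vmin L l = vclass L l ` Sync L l"

text \<open>\<open>A_{l,l+1}(u,\<alpha>,v) = 1\<close>: there is an edge labeled \<open>\<alpha>\<close> from \<open>u\<in>V_l\<close> to \<open>v\<in>V_{l+1}\<close>.\<close>
definition Amin :: "(int \<Rightarrow> 's) set \<Rightarrow> nat \<Rightarrow> 's list set \<Rightarrow> 's \<Rightarrow> 's list set \<Rightarrow> bool" where
  "Amin L l u \<alpha> v \<longleftrightarrow> (\<exists>\<nu>\<in>Sync L (Suc l). \<alpha> # \<nu> \<in> Bstar L \<and>
       u = vclass L l (\<alpha> # \<nu>) \<and> v = vclass L (Suc l) \<nu>)"

text \<open>\<open>I_{l,l+1}(u,v) = 1\<close>: \<open>\<iota>(v) = u\<close>, where \<open>\<iota>([\<nu>]_{l+1}) = [\<nu>]_l\<close>.\<close>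
definition Imin :: "(int \<Rightarrow> 's) set \<Rightarrow> nat \<Rightarrow> 's list set \<Rightarrow> 's list set \<Rightarrow> bool" where
  "Imin L l u v \<longleftrightarrow> (\<exists>\<nu>\<in>Sync L (Suc l). u = vclass L l \<nu> \<and> v = vclass L (Suc l) \<nu>)"

record 'a cstar = "'a ring" +
  smult :: "complex \<Rightarrow> 'a \<Rightarrow> 'a"
  star :: "'a \<Rightarrow> 'a"
  cnorm :: "'a \<Rightarrow> real"

definition unital_cstar_algebra :: "('a, 'm) cstar_scheme \<Rightarrow> bool" where
  "unital_cstar_algebra A \<longleftrightarrow> ring A \<and>
    (\<forall>c. \<forall>x\<in>carrier A. smult A c x \<in> carrier A) \<and>
    (\<forall>c. \<forall>x\<in>carrier A. \<forall>y\<in>carrier A. smult A c (add A x y) = add A (smult A c x) (smult A c y)) \<and>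
    (\<forall>c d. \<forall>x\<in>carrier A. smult A (c + d) x = add A (smult A c x) (smult A d x)) \<and>
    (\<forall>c d. \<forall>x\<in>carrier A. smult A c (smult A d x) = smult A (c * d) x) \<and>
    (\<forall>x\<in>carrier A. smult A 1 x = x) \<and>
    (\<forall>c. \<forall>x\<in>carrier A. \<forall>y\<in>carrier A.
        smult A c (mult A x y) = mult A (smult A c x) y \<and>
        smult A c (mult A x y) = mult A x (smult A c y)) \<and>
    (\<forall>x\<in>carrier A. star A x \<in> carrier A) \<and>
    (\<forall>x\<in>carrier A. star A (star A x) = x) \<and>
    (\<forall>x\<in>carrier A. \<forall>y\<in>carrier A. star A (add A x y) = add A (star A x) (star A y)) \<and>
    (\<forall>c. \<forall>x\<in>carrier A. star A (smult A c x) = smult A (cnj c) (star A x)) \<and>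
    (\<forall>x\<in>carrier A. \<forall>y\<in>carrier A. star A (mult A x y) = mult A (star A y) (star A x)) \<and>
    (\<forall>x\<in>carrier A. cnorm A x \<ge> 0 \<and> (cnorm A x = 0 \<longleftrightarrow> x = zero A)) \<and>
    (\<forall>x\<in>carrier A. \<forall>y\<in>carrier A. cnorm A (add A x y) \<le> cnorm A x + cnorm A y) \<and>
    (\<forall>c. \<forall>x\<in>carrier A. cnorm A (smult A c x) = cmod c * cnorm A x) \<and>
    (\<forall>x\<in>carrier A. \<forall>y\<in>carrier A. cnorm A (mult A x y) \<le> cnorm A x * cnorm A y) \<and>
    (\<forall>x\<in>carrier A. cnorm A (mult A (star A x) x) = (cnorm A x)\<^sup>2) \<and>
    (\<forall>f. (\<forall>n. f n \<in> carrier A) \<and>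
         (\<forall>e::real>0. \<exists>N::nat. \<forall>m\<ge>N. \<forall>n\<ge>N. cnorm A (a_minus A (f m) (f n)) < e) \<longrightarrow>
         (\<exists>x\<in>carrier A. \<forall>e::real>0. \<exists>N::nat. \<forall>n\<ge>N. cnorm A (a_minus A (f n) x) < e))"

definition norm_closed :: "('a, 'm) cstar_scheme \<Rightarrow> 'a set \<Rightarrow> bool" where
  "norm_closed A X \<longleftrightarrow> X \<subseteq> carrier A \<and>
     (\<forall>f. \<forall>x\<in>carrier A. (\<forall>n. f n \<in> X) \<and>
        (\<forall>e::real>0. \<exists>N::nat. \<forall>n\<ge>N. cnorm A (a_minus A (f n) x) < e) \<longrightarrow> x \<in> X)"

definition cstar_subalgebra :: "('a, 'm) cstar_scheme \<Rightarrow> 'a set \<Rightarrow> bool" where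
  "cstar_subalgebra A X \<longleftrightarrow> norm_closed A X \<and> zero A \<in> X \<and>
     (\<forall>x\<in>X. \<forall>y\<in>X. add A x y \<in> X \<and> mult A x y \<in> X) \<and>
     (\<forall>c. \<forall>x\<in>X. smult A c x \<in> X) \<and> (\<forall>x\<in>X. star A x \<in> X)"

definition generated_by :: "('a, 'm) cstar_scheme \<Rightarrow> 'a set \<Rightarrow> bool" where
  "generated_by A G \<longleftrightarrow>
     (\<forall>X. cstar_subalgebra A X \<and> one A \<in> X \<and> G \<subseteq> X \<longrightarrow> X = carrier A)"

definition unital_star_hom ::
  "('a, 'm) cstar_scheme \<Rightarrow> ('b, 'n) cstar_scheme \<Rightarrow> ('a \<Rightarrow> 'b) \<Rightarrow> bool" where
  "unital_star_hom A B h \<longleftrightarrow> h ` carrier A \<subseteq> carrier B \<and> h (one A) = one B \<and>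
     (\<forall>x\<in>carrier A. \<forall>y\<in>carrier A. h (add A x y) = add B (h x) (h y) \<and>
                                   h (mult A x y) = mult B (h x) (h y)) \<and>
     (\<forall>c. \<forall>x\<in>carrier A. h (smult A c x) = smult B c (h x)) \<and>
     (\<forall>x\<in>carrier A. h (star A x) = star B (h x))"

definition is_projection :: "('a, 'm) cstar_scheme \<Rightarrow> 'a \<Rightarrow> bool" where
  "is_projection A p \<longleftrightarrow> p \<in> carrier A \<and> mult A p p = p \<and> star A p = p"

definition is_partial_isometry :: "('a, 'm) cstar_scheme \<Rightarrow> 'a \<Rightarrow> bool" where
  "is_partial_isometry A s \<longleftrightarrow> s \<in> carrier A \<and> is_projection A (mult A (star A s) s)"

definition closed_ideal :: "('a, 'm) cstar_scheme \<Rightarrow> 'a set \<Rightarrow> bool" where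
  "closed_ideal A I \<longleftrightarrow> norm_closed A I \<and> zero A \<in> I \<and>
     (\<forall>x\<in>I. \<forall>y\<in>I. add A x y \<in> I) \<and> (\<forall>c. \<forall>x\<in>I. smult A c x \<in> I) \<and>
     (\<forall>x\<in>I. \<forall>a\<in>carrier A. mult A a x \<in> I \<and> mult A x a \<in> I)"

definition simple_cstar :: "('a, 'm) cstar_scheme \<Rightarrow> bool" where
  "simple_cstar A \<longleftrightarrow> carrier A \<noteq> {zero A} \<and>
     (\<forall>I. closed_ideal A I \<longrightarrow> I = {zero A} \<or> I = carrier A)"

definition positive :: "('a, 'm) cstar_scheme \<Rightarrow> 'a \<Rightarrow> bool" where
  "positive A a \<longleftrightarrow> (\<exists>x\<in>carrier A. a = mult A (star A x) x)"

definition hereditary :: "('a, 'm) cstar_scheme \<Rightarrow> 'a set \<Rightarrow> bool" where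
  "hereditary A H \<longleftrightarrow> cstar_subalgebra A H \<and>
     (\<forall>a\<in>carrier A. \<forall>b\<in>H. positive A a \<and> positive A b \<and> positive A (a_minus A b a) \<longrightarrow> a \<in> H)"

definition mvn_equiv :: "('a, 'm) cstar_scheme \<Rightarrow> 'a \<Rightarrow> 'a \<Rightarrow> bool" where
  "mvn_equiv A p q \<longleftrightarrow> (\<exists>v\<in>carrier A. mult A (star A v) v = p \<and> mult A v (star A v) = q)"

definition infinite_projection :: "('a, 'm) cstar_scheme \<Rightarrow> 'a \<Rightarrow> bool" where
  "infinite_projection A p \<longleftrightarrow> is_projection A p \<and>
     (\<exists>q. is_projection A q \<and> mult A q p = q \<and> q \<noteq> p \<and> mvn_equiv A p q)"

definition purely_infinite :: "('a, 'm) cstar_scheme \<Rightarrow> bool" where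
  "purely_infinite A \<longleftrightarrow>
     (\<forall>H. hereditary A H \<and> H \<noteq> {zero A} \<longrightarrow> (\<exists>p\<in>H. infinite_projection A p))"

definition min_relations ::
  "(int \<Rightarrow> 's::finite) set \<Rightarrow> ('a, 'm) cstar_scheme \<Rightarrow> ('s \<Rightarrow> 'a) \<Rightarrow> (nat \<Rightarrow> 's list set \<Rightarrow> 'a) \<Rightarrow> bool" where
  "min_relations L A S E \<longleftrightarrow>
     (\<forall>\<alpha>. is_partial_isometry A (S \<alpha>)) \<and>
     (\<forall>l. \<forall>v\<in>Vmin L l. is_projection A (E l v)) \<and>
     finsum A (\<lambda>\<beta>. mult A (S \<beta>) (star A (S \<beta>))) UNIV = one A \<and>
     (\<forall>l. finsum A (E l) (Vmin L l) = one A) \<and>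
     (\<forall>l \<alpha>. \<forall>v\<in>Vmin L l.
        mult A (mult A (S \<alpha>) (star A (S \<alpha>))) (E l v) = mult A (E l v) (mult A (S \<alpha>) (star A (S \<alpha>)))) \<and>
     (\<forall>l. \<forall>u\<in>Vmin L l. E l u = finsum A (E (Suc l)) {v \<in> Vmin L (Suc l). Imin L l u v}) \<and>
     (\<forall>l \<alpha>. \<forall>u\<in>Vmin L l. mult A (mult A (star A (S \<alpha>)) (E l u)) (S \<alpha>) =
        finsum A (E (Suc l)) {v \<in> Vmin L (Suc l). Amin L l u \<alpha> v})"

text \<open>\<open>(A,S,E)\<close> is the universal unital C*-algebra for these relations. Universality is
  required against all unital C*-algebras whose carrier lies in the type \<open>nat \<Rightarrow> complex\<close>
  (of continuum cardinality); since the relevant C*-algebras are separable, every target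
  C*-algebra can be reduced to one of this form, so this is the usual universal property.\<close>
definition is_O_min ::
  "(int \<Rightarrow> 's::finite) set \<Rightarrow> ('a, 'm) cstar_scheme \<Rightarrow> ('s \<Rightarrow> 'a) \<Rightarrow> (nat \<Rightarrow> 's list set \<Rightarrow> 'a) \<Rightarrow> bool" where
  "is_O_min L A S E \<longleftrightarrow> unital_cstar_algebra A \<and> min_relations L A S E \<and>
     generated_by A (range S \<union> {E l v | l v. v \<in> Vmin L l}) \<and>
     (\<forall>(B :: (nat \<Rightarrow> complex) cstar) S' E'.
        unital_cstar_algebra B \<and> min_relations L B S' E' \<longrightarrow>
        (\<exists>h. unital_star_hom A B h \<and> (\<forall>\<alpha>. h (S \<alpha>) = S' \<alpha>) \<and>
             (\<forall>l. \<forall>v\<in>Vmin L l. h (E l v) = E' l v)))"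

end

theory Submission
  imports Defs "HOL-Algebra.QuotRing" "HOL-Library.Countable_Set"
    "HOL-Analysis.L2_Norm" "HOL-Analysis.Operator_Norm" "HOL-Analysis.Infinite_Sum"
begin

text \<open>The monomials \<open>S\<^sub>\<mu> E S\<^sub>\<nu>\<^sup>*\<close> span a dense subalgebra graded by \<open>|\<mu>| - |\<nu>|\<close>. Since the gauge action comes from the
  universal property, Fejer means are contractions and every \<open>b \<noteq> 0\<close> is approximated by a sum \<open>y\<close> of homogeneous
  elements one of which is large. Compressing \<open>y y\<^sup>*\<close> first by a vector that almost attains the norm of that element
  and then by \<open>S\<^sub>\<xi>\<close> for an aperiodic word \<open>\<xi>\<close>, which exists because the subshift is infinite and
  \<open>\<lambda>\<close>-synchronizing, leaves a large multiple of a vertex projection. Hence some \<open>t\<close> satisfies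
  \<open>t\<^sup>* b b\<^sup>* t = e\<close> for a vertex projection \<open>e\<close>. By \<open>\<lambda>\<close>-transitivity an ideal containing one vertex projection
  contains the unit; condition (I) moreover makes every vertex projection infinite, and \<open>b\<^sup>* t\<close> carries \<open>e\<close>
  into the hereditary subalgebra generated by \<open>b\<close>. The algebra is nonzero because it is represented on
  the \<open>l\<^sup>2\<close> space of a countable set of synchronizing points.\<close>

section \<open>Elementary C*-algebra theory\<close>

text \<open>The textbook route through a faithful conditional expectation onto the gauge-fixed core,
  its AF structure and functional calculus is replaced by elementary estimates. Positivity is
  handled by norms: square roots and inverses are fixed points of contractions, and relations such
  as r r + s s = 1 stand in for spectra. The product y y\<dagger> is compressed rather than y
  because the degree zero part of y may vanish, whereas that of y y\<dagger> is the sum of the y_d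
  y_d\<dagger>; these compress to nonnegative scalars, so nothing cancels and the large term
  survives. Two features of the definitions shape the rest. The relations ask that the vertex
  projections, and the range projections of the \<open>S \<alpha>\<close>, add up to one but not
  that they are orthogonal; this has to be deduced. And universality is only required against
  algebras carried by \<open>nat \<Rightarrow> complex\<close>: the algebra itself must be embedded
  there, by separability, to obtain the gauge action, and so must the operators on l^2, by their
  matrices, to see that the algebra is nonzero.\<close>

locale cstar_alg =
  fixes A :: "('a, 'm) cstar_scheme" (structure)
  assumes cstar: "unital_cstar_algebra A"
begin

sublocale ring A
  using cstar by (simp add: unital_cstar_algebra_def)

abbreviation scal :: "complex \<Rightarrow> 'a \<Rightarrow> 'a" (infixr \<open>\<odot>\<close> 75) where "c \<odot> x \<equiv> smult A c x"
abbreviation adjo :: "'a \<Rightarrow> 'a" (\<open>_\<dagger>\<close> [1000] 1000) where "x\<dagger> \<equiv> star A x"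
abbreviation nrm :: "'a \<Rightarrow> real" where "nrm \<equiv> cnorm A"

lemma sc_closed [simp, intro]: "x \<in> carrier A \<Longrightarrow> c \<odot> x \<in> carrier A"
  and sc_add_right: "x \<in> carrier A \<Longrightarrow> y \<in> carrier A \<Longrightarrow> c \<odot> (x \<oplus> y) = c \<odot> x \<oplus> c \<odot> y"
  and sc_add_left: "x \<in> carrier A \<Longrightarrow> (c + d) \<odot> x = c \<odot> x \<oplus> d \<odot> x"
  and sc_sc [simp]: "x \<in> carrier A \<Longrightarrow> c \<odot> d \<odot> x = (c * d) \<odot> x"
  and sc_one [simp]: "x \<in> carrier A \<Longrightarrow> 1 \<odot> x = x"
  and sc_mult_left [simp]: "x \<in> carrier A \<Longrightarrow> y \<in> carrier A \<Longrightarrow> (c \<odot> x) \<otimes> y = c \<odot> (x \<otimes> y)"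
  and sc_mult_right [simp]: "x \<in> carrier A \<Longrightarrow> y \<in> carrier A \<Longrightarrow> x \<otimes> (c \<odot> y) = c \<odot> (x \<otimes> y)"
  and adj_closed [simp, intro]: "x \<in> carrier A \<Longrightarrow> x\<dagger> \<in> carrier A"
  and adj_adj [simp]: "x \<in> carrier A \<Longrightarrow> x\<dagger>\<dagger> = x"
  and adj_add [simp]: "x \<in> carrier A \<Longrightarrow> y \<in> carrier A \<Longrightarrow> (x \<oplus> y)\<dagger> = x\<dagger> \<oplus> y\<dagger>"
  and adj_sc [simp]: "x \<in> carrier A \<Longrightarrow> (c \<odot> x)\<dagger> = cnj c \<odot> x\<dagger>"
  and adj_mult [simp]: "x \<in> carrier A \<Longrightarrow> y \<in> carrier A \<Longrightarrow> (x \<otimes> y)\<dagger> = y\<dagger> \<otimes> x\<dagger>"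
  and nrm_ge [simp]: "x \<in> carrier A \<Longrightarrow> 0 \<le> nrm x"
  and nrm_eq_0 [simp]: "x \<in> carrier A \<Longrightarrow> nrm x = 0 \<longleftrightarrow> x = \<zero>"
  and nrm_add: "x \<in> carrier A \<Longrightarrow> y \<in> carrier A \<Longrightarrow> nrm (x \<oplus> y) \<le> nrm x + nrm y"
  and nrm_sc [simp]: "x \<in> carrier A \<Longrightarrow> nrm (c \<odot> x) = cmod c * nrm x"
  and nrm_mult: "x \<in> carrier A \<Longrightarrow> y \<in> carrier A \<Longrightarrow> nrm (x \<otimes> y) \<le> nrm x * nrm y"
  and nrm_cstar: "x \<in> carrier A \<Longrightarrow> nrm (x\<dagger> \<otimes> x) = (nrm x)\<^sup>2"
  using cstar unfolding unital_cstar_algebra_def by metis+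

lemma complete:
  assumes "\<And>n. f n \<in> carrier A"
    and "\<And>e. 0 < e \<Longrightarrow> \<exists>N::nat. \<forall>m\<ge>N. \<forall>n\<ge>N. nrm (f m \<ominus> f n) < e"
  obtains x where "x \<in> carrier A" "(\<lambda>n. nrm (f n \<ominus> x)) \<longlonglongrightarrow> 0"
proof -
  have "\<exists>x\<in>carrier A. \<forall>e>0. \<exists>N. \<forall>n\<ge>N. nrm (f n \<ominus> x) < e"
    using cstar assms unfolding unital_cstar_algebra_def by blast
  then obtain x where x: "x \<in> carrier A" "\<forall>e>0. \<exists>N. \<forall>n\<ge>N. nrm (f n \<ominus> x) < e" by blast
  have "(\<lambda>n. nrm (f n \<ominus> x)) \<longlonglongrightarrow> 0"
    using x assms(1) by (auto simp: LIMSEQ_iff)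
  then show thesis using that x by blast
qed

lemma sc_zero_left [simp]: "x \<in> carrier A \<Longrightarrow> 0 \<odot> x = \<zero>"
  using nrm_sc[of x 0] nrm_eq_0[of "0 \<odot> x"] by simp

lemma sc_zero_right [simp]: "c \<odot> \<zero> = \<zero>"
  using nrm_sc[of \<zero> c] nrm_eq_0[of "c \<odot> \<zero>"] by simp

lemma neg_sc: "x \<in> carrier A \<Longrightarrow> \<ominus> x = (-1) \<odot> x"
  using sc_add_left[of x "-1" 1] by (metis add.left_inverse minus_equality sc_closed sc_one sc_zero_left)

lemma sc_minus_right: "x \<in> carrier A \<Longrightarrow> y \<in> carrier A \<Longrightarrow> c \<odot> (x \<ominus> y) = c \<odot> x \<ominus> c \<odot> y"
  by (simp add: a_minus_def neg_sc sc_add_right)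

lemma sc_minus_left: "x \<in> carrier A \<Longrightarrow> (c - d) \<odot> x = c \<odot> x \<ominus> d \<odot> x"
  using sc_add_left[of x c "- d"] by (simp add: a_minus_def neg_sc)

lemma adj_zero [simp]: "\<zero>\<dagger> = \<zero>"
  by (metis adj_sc complex_cnj_zero sc_zero_left adj_closed zero_closed)

lemma adj_one [simp]: "\<one>\<dagger> = \<one>"
  by (metis adj_adj adj_closed adj_mult l_one one_closed r_one)

lemma adj_neg [simp]: "x \<in> carrier A \<Longrightarrow> (\<ominus> x)\<dagger> = \<ominus> x\<dagger>"
  by (simp add: neg_sc)

lemma adj_minus [simp]: "x \<in> carrier A \<Longrightarrow> y \<in> carrier A \<Longrightarrow> (x \<ominus> y)\<dagger> = x\<dagger> \<ominus> y\<dagger>"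
  by (simp add: a_minus_def)

lemma nrm_zero [simp]: "nrm \<zero> = 0"
  by simp

lemma nrm_neg [simp]: "x \<in> carrier A \<Longrightarrow> nrm (\<ominus> x) = nrm x"
  by (simp add: neg_sc)

lemma nrm_minus_commute: "x \<in> carrier A \<Longrightarrow> y \<in> carrier A \<Longrightarrow> nrm (x \<ominus> y) = nrm (y \<ominus> x)"
  by (metis minus_add nrm_neg minus_closed a_minus_def a_comm a_inv_closed minus_minus)

lemma nrm_minus: "x \<in> carrier A \<Longrightarrow> y \<in> carrier A \<Longrightarrow> nrm (x \<ominus> y) \<le> nrm x + nrm y"
  using nrm_add[of x "\<ominus> y"] by (simp add: a_minus_def)

lemma minus_eq_0 [simp]: "x \<in> carrier A \<Longrightarrow> y \<in> carrier A \<Longrightarrow> x \<ominus> y = \<zero> \<longleftrightarrow> x = y"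
  by (metis minus_equality minus_minus a_minus_def a_inv_closed r_neg)

lemma minus_self [simp]: "x \<in> carrier A \<Longrightarrow> x \<ominus> x = \<zero>"
  by simp

lemma minus_trans:
  "x \<in> carrier A \<Longrightarrow> y \<in> carrier A \<Longrightarrow> z \<in> carrier A \<Longrightarrow> x \<ominus> z = (x \<ominus> y) \<oplus> (y \<ominus> z)"
  by algebra

lemma nrm_triangle:
  "x \<in> carrier A \<Longrightarrow> y \<in> carrier A \<Longrightarrow> z \<in> carrier A \<Longrightarrow> nrm (x \<ominus> z) \<le> nrm (x \<ominus> y) + nrm (y \<ominus> z)"
  using minus_trans[of x y z] nrm_add[of "x \<ominus> y" "y \<ominus> z"] by simp

lemma nrm_le_add_minus:
  "x \<in> carrier A \<Longrightarrow> y \<in> carrier A \<Longrightarrow> nrm x \<le> nrm y + nrm (x \<ominus> y)"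
  using nrm_triangle[of x y \<zero>] by (simp add: a_minus_def)

lemma nrm_le_add_minus':
  "x \<in> carrier A \<Longrightarrow> y \<in> carrier A \<Longrightarrow> nrm x \<le> nrm y + nrm (y \<ominus> x)"
  using nrm_le_add_minus[of x y] nrm_minus_commute[of x y] by simp

lemma nrm_adj_le: assumes "x \<in> carrier A" shows "nrm x \<le> nrm (x\<dagger>)"
proof (cases "nrm x = 0")
  case True then show ?thesis using assms by (metis adj_closed nrm_ge)
next
  case False
  have "nrm x * nrm x \<le> nrm (x\<dagger>) * nrm x"
    using nrm_cstar[OF assms] nrm_mult[of "x\<dagger>" x] assms by (simp add: power2_eq_square)
  then show ?thesis using False nrm_ge[OF assms] by (simp add: mult_le_cancel_right)
qed

lemma nrm_adj [simp]: "x \<in> carrier A \<Longrightarrow> nrm (x\<dagger>) = nrm x"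
  using nrm_adj_le[of x] nrm_adj_le[of "x\<dagger>"] by simp

lemma nrm_cstar': "x \<in> carrier A \<Longrightarrow> nrm (x \<otimes> x\<dagger>) = (nrm x)\<^sup>2"
  using nrm_cstar[of "x\<dagger>"] by simp

lemma adj_mult_eq_0: "x \<in> carrier A \<Longrightarrow> x\<dagger> \<otimes> x = \<zero> \<Longrightarrow> x = \<zero>"
  using nrm_cstar[of x] by simp

text \<open>Only an inequality, because the zero ring satisfies \<open>unital_cstar_algebra\<close>;
  there the unit has norm 0.\<close>

lemma nrm_one_le: "nrm \<one> \<le> 1"
proof -
  have "nrm \<one> * nrm \<one> = nrm \<one>" using nrm_cstar[of \<one>] by (simp add: power2_eq_square)
  then have "nrm \<one> = 0 \<or> nrm \<one> = 1" by (metis mult_cancel_right1)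
  then show ?thesis by auto
qed

lemma nrm_mult_le:
  "x \<in> carrier A \<Longrightarrow> y \<in> carrier A \<Longrightarrow> nrm x \<le> a \<Longrightarrow> nrm y \<le> b \<Longrightarrow> nrm (x \<otimes> y) \<le> a * b"
  by (rule order_trans[OF nrm_mult mult_mono]) (auto intro: order_trans[OF nrm_ge])

lemma nrm_add_le:
  "x \<in> carrier A \<Longrightarrow> y \<in> carrier A \<Longrightarrow> nrm x \<le> a \<Longrightarrow> nrm y \<le> b \<Longrightarrow> nrm (x \<oplus> y) \<le> a + b"
  using nrm_add[of x y] by simp

lemma nrm_mult_minus:
  assumes "x \<in> carrier A" "y \<in> carrier A" "x' \<in> carrier A" "y' \<in> carrier A"
  shows "nrm (x \<otimes> y \<ominus> x' \<otimes> y') \<le> nrm (x \<ominus> x') * nrm y + nrm x' * nrm (y \<ominus> y')"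
proof -
  have "x \<otimes> y \<ominus> x' \<otimes> y' = (x \<ominus> x') \<otimes> y \<oplus> x' \<otimes> (y \<ominus> y')"
    using assms by algebra
  then show ?thesis using assms by (simp add: nrm_add_le nrm_mult)
qed

subsection \<open>Limits\<close>

text \<open>Membership in the carrier is built in, since norm and operations say nothing about
  elements outside it.\<close>

definition lims :: "(nat \<Rightarrow> 'a) \<Rightarrow> 'a \<Rightarrow> bool" where
  "lims f x \<longleftrightarrow> (\<forall>n. f n \<in> carrier A) \<and> x \<in> carrier A \<and> (\<lambda>n. nrm (f n \<ominus> x)) \<longlonglongrightarrow> 0"

lemma limsD: "lims f x \<Longrightarrow> f n \<in> carrier A" "lims f x \<Longrightarrow> x \<in> carrier A"
  by (auto simp: lims_def)

lemma lims_const: "x \<in> carrier A \<Longrightarrow> lims (\<lambda>n. x) x"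
  by (simp add: lims_def)

lemma tendsto_0_le: 
  fixes f g :: "nat \<Rightarrow> real"
  assumes "g \<longlonglongrightarrow> 0" "\<And>n. 0 \<le> f n" "\<And>n. f n \<le> g n" shows "f \<longlonglongrightarrow> 0"
  by (rule tendsto_sandwich[of "\<lambda>_. 0" f sequentially g]) (simp_all add: assms)

lemma lims_nrm: assumes "lims f x" shows "(\<lambda>n. nrm (f n)) \<longlonglongrightarrow> nrm x"
proof -
  have c [simp]: "f n \<in> carrier A" "x \<in> carrier A" for n using limsD[OF assms] by auto
  have "\<bar>nrm (f n) - nrm x\<bar> \<le> nrm (f n \<ominus> x)" for n
    using nrm_le_add_minus[OF c, of n] nrm_le_add_minus'[OF c(2) c(1), of n] by (simp add: abs_le_iff)
  then have "(\<lambda>n. \<bar>nrm (f n) - nrm x\<bar>) \<longlonglongrightarrow> 0"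
    by - (rule tendsto_0_le[of "\<lambda>n. nrm (f n \<ominus> x)"], use assms in \<open>simp_all add: lims_def\<close>)
  then have "(\<lambda>n. nrm (f n) - nrm x) \<longlonglongrightarrow> 0" by (rule tendsto_rabs_zero_cancel)
  then show ?thesis by (rule LIM_zero_cancel)
qed

lemma lims_add: assumes "lims f x" "lims g y" shows "lims (\<lambda>n. f n \<oplus> g n) (x \<oplus> y)"
proof -
  have c [simp]: "f n \<in> carrier A" "x \<in> carrier A" "g n \<in> carrier A" "y \<in> carrier A" for n
    using limsD[OF assms(1)] limsD[OF assms(2)] by auto
  have "nrm ((f n \<oplus> g n) \<ominus> (x \<oplus> y)) \<le> nrm (f n \<ominus> x) + nrm (g n \<ominus> y)" for n
  proof -
    have "(f n \<oplus> g n) \<ominus> (x \<oplus> y) = (f n \<ominus> x) \<oplus> (g n \<ominus> y)"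
      using c(1)[of n] c(2) c(3)[of n] c(4) by algebra
    then show ?thesis by (simp add: nrm_add)
  qed
  moreover have "(\<lambda>n. nrm (f n \<ominus> x) + nrm (g n \<ominus> y)) \<longlonglongrightarrow> 0"
    using tendsto_add[of "\<lambda>n. nrm (f n \<ominus> x)" 0 _ "\<lambda>n. nrm (g n \<ominus> y)" 0] assms by (simp add: lims_def)
  ultimately show ?thesis
    unfolding lims_def by (simp add: tendsto_0_le)
qed

lemma lims_mult: assumes "lims f x" "lims g y" shows "lims (\<lambda>n. f n \<otimes> g n) (x \<otimes> y)"
proof -
  have c [simp]: "f n \<in> carrier A" "x \<in> carrier A" "g n \<in> carrier A" "y \<in> carrier A" for n
    using limsD[OF assms(1)] limsD[OF assms(2)] by auto
  have "nrm ((f n \<otimes> g n) \<ominus> (x \<otimes> y)) \<le> nrm (f n \<ominus> x) * nrm (g n) + nrm x * nrm (g n \<ominus> y)" for n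
    by (rule nrm_mult_minus) simp_all
  moreover have "(\<lambda>n. nrm (f n \<ominus> x) * nrm (g n) + nrm x * nrm (g n \<ominus> y)) \<longlonglongrightarrow> 0 * nrm y + nrm x * 0"
    by (intro tendsto_intros lims_nrm assms) (use assms in \<open>simp_all add: lims_def\<close>)
  ultimately show ?thesis
    unfolding lims_def by (simp add: tendsto_0_le)
qed

lemma lims_sc: assumes "lims f x" shows "lims (\<lambda>n. c \<odot> f n) (c \<odot> x)"
  using assms tendsto_mult_left[of "\<lambda>n. nrm (f n \<ominus> x)" 0 _ "cmod c"]
  by (simp add: lims_def sc_minus_right[symmetric])

lemma lims_adj: assumes "lims f x" shows "lims (\<lambda>n. (f n)\<dagger>) (x\<dagger>)"
  using assms by (simp add: lims_def adj_minus[symmetric] del: adj_minus)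

lemma lims_unique: assumes "lims f x" "lims f y" shows "x = y"
proof -
  have "nrm (x \<ominus> y) \<le> nrm (f n \<ominus> x) + nrm (f n \<ominus> y)" for n
    using nrm_triangle[of x "f n" y] nrm_minus_commute[of x "f n"] limsD[OF assms(1)] limsD[OF assms(2)] by simp
  moreover have "(\<lambda>n. nrm (f n \<ominus> x) + nrm (f n \<ominus> y)) \<longlonglongrightarrow> 0 + 0"
    by (intro tendsto_add) (use assms in \<open>auto simp: lims_def\<close>)
  ultimately have "nrm (x \<ominus> y) \<le> 0"
    by (intro LIMSEQ_le_const[of _ 0]) auto
  then have "nrm (x \<ominus> y) = 0"
    using nrm_ge[of "x \<ominus> y"] limsD[OF assms(1)] limsD[OF assms(2)] by (intro antisym) auto
  then show ?thesis
    using limsD[OF assms(1)] limsD[OF assms(2)] by simp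
qed

lemma norm_closed_iff: "norm_closed A X \<longleftrightarrow> X \<subseteq> carrier A \<and> (\<forall>f x. (\<forall>n. f n \<in> X) \<and> lims f x \<longrightarrow> x \<in> X)"
proof -
  have *: "lims f x \<longleftrightarrow> x \<in> carrier A \<and> (\<forall>e>0. \<exists>N. \<forall>n\<ge>N. nrm (f n \<ominus> x) < e)"
    if "X \<subseteq> carrier A" "\<forall>n. f n \<in> X" for f x
  proof -
    have "f n \<in> carrier A" for n using that by auto
    then show ?thesis by (auto simp: lims_def LIMSEQ_iff)
  qed
  then show ?thesis unfolding norm_closed_def by blast
qed

lemma norm_closedD: "norm_closed A X \<Longrightarrow> (\<And>n. f n \<in> X) \<Longrightarrow> lims f x \<Longrightarrow> x \<in> X"
  unfolding norm_closed_iff by blast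

lemma lims_Cauchy:
  assumes "\<And>n. f n \<in> carrier A" "\<And>n. nrm (f (Suc n) \<ominus> f n) \<le> C * r ^ n" "0 \<le> r" "r < 1"
  obtains x where "lims f x"
proof -
  have C: "0 \<le> C"
    using order_trans[OF nrm_ge assms(2)[of 0]] assms(1) by simp
  have le: "nrm (f (n + k) \<ominus> f n) \<le> C * r ^ n * (\<Sum>i<k. r ^ i)" for n k
  proof (induction k)
    case (Suc k)
    have "nrm (f (n + Suc k) \<ominus> f n) \<le> nrm (f (Suc (n + k)) \<ominus> f (n + k)) + nrm (f (n + k) \<ominus> f n)"
      using nrm_triangle[of "f (Suc (n + k))" "f (n + k)" "f n"] assms(1) by simp
    also have "\<dots> \<le> C * r ^ (n + k) + C * r ^ n * (\<Sum>i<k. r ^ i)"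
      using assms(2) Suc by (intro add_mono) auto
    finally show ?case by (simp add: power_add algebra_simps)
  qed (use assms in \<open>simp add: a_minus_def r_neg\<close>)
  have geo: "(\<Sum>i<k. r ^ i) \<le> 1 / (1 - r)" for k
    using sum_le_suminf[of "\<lambda>i. r ^ i" "{..<k}"] assms by (simp add: suminf_geometric)
  have le2: "nrm (f m \<ominus> f n) \<le> C / (1 - r) * r ^ n" if "n \<le> m" for m n
  proof -
    have "nrm (f m \<ominus> f n) \<le> C * r ^ n * (\<Sum>i<m - n. r ^ i)" using le[of n "m - n"] that by simp
    also have "\<dots> \<le> C * r ^ n * (1 / (1 - r))"
      using geo C assms by (intro mult_left_mono) auto
    finally show ?thesis by (simp add: field_simps)
  qed
  have lim: "(\<lambda>n. C / (1 - r) * r ^ n) \<longlonglongrightarrow> 0"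
    using tendsto_mult_left[OF LIMSEQ_power_zero[of r], of "C / (1 - r)"] assms by simp
  show thesis
  proof (rule complete[of f])
    fix e :: real assume "0 < e"
    obtain N where N: "C / (1 - r) * r ^ n < e" if "n \<ge> N" for n
      using order_tendstoD(2)[OF lim \<open>0 < e\<close>] unfolding eventually_sequentially by blast
    have "nrm (f m \<ominus> f n) < e" if "m \<ge> N" "n \<ge> N" for m n
    proof (cases "n \<le> m")
      case True then show ?thesis using le2[of n m] N[of n] that by simp
    next
      case False then show ?thesis using le2[of m n] N[of m] that nrm_minus_commute[of "f m" "f n"] assms(1) by simp
    qed
    then show "\<exists>N. \<forall>m\<ge>N. \<forall>n\<ge>N. nrm (f m \<ominus> f n) < e" by blast
  next
    fix x assume "x \<in> carrier A" "(\<lambda>n. nrm (f n \<ominus> x)) \<longlonglongrightarrow> 0"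
    then show thesis using that[of x] assms by (auto simp: lims_def)
  qed (use assms in auto)
qed

text \<open>Banach's fixed point theorem on a closed subset of the carrier. A fixed point inherits
  every closed property put into \<open>X\<close>, such as self-adjointness, a norm bound or
  commutation relations.\<close>

lemma contraction_fixpoint:
  assumes X: "norm_closed A X" "x0 \<in> X" "\<And>x. x \<in> X \<Longrightarrow> T x \<in> X"
    and r: "0 \<le> r" "r < 1" "\<And>x y. x \<in> X \<Longrightarrow> y \<in> X \<Longrightarrow> nrm (T x \<ominus> T y) \<le> r * nrm (x \<ominus> y)"
  obtains x where "x \<in> X" "T x = x"
proof -
  define f where "f n = (T ^^ n) x0" for n
  have fX: "f n \<in> X" for n by (induction n) (auto simp: f_def X)
  have XA: "x \<in> X \<Longrightarrow> x \<in> carrier A" for x using X(1) by (auto simp: norm_closed_def)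
  have "nrm (f (Suc n) \<ominus> f n) \<le> nrm (f 1 \<ominus> f 0) * r ^ n" for n
  proof (induction n)
    case (Suc n)
    have "nrm (f (Suc (Suc n)) \<ominus> f (Suc n)) \<le> r * nrm (f (Suc n) \<ominus> f n)"
      using r(3)[OF fX fX, of "Suc n" n] by (simp add: f_def)
    also have "\<dots> \<le> r * (nrm (f 1 \<ominus> f 0) * r ^ n)"
      using Suc r by (intro mult_left_mono) auto
    finally show ?case by (simp add: algebra_simps)
  qed simp
  then obtain x where x: "lims f x"
    using lims_Cauchy[of f "nrm (f 1 \<ominus> f 0)" r] r(1,2) XA[OF fX] by metis
  then have xX: "x \<in> X" using norm_closedD[OF X(1)] fX by blast
  have "(\<lambda>n. nrm (f n \<ominus> x)) \<longlonglongrightarrow> 0" using x by (simp add: lims_def)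
  then have "(\<lambda>n. r * nrm (f n \<ominus> x)) \<longlonglongrightarrow> 0" by (rule tendsto_mult_right_zero)
  moreover have "nrm (f (Suc n) \<ominus> T x) \<le> r * nrm (f n \<ominus> x)" for n
    using r(3)[OF fX xX, of n] by (simp add: f_def)
  ultimately have "(\<lambda>n. nrm (f (Suc n) \<ominus> T x)) \<longlonglongrightarrow> 0"
    by - (rule tendsto_0_le, assumption, use fX X xX XA in auto)
  then have "lims (\<lambda>n. f (Suc n)) (T x)" using fX X xX XA by (auto simp: lims_def)
  moreover have "lims (\<lambda>n. f (Suc n)) x"
    using x LIMSEQ_Suc[of "\<lambda>n. nrm (f n \<ominus> x)"] by (auto simp: lims_def)
  ultimately have "T x = x" using lims_unique by blast
  then show thesis using that xX by blast
qed

end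

context cstar_alg begin

subsection \<open>Square roots and inverses by fixed points\<close>

lemma one_minus_mult:
  assumes "x \<in> carrier A" "y \<in> carrier A"
  shows "(\<one> \<ominus> x) \<otimes> (\<one> \<ominus> y) = \<one> \<ominus> x \<ominus> y \<oplus> x \<otimes> y"
proof -
  have "(\<one> \<ominus> x) \<otimes> (\<one> \<ominus> y) = \<one> \<ominus> y \<ominus> x \<otimes> \<one> \<oplus> x \<otimes> y"
    using assms by algebra
  also have "\<dots> = \<one> \<ominus> x \<ominus> y \<oplus> x \<otimes> y" unfolding r_one[OF assms(1)] using assms by algebra
  finally show ?thesis .
qed

lemma mult_minus_right:
  "x \<in> carrier A \<Longrightarrow> y \<in> carrier A \<Longrightarrow> z \<in> carrier A \<Longrightarrow> x \<otimes> (y \<ominus> z) = x \<otimes> y \<ominus> x \<otimes> z"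
  and mult_minus_left:
  "x \<in> carrier A \<Longrightarrow> y \<in> carrier A \<Longrightarrow> z \<in> carrier A \<Longrightarrow> (y \<ominus> z) \<otimes> x = y \<otimes> x \<ominus> z \<otimes> x"
  by (simp_all add: a_minus_def r_distr l_distr r_minus l_minus)

lemma commutant_lims:
  assumes "lims f x" "\<And>n. c \<otimes> f n = f n \<otimes> c" "c \<in> carrier A"
  shows "c \<otimes> x = x \<otimes> c"
proof -
  have "lims (\<lambda>n. c \<otimes> f n) (c \<otimes> x)" "lims (\<lambda>n. c \<otimes> f n) (x \<otimes> c)"
    using lims_mult[OF lims_const[OF assms(3)] assms(1)] lims_mult[OF assms(1) lims_const[OF assms(3)]] assms(2)
    by auto
  then show ?thesis by (rule lims_unique)
qed

lemma norm_closed_sa_commutant: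
  assumes "C \<subseteq> carrier A"
  shows "norm_closed A {x \<in> carrier A. x\<dagger> = x \<and> nrm x \<le> r \<and> (\<forall>c\<in>C. c \<otimes> x = x \<otimes> c)}"
  unfolding norm_closed_iff
proof (intro conjI allI impI)
  fix f x assume *: "(\<forall>n. f n \<in> {x \<in> carrier A. x\<dagger> = x \<and> nrm x \<le> r \<and> (\<forall>c\<in>C. c \<otimes> x = x \<otimes> c)}) \<and> lims f x"
  then have l: "lims f x" by blast
  have "lims f (x\<dagger>)" using lims_adj[OF l] * by auto
  then have "x\<dagger> = x" using l lims_unique by blast
  moreover have "nrm x \<le> r"
    using lims_nrm[OF l] by (rule LIMSEQ_le_const2) (use * in auto)
  moreover have "\<forall>c\<in>C. c \<otimes> x = x \<otimes> c"
    using commutant_lims[OF l] * assms by blast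
  ultimately show "x \<in> {x \<in> carrier A. x\<dagger> = x \<and> nrm x \<le> r \<and> (\<forall>c\<in>C. c \<otimes> x = x \<otimes> c)}"
    using limsD(2)[OF l] by simp
qed auto

text \<open>The equation x = (a + x x) / 2 is equivalent to (1 - x)(1 - x) = 1 - a, and on the ball
  of radius \<open>nrm a\<close> its right hand side is a contraction with constant
  \<open>nrm a\<close>. The root commutes with whatever commutes with \<open>a\<close> because the
  iteration runs inside the commutant of all those elements.\<close>

lemma sqrt_one_minus:
  assumes a: "a \<in> carrier A" "a\<dagger> = a" "nrm a < 1"
  obtains s where "s \<in> carrier A" "s\<dagger> = s" "nrm (\<one> \<ominus> s) < 1" "s \<otimes> s = \<one> \<ominus> a"
    "\<And>c. c \<in> carrier A \<Longrightarrow> c \<otimes> a = a \<otimes> c \<Longrightarrow> c \<otimes> s = s \<otimes> c"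
proof -
  define C where "C = {c \<in> carrier A. c \<otimes> a = a \<otimes> c}"
  define X where "X = {x \<in> carrier A. x\<dagger> = x \<and> nrm x \<le> nrm a \<and> (\<forall>c\<in>C. c \<otimes> x = x \<otimes> c)}"
  define T where "T x = (1/2) \<odot> (a \<oplus> x \<otimes> x)" for x
  have X: "norm_closed A X" unfolding X_def by (rule norm_closed_sa_commutant) (auto simp: C_def)
  have TX: "T x \<in> X" if "x \<in> X" for x
  proof -
    have x: "x \<in> carrier A" "x\<dagger> = x" "nrm x \<le> nrm a" "\<And>c. c \<in> C \<Longrightarrow> c \<otimes> x = x \<otimes> c"
      using that by (auto simp: X_def)
    have "nrm (a \<oplus> x \<otimes> x) \<le> nrm a + nrm a * nrm a"
      by (intro nrm_add_le nrm_mult_le) (use x a in auto)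
    also have "\<dots> \<le> nrm a + nrm a * 1" using a by (intro add_left_mono mult_left_mono) auto
    finally have "nrm (T x) \<le> nrm a" using x a by (simp add: T_def)
    moreover have "c \<otimes> T x = T x \<otimes> c" if "c \<in> C" for c
    proof -
      have c: "c \<in> carrier A" "c \<otimes> a = a \<otimes> c" "c \<otimes> x = x \<otimes> c" using that x by (auto simp: C_def)
      have "c \<otimes> (x \<otimes> x) = (x \<otimes> x) \<otimes> c" using c x(1) by (metis m_assoc)
      then show ?thesis using x(1) a(1) c by (simp add: T_def r_distr l_distr)
    qed
    ultimately show ?thesis using x a by (simp add: X_def T_def)
  qed
  have lip: "nrm (T x \<ominus> T y) \<le> nrm a * nrm (x \<ominus> y)" if "x \<in> X" "y \<in> X" for x y
  proof -
    have c: "x \<in> carrier A" "y \<in> carrier A" "nrm x \<le> nrm a" "nrm y \<le> nrm a" using that by (auto simp: X_def)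
    have "(a \<oplus> x \<otimes> x) \<ominus> (a \<oplus> y \<otimes> y) = x \<otimes> x \<ominus> y \<otimes> y" using c a by algebra
    then have "T x \<ominus> T y = (1/2) \<odot> (x \<otimes> x \<ominus> y \<otimes> y)"
      using c a by (simp add: T_def sc_minus_right[symmetric])
    moreover have "nrm (x \<otimes> x \<ominus> y \<otimes> y) \<le> nrm (x \<ominus> y) * nrm x + nrm y * nrm (x \<ominus> y)"
      using nrm_mult_minus c by blast
    moreover have "\<dots> \<le> nrm (x \<ominus> y) * nrm a + nrm a * nrm (x \<ominus> y)"
      using c a(1) by (intro add_mono mult_mono) auto
    ultimately show ?thesis using c by simp
  qed
  have zero: "\<zero> \<in> X" using a by (auto simp: X_def C_def)
  obtain x where x: "x \<in> X" "T x = x"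
    by (rule contraction_fixpoint[OF X zero TX nrm_ge[OF a(1)] a(3) lip])
  have xc: "x \<in> carrier A" "x\<dagger> = x" "nrm x \<le> nrm a" "\<And>c. c \<in> C \<Longrightarrow> c \<otimes> x = x \<otimes> c"
    using x(1) by (auto simp: X_def)
  have "a \<oplus> x \<otimes> x = 2 \<odot> T x" using xc a by (simp add: T_def)
  also have "\<dots> = x \<oplus> x" using sc_add_left[of x 1 1] xc x by simp
  finally have e: "a \<oplus> x \<otimes> x = x \<oplus> x" .
  have "(\<one> \<ominus> x) \<otimes> (\<one> \<ominus> x) = \<one> \<oplus> (a \<oplus> x \<otimes> x) \<ominus> (x \<oplus> x) \<ominus> a"
    unfolding one_minus_mult[OF xc(1) xc(1)] using xc(1) a(1) by algebra
  also have "\<dots> = \<one> \<ominus> a" unfolding e using xc(1) a(1) by algebra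
  finally have "(\<one> \<ominus> x) \<otimes> (\<one> \<ominus> x) = \<one> \<ominus> a" .
  moreover have "\<one> \<ominus> (\<one> \<ominus> x) = x" using xc(1) by algebra
  moreover have "c \<otimes> (\<one> \<ominus> x) = (\<one> \<ominus> x) \<otimes> c" if "c \<in> carrier A" "c \<otimes> a = a \<otimes> c" for c
    using xc(4)[of c] that(1) CollectI[of "\<lambda>c. c \<in> carrier A \<and> c \<otimes> a = a \<otimes> c", OF conjI[OF that]] xc(1)
    unfolding C_def by (simp add: mult_minus_right mult_minus_left)
  moreover have "\<one> \<ominus> x \<in> carrier A" "(\<one> \<ominus> x)\<dagger> = \<one> \<ominus> x" "nrm x < 1" using xc(1-3) a(3) by simp_all
  ultimately show thesis by (metis that)
qed

text \<open>The inverse solves t = 1 + (1 - s) t, whose right hand side is a contraction in t.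
  Taking adjoints turns the right inverse into a left inverse, which makes it two-sided and
  self-adjoint.\<close>

lemma neumann_inverse:
  assumes s: "s \<in> carrier A" "s\<dagger> = s" "nrm (\<one> \<ominus> s) < 1"
  obtains t where "t \<in> carrier A" "t\<dagger> = t" "s \<otimes> t = \<one>" "t \<otimes> s = \<one>"
    "\<And>c. c \<in> carrier A \<Longrightarrow> c \<otimes> s = s \<otimes> c \<Longrightarrow> c \<otimes> t = t \<otimes> c"
proof -
  let ?x = "\<one> \<ominus> s"
  have x: "?x \<in> carrier A" using s by simp
  have X: "norm_closed A (carrier A)" unfolding norm_closed_iff using limsD(2) by auto
  have lip: "nrm ((\<one> \<oplus> ?x \<otimes> y) \<ominus> (\<one> \<oplus> ?x \<otimes> z)) \<le> nrm ?x * nrm (y \<ominus> z)"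
    if "y \<in> carrier A" "z \<in> carrier A" for y z
  proof -
    have "(\<one> \<oplus> ?x \<otimes> y) \<ominus> (\<one> \<oplus> ?x \<otimes> z) = ?x \<otimes> (y \<ominus> z)" using that x by algebra
    then show ?thesis using that x by (simp add: nrm_mult)
  qed
  obtain t where t: "t \<in> carrier A" "\<one> \<oplus> ?x \<otimes> t = t"
    by (rule contraction_fixpoint[OF X zero_closed _ nrm_ge[OF x] s(3) lip]) (use x in auto)
  have "s \<otimes> t = t \<ominus> ?x \<otimes> t" using t(1) s(1) by algebra
  also have "\<dots> = (\<one> \<oplus> ?x \<otimes> t) \<ominus> ?x \<otimes> t" by (simp add: t(2))
  also have "\<dots> = \<one>" using t(1) s(1) by algebra
  finally have st: "s \<otimes> t = \<one>" .
  then have ts': "t\<dagger> \<otimes> s = \<one>" using s t by (metis adj_mult adj_one)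
  then have tt: "t\<dagger> = t" using st s t by (metis adj_closed l_one m_assoc r_one)
  then have ts: "t \<otimes> s = \<one>" using ts' by simp
  have "c \<otimes> t = t \<otimes> c" if c: "c \<in> carrier A" "c \<otimes> s = s \<otimes> c" for c
  proof -
    have "c \<otimes> t = (t \<otimes> s) \<otimes> c \<otimes> t" using ts c t by simp
    also have "\<dots> = t \<otimes> (s \<otimes> c) \<otimes> t" using c t s by (simp add: m_assoc)
    also have "\<dots> = t \<otimes> (c \<otimes> s) \<otimes> t" by (simp add: c)
    also have "\<dots> = t \<otimes> c \<otimes> (s \<otimes> t)" using c(1) t s by (simp add: m_assoc)
    also have "\<dots> = t \<otimes> c" using c t st by simp
    finally show ?thesis .
  qed
  then show thesis using that t tt st ts by blast
qed

text \<open>Since \<open>a\<close> lives in the corner of \<open>p\<close>, the element 1 - (p - a)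
  is \<open>a\<close> on that corner and 1 on its complement, at distance less than one from the
  unit. Its inverse square root commutes with \<open>p\<close> and turns \<open>a\<close> into
  \<open>p\<close>.\<close>

lemma inverse_sqrt_near_projection:
  assumes p: "is_projection A p" and a: "a \<in> carrier A" "a\<dagger> = a" "p \<otimes> a = a" "nrm (a \<ominus> p) < 1"
  obtains t where "t \<in> carrier A" "t\<dagger> \<otimes> a \<otimes> t = p" "t\<dagger> = t"
proof -
  have pc: "p \<in> carrier A" "p \<otimes> p = p" "p\<dagger> = p" using p by (auto simp: is_projection_def)
  have ap: "a \<otimes> p = a" using a pc by (metis adj_mult)
  define d where "d = p \<ominus> a"
  have d: "d \<in> carrier A" "d\<dagger> = d" "nrm d < 1"
    using a pc nrm_minus_commute[of a p] by (auto simp: d_def)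
  obtain s where s: "s \<in> carrier A" "s\<dagger> = s" "nrm (\<one> \<ominus> s) < 1" "s \<otimes> s = \<one> \<ominus> d"
      "\<And>c. c \<in> carrier A \<Longrightarrow> c \<otimes> d = d \<otimes> c \<Longrightarrow> c \<otimes> s = s \<otimes> c"
    using sqrt_one_minus[OF d] by blast
  obtain t where t: "t \<in> carrier A" "t\<dagger> = t" "s \<otimes> t = \<one>" "t \<otimes> s = \<one>"
      "\<And>c. c \<in> carrier A \<Longrightarrow> c \<otimes> s = s \<otimes> c \<Longrightarrow> c \<otimes> t = t \<otimes> c"
    using neumann_inverse[OF s(1-3)] by blast
  have "p \<otimes> d = d \<otimes> p" using pc a ap by (simp add: d_def mult_minus_right mult_minus_left)
  then have pt: "p \<otimes> t = t \<otimes> p" using s(5) t(5) pc by blast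
  have "(\<one> \<ominus> d) \<otimes> p = p \<ominus> (p \<otimes> p \<ominus> a \<otimes> p)" unfolding d_def using pc(1) a(1) by algebra
  also have "\<dots> = a" unfolding pc(2) ap using pc(1) a(1) by algebra
  finally have e: "s \<otimes> s \<otimes> p = a" by (simp add: s(4))
  have "t\<dagger> \<otimes> a \<otimes> t = t \<otimes> (s \<otimes> s \<otimes> p) \<otimes> t" by (simp add: t(2) e)
  also have "\<dots> = (t \<otimes> s) \<otimes> s \<otimes> (p \<otimes> t)" using t(1) s(1) pc(1) by (simp add: m_assoc)
  also have "\<dots> = s \<otimes> t \<otimes> p" using t(1,4) s(1) pc(1) pt by (simp add: m_assoc)
  also have "\<dots> = p" using t(3) pc(1) by simp
  finally show thesis using that t by blast
qed

text \<open>For u = x + i y the commutation gives u\<dagger> u = x x + y y, while x is the real part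
  of u and so has norm at most \<open>nrm u\<close>.\<close>

lemma nrm_sq_le_sum:
  assumes x: "x \<in> carrier A" "x\<dagger> = x" and y: "y \<in> carrier A" "y\<dagger> = y" and xy: "x \<otimes> y = y \<otimes> x"
  shows "(nrm x)\<^sup>2 \<le> nrm (x \<otimes> x \<oplus> y \<otimes> y)"
proof -
  have ic: "\<i> \<odot> y \<in> carrier A" using y(1) by simp
  define u where "u = x \<oplus> \<i> \<odot> y"
  have u: "u \<in> carrier A" using x(1) ic by (simp add: u_def)
  have ud: "u\<dagger> = x \<ominus> \<i> \<odot> y" using x y by (simp add: u_def a_minus_def neg_sc)
  have i2: "(\<i> \<odot> y) \<otimes> (\<i> \<odot> y) = \<ominus> (y \<otimes> y)" "x \<otimes> (\<i> \<odot> y) = (\<i> \<odot> y) \<otimes> x"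
    using x(1) y(1) xy by (simp_all add: neg_sc)
  have "u\<dagger> \<otimes> u = x \<otimes> x \<oplus> x \<otimes> (\<i> \<odot> y) \<ominus> (\<i> \<odot> y) \<otimes> x \<ominus> (\<i> \<odot> y) \<otimes> (\<i> \<odot> y)"
    unfolding ud unfolding u_def using x(1) ic by algebra
  also have "\<dots> = x \<otimes> x \<oplus> y \<otimes> y" unfolding i2 using x(1) ic y(1) by algebra
  finally have uu: "u\<dagger> \<otimes> u = x \<otimes> x \<oplus> y \<otimes> y" .
  have "2 \<odot> x = x \<oplus> x" using sc_add_left[OF x(1), of 1 1] x(1) by simp
  also have "\<dots> = u \<oplus> u\<dagger>" unfolding ud unfolding u_def using x(1) ic by algebra
  finally have "nrm (2 \<odot> x) \<le> nrm u + nrm (u\<dagger>)" using nrm_add[OF u adj_closed[OF u]] by simp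
  then have "nrm x \<le> nrm u" using u x(1) by simp
  then have "(nrm x)\<^sup>2 \<le> (nrm u)\<^sup>2" using x(1) by (intro power_mono) auto
  then show ?thesis using nrm_cstar[OF u] uu by simp
qed

text \<open>If \<open>r\<close> is self-adjoint and \<open>s = sqrt (1 - r\<^sup>2)\<close>, then \<open>r + i s\<close> is unitary. This replaces
  spectral theory throughout.\<close>
lemma sqrt_one_minus_sq:
  assumes r: "r \<in> carrier A" "r\<dagger> = r" "nrm r < 1"
  obtains s where "s \<in> carrier A" "s\<dagger> = s" "r \<otimes> s = s \<otimes> r" "r \<otimes> r \<oplus> s \<otimes> s = \<one>"
proof -
  have rr: "r \<otimes> r \<in> carrier A" "(r \<otimes> r)\<dagger> = r \<otimes> r" "nrm (r \<otimes> r) < 1"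
    using nrm_cstar[of r] r by (simp_all add: power_less_one_iff)
  obtain s where s: "s \<in> carrier A" "s\<dagger> = s" "s \<otimes> s = \<one> \<ominus> r \<otimes> r"
      "\<And>c. c \<in> carrier A \<Longrightarrow> c \<otimes> (r \<otimes> r) = r \<otimes> r \<otimes> c \<Longrightarrow> c \<otimes> s = s \<otimes> c"
    using sqrt_one_minus[OF rr] by blast
  have "r \<otimes> s = s \<otimes> r" using s(4)[OF r(1) m_assoc[OF r(1) r(1) r(1), symmetric]] .
  moreover have "r \<otimes> r \<oplus> s \<otimes> s = \<one>" unfolding s(3) using rr(1) by algebra
  ultimately show thesis using that s(1,2) by blast
qed

text \<open>With the root s of 1 - r r at hand, s s + r r = 1 bounds the norm of s by one.\<close>

lemma nrm_one_minus_sq: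
  assumes r: "r \<in> carrier A" "r\<dagger> = r" "nrm r < 1"
  shows "nrm (\<one> \<ominus> r \<otimes> r) \<le> 1"
proof -
  obtain s where s: "s \<in> carrier A" "s\<dagger> = s" "r \<otimes> s = s \<otimes> r" "r \<otimes> r \<oplus> s \<otimes> s = \<one>"
    using sqrt_one_minus_sq[OF r] .
  have "\<one> \<ominus> r \<otimes> r = s \<otimes> s" unfolding s(4)[symmetric] using r(1) s(1) by algebra
  moreover have "s \<otimes> s \<oplus> r \<otimes> r = \<one>" using s(1,4) r(1) by (simp add: a_comm)
  then have "(nrm s)\<^sup>2 \<le> 1"
    using nrm_sq_le_sum[OF s(1,2) r(1,2) s(3)[symmetric]] nrm_one_le by simp
  ultimately show ?thesis using nrm_cstar[OF s(1)] s(2) by simp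
qed

end

text \<open>Exponents 2 ^ n only, because the C*-identity computes norms of powers of self-adjoint
  elements just for repeated squaring. The constant \<open>C\<close> disappears in the 2 ^ n-th
  root, so crude values of it do no harm.\<close>

lemma pow2_bound:
  fixes x \<rho> C :: real
  assumes "0 \<le> x" "0 \<le> \<rho>" "\<And>n::nat. x ^ (2 ^ n) \<le> C * \<rho> ^ (2 ^ n)"
  shows "x \<le> \<rho>"
proof (rule ccontr)
  assume "\<not> x \<le> \<rho>"
  then have lt: "\<rho> < x" by simp
  show False
  proof (cases "\<rho> = 0")
    case True
    then show False using assms(3)[of 0] lt by simp
  next
    case False
    then have pos: "0 < \<rho>" using assms by simp
    then have "1 < x / \<rho>" using lt by simp
    then obtain k where k: "C < (x / \<rho>) ^ k" using real_arch_pow by blast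
    also have "\<dots> \<le> (x / \<rho>) ^ (2 ^ k)"
      using \<open>1 < x / \<rho>\<close> by (intro power_increasing) (auto intro: less_imp_le less_exp)
    also have "\<dots> \<le> C" using assms(3)[of k] pos by (simp add: power_divide pos_divide_le_eq)
    finally show False by simp
  qed
qed

section \<open>Norms of powers, projections and positivity\<close>

context cstar_alg begin

lemma pow_closed [simp, intro]: "x \<in> carrier A \<Longrightarrow> x [^] (n::nat) \<in> carrier A"
  by simp

lemma adj_pow: "x \<in> carrier A \<Longrightarrow> x\<dagger> = x \<Longrightarrow> (x [^] (n::nat))\<dagger> = x [^] n"
proof (induction n)
  case (Suc n)
  then show ?case by (metis adj_mult nat_pow_Suc nat_pow_Suc2 pow_closed)
qed simp

lemma nrm_pow_sa:
  assumes "x \<in> carrier A" "x\<dagger> = x"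
  shows "nrm (x [^] ((2::nat) ^ n)) = nrm x ^ (2 ^ n)"
proof (induction n)
  case (Suc n)
  have "x [^] ((2::nat) ^ Suc n) = (x [^] ((2::nat) ^ n))\<dagger> \<otimes> (x [^] ((2::nat) ^ n))"
    using assms by (simp add: adj_pow nat_pow_mult mult_2)
  then show ?case using nrm_cstar[of "x [^] ((2::nat) ^ n)"] assms Suc
    by (simp add: power_mult[symmetric] mult.commute)
qed (use assms in simp)

text \<open>By \<open>nrm_pow_sa\<close> the norm of a 2 ^ n-th power is the power of the norm, so a
  uniform bound forces the norm down to one; this stands in for the spectral radius formula.\<close>

lemma nrm_le_one_if_bounded_powers:
  assumes "x \<in> carrier A" "x\<dagger> = x" "\<And>n::nat. 0 < n \<Longrightarrow> nrm (x [^] n) \<le> C"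
  shows "nrm x \<le> 1"
proof (rule pow2_bound[of _ _ C])
  fix n
  show "nrm x ^ (2 ^ n) \<le> C * 1 ^ (2 ^ n)"
    using assms(3)[of "2 ^ n"] nrm_pow_sa[OF assms(1,2), of n] by simp
qed (use assms in auto)

lemma finsum_sc: "finite F \<Longrightarrow> f \<in> F \<rightarrow> carrier A \<Longrightarrow> c \<odot> finsum A f F = finsum A (\<lambda>i. c \<odot> f i) F"
  by (induction F rule: finite_induct) (auto simp: sc_add_right Pi_def)

lemma finsum_adj: "finite F \<Longrightarrow> f \<in> F \<rightarrow> carrier A \<Longrightarrow> (finsum A f F)\<dagger> = finsum A (\<lambda>i. (f i)\<dagger>) F"
  by (induction F rule: finite_induct) (auto simp: Pi_def)

lemma nrm_finsum: "finite F \<Longrightarrow> f \<in> F \<rightarrow> carrier A \<Longrightarrow> nrm (finsum A f F) \<le> (\<Sum>i\<in>F. nrm (f i))"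
  by (induction F rule: finite_induct) (auto simp: Pi_def intro!: nrm_add_le)

lemma projD: "is_projection A p \<Longrightarrow> p \<in> carrier A" "is_projection A p \<Longrightarrow> p \<otimes> p = p" "is_projection A p \<Longrightarrow> p\<dagger> = p"
  by (auto simp: is_projection_def)

lemma proj_assoc: "is_projection A p \<Longrightarrow> x \<in> carrier A \<Longrightarrow> p \<otimes> (p \<otimes> x) = p \<otimes> x"
  by (metis projD(1,2) m_assoc)

lemma nrm_proj_le: assumes "is_projection A p" shows "nrm p \<le> 1"
proof (rule nrm_le_one_if_bounded_powers[of p "nrm p"])
  fix n :: nat assume "0 < n"
  then have "p [^] n = p"
    by (induction n) (use projD[OF assms] in \<open>auto simp: nat_pow_Suc2\<close>, metis l_one nat_pow_0 neq0_conv)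
  then show "nrm (p [^] n) \<le> nrm p" by simp
qed (use projD[OF assms] in auto)

lemma nrm_proj: assumes "is_projection A p" "p \<noteq> \<zero>" shows "nrm p = 1"
proof -
  have "nrm p * nrm p = nrm p" using nrm_cstar[of p] projD[OF assms(1)] by (simp add: power2_eq_square)
  then show ?thesis using assms nrm_eq_0[OF projD(1)[OF assms(1)]] by auto
qed

lemma proj_one_minus: assumes "is_projection A p" shows "is_projection A (\<one> \<ominus> p)"
proof -
  note p = projD[OF assms]
  have "(\<one> \<ominus> p) \<otimes> (\<one> \<ominus> p) = \<one> \<ominus> p" unfolding one_minus_mult[OF p(1) p(1)] p(2) using p(1) by algebra
  then show ?thesis using p by (simp add: is_projection_def)
qed

text \<open>With p = x\<dagger> x the element y = x - x p satisfies y\<dagger> y = p - p p - (p p -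
  p p p) = 0, so x = x p.\<close>

lemma range_projection:
  assumes "x \<in> carrier A" "is_projection A (x\<dagger> \<otimes> x)"
  shows "x \<otimes> (x\<dagger> \<otimes> x) = x" "is_projection A (x \<otimes> x\<dagger>)"
proof -
  note p = projD[OF assms(2)]
  let ?p = "x\<dagger> \<otimes> x" let ?y = "x \<ominus> x \<otimes> ?p"
  have xp: "x \<otimes> ?p \<in> carrier A" using assms by simp
  have "?y\<dagger> = x\<dagger> \<ominus> ?p \<otimes> x\<dagger>" using assms(1) p by simp
  then have "?y\<dagger> \<otimes> ?y = ?p \<ominus> ?p \<otimes> ?p \<ominus> (?p \<otimes> ?p \<ominus> ?p \<otimes> (?p \<otimes> ?p))"
    using assms(1) by (simp add: mult_minus_right mult_minus_left m_assoc)
  also have "\<dots> = \<zero>" unfolding p(2) using p(1) by simp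
  finally have "?y = \<zero>" by (rule adj_mult_eq_0[rotated]) (use assms(1) in simp)
  then show *: "x \<otimes> ?p = x" using assms(1) xp by simp
  show "is_projection A (x \<otimes> x\<dagger>)"
    unfolding is_projection_def using assms(1) * by (simp add: m_assoc[symmetric])
qed

text \<open>Otherwise \<open>x\<^sup>*x = -p\<close> after scaling, so \<open>-xx\<^sup>*\<close> is also a projection, and
  \<open>2x\<^sup>*x + 2xx\<^sup>* = (x + x\<^sup>*)\<^sup>2 - (x - x\<^sup>*)\<^sup>2\<close> turns \<open>-2p\<close> into a sum of positive terms.\<close>
lemma scalar_positive:
  assumes x: "x \<in> carrier A" and p: "is_projection A p" "p \<noteq> \<zero>" and xx: "x\<dagger> \<otimes> x = c \<odot> p"
  shows "c = complex_of_real ((nrm x)\<^sup>2)"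
proof -
  note pp = projD[OF p(1)]
  have np: "nrm p = 1" by (rule nrm_proj[OF p])
  have nx: "(nrm x)\<^sup>2 = cmod c" using nrm_cstar[OF x] xx pp np by simp
  have "(c - cnj c) \<odot> p = \<zero>"
  proof -
    have "(x\<dagger> \<otimes> x)\<dagger> = x\<dagger> \<otimes> x" using x by simp
    then have "cnj c \<odot> p = c \<odot> p" using xx pp by simp
    then show ?thesis using pp by (simp add: sc_minus_left)
  qed
  then have "cmod (c - cnj c) = 0" using nrm_sc[OF pp(1), of "c - cnj c"] np by simp
  then have real: "c = complex_of_real (Re c)" by (simp add: complex_eq_iff)
  have "0 \<le> Re c"
  proof (rule ccontr)
    assume "\<not> 0 \<le> Re c"
    then have neg: "Re c < 0" by simp
    define t where "t = complex_of_real (1 / sqrt (- Re c))"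
    define y where "y = t \<odot> x"
    have y: "y \<in> carrier A" using x by (simp add: y_def)
    have "t * t = complex_of_real (1 / sqrt (- Re c) * (1 / sqrt (- Re c)))"
      unfolding t_def of_real_mult ..
    also have "1 / sqrt (- Re c) * (1 / sqrt (- Re c)) = 1 / (- Re c)"
      using neg by simp
    finally have "t * t * c = complex_of_real (1 / (- Re c)) * complex_of_real (Re c)"
      using real by simp
    also have "\<dots> = -1" using neg by (simp flip: of_real_mult)
    finally have tc: "t * (cnj t * c) = -1" by (simp add: t_def mult.assoc)
    have yy: "y\<dagger> \<otimes> y = \<ominus> p" using x pp xx tc by (simp add: y_def neg_sc)
    have ny: "nrm y \<le> 1" using nrm_cstar[OF y] yy pp np by (auto simp: power2_eq_1_iff)
    \<comment> \<open>The source of \<open>y\<close> lies under \<open>p\<close>, because the square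
      of \<open>?g\<close> collapses to zero; this is what makes -y y\<dagger> a projection.\<close>
    let ?g = "y \<ominus> y \<otimes> p"
    have gc: "?g \<in> carrier A" using y pp by simp
    have "?g\<dagger> \<otimes> ?g = y\<dagger> \<otimes> y \<ominus> (y\<dagger> \<otimes> y) \<otimes> p \<ominus> p \<otimes> (y\<dagger> \<otimes> y) \<oplus> p \<otimes> (y\<dagger> \<otimes> y) \<otimes> p"
    proof -
      have "?g\<dagger> = y\<dagger> \<ominus> p \<otimes> y\<dagger>" using y pp by simp
      moreover have "(y\<dagger> \<ominus> p \<otimes> y\<dagger>) \<otimes> (y \<ominus> y \<otimes> p) =
        y\<dagger> \<otimes> y \<ominus> (y\<dagger> \<otimes> y) \<otimes> p \<ominus> p \<otimes> (y\<dagger> \<otimes> y) \<oplus> p \<otimes> (y\<dagger> \<otimes> y) \<otimes> p"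
        using y adj_closed[OF y] pp(1) by algebra
      ultimately show ?thesis by simp
    qed
    also have "\<dots> = \<zero>"
    proof -
      have "\<ominus> p \<ominus> (\<ominus> p) \<otimes> p \<ominus> p \<otimes> (\<ominus> p) \<oplus> p \<otimes> (\<ominus> p) \<otimes> p =
        \<ominus> p \<oplus> p \<otimes> p \<oplus> p \<otimes> p \<ominus> p \<otimes> p \<otimes> p" using pp(1) by algebra
      also have "\<dots> = \<zero>" unfolding pp(2) using pp(1) by algebra
      finally show ?thesis unfolding yy .
    qed
    finally have "?g = \<zero>" using adj_mult_eq_0[OF gc] by blast
    then have yp: "y \<otimes> p = y" using y pp by simp
    define f where "f = \<ominus> (y \<otimes> y\<dagger>)"
    have fc: "f \<in> carrier A" "f\<dagger> = f" using y by (auto simp: f_def)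
    have "f \<otimes> f = y \<otimes> (y\<dagger> \<otimes> y) \<otimes> y\<dagger>"
      unfolding f_def using y adj_closed[OF y] by algebra
    also have "\<dots> = \<ominus> (y \<otimes> p \<otimes> y\<dagger>)"
      unfolding yy using y adj_closed[OF y] pp(1) by algebra
    also have "\<dots> = f" unfolding yp f_def ..
    finally have pf: "is_projection A f" using fc by (simp add: is_projection_def)
    define R where "R = y \<oplus> y\<dagger>"
    define S where "S = \<i> \<odot> (y \<ominus> y\<dagger>)"
    have R: "R \<in> carrier A" "R\<dagger> = R" using y by (auto simp: R_def a_comm)
    have S: "S \<in> carrier A" "S\<dagger> = S"
      using y by (auto simp: S_def a_minus_def neg_sc sc_add_right a_comm)
    \<comment> \<open>Dividing by 3 rather than 2 gives the strict bound that
      \<open>nrm_one_minus_sq\<close> asks for; 9 is the square of 3.\<close>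
    have bound: "nrm (9 \<odot> \<one> \<ominus> x \<otimes> x) \<le> 9" if "x \<in> carrier A" "x\<dagger> = x" "nrm x \<le> 2" for x
    proof -
      have "nrm (\<one> \<ominus> ((1/3) \<odot> x) \<otimes> ((1/3) \<odot> x)) \<le> 1"
        by (rule nrm_one_minus_sq) (use that in auto)
      moreover have "9 \<odot> \<one> \<ominus> x \<otimes> x = 9 \<odot> (\<one> \<ominus> ((1/3) \<odot> x) \<otimes> ((1/3) \<odot> x))"
        using that by (simp add: sc_minus_right)
      ultimately show ?thesis using that by simp
    qed
    have nR: "nrm R \<le> 2" using nrm_add[of y "y\<dagger>"] y ny by (simp add: R_def)
    have nS: "nrm S \<le> 2" using nrm_minus[of y "y\<dagger>"] y ny by (simp add: S_def)
    \<comment> \<open>The four summands bound the norm of \<open>?E\<close> by 20. But R R + S S =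
      -2 f - 2 p, so \<open>?E\<close> equals 20 + 2 p and acts on \<open>p\<close> as 22.\<close>
    let ?E = "(9 \<odot> \<one> \<ominus> R \<otimes> R) \<oplus> (9 \<odot> \<one> \<ominus> S \<otimes> S) \<oplus> (\<one> \<ominus> f) \<oplus> (\<one> \<ominus> f)"
    have "nrm ?E \<le> 9 + 9 + 1 + 1"
      using R(1) S(1) fc bound[OF R nR] bound[OF S nS] nrm_proj_le[OF proj_one_minus[OF pf]]
      by (intro nrm_add_le) auto
    then have "nrm (?E \<otimes> p) \<le> 20 * 1"
      using R S fc pp np by (intro nrm_mult_le) auto
    moreover have "?E \<otimes> p = 22 \<odot> p"
    proof -
      have SS: "S \<otimes> S = \<ominus> ((y \<ominus> y\<dagger>) \<otimes> (y \<ominus> y\<dagger>))" using y by (simp add: S_def neg_sc)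
      have oc: "9 \<odot> \<one> \<in> carrier A" by simp
      have "R \<otimes> R \<oplus> S \<otimes> S = (y \<otimes> y\<dagger> \<oplus> y \<otimes> y\<dagger>) \<oplus> (y\<dagger> \<otimes> y \<oplus> y\<dagger> \<otimes> y)"
        unfolding SS unfolding R_def using y adj_closed[OF y] by algebra
      also have "\<dots> = \<ominus> (f \<oplus> f \<oplus> p \<oplus> p)"
        unfolding yy unfolding f_def using y adj_closed[OF y] pp(1) by algebra
      finally have RS: "R \<otimes> R \<oplus> S \<otimes> S = \<ominus> (f \<oplus> f \<oplus> p \<oplus> p)" .
      have "?E = 9 \<odot> \<one> \<oplus> 9 \<odot> \<one> \<oplus> \<one> \<oplus> \<one> \<ominus> (R \<otimes> R \<oplus> S \<otimes> S) \<ominus> f \<ominus> f"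
        using R(1) S(1) fc(1) oc by algebra
      also have "\<dots> = 9 \<odot> \<one> \<oplus> 9 \<odot> \<one> \<oplus> \<one> \<oplus> \<one> \<oplus> p \<oplus> p"
        unfolding RS using fc(1) pp(1) oc by algebra
      finally have "?E \<otimes> p = 9 \<odot> p \<oplus> 9 \<odot> p \<oplus> p \<oplus> p \<oplus> p \<oplus> p"
        using pp by (simp add: l_distr)
      also have "\<dots> = (9 + 9 + 1 + 1 + 1 + 1) \<odot> p" using pp(1) by (simp only: sc_add_left sc_one)
      finally show ?thesis by simp
    qed
    ultimately show False using pp np by simp
  qed
  then have "cmod c = Re c" by (metis real norm_of_real abs_of_nonneg)
  then show ?thesis using nx real by simp
qed

text \<open>The two bounds say that e and -e are positive. Shrinking by k = 1 / (1 + \<epsilon>)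
  makes both square roots available: s1 s1 = k (\<epsilon> + e) and s2 s2 = k (\<epsilon> - e). For
  g = s1 s2 this gives (k e)(k e) + g g = (k \<epsilon>)(k \<epsilon>), hence
  \<open>nrm e \<le> \<epsilon>\<close>.\<close>

lemma sa_eq_zero_if_two_sided:
  assumes e: "e \<in> carrier A" "e\<dagger> = e" and le: "nrm (\<one> \<ominus> e) \<le> 1" "nrm (\<one> \<oplus> e) \<le> 1"
  shows "e = \<zero>"
proof -
  have "nrm e \<le> 0 + \<epsilon>" if "0 < \<epsilon>" for \<epsilon> :: real
  proof -
    define k where "k = complex_of_real (1 / (1 + \<epsilon>))"
    have k: "cmod k < 1" "cnj k = k" "k * (1 + of_real \<epsilon>) = 1"
      using that by (auto simp: k_def norm_divide simp del: of_real_add of_real_divide)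
         (simp_all add: field_simps complex_eq_iff)
    have kle: "cmod k * a < 1" if "a \<le> 1" for a
      using k(1) mult_left_mono[OF that, of "cmod k"] by simp
    obtain s1 where s1: "s1 \<in> carrier A" "s1\<dagger> = s1" "s1 \<otimes> s1 = \<one> \<ominus> k \<odot> (\<one> \<ominus> e)"
      "\<And>c. c \<in> carrier A \<Longrightarrow> c \<otimes> (k \<odot> (\<one> \<ominus> e)) = (k \<odot> (\<one> \<ominus> e)) \<otimes> c \<Longrightarrow> c \<otimes> s1 = s1 \<otimes> c"
      using sqrt_one_minus[of "k \<odot> (\<one> \<ominus> e)"] e k kle[OF le(1)] by (metis adj_minus adj_one adj_sc minus_closed nrm_sc one_closed sc_closed)
    obtain s2 where s2: "s2 \<in> carrier A" "s2\<dagger> = s2" "s2 \<otimes> s2 = \<one> \<ominus> k \<odot> (\<one> \<oplus> e)"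
      "\<And>c. c \<in> carrier A \<Longrightarrow> c \<otimes> (k \<odot> (\<one> \<oplus> e)) = (k \<odot> (\<one> \<oplus> e)) \<otimes> c \<Longrightarrow> c \<otimes> s2 = s2 \<otimes> c"
      using sqrt_one_minus[of "k \<odot> (\<one> \<oplus> e)"] e k kle[OF le(2)] by (metis adj_add adj_one adj_sc a_closed nrm_sc one_closed sc_closed)
    have es1: "e \<otimes> s1 = s1 \<otimes> e" by (rule s1(4)) (use e(1) in \<open>simp_all add: mult_minus_left mult_minus_right\<close>)
    have es2: "e \<otimes> s2 = s2 \<otimes> e" by (rule s2(4)) (use e(1) in \<open>simp_all add: l_distr r_distr\<close>)
    have s12: "s1 \<otimes> s2 = s2 \<otimes> s1"
      by (rule s2(4)) (use e(1) s1(1) es1 in \<open>simp_all add: l_distr r_distr\<close>)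
    define g where "g = s1 \<otimes> s2"
    have g: "g \<in> carrier A" "g\<dagger> = g" using s1(1,2) s2(1,2) s12 by (auto simp: g_def)
    have eg: "e \<otimes> g = g \<otimes> e" unfolding g_def by (metis e(1) es1 es2 m_assoc s1(1) s2(1))
    define x where "x = k \<odot> e"
    have x: "x \<in> carrier A" "x\<dagger> = x" "x \<otimes> g = g \<otimes> x" using e g eg k by (auto simp: x_def)
    define d where "d = (k * of_real \<epsilon>) \<odot> \<one>"
    have d: "d \<in> carrier A" by (simp add: d_def)
    have k1: "\<one> \<ominus> k \<odot> \<one> = d"
    proof -
      have "(1 - k) \<odot> \<one> = \<one> \<ominus> k \<odot> \<one>" using sc_minus_left[of \<one> 1 k] by simp
      moreover have "1 - k = k * of_real \<epsilon>" using k(3) by (simp add: algebra_simps)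
      ultimately show ?thesis by (simp add: d_def)
    qed
    have q1: "s1 \<otimes> s1 = d \<oplus> x"
    proof -
      have "\<one> \<ominus> k \<odot> (\<one> \<ominus> e) = \<one> \<ominus> k \<odot> \<one> \<oplus> x"
        unfolding x_def sc_minus_right[OF one_closed e(1)] using sc_closed[OF e(1), of k] sc_closed[OF one_closed, of k]
        by algebra
      then show ?thesis by (simp add: s1(3) k1)
    qed
    have q2: "s2 \<otimes> s2 = d \<ominus> x"
    proof -
      have "\<one> \<ominus> k \<odot> (\<one> \<oplus> e) = \<one> \<ominus> k \<odot> \<one> \<ominus> x"
        unfolding x_def sc_add_right[OF one_closed e(1)] using sc_closed[OF e(1), of k] sc_closed[OF one_closed, of k]
        by algebra
      then show ?thesis by (simp add: s2(3) k1)
    qed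
    have "g \<otimes> g = s1 \<otimes> (s1 \<otimes> s2) \<otimes> s2"
      unfolding g_def using s1(1) s2(1) s12 by (metis m_assoc m_closed)
    also have "\<dots> = (s1 \<otimes> s1) \<otimes> (s2 \<otimes> s2)" using s1(1) s2(1) by (simp add: m_assoc)
    also have "\<dots> = d \<otimes> d \<oplus> x \<otimes> d \<ominus> d \<otimes> x \<ominus> x \<otimes> x" unfolding q1 q2 using d x(1) by algebra
    also have "x \<otimes> d = d \<otimes> x" using x(1) by (simp add: d_def)
    finally have gg: "g \<otimes> g = d \<otimes> d \<oplus> d \<otimes> x \<ominus> d \<otimes> x \<ominus> x \<otimes> x" .
    have "x \<otimes> x \<oplus> g \<otimes> g = d \<otimes> d" unfolding gg using x(1) d by algebra
    then have "(nrm x)\<^sup>2 \<le> nrm (d \<otimes> d)" using nrm_sq_le_sum[OF x(1,2) g x(3)] by simp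
    also have "\<dots> \<le> (cmod k * \<epsilon>)\<^sup>2"
    proof -
      have "nrm (d \<otimes> d) = (cmod k * \<epsilon>)\<^sup>2 * nrm \<one>"
        using that by (simp add: d_def norm_mult power2_eq_square)
      then show ?thesis using nrm_one_le by (simp add: mult_left_le)
    qed
    finally have "nrm x \<le> cmod k * \<epsilon>" by (rule power2_le_imp_le) (use that in auto)
    then have "cmod k * nrm e \<le> cmod k * \<epsilon>" using e by (simp add: x_def)
    moreover have "0 < cmod k" using k(3) by auto
    ultimately show ?thesis by simp
  qed
  then have "nrm e \<le> 0" by (rule field_le_epsilon)
  then show ?thesis using e nrm_ge[OF e(1)] nrm_eq_0[OF e(1)] by linarith
qed

text \<open>The element splits into the orthogonal pieces 1 - P and b = P (1 - Q) P, so its n-th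
  power is (1 - P) + b ^ n with norm at most 2, and bounded powers suffice.\<close>

lemma nrm_one_minus_compression:
  assumes P: "is_projection A P" and Q: "is_projection A Q"
  shows "nrm (\<one> \<ominus> P \<otimes> Q \<otimes> P) \<le> 1"
proof -
  note p = projD[OF P] and q = projD[OF Q]
  define b where "b = P \<otimes> (\<one> \<ominus> Q) \<otimes> P"
  have b: "b \<in> carrier A" "P \<otimes> b = b" using p q by (auto simp: b_def m_assoc[symmetric])
  have "nrm b \<le> 1 * 1 * 1"
    unfolding b_def using nrm_proj_le[OF P] nrm_proj_le[OF proj_one_minus[OF Q]] p q
    by (intro nrm_mult_le) auto
  then have nb: "nrm b \<le> 1" by simp
  define a where "a = \<one> \<ominus> P \<otimes> Q \<otimes> P"
  have a: "a \<in> carrier A" "a\<dagger> = a" using p q by (auto simp: a_def m_assoc)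
  have "b = P \<otimes> P \<ominus> P \<otimes> Q \<otimes> P"
  proof -
    have "P \<otimes> (\<one> \<ominus> Q) = P \<ominus> P \<otimes> Q" using p(1) q(1) by (simp add: mult_minus_right)
    then show ?thesis using p(1) q(1) by (simp add: b_def mult_minus_left)
  qed
  then have bP: "b = P \<ominus> P \<otimes> Q \<otimes> P" using p by simp
  have ab: "a = (\<one> \<ominus> P) \<oplus> b" unfolding a_def bP using p(1) q(1) by algebra
  have Pb: "(\<one> \<ominus> P) \<otimes> b = \<zero>" using b p by (simp add: mult_minus_left)
  have bP0: "b \<otimes> (\<one> \<ominus> P) = \<zero>"
  proof -
    have "b \<otimes> P = b" using p q by (simp add: b_def m_assoc)
    then show ?thesis using b p by (simp add: mult_minus_right)
  qed
  have pw: "a [^] Suc n = (\<one> \<ominus> P) \<oplus> b [^] Suc n" for n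
  proof (induction n)
    case 0 then show ?case using ab a b p by simp
  next
    case (Suc n)
    have bn: "b [^] Suc n \<otimes> (\<one> \<ominus> P) = \<zero>" using bP0 b p by (simp add: m_assoc)
    have "a [^] Suc (Suc n) = ((\<one> \<ominus> P) \<oplus> b [^] Suc n) \<otimes> ((\<one> \<ominus> P) \<oplus> b)"
      using Suc ab by simp
    also have "\<dots> = (\<one> \<ominus> P) \<otimes> (\<one> \<ominus> P) \<oplus> (\<one> \<ominus> P) \<otimes> b \<oplus> b [^] Suc n \<otimes> (\<one> \<ominus> P) \<oplus> b [^] Suc n \<otimes> b"
      using b(1) p(1) pow_closed[OF b(1), of "Suc n"] minus_closed[OF one_closed p(1)]
      by (simp only: l_distr r_distr a_closed m_closed a_assoc) (simp only: a_ac m_closed a_closed)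
    also have "\<dots> = (\<one> \<ominus> P) \<oplus> b [^] Suc (Suc n)"
      unfolding Pb bn projD(2)[OF proj_one_minus[OF P]] using b p by simp
    finally show ?case .
  qed
  have "nrm a \<le> 1"
  proof (rule nrm_le_one_if_bounded_powers[OF a])
    fix n :: nat assume "0 < n"
    then obtain m where n: "n = Suc m" by (cases n) auto
    have "nrm (b [^] k) \<le> 1" for k :: nat
    proof (induction k)
      case (Suc k)
      then show ?case using nrm_mult_le[of "b [^] k" b 1 1] b nb by simp
    qed (simp add: nrm_one_le)
    then show "nrm (a [^] n) \<le> 1 + 1"
      unfolding n pw
      using nrm_add_le[OF minus_closed[OF one_closed p(1)] pow_closed[OF b(1)] nrm_proj_le[OF proj_one_minus[OF P]]]
      by blast
  qed
  then show ?thesis by (simp add: a_def)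
qed

text \<open>Compress the sum by P = \<open>Q i\<close>. The term of index i contributes P itself, so
  the remaining P \<open>Q k\<close> P add up to zero. Each of them is positive in the sense
  \<open>nrm (\<one> \<ominus> d k) \<le> 1\<close>, hence \<open>d j\<close> is also minus a sum of
  positive elements and must vanish.\<close>

lemma orthogonal_if_sum_one:
  assumes fin: "finite I" and Q: "\<And>i. i \<in> I \<Longrightarrow> is_projection A (Q i)"
    and sum: "finsum A Q I = \<one>" and ij: "i \<in> I" "j \<in> I" "i \<noteq> j"
  shows "Q i \<otimes> Q j = \<zero>"
proof -
  note q = projD[OF Q]
  define P where "P = Q i"
  have p: "P \<in> carrier A" "P \<otimes> P = P" "P\<dagger> = P" using q[OF ij(1)] by (auto simp: P_def)
  define d where "d k = P \<otimes> Q k \<otimes> P" for k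
  have dc: "d k \<in> carrier A" "(d k)\<dagger> = d k" if "k \<in> I" for k
    using p q[OF that] by (auto simp: d_def m_assoc)
  have dn: "nrm (\<one> \<ominus> d k) \<le> 1" if "k \<in> I" for k
    using nrm_one_minus_compression[OF Q[OF ij(1)] Q[OF that]] by (simp add: d_def P_def)
  define J where "J = I - {i, j}"
  have J: "finite J" "J \<subseteq> I" "i \<notin> insert j J" "j \<notin> J" "I = insert i (insert j J)" using fin ij by (auto simp: J_def)
  have "finsum A d I = finsum A (\<lambda>k. P \<otimes> Q k) I \<otimes> P"
    unfolding d_def by (rule finsum_ldistr[symmetric]) (use fin p q in auto)
  also have "finsum A (\<lambda>k. P \<otimes> Q k) I = P \<otimes> finsum A Q I"
    by (rule finsum_rdistr[symmetric]) (use fin p q in auto)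
  finally have "finsum A d I = P" using sum p by simp
  moreover have "finsum A d I = d i \<oplus> (d j \<oplus> finsum A d J)"
    using J dc ij by (subst J(5), subst finsum_insert) (auto simp: finsum_insert Pi_def)
  moreover have "d i = P" using p by (simp add: d_def P_def)
  ultimately have "P \<oplus> (d j \<oplus> finsum A d J) = P \<oplus> \<zero>" using p by simp
  moreover have dJ: "finsum A d J \<in> carrier A" using J dc by (intro finsum_closed) auto
  moreover have "d j \<oplus> finsum A d J = (P \<oplus> (d j \<oplus> finsum A d J)) \<ominus> P"
    using dJ p(1) dc(1)[OF ij(2)] by algebra
  ultimately have z: "d j \<oplus> finsum A d J = \<zero>" using p by simp
  have cardJ: "nrm (of_nat (card F) \<odot> \<one> \<ominus> finsum A d F) \<le> card F" if "F \<subseteq> I" for F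
    using finite_subset[OF that fin] that
  proof (induction F rule: finite_induct)
    case (insert k F)
    have f: "finsum A d F \<in> carrier A" using insert dc by (intro finsum_closed) auto
    have k: "d k \<in> carrier A" using insert dc by auto
    have c: "of_nat (card F) \<odot> \<one> \<in> carrier A" by simp
    have "of_nat (card (insert k F)) \<odot> \<one> \<ominus> finsum A d (insert k F) =
      (\<one> \<oplus> of_nat (card F) \<odot> \<one>) \<ominus> (d k \<oplus> finsum A d F)"
      using insert dc by (subst finsum_insert) (auto simp: sc_add_left)
    also have "\<dots> = (\<one> \<ominus> d k) \<oplus> (of_nat (card F) \<odot> \<one> \<ominus> finsum A d F)" using f k c by algebra
    finally show ?case using insert f k dn by (auto intro: nrm_add_le)
  qed simp
  \<comment> \<open>The number of indices other than i. After division by it \<open>d j\<close> fits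
    \<open>sa_eq_zero_if_two_sided\<close>, since M (1 + e) and M (1 - e) both split into parts of
    total norm at most M.\<close>
  define M where "M = real (card J) + 1"
  have M: "0 < M" "complex_of_real M = 1 + of_nat (card J)" by (auto simp: M_def)
  define e where "e = of_real (1 / M) \<odot> d j"
  have e: "e \<in> carrier A" "e\<dagger> = e" using dc[OF ij(2)] by (auto simp: e_def)
  have c: "of_nat (card J) \<odot> \<one> \<in> carrier A" by simp
  have Me: "of_real M \<odot> e = d j" "of_real M \<odot> \<one> = \<one> \<oplus> of_nat (card J) \<odot> \<one>"
    using M(1) dc[OF ij(2)] by (simp add: e_def flip: of_real_mult, simp add: sc_add_left M(2))
  have "of_real M \<odot> (\<one> \<oplus> e) = \<one> \<oplus> (of_nat (card J) \<odot> \<one> \<ominus> finsum A d J)"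
  proof -
    have "d j = \<ominus> finsum A d J" using z dJ dc[OF ij(2)] by (metis minus_equality a_comm)
    then show ?thesis
      using e c dJ by (simp add: sc_add_right Me a_assoc) (simp add: a_minus_def)
  qed
  then have "M * nrm (\<one> \<oplus> e) \<le> 1 + card J"
    using nrm_sc[of "\<one> \<oplus> e" "of_real M"] M(1) e nrm_add_le[OF one_closed _ nrm_one_le cardJ[OF J(2)]] c dJ by simp
  then have "M * nrm (\<one> \<oplus> e) \<le> M * 1" by (simp only: M_def mult_1_right add.commute)
  then have up: "nrm (\<one> \<oplus> e) \<le> 1" using M(1) by (simp only: mult_le_cancel_left_pos)
  have "of_real M \<odot> (\<one> \<ominus> e) = (\<one> \<ominus> d j) \<oplus> of_nat (card J) \<odot> \<one>"
    unfolding sc_minus_right[OF one_closed e(1)] Me using c dc[OF ij(2)] by algebra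
  moreover have "nrm (of_nat (card J) \<odot> \<one>) \<le> card J" using nrm_one_le by (simp add: mult_left_le)
  ultimately have "M * nrm (\<one> \<ominus> e) \<le> 1 + card J"
    using nrm_sc[of "\<one> \<ominus> e" "of_real M"] M(1) e dc[OF ij(2)] c dn[OF ij(2)]
      nrm_add_le[of "\<one> \<ominus> d j" "of_nat (card J) \<odot> \<one>" 1 "card J"] by simp
  then have "M * nrm (\<one> \<ominus> e) \<le> M * 1" by (simp only: M_def mult_1_right add.commute)
  then have dn': "nrm (\<one> \<ominus> e) \<le> 1" using M(1) by (simp only: mult_le_cancel_left_pos)
  have "e = \<zero>" using sa_eq_zero_if_two_sided[OF e dn' up] .
  then have "d j = \<zero>" using Me(1) by simp
  moreover have "d j = (Q j \<otimes> P)\<dagger> \<otimes> (Q j \<otimes> P)"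
    using p q[OF ij(2)] proj_assoc[OF Q[OF ij(2)]] by (simp add: d_def m_assoc)
  ultimately have "Q j \<otimes> P = \<zero>" using adj_mult_eq_0[of "Q j \<otimes> P"] p q[OF ij(2)] by simp
  then have "(Q j \<otimes> P)\<dagger> = \<zero>\<dagger>" by simp
  then show ?thesis using p q[OF ij(2)] by (simp add: P_def)
qed

end

text \<open>A relation r r + s s = 1 with commuting self-adjoint r and s is preserved by
  \<open>h\<close> and bounds \<open>h r\<close> by one. Scaling gives the claim for self-adjoint
  elements, the C*-identity for all.\<close>

lemma star_hom_contractive:
  assumes "unital_cstar_algebra A" "unital_cstar_algebra B" "unital_star_hom A B h" "x \<in> carrier A"
  shows "cnorm B (h x) \<le> cnorm A x"
proof -
  interpret A: cstar_alg A by unfold_locales fact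
  interpret B: cstar_alg B by unfold_locales fact
  have hc: "h x \<in> carrier B" if "x \<in> carrier A" for x
    using assms(3) that by (auto simp: unital_star_hom_def)
  have h: "h \<one>\<^bsub>A\<^esub> = \<one>\<^bsub>B\<^esub>"
    "\<And>x y. x \<in> carrier A \<Longrightarrow> y \<in> carrier A \<Longrightarrow> h (x \<oplus>\<^bsub>A\<^esub> y) = h x \<oplus>\<^bsub>B\<^esub> h y"
    "\<And>x y. x \<in> carrier A \<Longrightarrow> y \<in> carrier A \<Longrightarrow> h (x \<otimes>\<^bsub>A\<^esub> y) = h x \<otimes>\<^bsub>B\<^esub> h y"
    "\<And>c x. x \<in> carrier A \<Longrightarrow> h (smult A c x) = smult B c (h x)"
    "\<And>x. x \<in> carrier A \<Longrightarrow> h (star A x) = star B (h x)"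
    using assms(3) by (auto simp: unital_star_hom_def)
  have small: "cnorm B (h r) \<le> 1" if r: "r \<in> carrier A" "star A r = r" "cnorm A r < 1" for r
  proof -
    obtain s where s: "s \<in> carrier A" "star A s = s" "r \<otimes>\<^bsub>A\<^esub> s = s \<otimes>\<^bsub>A\<^esub> r"
        "r \<otimes>\<^bsub>A\<^esub> r \<oplus>\<^bsub>A\<^esub> s \<otimes>\<^bsub>A\<^esub> s = \<one>\<^bsub>A\<^esub>"
      using A.sqrt_one_minus_sq[OF r] .
    have "(cnorm B (h r))\<^sup>2 \<le> cnorm B (h r \<otimes>\<^bsub>B\<^esub> h r \<oplus>\<^bsub>B\<^esub> h s \<otimes>\<^bsub>B\<^esub> h s)"
    proof (rule B.nrm_sq_le_sum)
      show "star B (h r) = h r" "star B (h s) = h s" using h(5) r s by metis+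
      show "h r \<otimes>\<^bsub>B\<^esub> h s = h s \<otimes>\<^bsub>B\<^esub> h r" using h(3) r s by metis
    qed (use r s hc in auto)
    also have "h r \<otimes>\<^bsub>B\<^esub> h r \<oplus>\<^bsub>B\<^esub> h s \<otimes>\<^bsub>B\<^esub> h s = h (r \<otimes>\<^bsub>A\<^esub> r \<oplus>\<^bsub>A\<^esub> s \<otimes>\<^bsub>A\<^esub> s)"
      using r(1) s(1) by (simp add: h)
    finally have "(cnorm B (h r))\<^sup>2 \<le> 1" using B.nrm_one_le by (simp add: s(4) h)
    then show ?thesis by (simp add: abs_square_le_1 B.nrm_ge hc r)
  qed
  have sa: "cnorm B (h r) \<le> cnorm A r" if r: "r \<in> carrier A" "star A r = r" for r
  proof (rule field_le_epsilon)
    fix \<epsilon> :: real assume "0 < \<epsilon>"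
    define t where "t = cnorm A r + \<epsilon>"
    have t: "0 < t" "cnorm A r < t" using \<open>0 < \<epsilon>\<close> A.nrm_ge[OF r(1)] by (simp_all add: t_def)
    have "cnorm B (h (smult A (of_real (1 / t)) r)) \<le> 1"
      by (rule small) (use r t in \<open>simp_all add: norm_divide\<close>)
    then have "cnorm B (h r) \<le> t" using r t hc by (simp add: h norm_divide)
    then show "cnorm B (h r) \<le> cnorm A r + \<epsilon>" by (simp add: t_def)
  qed
  have "(cnorm B (h x))\<^sup>2 = cnorm B (h (star A x \<otimes>\<^bsub>A\<^esub> x))"
    using assms(4) hc B.nrm_cstar by (simp add: h)
  also have "\<dots> \<le> cnorm A (star A x \<otimes>\<^bsub>A\<^esub> x)" using assms(4) by (intro sa) auto
  also have "\<dots> = (cnorm A x)\<^sup>2" using assms(4) A.nrm_cstar by simp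
  finally show ?thesis by (rule power2_le_imp_le) (use assms(4) in auto)
qed

section \<open>Separability, transport of structure and the gauge action\<close>

text \<open>A vertex is determined by its set of admissible pasts, a set of words of length
  \<open>l\<close> over a finite alphabet.\<close>

lemma finite_Vmin [simp]: "finite (Vmin (L :: (int \<Rightarrow> 's::finite) set) l)"
proof -
  have "Vmin L l \<subseteq> (\<lambda>X. {\<nu> \<in> Sync L l. Gamma_minus L l \<nu> = X}) ` Pow {w. set w \<subseteq> UNIV \<and> length w = l}"
    by (auto simp: Vmin_def vclass_def past_eq_def Gamma_minus_def Bl_def)
  moreover have "finite (Pow {w :: 's list. set w \<subseteq> UNIV \<and> length w = l})"
    by (intro finite_Pow_iff[THEN iffD2] finite_lists_length_eq) simp
  ultimately show ?thesis by (meson finite_imageI finite_subset)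
qed

lemma unital_star_homD:
  assumes "unital_star_hom A B h"
  shows "x \<in> carrier A \<Longrightarrow> h x \<in> carrier B" "h \<one>\<^bsub>A\<^esub> = \<one>\<^bsub>B\<^esub>"
    "x \<in> carrier A \<Longrightarrow> y \<in> carrier A \<Longrightarrow> h (x \<oplus>\<^bsub>A\<^esub> y) = h x \<oplus>\<^bsub>B\<^esub> h y"
    "x \<in> carrier A \<Longrightarrow> y \<in> carrier A \<Longrightarrow> h (x \<otimes>\<^bsub>A\<^esub> y) = h x \<otimes>\<^bsub>B\<^esub> h y"
    "x \<in> carrier A \<Longrightarrow> h (smult A c x) = smult B c (h x)"
    "x \<in> carrier A \<Longrightarrow> h (star A x) = star B (h x)"
  using assms by (auto simp: unital_star_hom_def)

lemma min_relationsD: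
  assumes "min_relations L A S E"
  shows "is_partial_isometry A (S \<alpha>)"
    and "v \<in> Vmin L l \<Longrightarrow> is_projection A (E l v)"
    and "finsum A (\<lambda>\<beta>. monoid.mult A (S \<beta>) (star A (S \<beta>))) UNIV = one A"
    and "finsum A (E l) (Vmin L l) = one A"
    and "v \<in> Vmin L l \<Longrightarrow>
        monoid.mult A (monoid.mult A (S \<alpha>) (star A (S \<alpha>))) (E l v) = monoid.mult A (E l v) (monoid.mult A (S \<alpha>) (star A (S \<alpha>)))"
    and "v \<in> Vmin L l \<Longrightarrow> E l v = finsum A (E (Suc l)) {w \<in> Vmin L (Suc l). Imin L l v w}"
    and "v \<in> Vmin L l \<Longrightarrow> monoid.mult A (monoid.mult A (star A (S \<alpha>)) (E l v)) (S \<alpha>) =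
        finsum A (E (Suc l)) {w \<in> Vmin L (Suc l). Amin L l v \<alpha> w}"
  using assms unfolding min_relations_def by (elim conjE; blast)+

locale cstar_hom = A: cstar_alg A + B: cstar_alg B
  for A :: "('a, 'm) cstar_scheme" and B :: "('b, 'n) cstar_scheme" +
  fixes h assumes hom: "unital_star_hom A B h"
begin

lemmas hom_simps [simp] = unital_star_homD[OF hom]

lemma hom_zero [simp]: "h \<zero>\<^bsub>A\<^esub> = \<zero>\<^bsub>B\<^esub>"
  using hom_simps(5)[of "\<zero>\<^bsub>A\<^esub>" 0] by simp

lemma hom_finsum:
  assumes "\<And>i. i \<in> F \<Longrightarrow> f i \<in> carrier A"
  shows "h (finsum A f F) = finsum B (\<lambda>i. h (f i)) F"
proof (cases "finite F")
  case True
  then show ?thesis using assms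
    by (induction F rule: finite_induct) (auto simp: Pi_def A.finsum_insert B.finsum_insert)
next
  \<comment> \<open>Over an infinite index set both sums have the default value zero.\<close>
  case False
  then show ?thesis by (simp add: finsum_def finprod_def)
qed

lemma hom_projection: "is_projection A p \<Longrightarrow> is_projection B (h p)"
  unfolding is_projection_def by (metis hom_simps(1,4,6))

text \<open>The relations are identities between *-polynomials, so unital *-homomorphisms preserve
  them. In this way solutions in the algebra itself or in \<open>BH\<close> are moved to a copy
  carried by \<open>nat \<Rightarrow> complex\<close>.\<close>

lemma hom_min_relations:
  assumes "min_relations L A S E"
  shows "min_relations L B (\<lambda>\<alpha>. h (S \<alpha>)) (\<lambda>l v. h (E l v))"
proof -
  have S: "S \<alpha> \<in> carrier A" "is_projection A (star A (S \<alpha>) \<otimes>\<^bsub>A\<^esub> S \<alpha>)" for \<alpha>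
    using assms by (auto simp: min_relations_def is_partial_isometry_def)
  have E: "is_projection A (E l v)" if "v \<in> Vmin L l" for l v using assms that by (auto simp: min_relations_def)
  then have Ec: "E l v \<in> carrier A" if "v \<in> Vmin L l" for l v using that by (auto simp: is_projection_def)
  show ?thesis unfolding min_relations_def
  proof (intro conjI allI ballI)
    fix \<alpha> show "is_partial_isometry B (h (S \<alpha>))"
      using S hom_projection[OF S(2)[of \<alpha>]] by (simp add: is_partial_isometry_def)
  next
    have "finsum B (\<lambda>\<beta>. h (S \<beta>) \<otimes>\<^bsub>B\<^esub> star B (h (S \<beta>))) UNIV =
      finsum B (\<lambda>\<beta>. h (S \<beta> \<otimes>\<^bsub>A\<^esub> star A (S \<beta>))) UNIV"
      using S by (intro B.finsum_cong') auto
    also have "\<dots> = h (finsum A (\<lambda>\<beta>. S \<beta> \<otimes>\<^bsub>A\<^esub> star A (S \<beta>)) UNIV)"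
      using S by (subst hom_finsum) auto
    finally show "finsum B (\<lambda>\<beta>. h (S \<beta>) \<otimes>\<^bsub>B\<^esub> star B (h (S \<beta>))) UNIV = \<one>\<^bsub>B\<^esub>"
      using min_relationsD(3)[OF assms] by simp
  next
    fix l show "finsum B (\<lambda>v. h (E l v)) (Vmin L l) = \<one>\<^bsub>B\<^esub>"
      using min_relationsD(4)[OF assms] hom_finsum[of "Vmin L l" "E l"] Ec by simp
  next
    fix l v assume "v \<in> Vmin L l" then show "is_projection B (h (E l v))" using E hom_projection by blast
  next
    fix l \<alpha> v assume v: "v \<in> Vmin L l"
    have "S \<alpha> \<otimes>\<^bsub>A\<^esub> star A (S \<alpha>) \<otimes>\<^bsub>A\<^esub> E l v = E l v \<otimes>\<^bsub>A\<^esub> (S \<alpha> \<otimes>\<^bsub>A\<^esub> star A (S \<alpha>))"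
      by (rule min_relationsD(5)[OF assms v])
    then have "h (S \<alpha> \<otimes>\<^bsub>A\<^esub> star A (S \<alpha>) \<otimes>\<^bsub>A\<^esub> E l v) = h (E l v \<otimes>\<^bsub>A\<^esub> (S \<alpha> \<otimes>\<^bsub>A\<^esub> star A (S \<alpha>)))" by simp
    then show "h (S \<alpha>) \<otimes>\<^bsub>B\<^esub> star B (h (S \<alpha>)) \<otimes>\<^bsub>B\<^esub> h (E l v) = h (E l v) \<otimes>\<^bsub>B\<^esub> (h (S \<alpha>) \<otimes>\<^bsub>B\<^esub> star B (h (S \<alpha>)))"
      using S Ec v by simp
  next
    fix l u assume u: "u \<in> Vmin L l"
    have "h (E l u) = h (finsum A (E (Suc l)) {v \<in> Vmin L (Suc l). Imin L l u v})"
      using min_relationsD(6)[OF assms u] by simp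
    also have "\<dots> = finsum B (\<lambda>v. h (E (Suc l) v)) {v \<in> Vmin L (Suc l). Imin L l u v}"
      by (rule hom_finsum) (use Ec in auto)
    finally show "h (E l u) = finsum B (\<lambda>v. h (E (Suc l) v)) {v \<in> Vmin L (Suc l). Imin L l u v}" .
  next
    fix l \<alpha> u assume u: "u \<in> Vmin L l"
    have "star A (S \<alpha>) \<otimes>\<^bsub>A\<^esub> E l u \<otimes>\<^bsub>A\<^esub> S \<alpha> = finsum A (E (Suc l)) {v \<in> Vmin L (Suc l). Amin L l u \<alpha> v}"
      by (rule min_relationsD(7)[OF assms u])
    then have "h (star A (S \<alpha>) \<otimes>\<^bsub>A\<^esub> E l u \<otimes>\<^bsub>A\<^esub> S \<alpha>) = h (finsum A (E (Suc l)) {v \<in> Vmin L (Suc l). Amin L l u \<alpha> v})"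
      by simp
    moreover have "h (finsum A (E (Suc l)) {v \<in> Vmin L (Suc l). Amin L l u \<alpha> v}) =
        finsum B (\<lambda>v. h (E (Suc l) v)) {v \<in> Vmin L (Suc l). Amin L l u \<alpha> v}"
      by (rule hom_finsum) (use Ec in auto)
    ultimately show "star B (h (S \<alpha>)) \<otimes>\<^bsub>B\<^esub> h (E l u) \<otimes>\<^bsub>B\<^esub> h (S \<alpha>) = finsum B (\<lambda>v. h (E (Suc l) v)) {v \<in> Vmin L (Suc l). Amin L l u \<alpha> v}"
      using S Ec u by simp
  qed
qed

end

subsection \<open>Density\<close>

context cstar_alg begin

lemma lims_eventually:
  assumes "lims f x" "0 < e" shows "\<exists>N. \<forall>n\<ge>N. nrm (f n \<ominus> x) < e"
proof -
  have "(\<lambda>n. nrm (f n \<ominus> x)) \<longlonglongrightarrow> 0" using assms by (simp add: lims_def)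
  from order_tendstoD(2)[OF this assms(2)] show ?thesis unfolding eventually_sequentially .
qed

definition cl :: "'a set \<Rightarrow> 'a set" where
  "cl D = {x \<in> carrier A. \<forall>e>0. \<exists>d\<in>D. nrm (d \<ominus> x) < e}"

lemma subset_cl: "D \<subseteq> carrier A \<Longrightarrow> D \<subseteq> cl D"
  unfolding cl_def by (auto intro!: bexI)

lemma cl_lims: assumes D: "D \<subseteq> carrier A" and x: "x \<in> cl D" obtains f where "\<And>n. f n \<in> D" "lims f x"
proof -
  have "\<forall>n. \<exists>d\<in>D. nrm (d \<ominus> x) < 1 / real (Suc n)" using x by (auto simp: cl_def)
  then obtain f where f: "\<And>n. f n \<in> D" "\<And>n. nrm (f n \<ominus> x) < 1 / real (Suc n)" by metis
  have c: "f n \<in> carrier A" "x \<in> carrier A" for n using f(1) D x by (auto simp: cl_def)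
  have "(\<lambda>n. nrm (f n \<ominus> x)) \<longlonglongrightarrow> 0"
    by (rule tendsto_0_le[OF LIMSEQ_Suc[OF lim_1_over_n]]) (use f(2) c in \<open>auto intro: less_imp_le\<close>)
  then show thesis using that f(1) c by (auto simp: lims_def)
qed

lemma lims_cl: assumes "lims f x" "\<And>n. f n \<in> cl D" "D \<subseteq> carrier A" shows "x \<in> cl D"
  unfolding cl_def
proof (intro CollectI conjI allI impI)
  show x: "x \<in> carrier A" using limsD(2)[OF assms(1)] .
  fix e :: real assume "0 < e"
  then have e2: "0 < e / 2" by simp
  obtain n where n: "nrm (f n \<ominus> x) < e / 2"
    using lims_eventually[OF assms(1) e2] by blast
  have "\<forall>e>0. \<exists>d\<in>D. nrm (d \<ominus> f n) < e" using assms(2)[of n] by (simp add: cl_def)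
  then obtain d where d: "d \<in> D" "nrm (d \<ominus> f n) < e / 2" using e2 by blast
  then have "nrm (d \<ominus> x) < e"
    using nrm_triangle[of d "f n" x] n assms(3) limsD[OF assms(1)] by (auto simp: subset_eq)
  then show "\<exists>d\<in>D. nrm (d \<ominus> x) < e" using d by blast
qed

text \<open>Scalar multiples are only required to lie in the closure, because the set used for
  separability is closed under Gaussian rational scalars alone.\<close>

lemma cl_subalgebra:
  assumes D: "D \<subseteq> carrier A" and zero: "\<zero> \<in> D"
    and add: "\<And>x y. x \<in> D \<Longrightarrow> y \<in> D \<Longrightarrow> x \<oplus> y \<in> D"
    and mul: "\<And>x y. x \<in> D \<Longrightarrow> y \<in> D \<Longrightarrow> x \<otimes> y \<in> D"
    and adj: "\<And>x. x \<in> D \<Longrightarrow> x\<dagger> \<in> D"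
    and sc: "\<And>c x. x \<in> D \<Longrightarrow> c \<odot> x \<in> cl D"
  shows "cstar_subalgebra A (cl D)"
  unfolding cstar_subalgebra_def
proof (intro conjI ballI allI)
  show "norm_closed A (cl D)" unfolding norm_closed_iff using lims_cl[OF _ _ D] by (auto simp: cl_def)
  show "\<zero> \<in> cl D" using zero subset_cl[OF D] by blast
next
  fix x y assume "x \<in> cl D" "y \<in> cl D"
  then obtain f g where f: "\<And>n. f n \<in> D" "lims f x" and g: "\<And>n. g n \<in> D" "lims g y"
    using cl_lims[OF D] by metis
  show "x \<oplus> y \<in> cl D" using lims_cl[OF lims_add[OF f(2) g(2)] _ D] add f g subset_cl[OF D] by blast
  show "x \<otimes> y \<in> cl D" using lims_cl[OF lims_mult[OF f(2) g(2)] _ D] mul f g subset_cl[OF D] by blast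
next
  fix x c assume "x \<in> cl D"
  then obtain f where f: "\<And>n. f n \<in> D" "lims f x" using cl_lims[OF D] by metis
  show "c \<odot> x \<in> cl D" using lims_cl[OF lims_sc[OF f(2)] _ D] sc f by blast
next
  fix x assume "x \<in> cl D"
  then obtain f where f: "\<And>n. f n \<in> D" "lims f x" using cl_lims[OF D] by metis
  show "x\<dagger> \<in> cl D" using lims_cl[OF lims_adj[OF f(2)] _ D] adj f subset_cl[OF D] by blast
qed

end

text \<open>Syntax for *-polynomials with coefficients in Q + i Q. Being a datatype it is countable,
  so its values form a countable set.\<close>

datatype star_term =
  Gen nat | One | Scal rat rat star_term | Add star_term star_term | Mult star_term star_term | Star star_term

instance star_term :: countable by countable_datatype

context cstar_alg begin

primrec eval_term :: "(nat \<Rightarrow> 'a) \<Rightarrow> star_term \<Rightarrow> 'a" where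
  "eval_term g (Gen n) = g n"
| "eval_term g One = \<one>"
| "eval_term g (Scal q r t) = Complex (of_rat q) (of_rat r) \<odot> eval_term g t"
| "eval_term g (Add s t) = eval_term g s \<oplus> eval_term g t"
| "eval_term g (Mult s t) = eval_term g s \<otimes> eval_term g t"
| "eval_term g (Star t) = (eval_term g t)\<dagger>"

lemma complex_rat_dense: "0 < e \<Longrightarrow> \<exists>q r. cmod (Complex (of_rat q) (of_rat r) - c) < e"
proof -
  assume "0 < e"
  then obtain q r where q: "Re c < of_rat q" "of_rat q < Re c + e / 2" and r: "Im c < of_rat r" "of_rat r < Im c + e / 2"
    using of_rat_dense[of "Re c" "Re c + e / 2"] of_rat_dense[of "Im c" "Im c + e / 2"] by auto
  have "cmod (Complex (of_rat q) (of_rat r) - c) \<le> \<bar>of_rat q - Re c\<bar> + \<bar>of_rat r - Im c\<bar>"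
    using cmod_le[of "Complex (of_rat q) (of_rat r) - c"] by simp
  then show ?thesis using q r by (intro exI[of _ q] exI[of _ r]) simp
qed

text \<open>The values of \<open>eval_term\<close> are closed under all operations except complex
  scalars, which are approximated by Gaussian rational ones. Their closure is thus a C*-subalgebra
  containing the generators, and is everything.\<close>

lemma separable:
  assumes gen: "generated_by A G" and G: "countable G" "G \<subseteq> carrier A"
  obtains d :: "nat \<Rightarrow> 'a" where "\<And>n. d n \<in> carrier A" "\<And>x e. x \<in> carrier A \<Longrightarrow> 0 < e \<Longrightarrow> \<exists>n. nrm (x \<ominus> d n) < e"
proof -
  have cG: "countable (insert \<one> G)" using G by simp
  define g where "g = from_nat_into (insert \<one> G)"
  have rg: "range g = insert \<one> G" unfolding g_def using cG by (intro range_from_nat_into) auto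
  then have gc: "g n \<in> carrier A" for n using G(2) by (metis insert_iff one_closed rangeI subsetD)
  define D where "D = range (eval_term g)"
  have ec: "eval_term g t \<in> carrier A" for t by (induction t) (auto simp: gc)
  have D: "D \<subseteq> carrier A" using ec by (auto simp: D_def)
  have "cstar_subalgebra A (cl D)"
  proof (rule cl_subalgebra[OF D])
    have "Complex 0 0 = 0" by (simp add: complex_eq_iff)
    then show "\<zero> \<in> D" using rangeI[of "eval_term g" "Scal 0 0 One"] by (simp add: D_def)
    show "x \<oplus> y \<in> D" if xy: "x \<in> D" "y \<in> D" for x y
    proof -
      obtain s t where "x = eval_term g s" "y = eval_term g t" using xy by (auto simp: D_def)
      then show ?thesis using rangeI[of "eval_term g" "Add s t"] by (simp add: D_def)
    qed
    show "x \<otimes> y \<in> D" if xy: "x \<in> D" "y \<in> D" for x y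
    proof -
      obtain s t where "x = eval_term g s" "y = eval_term g t" using xy by (auto simp: D_def)
      then show ?thesis using rangeI[of "eval_term g" "Mult s t"] by (simp add: D_def)
    qed
    show "x\<dagger> \<in> D" if xy: "x \<in> D" for x
    proof -
      obtain t where "x = eval_term g t" using xy by (auto simp: D_def)
      then show ?thesis using rangeI[of "eval_term g" "Star t"] by (simp add: D_def)
    qed
    show "c \<odot> x \<in> cl D" if x: "x \<in> D" for c x
      unfolding cl_def
    proof (intro CollectI conjI allI impI)
      have xc: "x \<in> carrier A" using x D by blast
      then show "c \<odot> x \<in> carrier A" by simp
      fix e :: real assume "0 < e"
      define e' where "e' = e / (nrm x + 1)"
      have nx: "0 < nrm x + 1" using nrm_ge[OF xc] by linarith
      have e': "0 < e'" "e' * nrm x < e" using \<open>0 < e\<close> nrm_ge[OF xc] nx by (auto simp: e'_def field_simps)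
      obtain q r where qr: "cmod (Complex (of_rat q) (of_rat r) - c) < e'" using complex_rat_dense[OF e'(1)] by blast
      obtain t where t: "x = eval_term g t" using x by (auto simp: D_def)
      have "eval_term g (Scal q r t) \<ominus> c \<odot> x = (Complex (of_rat q) (of_rat r) - c) \<odot> x"
        using xc t by (simp add: sc_minus_left)
      then have "nrm (eval_term g (Scal q r t) \<ominus> c \<odot> x) = cmod (Complex (of_rat q) (of_rat r) - c) * nrm x"
        using xc by simp
      also have "\<dots> \<le> e' * nrm x" using qr nrm_ge[OF xc] by (intro mult_right_mono) auto
      finally show "\<exists>d\<in>D. nrm (d \<ominus> c \<odot> x) < e" using e' unfolding D_def by (meson order_le_less_trans rangeI)
    qed
  qed
  moreover have "insert \<one> G \<subseteq> cl D"
  proof -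
    have "g n \<in> D" for n using rangeI[of "eval_term g" "Gen n"] by (simp add: D_def)
    then have "insert \<one> G \<subseteq> D" unfolding rg[symmetric] by blast
    then show ?thesis using subset_cl[OF D] by blast
  qed
  ultimately have clD: "cl D = carrier A" using gen unfolding generated_by_def by auto
  define d where "d n = eval_term g (from_nat n)" for n
  show thesis
  proof (rule that[of d])
    show "d n \<in> carrier A" for n using ec by (simp add: d_def)
    fix x and e :: real assume x: "x \<in> carrier A" "0 < e"
    then obtain t where "nrm (eval_term g t \<ominus> x) < e" using clD unfolding cl_def D_def by auto
    then show "\<exists>n. nrm (x \<ominus> d n) < e"
      using x ec nrm_minus_commute[of x "eval_term g t"] by (intro exI[of _ "to_nat t"]) (simp add: d_def)
  qed
qed

end

subsection \<open>Transport of structure\<close>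

text \<open>Transport of structure along a map injective on the carrier, needed because the
  universal property speaks only about targets carried by
  \<open>nat \<Rightarrow> complex\<close>.\<close>

definition cstar_image :: "('a \<Rightarrow> 'b) \<Rightarrow> ('a, 'm) cstar_scheme \<Rightarrow> 'b cstar" where
  "cstar_image \<phi> A = (let \<psi> = inv_into (carrier A) \<phi> in
     \<lparr> carrier = \<phi> ` carrier A, monoid.mult = \<lambda>x y. \<phi> (monoid.mult A (\<psi> x) (\<psi> y)), one = \<phi> (one A),
       zero = \<phi> (zero A), add = \<lambda>x y. \<phi> (add A (\<psi> x) (\<psi> y)),
       smult = \<lambda>c x. \<phi> (smult A c (\<psi> x)), star = \<lambda>x. \<phi> (star A (\<psi> x)), cnorm = \<lambda>x. cnorm A (\<psi> x) \<rparr>)"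

context cstar_alg begin

lemma cstar_image_simps:
  assumes "inj_on \<phi> (carrier A)"
  shows "carrier (cstar_image \<phi> A) = \<phi> ` carrier A" "one (cstar_image \<phi> A) = \<phi> \<one>" "zero (cstar_image \<phi> A) = \<phi> \<zero>"
    "x \<in> carrier A \<Longrightarrow> y \<in> carrier A \<Longrightarrow> monoid.mult (cstar_image \<phi> A) (\<phi> x) (\<phi> y) = \<phi> (x \<otimes> y)"
    "x \<in> carrier A \<Longrightarrow> y \<in> carrier A \<Longrightarrow> add (cstar_image \<phi> A) (\<phi> x) (\<phi> y) = \<phi> (x \<oplus> y)"
    "x \<in> carrier A \<Longrightarrow> smult (cstar_image \<phi> A) c (\<phi> x) = \<phi> (c \<odot> x)"
    "x \<in> carrier A \<Longrightarrow> star (cstar_image \<phi> A) (\<phi> x) = \<phi> (x\<dagger>)"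
    "x \<in> carrier A \<Longrightarrow> cnorm (cstar_image \<phi> A) (\<phi> x) = nrm x"
  using assms by (simp_all add: cstar_image_def Let_def)

lemma cstar_image_hom:
  assumes "inj_on \<phi> (carrier A)"
  shows "unital_star_hom A (cstar_image \<phi> A) \<phi>"
  by (auto simp: unital_star_hom_def cstar_image_simps[OF assms])

lemma cstar_image_unital:
  assumes inj: "inj_on \<phi> (carrier A)"
  shows "unital_cstar_algebra (cstar_image \<phi> A)"
proof -
  let ?B = "cstar_image \<phi> A"
  note s = cstar_image_simps[OF inj]
  have "\<phi> \<in> ring_iso A ?B"
    using inj by (auto simp: ring_iso_def ring_hom_def bij_betw_def s)
  \<comment> \<open>The image ring comes with its zero overwritten by \<open>\<phi> \<zero>\<close>,
    which already is the zero of \<open>?B\<close>.\<close>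
  then have "ring (?B \<lparr> zero := \<phi> \<zero> \<rparr>)" using ring_iso_imp_img_ring by blast
  moreover have "?B \<lparr> zero := \<phi> \<zero> \<rparr> = ?B" by (simp add: cstar_image_def Let_def)
  ultimately have rB: "ring ?B" by simp
  interpret B: ring ?B by (rule rB)
  have minus: "a_minus ?B (\<phi> x) (\<phi> y) = \<phi> (x \<ominus> y)" if "x \<in> carrier A" "y \<in> carrier A" for x y
  proof -
    have "\<phi> (\<ominus> y) = a_inv ?B (\<phi> y)"
      using that by (intro B.minus_equality[symmetric]) (auto simp: s l_neg)
    then show ?thesis using that by (simp add: a_minus_def s flip: s(5))
  qed
  have ex: "\<exists>a\<in>carrier A. x = \<phi> a" if "x \<in> \<phi> ` carrier A" for x using that by blast
  have comp: "(\<forall>n. f n \<in> \<phi> ` carrier A) \<and>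
      (\<forall>e>0. \<exists>N::nat. \<forall>m\<ge>N. \<forall>n\<ge>N. cnorm ?B (a_minus ?B (f m) (f n)) < e) \<longrightarrow>
      (\<exists>x\<in>\<phi> ` carrier A. \<forall>e>0. \<exists>N::nat. \<forall>n\<ge>N. cnorm ?B (a_minus ?B (f n) x) < e)" for f
  proof (intro impI, elim conjE)
    assume f: "\<forall>n. f n \<in> \<phi> ` carrier A" "\<forall>e>0. \<exists>N::nat. \<forall>m\<ge>N. \<forall>n\<ge>N. cnorm ?B (a_minus ?B (f m) (f n)) < e"
    have "\<forall>n. \<exists>a. a \<in> carrier A \<and> f n = \<phi> a" using f(1) by blast
    then obtain g where g: "\<And>n. g n \<in> carrier A" "\<And>n. f n = \<phi> (g n)" by metis
    have "\<exists>N. \<forall>m\<ge>N. \<forall>n\<ge>N. nrm (g m \<ominus> g n) < e" if "0 < e" for e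
      using f(2) that g by (simp add: minus s)
    then obtain x where x: "x \<in> carrier A" "(\<lambda>n. nrm (g n \<ominus> x)) \<longlonglongrightarrow> 0" using complete[of g] g(1) by blast
    have "\<exists>N. \<forall>n\<ge>N. cnorm ?B (a_minus ?B (f n) (\<phi> x)) < e" if "0 < e" for e
      using order_tendstoD(2)[OF x(2) that] g x(1) unfolding eventually_sequentially by (simp add: minus s)
    then show "\<exists>x\<in>\<phi> ` carrier A. \<forall>e>0. \<exists>N::nat. \<forall>n\<ge>N. cnorm ?B (a_minus ?B (f n) x) < e"
      using x(1) by blast
  qed
  show ?thesis
    unfolding unital_cstar_algebra_def s(1) ball_simps(9)
    apply (intro conjI allI ballI)
    apply (rule rB)
    \<comment> \<open>The last of the remaining goals is completeness; the others follow by
      simplification from the laws of \<open>A\<close>.\<close>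
    apply (rule_tac [19] comp)
    apply (simp_all add: s sc_add_right sc_add_left nrm_add nrm_mult nrm_cstar inj_on_eq_iff[OF inj])
    done
qed

end


subsection \<open>The gauge action\<close>

locale universal_cstar = cstar_alg A
  for A :: "('a, 'm) cstar_scheme" (structure) +
  fixes L :: "(int \<Rightarrow> 's::finite) set" and S :: "'s \<Rightarrow> 'a" and E :: "nat \<Rightarrow> 's list set \<Rightarrow> 'a"
  assumes omin: "is_O_min L A S E"
begin

lemma relations: "min_relations L A S E"
  and generated: "generated_by A (range S \<union> {E l v | l v. v \<in> Vmin L l})"
  and universal: "unital_cstar_algebra (B :: (nat \<Rightarrow> complex) cstar) \<Longrightarrow> min_relations L B S' E' \<Longrightarrow>
        \<exists>h. unital_star_hom A B h \<and> (\<forall>\<alpha>. h (S \<alpha>) = S' \<alpha>) \<and> (\<forall>l. \<forall>v\<in>Vmin L l. h (E l v) = E' l v)"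
  using omin unfolding is_O_min_def by blast+

lemmas rels = min_relationsD[OF relations]

lemma S_closed [simp, intro]: "S \<alpha> \<in> carrier A"
  using rels(1)[of \<alpha>] by (simp add: is_partial_isometry_def)

lemma E_closed [simp, intro]: "v \<in> Vmin L l \<Longrightarrow> E l v \<in> carrier A"
  using rels(2) projD(1) by blast

text \<open>A is separable, so it embeds into \<open>nat \<Rightarrow> complex\<close> through the distances to a dense sequence;
  hence it satisfies its universal property against itself.\<close>
lemma universal_self:
  assumes "min_relations L A S' E'"
  obtains h where "unital_star_hom A A h" "\<And>\<alpha>. h (S \<alpha>) = S' \<alpha>" "\<And>l v. v \<in> Vmin L l \<Longrightarrow> h (E l v) = E' l v"
proof -
  let ?G = "range S \<union> {E l v | l v. v \<in> Vmin L l}"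
  have "{E l v | l v. v \<in> Vmin L l} = (\<Union>l. E l ` Vmin L l)" by auto
  then have "countable ?G" by (simp add: countable_finite)
  moreover have "?G \<subseteq> carrier A" by auto
  ultimately obtain d :: "nat \<Rightarrow> 'a" where d: "\<And>n. d n \<in> carrier A"
      "\<And>x e. x \<in> carrier A \<Longrightarrow> 0 < e \<Longrightarrow> \<exists>n. nrm (x \<ominus> d n) < e"
    using separable[OF generated] by metis
  define \<phi> where "\<phi> x = (\<lambda>n. complex_of_real (nrm (x \<ominus> d n)))" for x
  have inj: "inj_on \<phi> (carrier A)"
  proof (rule inj_onI)
    fix x y assume xy: "x \<in> carrier A" "y \<in> carrier A" "\<phi> x = \<phi> y"
    have eq: "nrm (x \<ominus> d n) = nrm (y \<ominus> d n)" for n using fun_cong[OF xy(3), of n] by (simp add: \<phi>_def)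
    have "nrm (x \<ominus> y) \<le> 0 + e" if "0 < e" for e
    proof -
      obtain n where "nrm (x \<ominus> d n) < e / 2" using d(2)[OF xy(1), of "e / 2"] \<open>0 < e\<close> by auto
      then show ?thesis
        using nrm_triangle[OF xy(1) d(1) xy(2), of n] eq[of n] nrm_minus_commute[OF xy(2) d(1), of n] by simp
    qed
    then have "nrm (x \<ominus> y) \<le> 0" by (rule field_le_epsilon)
    then have "nrm (x \<ominus> y) = 0" using xy by (intro antisym) auto
    then show "x = y" using xy by simp
  qed
  let ?B = "cstar_image \<phi> A"
  interpret \<phi>: cstar_hom A ?B \<phi>
    by unfold_locales (rule cstar_image_unital[OF inj], rule cstar_image_hom[OF inj])
  obtain h where h: "unital_star_hom A ?B h" "\<And>\<alpha>. h (S \<alpha>) = \<phi> (S' \<alpha>)" "\<And>l v. v \<in> Vmin L l \<Longrightarrow> h (E l v) = \<phi> (E' l v)"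
    using universal[OF \<phi>.B.cstar \<phi>.hom_min_relations[OF assms]] by blast
  define \<psi> where "\<psi> = inv_into (carrier A) \<phi>"
  have \<psi>: "\<psi> (\<phi> x) = x" if "x \<in> carrier A" for x using inj that by (simp add: \<psi>_def)
  have \<psi>c: "\<psi> y \<in> carrier A" "\<phi> (\<psi> y) = y" if "y \<in> carrier ?B" for y
    using that by (auto simp: \<psi>_def cstar_image_simps[OF inj] inv_into_into f_inv_into_f)
  note hh = unital_star_homD[OF h(1)]
  have "unital_star_hom A A (\<lambda>x. \<psi> (h x))"
    unfolding unital_star_hom_def
  proof (intro conjI ballI allI)
    show "(\<lambda>x. \<psi> (h x)) ` carrier A \<subseteq> carrier A"
      by (rule image_subsetI) (rule \<psi>c(1)[OF hh(1)])
    show "\<psi> (h \<one>) = \<one>" using hh(2) \<psi>[of \<one>] by simp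
  next
    fix x y assume xy: "x \<in> carrier A" "y \<in> carrier A"
    have "h (x \<oplus> y) = \<phi> (\<psi> (h x) \<oplus> \<psi> (h y))" using xy hh(1,3) \<psi>c by simp
    then show "\<psi> (h (x \<oplus> y)) = \<psi> (h x) \<oplus> \<psi> (h y)"
      by (simp only: \<psi> a_closed \<psi>c(1) hh(1) xy)
    have "h (x \<otimes> y) = \<phi> (\<psi> (h x) \<otimes> \<psi> (h y))" using xy hh(1,4) \<psi>c by simp
    then show "\<psi> (h (x \<otimes> y)) = \<psi> (h x) \<otimes> \<psi> (h y)"
      by (simp only: \<psi> m_closed \<psi>c(1) hh(1) xy)
  next
    fix x c assume x: "x \<in> carrier A"
    have "h (c \<odot> x) = \<phi> (c \<odot> \<psi> (h x))" using x hh(1,5) \<psi>c by simp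
    then show "\<psi> (h (c \<odot> x)) = c \<odot> \<psi> (h x)" by (simp only: \<psi> sc_closed \<psi>c(1) hh(1) x)
  next
    fix x assume x: "x \<in> carrier A"
    have "h (x\<dagger>) = \<phi> ((\<psi> (h x))\<dagger>)" using x hh(1,6) \<psi>c by simp
    then show "\<psi> (h (x\<dagger>)) = (\<psi> (h x))\<dagger>" by (simp only: \<psi> adj_closed \<psi>c(1) hh(1) x)
  qed
  moreover have "S' \<alpha> \<in> carrier A" for \<alpha>
    using min_relationsD(1)[OF assms, of \<alpha>] by (simp add: is_partial_isometry_def)
  moreover have "E' l v \<in> carrier A" if "v \<in> Vmin L l" for l v
    using min_relationsD(2)[OF assms that] by (simp add: is_projection_def)
  ultimately show thesis using that[of "\<lambda>x. \<psi> (h x)"] h \<psi> by simp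
qed

text \<open>In every relation \<open>S \<alpha>\<close> occurs together with its adjoint, so a
  factor z of modulus one cancels against its conjugate.\<close>

lemma gauge:
  assumes z: "cmod z = 1"
  obtains \<gamma> where "unital_star_hom A A \<gamma>" "\<And>\<alpha>. \<gamma> (S \<alpha>) = z \<odot> S \<alpha>" "\<And>l v. v \<in> Vmin L l \<Longrightarrow> \<gamma> (E l v) = E l v"
proof -
  have zz: "z * cnj z = 1" "cnj z * z = 1" using z by (simp_all add: complex_norm_square[symmetric] mult.commute)
  have e: "(z \<odot> S \<alpha>)\<dagger> \<otimes> (z \<odot> S \<alpha>) = (S \<alpha>)\<dagger> \<otimes> S \<alpha>" "(z \<odot> S \<alpha>) \<otimes> (z \<odot> S \<alpha>)\<dagger> = S \<alpha> \<otimes> (S \<alpha>)\<dagger>"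
     "v \<in> Vmin L l \<Longrightarrow> (z \<odot> S \<alpha>)\<dagger> \<otimes> E l v \<otimes> (z \<odot> S \<alpha>) = (S \<alpha>)\<dagger> \<otimes> E l v \<otimes> S \<alpha>" for \<alpha> l v
    by (simp_all add: zz)
  have "min_relations L A (\<lambda>\<alpha>. z \<odot> S \<alpha>) E"
    unfolding min_relations_def is_partial_isometry_def e(1,2)
    by (intro conjI allI ballI; (rule rels(2,3,4,5,6); assumption?)?; (subst e(3), assumption, rule rels(7), assumption)?;
        use rels(1) in \<open>simp add: is_partial_isometry_def\<close>)
  then show thesis using universal_self that by blast
qed

end

section \<open>Bounded operators on a separable Hilbert space\<close>

typedef ell2 = "{f :: nat \<Rightarrow> complex. summable (\<lambda>n. (cmod (f n))\<^sup>2)}"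
  morphisms coord Ell2
  by (rule exI[of _ "\<lambda>_. 0"]) simp

setup_lifting type_definition_ell2

lemma summable_coord: "summable (\<lambda>n. (cmod (coord x n))\<^sup>2)"
  using coord[of x] by simp

lemma ell2_eqI: "(\<And>n. coord x n = coord y n) \<Longrightarrow> x = y"
  by (simp add: coord_inject[symmetric] ext)

lemma l2_bounded: 
  assumes "\<And>n. L2_set (\<lambda>i. cmod (f i)) {..<n} \<le> C"
  shows "summable (\<lambda>n. (cmod (f n))\<^sup>2)" "sqrt (\<Sum>n. (cmod (f n))\<^sup>2) \<le> C"
proof -
  have C: "0 \<le> C" using assms[of 0] by simp
  have le: "(\<Sum>i<n. (cmod (f i))\<^sup>2) \<le> C\<^sup>2" for n
    using assms[of n] C unfolding L2_set_def by (metis real_sqrt_le_iff real_sqrt_unique)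
  show s: "summable (\<lambda>n. (cmod (f n))\<^sup>2)"
    by (rule summableI_nonneg_bounded[of _ "C\<^sup>2"]) (use le in auto)
  have "(\<Sum>n. (cmod (f n))\<^sup>2) \<le> C\<^sup>2" by (rule suminf_le_const[OF s]) (rule le)
  then show "sqrt (\<Sum>n. (cmod (f n))\<^sup>2) \<le> C" using C by (metis real_sqrt_le_iff real_sqrt_unique)
qed

lemma L2_set_coord_le: "finite F \<Longrightarrow> L2_set (\<lambda>i. cmod (coord x i)) F \<le> sqrt (\<Sum>n. (cmod (coord x n))\<^sup>2)"
  unfolding L2_set_def by (intro real_sqrt_le_mono sum_le_suminf summable_coord) auto

lemma L2_set_cmod_add: "L2_set (\<lambda>i. cmod (f i + g i)) F \<le> L2_set (\<lambda>i. cmod (f i)) F + L2_set (\<lambda>i. cmod (g i)) F"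
  by (rule order_trans[OF L2_set_mono L2_set_triangle_ineq]) (auto intro: norm_triangle_ineq)

lemma L2_add_le:
  "L2_set (\<lambda>i. cmod (coord x i + coord y i)) {..<n} \<le>
    sqrt (\<Sum>n. (cmod (coord x n))\<^sup>2) + sqrt (\<Sum>n. (cmod (coord y n))\<^sup>2)"
  by (rule order_trans[OF L2_set_cmod_add add_mono]) (auto intro: L2_set_coord_le)

text \<open>The type class structure on \<open>ell2\<close> is over the reals; complex scalars are
  kept as this separate operation.\<close>

lift_definition cscale :: "complex \<Rightarrow> ell2 \<Rightarrow> ell2" is "\<lambda>c f n. c * f n"
proof -
  fix c and f :: "nat \<Rightarrow> complex" assume "summable (\<lambda>n. (cmod (f n))\<^sup>2)"
  then show "summable (\<lambda>n. (cmod (c * f n))\<^sup>2)" by (simp add: norm_mult power_mult_distrib summable_mult)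
qed

instantiation ell2 :: real_normed_vector
begin

lift_definition zero_ell2 :: ell2 is "\<lambda>_. 0" by simp
lift_definition plus_ell2 :: "ell2 \<Rightarrow> ell2 \<Rightarrow> ell2" is "\<lambda>f g n. f n + g n"
proof -
  fix f g :: "nat \<Rightarrow> complex" assume "summable (\<lambda>n. (cmod (f n))\<^sup>2)" "summable (\<lambda>n. (cmod (g n))\<^sup>2)"
  then have "f = coord (Ell2 f)" "g = coord (Ell2 g)" by (simp_all add: Ell2_inverse)
  then show "summable (\<lambda>n. (cmod (f n + g n))\<^sup>2)" using l2_bounded(1)[OF L2_add_le] by metis
qed
definition uminus_ell2 :: "ell2 \<Rightarrow> ell2" where "uminus_ell2 x = cscale (-1) x"
definition minus_ell2 :: "ell2 \<Rightarrow> ell2 \<Rightarrow> ell2" where "minus_ell2 x y = x + (- y)"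
definition scaleR_ell2 :: "real \<Rightarrow> ell2 \<Rightarrow> ell2" where "scaleR_ell2 r x = cscale (of_real r) x"
definition norm_ell2 :: "ell2 \<Rightarrow> real" where "norm_ell2 x = sqrt (\<Sum>n. (cmod (coord x n))\<^sup>2)"
definition dist_ell2 :: "ell2 \<Rightarrow> ell2 \<Rightarrow> real" where "dist_ell2 x y = norm (x - y)"
definition sgn_ell2 :: "ell2 \<Rightarrow> ell2" where "sgn_ell2 x = inverse (norm x) *\<^sub>R x"
definition uniformity_ell2 :: "(ell2 \<times> ell2) filter" where
  "uniformity_ell2 = (INF e\<in>{0<..}. principal {(x, y). dist x y < e})"
definition open_ell2 :: "ell2 set \<Rightarrow> bool" where
  "open_ell2 U = (\<forall>x\<in>U. eventually (\<lambda>(x', y). x' = x \<longrightarrow> y \<in> U) uniformity)"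

lemma coord_simps [simp]:
  "coord 0 n = 0" "coord (x + y) n = coord x n + coord y n" "coord (- x) n = - coord x n"
  "coord (x - y) n = coord x n - coord y n" "coord (r *\<^sub>R x) n = of_real r * coord x n" "coord (cscale c x) n = c * coord x n"
  by (simp_all add: zero_ell2.rep_eq plus_ell2.rep_eq uminus_ell2_def minus_ell2_def scaleR_ell2_def cscale.rep_eq)

lemma norm_ell2_add: "norm (x + y) \<le> norm x + norm (y :: ell2)"
  using l2_bounded(2)[OF L2_add_le[of x y]] by (simp add: norm_ell2_def)

lemma norm_cscale [simp]: "norm (cscale c x) = cmod c * norm x"
  by (simp add: norm_ell2_def norm_mult power_mult_distrib suminf_mult summable_coord real_sqrt_mult)

instance
proof
  fix x y z :: ell2 and a b :: real
  show "x + y + z = x + (y + z)" "x + y = y + x" "0 + x = x" "- x + x = 0" "x - y = x + - y"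
    by (rule ell2_eqI; simp)+
  show "a *\<^sub>R (x + y) = a *\<^sub>R x + a *\<^sub>R y" "(a + b) *\<^sub>R x = a *\<^sub>R x + b *\<^sub>R x" "a *\<^sub>R b *\<^sub>R x = (a * b) *\<^sub>R x" "1 *\<^sub>R x = x"
    by (rule ell2_eqI; simp add: algebra_simps)+
  show "dist x y = norm (x - y)" by (rule dist_ell2_def)
  show "sgn x = inverse (norm x) *\<^sub>R x" by (rule sgn_ell2_def)
  show "uniformity = (INF e\<in>{0<..}. principal {(x :: ell2, y). dist x y < e})" by (rule uniformity_ell2_def)
  show "open U = (\<forall>x\<in>U. eventually (\<lambda>(x', y). x' = x \<longrightarrow> y \<in> U) uniformity)" for U :: "ell2 set" by (rule open_ell2_def)
  show "norm x = 0 \<longleftrightarrow> x = 0"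
  proof
    assume "norm x = 0"
    then have "(\<lambda>n. (cmod (coord x n))\<^sup>2) = (\<lambda>n. 0)"
      using suminf_eq_zero_iff[OF summable_coord[of x]] by (simp add: norm_ell2_def)
    then have "coord x n = 0" for n using fun_cong[of _ _ n] by fastforce
    then show "x = 0" by (intro ell2_eqI) simp
  qed (simp add: norm_ell2_def)
  show "norm (x + y) \<le> norm x + norm y" by (rule norm_ell2_add)
  show "norm (a *\<^sub>R x) = \<bar>a\<bar> * norm x" by (simp add: scaleR_ell2_def)
qed

end

lemma norm_ell2_le: "(\<And>n. L2_set (\<lambda>i. cmod (coord x i)) {..<n} \<le> C) \<Longrightarrow> norm x \<le> C"
  using l2_bounded(2) by (simp add: norm_ell2_def)

lemma L2_set_le_norm: "finite F \<Longrightarrow> L2_set (\<lambda>i. cmod (coord x i)) F \<le> norm x"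
  using L2_set_coord_le by (simp add: norm_ell2_def)

lemma norm_coord_le: "cmod (coord x n) \<le> norm x"
  using L2_set_le_norm[of "{n}" x] by simp

lemma power2_norm_ell2: "(norm x)\<^sup>2 = (\<Sum>n. (cmod (coord x n))\<^sup>2)"
  by (simp add: norm_ell2_def suminf_nonneg summable_coord)

instance ell2 :: banach
proof
  fix X :: "nat \<Rightarrow> ell2" assume X: "Cauchy X"
  have "Cauchy (\<lambda>n. coord (X n) i)" for i
  proof (rule CauchyI)
    fix e :: real assume "0 < e"
    then obtain M where M: "\<forall>m\<ge>M. \<forall>n\<ge>M. norm (X m - X n) < e" using CauchyD[OF X] by blast
    have "norm (coord (X m) i - coord (X n) i) < e" if "m \<ge> M" "n \<ge> M" for m n
      using norm_coord_le[of "X m - X n" i] M that by (metis coord_simps(4) order_le_less_trans)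
    then show "\<exists>M. \<forall>m\<ge>M. \<forall>n\<ge>M. norm (coord (X m) i - coord (X n) i) < e" by blast
  qed
  then have "\<forall>i. \<exists>l. (\<lambda>n. coord (X n) i) \<longlonglongrightarrow> l" using Cauchy_convergent_iff convergent_def by metis
  then obtain f where f: "\<And>i. (\<lambda>n. coord (X n) i) \<longlonglongrightarrow> f i" by metis
  have L2: "L2_set (\<lambda>i. cmod (coord (X n) i - f i)) {..<k} \<le> e"
    if "\<forall>m\<ge>M. norm (X n - X m) \<le> e" for n M e k
  proof (rule LIMSEQ_le_const2)
    show "(\<lambda>m. L2_set (\<lambda>i. cmod (coord (X n) i - coord (X m) i)) {..<k}) \<longlonglongrightarrow> L2_set (\<lambda>i. cmod (coord (X n) i - f i)) {..<k}"
      unfolding L2_set_def by (intro tendsto_intros f)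
    show "\<exists>N. \<forall>m\<ge>N. L2_set (\<lambda>i. cmod (coord (X n) i - coord (X m) i)) {..<k} \<le> e"
      using that L2_set_le_norm[of "{..<k}" "X n - X _"] by (intro exI[of _ M]) (auto intro: order_trans)
  qed
  obtain M where M: "\<forall>m\<ge>M. \<forall>n\<ge>M. norm (X m - X n) < 1" using CauchyD[OF X, of 1] by auto
  then have "\<forall>m\<ge>M. norm (X M - X m) \<le> 1" by (auto intro: less_imp_le)
  from l2_bounded(1)[OF L2[OF this]] have "summable (\<lambda>i. (cmod (coord (X M) i - f i))\<^sup>2)" .
  then have g: "coord (Ell2 (\<lambda>i. coord (X M) i - f i)) i = coord (X M) i - f i" for i by (simp add: Ell2_inverse)
  define x where "x = X M - Ell2 (\<lambda>i. coord (X M) i - f i)"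
  have x: "coord x i = f i" for i by (simp add: x_def g)
  have "X \<longlonglongrightarrow> x"
  proof (rule LIMSEQ_I)
    fix e :: real assume "0 < e"
    then have "0 < e / 2" by simp
    then obtain N where N: "\<forall>m\<ge>N. \<forall>n\<ge>N. norm (X m - X n) < e / 2" using CauchyD[OF X] by blast
    have "norm (X n - x) < e" if "n \<ge> N" for n
    proof -
      have "\<forall>m\<ge>N. norm (X n - X m) \<le> e / 2" using N that by (auto intro: less_imp_le)
      from L2[OF this] have "norm (X n - x) \<le> e / 2" by (intro norm_ell2_le) (simp add: x)
      then show ?thesis using \<open>0 < e\<close> by simp
    qed
    then show "\<exists>N. \<forall>n\<ge>N. norm (X n - x) < e" by blast
  qed
  then show "convergent X" by (auto simp: convergent_def)
qed

lemma null_comparison: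
  fixes f :: "nat \<Rightarrow> 'a::real_normed_vector"
  assumes "g \<longlonglongrightarrow> 0" "\<And>n. norm (f n) \<le> g n" shows "f \<longlonglongrightarrow> 0"
  by (rule tendsto_norm_zero_cancel, rule tendsto_sandwich[OF _ _ tendsto_const assms(1)]) (use assms(2) in auto)

section \<open>The inner product of l^2\<close>

definition ip :: "ell2 \<Rightarrow> ell2 \<Rightarrow> complex" where
  "ip x y = (\<Sum>n. cnj (coord x n) * coord y n)"

lemma ip_partial_le: "(\<Sum>i<n. cmod (cnj (coord x i) * coord y i)) \<le> norm x * norm y"
proof -
  have "(\<Sum>i<n. cmod (cnj (coord x i) * coord y i)) = (\<Sum>i<n. \<bar>cmod (coord x i)\<bar> * \<bar>cmod (coord y i)\<bar>)"
    by (simp add: norm_mult)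
  also have "\<dots> \<le> L2_set (\<lambda>i. cmod (coord x i)) {..<n} * L2_set (\<lambda>i. cmod (coord y i)) {..<n}" by (rule L2_set_mult_ineq)
  also have "\<dots> \<le> norm x * norm y" by (intro mult_mono L2_set_le_norm) (auto intro: L2_set_nonneg)
  finally show ?thesis .
qed

lemma summable_ip_norm: "summable (\<lambda>n. cmod (cnj (coord x n) * coord y n))"
  by (rule summableI_nonneg_bounded[OF _ ip_partial_le]) simp

lemma summable_ip: "summable (\<lambda>n. cnj (coord x n) * coord y n)"
  by (rule summable_norm_cancel[OF summable_ip_norm])

lemma norm_ip_le: "cmod (ip x y) \<le> norm x * norm y"
  unfolding ip_def
  by (rule order_trans[OF summable_norm[OF summable_ip_norm] suminf_le_const[OF summable_ip_norm ip_partial_le]])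

lemma ip_add_right: "ip x (y + z) = ip x y + ip x z"
  by (simp add: ip_def ring_distribs suminf_add[OF summable_ip summable_ip, symmetric])

lemma ip_scale_right: "ip x (cscale c y) = c * ip x y"
  using suminf_mult[OF summable_ip[of x y], of c] by (simp add: ip_def mult.left_commute)

lemma ip_cnj: "cnj (ip x y) = ip y x"
proof -
  have "(\<lambda>n. cnj (cnj (coord x n) * coord y n)) sums cnj (ip x y)"
    unfolding ip_def by (subst sums_cnj) (rule summable_sums[OF summable_ip])
  then have "(\<lambda>n. cnj (coord y n) * coord x n) sums cnj (ip x y)" by (simp add: mult.commute)
  then show ?thesis by (simp add: ip_def sums_iff)
qed

lemma ip_add_left: "ip (x + y) z = ip x z + ip y z"
  using ip_add_right[of z x y] by (metis ip_cnj complex_cnj_add)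

lemma ip_scale_left: "ip (cscale c x) y = cnj c * ip x y"
  using ip_scale_right[of y c x] by (metis ip_cnj complex_cnj_mult)

lemma ip_self: "ip x x = complex_of_real ((norm x)\<^sup>2)"
  unfolding power2_norm_ell2 ip_def
  by (subst suminf_of_real[OF summable_coord]) (simp add: complex_norm_square mult.commute del: of_real_power)

lemma ip_minus_right: "ip x (y - z) = ip x y - ip x z"
  using ip_add_right[of x "y - z" z] by simp

lemma ip_nondegenerate: assumes "\<And>x. ip x y = ip x z" shows "y = z"
proof -
  have "ip (y - z) (y - z) = 0" using assms by (simp add: ip_minus_right)
  then show ?thesis by (simp add: ip_self)
qed

lemma tendsto_ip_right: assumes "f \<longlonglongrightarrow> y" shows "(\<lambda>n. ip x (f n)) \<longlonglongrightarrow> ip x y"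
proof -
  have "(\<lambda>n. norm x * norm (f n - y)) \<longlonglongrightarrow> norm x * norm (y - y)" by (intro tendsto_intros assms)
  then have "(\<lambda>n. ip x (f n) - ip x y) \<longlonglongrightarrow> 0"
    by - (rule null_comparison[of "\<lambda>n. norm x * norm (f n - y)"], auto simp: ip_minus_right[symmetric] norm_ip_le)
  then show ?thesis by (rule LIM_zero_cancel)
qed

lemma tendsto_ip_left: assumes "f \<longlonglongrightarrow> x" shows "(\<lambda>n. ip (f n) y) \<longlonglongrightarrow> ip x y"
  using tendsto_cnj[OF tendsto_ip_right[OF assms, of y]] by (simp add: ip_cnj)

lemma tendsto_cscale: assumes "f \<longlonglongrightarrow> x" shows "(\<lambda>n. cscale c (f n)) \<longlonglongrightarrow> cscale c x"
proof -
  have "cscale c (f n) - cscale c x = cscale c (f n - x)" for n by (rule ell2_eqI) (simp add: algebra_simps)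
  moreover have "(\<lambda>n. cmod c * norm (f n - x)) \<longlonglongrightarrow> cmod c * norm (x - x)" by (intro tendsto_intros assms)
  ultimately have "(\<lambda>n. cscale c (f n) - cscale c x) \<longlonglongrightarrow> 0"
    by - (rule null_comparison[of "\<lambda>n. cmod c * norm (f n - x)"], auto)
  then show ?thesis by (rule LIM_zero_cancel)
qed

lemma cscale_simps [simp]:
  "cscale c (cscale d x) = cscale (c * d) x" "cscale 1 x = x" "cscale c 0 = 0"
  "cscale c (x + y) = cscale c x + cscale c y" "cscale (c + d) x = cscale c x + cscale d x"
  "cscale (complex_of_real r) x = r *\<^sub>R x"
  by (rule ell2_eqI; simp add: algebra_simps)+

section \<open>The C*-algebra of adjointable operators\<close>

definition adjoint_of :: "(ell2 \<Rightarrow> ell2) \<Rightarrow> (ell2 \<Rightarrow> ell2) \<Rightarrow> bool" where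
  "adjoint_of T T' \<longleftrightarrow> bounded_linear T' \<and> (\<forall>x y. ip (T x) y = ip x (T' y))"

text \<open>\<open>bounded_linear\<close> is linearity over the reals, hence the clause on
  \<open>cscale\<close>. Demanding an adjoint avoids the Riesz representation theorem; in exchange
  completeness has to produce the adjoint of a limit.\<close>

definition opset :: "(ell2 \<Rightarrow> ell2) set" where
  "opset = {T. bounded_linear T \<and> (\<forall>c x. T (cscale c x) = cscale c (T x)) \<and> (\<exists>T'. adjoint_of T T')}"

definition op_adj :: "(ell2 \<Rightarrow> ell2) \<Rightarrow> ell2 \<Rightarrow> ell2" where
  "op_adj T = (SOME T'. adjoint_of T T')"

definition BH :: "(ell2 \<Rightarrow> ell2) cstar" where
  "BH = \<lparr> carrier = opset, monoid.mult = (\<lambda>S T x. S (T x)), one = (\<lambda>x. x), zero = (\<lambda>x. 0),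
     add = (\<lambda>S T x. S x + T x), smult = (\<lambda>c T x. cscale c (T x)), star = op_adj, cnorm = onorm \<rparr>"

lemma adjoint_unique: "adjoint_of T T' \<Longrightarrow> adjoint_of T T'' \<Longrightarrow> T' = T''"
  by (rule ext, rule ip_nondegenerate) (metis adjoint_of_def)

lemma op_adj_eq: "adjoint_of T T' \<Longrightarrow> op_adj T = T'"
  unfolding op_adj_def by (rule some_equality) (auto intro: adjoint_unique)

lemma opsetD:
  assumes "T \<in> opset"
  shows "bounded_linear T" "T (cscale c x) = cscale c (T x)" "adjoint_of T (op_adj T)"
  using assms op_adj_eq[of T] by (auto simp: opset_def)

lemma adjoint_sym: assumes "T \<in> opset" shows "adjoint_of (op_adj T) T"
  unfolding adjoint_of_def
proof (intro conjI allI)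
  fix x y have "cnj (ip (T y) x) = cnj (ip y (op_adj T x))"
    using opsetD(3)[OF assms] by (simp add: adjoint_of_def)
  then show "ip (op_adj T x) y = ip x (T y)" by (simp add: ip_cnj)
qed (rule opsetD(1)[OF assms])

lemma opset_adj: assumes "T \<in> opset" shows "op_adj T \<in> opset"
proof -
  have "op_adj T (cscale c y) = cscale c (op_adj T y)" for c y
  proof (rule ip_nondegenerate)
    fix x have "ip x (op_adj T (cscale c y)) = ip (T x) (cscale c y)"
      using opsetD(3)[OF assms] by (simp add: adjoint_of_def)
    also have "\<dots> = c * ip x (op_adj T y)"
      using opsetD(3)[OF assms] by (simp add: adjoint_of_def ip_scale_right)
    finally show "ip x (op_adj T (cscale c y)) = ip x (cscale c (op_adj T y))" by (simp add: ip_scale_right)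
  qed
  then show ?thesis using opsetD(3)[OF assms] adjoint_sym[OF assms] by (auto simp: opset_def adjoint_of_def)
qed

lemma op_adj_adj: "T \<in> opset \<Longrightarrow> op_adj (op_adj T) = T"
  by (rule op_adj_eq[OF adjoint_sym])

lemma bounded_linear_cscale: "bounded_linear (cscale c)"
proof (rule bounded_linear_intro[of _ "cmod c"])
  show "cscale c (r *\<^sub>R x) = r *\<^sub>R cscale c x" for r x by (rule ell2_eqI) simp
qed (simp_all add: mult.commute)

lemma opset_intro:
  assumes "bounded_linear T" "\<And>c x. T (cscale c x) = cscale c (T x)" "adjoint_of T T'"
  shows "T \<in> opset" "op_adj T = T'"
  using assms by (auto simp: opset_def op_adj_eq)

lemma adjoint_add: "adjoint_of S S' \<Longrightarrow> adjoint_of T T' \<Longrightarrow> adjoint_of (\<lambda>x. S x + T x) (\<lambda>x. S' x + T' x)"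
  by (simp add: adjoint_of_def bounded_linear_add ip_add_left ip_add_right)

lemma adjoint_comp: "adjoint_of S S' \<Longrightarrow> adjoint_of T T' \<Longrightarrow> adjoint_of (\<lambda>x. S (T x)) (\<lambda>x. T' (S' x))"
  by (simp add: adjoint_of_def bounded_linear_compose)

lemma adjoint_cscale: "adjoint_of T T' \<Longrightarrow> adjoint_of (\<lambda>x. cscale c (T x)) (\<lambda>x. cscale (cnj c) (T' x))"
  by (simp add: adjoint_of_def bounded_linear_compose[OF bounded_linear_cscale] ip_scale_left ip_scale_right)

lemma adjoint_id: "adjoint_of (\<lambda>x. x) (\<lambda>x. x)"
  by (simp add: adjoint_of_def bounded_linear_ident)

lemma ip_zero [simp]: "ip x 0 = 0" "ip 0 x = 0"
  using ip_scale_right[of x 0 0] ip_scale_left[of 0 0 x] by simp_all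

lemma adjoint_zero: "adjoint_of (\<lambda>x. 0) (\<lambda>x. 0)"
  by (simp add: adjoint_of_def bounded_linear_zero)

lemma opset_add: assumes "S \<in> opset" "T \<in> opset"
  shows "(\<lambda>x. S x + T x) \<in> opset" "op_adj (\<lambda>x. S x + T x) = (\<lambda>x. op_adj S x + op_adj T x)"
  by (rule opset_intro[OF _ _ adjoint_add[OF opsetD(3)[OF assms(1)] opsetD(3)[OF assms(2)]]];
      use opsetD(1,2)[OF assms(1)] opsetD(1,2)[OF assms(2)] in \<open>simp add: bounded_linear_add\<close>)+

lemma opset_comp: assumes "S \<in> opset" "T \<in> opset"
  shows "(\<lambda>x. S (T x)) \<in> opset" "op_adj (\<lambda>x. S (T x)) = (\<lambda>x. op_adj T (op_adj S x))"
  by (rule opset_intro[OF _ _ adjoint_comp[OF opsetD(3)[OF assms(1)] opsetD(3)[OF assms(2)]]];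
      use opsetD(1,2)[OF assms(1)] opsetD(1,2)[OF assms(2)] in \<open>simp add: bounded_linear_compose\<close>)+

lemma opset_cscale: assumes "T \<in> opset"
  shows "(\<lambda>x. cscale c (T x)) \<in> opset" "op_adj (\<lambda>x. cscale c (T x)) = (\<lambda>x. cscale (cnj c) (op_adj T x))"
  by (rule opset_intro[OF _ _ adjoint_cscale[OF opsetD(3)[OF assms(1)]]];
      use opsetD(1,2)[OF assms(1)] in \<open>simp add: bounded_linear_compose[OF bounded_linear_cscale] mult.commute\<close>)+

lemma opset_id: "(\<lambda>x. x) \<in> opset" and opset_zero: "(\<lambda>x. 0) \<in> opset"
  by (rule opset_intro(1)[OF _ _ adjoint_id] opset_intro(1)[OF _ _ adjoint_zero];
      simp add: bounded_linear_ident bounded_linear_zero)+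

lemma ring_BH: "ring BH"
proof (rule ringI)
  show "abelian_group BH"
  proof (rule abelian_groupI)
    fix T assume T: "T \<in> carrier BH"
    show "\<exists>y\<in>carrier BH. y \<oplus>\<^bsub>BH\<^esub> T = \<zero>\<^bsub>BH\<^esub>"
      using opset_cscale(1)[of T "-1"] T
      by (intro bexI[of _ "\<lambda>x. cscale (-1) (T x)"]) (auto simp: BH_def intro!: ext ell2_eqI)
  qed (auto simp: BH_def opset_add opset_zero add.assoc add.commute)
  show "Group.monoid BH"
    by unfold_locales (auto simp: BH_def opset_comp opset_id)
qed (auto simp: BH_def fun_eq_iff linear_add[OF bounded_linear.linear[OF opsetD(1)]])

lemma a_minus_BH: assumes "S \<in> opset" "T \<in> opset" shows "S \<ominus>\<^bsub>BH\<^esub> T = (\<lambda>x. S x - T x)"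
proof -
  interpret ring BH by (rule ring_BH)
  have "\<ominus>\<^bsub>BH\<^esub> T = (\<lambda>x. cscale (-1) (T x))"
    by (rule minus_equality) (use opset_cscale(1)[of T "-1"] assms in \<open>auto simp: BH_def intro!: ext ell2_eqI\<close>)
  then show ?thesis by (auto simp: a_minus_def BH_def intro!: ext ell2_eqI)
qed

lemma onorm_cscale: assumes "bounded_linear T" shows "onorm (\<lambda>x. cscale c (T x)) = cmod c * onorm T"
proof (rule antisym)
  show "onorm (\<lambda>x. cscale c (T x)) \<le> cmod c * onorm T"
    by (rule onorm_bound) (use onorm[OF assms] onorm_pos_le[OF assms] in \<open>simp_all add: mult.assoc mult_left_mono\<close>)
  show "cmod c * onorm T \<le> onorm (\<lambda>x. cscale c (T x))"
  proof (cases "c = 0")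
    case False
    have b: "bounded_linear (\<lambda>x. cscale c (T x))" by (rule bounded_linear_compose[OF bounded_linear_cscale assms])
    have "onorm T \<le> onorm (\<lambda>x. cscale c (T x)) / cmod c"
      by (rule onorm_bound) (use onorm[OF b] onorm_pos_le[OF b] False in \<open>simp_all add: field_simps\<close>)
    then show ?thesis using False by (simp add: field_simps)
  qed (simp add: onorm_pos_le[OF bounded_linear_compose[OF bounded_linear_cscale assms]])
qed

lemma onorm_adj_comp: assumes "T \<in> opset"
  shows "(onorm T)\<^sup>2 \<le> onorm (\<lambda>x. op_adj T (T x))"
proof -
  let ?B = "onorm (\<lambda>x. op_adj T (T x))"
  have b: "bounded_linear (\<lambda>x. op_adj T (T x))" using opsetD(1)[OF opset_comp(1)[OF opset_adj[OF assms] assms]] .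
  have "onorm T \<le> sqrt ?B"
  proof (rule onorm_bound)
    show "0 \<le> sqrt ?B" using onorm_pos_le[OF b] by simp
    fix x
    have "complex_of_real ((norm (T x))\<^sup>2) = ip x (op_adj T (T x))"
      using opsetD(3)[OF assms] by (simp add: ip_self[symmetric] adjoint_of_def del: of_real_power)
    then have "(norm (T x))\<^sup>2 = cmod (ip x (op_adj T (T x)))" by (metis norm_of_real abs_of_nonneg zero_le_power2)
    also have "\<dots> \<le> norm x * (?B * norm x)"
      by (rule order_trans[OF norm_ip_le mult_left_mono[OF onorm[OF b]]]) simp
    also have "\<dots> = (sqrt ?B * norm x)\<^sup>2" using onorm_pos_le[OF b] by (simp add: power_mult_distrib power2_eq_square)
    finally show "norm (T x) \<le> sqrt ?B * norm x" by (rule power2_le_imp_le) (simp add: onorm_pos_le[OF b])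
  qed
  then have "(onorm T)\<^sup>2 \<le> (sqrt ?B)\<^sup>2" using onorm_pos_le[OF opsetD(1)[OF assms]] by (intro power_mono)
  then show ?thesis using onorm_pos_le[OF b] by simp
qed

lemma onorm_op_adj: assumes "T \<in> opset" shows "onorm (op_adj T) \<le> onorm T"
proof (cases "onorm (op_adj T) = 0")
  case False
  have b: "bounded_linear T" "bounded_linear (op_adj T)" using opsetD(1) assms opset_adj by auto
  have "(onorm (op_adj T))\<^sup>2 \<le> onorm (\<lambda>x. T (op_adj T x))"
    using onorm_adj_comp[OF opset_adj[OF assms]] by (simp add: op_adj_adj assms)
  also have "\<dots> \<le> onorm T * onorm (op_adj T)" using onorm_compose[OF b] by (simp add: o_def)
  finally show ?thesis using False onorm_pos_le[OF b(2)] by (simp add: power2_eq_square mult_le_cancel_right)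
qed (simp add: onorm_pos_le opsetD(1) assms)

text \<open>Adjoints do not increase norms, so the adjoints of a Cauchy sequence are again Cauchy.
  Both sequences have limits, and passing to the limit in the inner product shows that the second
  limit is adjoint to the first.\<close>

lemma BH_complete:
  assumes f: "\<And>n. f n \<in> opset" and c: "\<And>e. 0 < e \<Longrightarrow> \<exists>N::nat. \<forall>m\<ge>N. \<forall>n\<ge>N. onorm (\<lambda>x. f m x - f n x) < e"
  shows "\<exists>T\<in>opset. \<forall>e>0. \<exists>N::nat. \<forall>n\<ge>N. onorm (\<lambda>x. f n x - T x) < e"
proof -
  have lim: "\<exists>T. (\<forall>x. (\<lambda>n. g n x) \<longlonglongrightarrow> T x) \<and> bounded_linear T \<and> (\<forall>e>0. \<exists>N. \<forall>n\<ge>N. onorm (\<lambda>x. g n x - T x) < e)"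
    if g: "\<And>n. bounded_linear (g n :: ell2 \<Rightarrow> ell2)"
      and gc: "\<And>e. 0 < e \<Longrightarrow> \<exists>N::nat. \<forall>m\<ge>N. \<forall>n\<ge>N. onorm (\<lambda>x. g m x - g n x) < e" for g
  proof -
    have le: "norm (g m x - g n x) \<le> onorm (\<lambda>x. g m x - g n x) * norm x" for m n x
      by (rule onorm) (rule bounded_linear_sub[OF g g])
    have "Cauchy (\<lambda>n. g n x)" for x
    proof (rule CauchyI)
      fix e :: real assume "0 < e"
      then have "0 < e / (norm x + 1)" by (simp add: add_nonneg_pos)
      then obtain N where N: "\<forall>m\<ge>N. \<forall>n\<ge>N. onorm (\<lambda>x. g m x - g n x) < e / (norm x + 1)" using gc by blast
      have "norm (g m x - g n x) < e" if "m \<ge> N" "n \<ge> N" for m n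
      proof -
        have "norm (g m x - g n x) \<le> e / (norm x + 1) * norm x"
          using N that by (intro order_trans[OF le mult_right_mono]) (auto intro: less_imp_le)
        also have "\<dots> < e" using \<open>0 < e\<close> by (simp add: divide_simps add_nonneg_pos)
        finally show ?thesis .
      qed
      then show "\<exists>M. \<forall>m\<ge>M. \<forall>n\<ge>M. norm (g m x - g n x) < e" by blast
    qed
    then have "\<forall>x. \<exists>l. (\<lambda>n. g n x) \<longlonglongrightarrow> l" using Cauchy_convergent_iff convergent_def by metis
    then obtain T where T: "\<And>x. (\<lambda>n. g n x) \<longlonglongrightarrow> T x" by metis
    have near: "norm (g n x - T x) \<le> e * norm x" if "\<forall>m\<ge>N. \<forall>n\<ge>N. onorm (\<lambda>x. g m x - g n x) < e" "n \<ge> N" for n N e x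
    proof (rule LIMSEQ_le_const2)
      show "(\<lambda>m. norm (g n x - g m x)) \<longlonglongrightarrow> norm (g n x - T x)" by (intro tendsto_intros T)
      show "\<exists>M. \<forall>m\<ge>M. norm (g n x - g m x) \<le> e * norm x"
        using that by (intro exI[of _ N] allI impI order_trans[OF le mult_right_mono]) (auto intro: less_imp_le)
    qed
    have lin: "linear T"
    proof (rule linearI)
      fix x y :: ell2 and r :: real
      have "(\<lambda>n. g n (x + y)) \<longlonglongrightarrow> T x + T y"
        using tendsto_add[OF T T] by (simp add: linear_add[OF bounded_linear.linear[OF g]])
      then show "T (x + y) = T x + T y" using T LIMSEQ_unique by blast
      have "(\<lambda>n. g n (r *\<^sub>R x)) \<longlonglongrightarrow> r *\<^sub>R T x"
        using tendsto_scaleR[OF tendsto_const T] by (simp add: linear_scale[OF bounded_linear.linear[OF g]])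
      then show "T (r *\<^sub>R x) = r *\<^sub>R T x" using T LIMSEQ_unique by blast
    qed
    obtain N where N: "\<forall>m\<ge>N. \<forall>n\<ge>N. onorm (\<lambda>x. g m x - g n x) < 1" using gc[of 1] by auto
    have "norm (T x) \<le> norm x * (onorm (g N) + 1)" for x
    proof -
      have "norm (T x) \<le> norm (g N x) + norm (g N x - T x)" using norm_triangle_sub[of "T x" "g N x"] by (simp add: norm_minus_commute)
      also have "\<dots> \<le> onorm (g N) * norm x + 1 * norm x" by (intro add_mono onorm g near[OF N]) auto
      finally show ?thesis by (simp add: algebra_simps)
    qed
    then have bl: "bounded_linear T" using lin by (auto simp: bounded_linear_def bounded_linear_axioms_def linear_iff intro!: exI linearI)
    have "\<exists>N. \<forall>n\<ge>N. onorm (\<lambda>x. g n x - T x) < e" if "0 < e" for e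
    proof -
      obtain N where N: "\<forall>m\<ge>N. \<forall>n\<ge>N. onorm (\<lambda>x. g m x - g n x) < e / 2" using gc[of "e / 2"] \<open>0 < e\<close> by auto
      have "onorm (\<lambda>x. g n x - T x) \<le> e / 2" if "n \<ge> N" for n by (rule onorm_bound[OF _ near[OF N that]]) (use \<open>0 < e\<close> in simp)
      moreover have "e / 2 < e" using \<open>0 < e\<close> by simp
      ultimately show ?thesis by (meson order_le_less_trans)
    qed
    then show ?thesis using T bl by blast
  qed
  obtain T where T: "\<And>x. (\<lambda>n. f n x) \<longlonglongrightarrow> T x" "bounded_linear T" "\<forall>e>0. \<exists>N. \<forall>n\<ge>N. onorm (\<lambda>x. f n x - T x) < e"
    using lim[OF opsetD(1)[OF f] c] by blast
  have "onorm (\<lambda>x. op_adj (f m) x - op_adj (f n) x) \<le> onorm (\<lambda>x. f m x - f n x)" for m n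
  proof -
    have e: "f m \<ominus>\<^bsub>BH\<^esub> f n = (\<lambda>x. f m x - f n x)" by (rule a_minus_BH[OF f f])
    have m: "(\<lambda>x. cscale (-1) (f n x)) \<in> opset" "op_adj (\<lambda>x. cscale (-1) (f n x)) = (\<lambda>x. cscale (-1) (op_adj (f n) x))"
      using opset_cscale[OF f, of "-1" n] by auto
    \<comment> \<open>Written as a sum, the difference has its adjoint computed by
      \<open>opset_add\<close>.\<close>
    have d: "(\<lambda>x. g x - h x) = (\<lambda>x. g x + cscale (-1) (h x))" for g h :: "ell2 \<Rightarrow> ell2"
      by (auto intro!: ext ell2_eqI)
    show ?thesis using onorm_op_adj[OF opset_add(1)[OF f m(1)]] unfolding opset_add(2)[OF f m(1)] m(2) d .
  qed
  then have c': "\<exists>N. \<forall>m\<ge>N. \<forall>n\<ge>N. onorm (\<lambda>x. op_adj (f m) x - op_adj (f n) x) < e" if "0 < e" for e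
    using c[OF that] by (meson order_le_less_trans)
  obtain T' where T': "\<And>x. (\<lambda>n. op_adj (f n) x) \<longlonglongrightarrow> T' x" "bounded_linear T'"
    using lim[of "\<lambda>n. op_adj (f n)", OF opsetD(1)[OF opset_adj[OF f]] c'] by blast
  have "T \<in> opset"
  proof (rule opset_intro[OF T(2)])
    fix c x
    have "(\<lambda>n. f n (cscale c x)) \<longlonglongrightarrow> cscale c (T x)" using tendsto_cscale[OF T(1)] by (simp add: opsetD(2)[OF f])
    then show "T (cscale c x) = cscale c (T x)" using T(1) LIMSEQ_unique by blast
    show "adjoint_of T T'" unfolding adjoint_of_def
    proof (intro conjI allI T'(2))
      fix x y
      have "(\<lambda>n. ip (f n x) y) \<longlonglongrightarrow> ip (T x) y" by (rule tendsto_ip_left[OF T(1)])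
      moreover have "(\<lambda>n. ip (f n x) y) \<longlonglongrightarrow> ip x (T' y)"
        using tendsto_ip_right[OF T'(1)] opsetD(3)[OF f] by (simp add: adjoint_of_def)
      ultimately show "ip (T x) y = ip x (T' y)" by (rule LIMSEQ_unique)
    qed
  qed
  then show ?thesis using T(3) by blast
qed

lemma unital_BH: "unital_cstar_algebra BH"
proof -
  have s: "carrier BH = opset" "\<one>\<^bsub>BH\<^esub> = (\<lambda>x. x)" "\<zero>\<^bsub>BH\<^esub> = (\<lambda>x. 0)"
    "S \<otimes>\<^bsub>BH\<^esub> T = (\<lambda>x. S (T x))" "S \<oplus>\<^bsub>BH\<^esub> T = (\<lambda>x. S x + T x)" "smult BH c T = (\<lambda>x. cscale c (T x))"
    "star BH = op_adj" "cnorm BH = onorm" for S T c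
    by (auto simp: BH_def)
  have comp: "(\<forall>n. f n \<in> opset) \<and>
      (\<forall>e>0. \<exists>N::nat. \<forall>m\<ge>N. \<forall>n\<ge>N. onorm (f m \<ominus>\<^bsub>BH\<^esub> f n) < e) \<longrightarrow>
      (\<exists>T\<in>opset. \<forall>e>0. \<exists>N::nat. \<forall>n\<ge>N. onorm (f n \<ominus>\<^bsub>BH\<^esub> T) < e)" for f
    using BH_complete[of f] by (auto simp: a_minus_BH cong: bex_cong)
  have cst: "onorm (\<lambda>x. op_adj T (T x)) = (onorm T)\<^sup>2" if "T \<in> opset" for T
  proof (rule antisym)
    have b: "bounded_linear T" "bounded_linear (op_adj T)" using opsetD(1) that opset_adj by auto
    have "onorm (\<lambda>x. op_adj T (T x)) \<le> onorm (op_adj T) * onorm T" using onorm_compose[OF b(2,1)] by (simp add: o_def)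
    also have "\<dots> \<le> onorm T * onorm T" using onorm_op_adj[OF that] onorm_pos_le[OF b(1)] by (intro mult_right_mono)
    finally show "onorm (\<lambda>x. op_adj T (T x)) \<le> (onorm T)\<^sup>2" by (simp add: power2_eq_square)
  qed (rule onorm_adj_comp[OF that])
  have zero: "onorm T = 0 \<longleftrightarrow> T = (\<lambda>x. 0)" if "T \<in> opset" for T
    using onorm_eq_0[OF opsetD(1)[OF that]] by auto
  have sub: "onorm (\<lambda>x. S (T x)) \<le> onorm S * onorm T" if "S \<in> opset" "T \<in> opset" for S T
    using onorm_compose[OF opsetD(1)[OF that(1)] opsetD(1)[OF that(2)]] by (simp add: o_def)
  show ?thesis
    unfolding unital_cstar_algebra_def s
    apply (intro conjI allI ballI)
    apply (rule ring_BH)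
    \<comment> \<open>Again completeness is the last remaining goal.\<close>
    apply (rule_tac [19] comp)
    apply (simp_all add: opset_cscale opset_adj op_adj_adj opset_add opset_comp opsetD(2) onorm_pos_le onorm_triangle
      onorm_cscale opsetD(1) cst zero sub)
    done
qed

subsection \<open>Operators permuting the coordinates\<close>

text \<open>Coordinate i of the image is read off at position \<open>r i\<close>. With
  \<open>r\<close> a partial tail map this moves the basis vector at j to the one at the point whose
  tail is j, so it models prefixing a letter.\<close>

definition perm_op :: "(nat \<Rightarrow> nat option) \<Rightarrow> ell2 \<Rightarrow> ell2" where
  "perm_op r x = Ell2 (\<lambda>i. case r i of None \<Rightarrow> 0 | Some n \<Rightarrow> coord x n)"

definition inverse_map :: "(nat \<Rightarrow> nat option) \<Rightarrow> (nat \<Rightarrow> nat option) \<Rightarrow> bool" where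
  "inverse_map r r' \<longleftrightarrow> (\<forall>i n. r i = Some n \<longleftrightarrow> r' n = Some i)"

lemma inverse_map_sym: "inverse_map r r' \<Longrightarrow> inverse_map r' r"
  by (simp add: inverse_map_def)

text \<open>\<open>r\<close> is injective where it is defined, so the coordinates read off are
  distinct coordinates of x.\<close>

lemma perm_op_aux:
  assumes "inverse_map r r'"
  shows "L2_set (\<lambda>i. cmod (case r i of None \<Rightarrow> 0 | Some n \<Rightarrow> coord x n)) {..<k} \<le> norm x"
proof -
  let ?F = "{i \<in> {..<k}. r i \<noteq> None}"
  have inj: "inj_on (\<lambda>i. the (r i)) ?F"
  proof (rule inj_onI)
    fix i j assume "i \<in> ?F" "j \<in> ?F" "the (r i) = the (r j)"
    then obtain n where "r i = Some n" "r j = Some n" by auto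
    then have "r' n = Some i" "r' n = Some j" using assms unfolding inverse_map_def by blast+
    then show "i = j" by simp
  qed
  have "(\<Sum>i<k. (cmod (case r i of None \<Rightarrow> 0 | Some n \<Rightarrow> coord x n))\<^sup>2) = (\<Sum>i\<in>?F. (cmod (coord x (the (r i))))\<^sup>2)"
    by (rule sum.mono_neutral_cong_right) auto
  also have "\<dots> = (\<Sum>n\<in>(\<lambda>i. the (r i)) ` ?F. (cmod (coord x n))\<^sup>2)"
    using sum.reindex[OF inj, of "\<lambda>n. (cmod (coord x n))\<^sup>2"] by (simp only: o_def)
  finally have "L2_set (\<lambda>i. cmod (case r i of None \<Rightarrow> 0 | Some n \<Rightarrow> coord x n)) {..<k} =
      L2_set (\<lambda>n. cmod (coord x n)) ((\<lambda>i. the (r i)) ` ?F)" by (simp add: L2_set_def)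
  then show ?thesis by (simp add: L2_set_le_norm)
qed

lemma coord_perm_op:
  assumes "inverse_map r r'"
  shows "coord (perm_op r x) i = (case r i of None \<Rightarrow> 0 | Some n \<Rightarrow> coord x n)"
  using l2_bounded(1)[OF perm_op_aux[OF assms]] by (simp add: perm_op_def Ell2_inverse)

lemma ip_eq_infsum: "((\<lambda>n. cnj (coord x n) * coord y n) has_sum ip x y) UNIV"
  unfolding ip_def by (rule norm_summable_imp_has_sum[OF summable_ip_norm summable_sums[OF summable_ip]])

lemma perm_op_opset:
  assumes r: "inverse_map r r'"
  shows "perm_op r \<in> opset" "op_adj (perm_op r) = perm_op r'"
proof -
  have bl: "bounded_linear (perm_op s)" if "inverse_map s s'" for s s'
  proof (rule bounded_linear_intro[of _ 1])
    fix x y :: ell2 and c :: real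
    show "perm_op s (x + y) = perm_op s x + perm_op s y" "perm_op s (c *\<^sub>R x) = c *\<^sub>R perm_op s x"
      by (rule ell2_eqI; simp add: coord_perm_op[OF that] split: option.split)+
    show "norm (perm_op s x) \<le> norm x * 1"
      using perm_op_aux[OF that] by (intro norm_ell2_le) (simp add: coord_perm_op[OF that])
  qed
  have lin: "perm_op r (cscale c x) = cscale c (perm_op r x)" for c x
    by (rule ell2_eqI) (simp add: coord_perm_op[OF r] split: option.split)
  have "ip (perm_op r x) y = ip x (perm_op r' y)" for x y
  proof -
    let ?I = "{i. r i \<noteq> None}" and ?J = "{n. r' n \<noteq> None}"
    have bij: "bij_betw (\<lambda>i. the (r i)) ?I ?J"
    proof (rule bij_betwI')
      have *: "r i = Some n \<longleftrightarrow> r' n = Some i" for i n using r by (simp add: inverse_map_def)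
      show "the (r i) = the (r j) \<longleftrightarrow> i = j" if "i \<in> ?I" "j \<in> ?I" for i j
      proof -
        obtain n m where nm: "r i = Some n" "r j = Some m" using \<open>i \<in> ?I\<close> \<open>j \<in> ?I\<close> by auto
        then have "r' n = Some i" "r' m = Some j" using * by blast+
        then show ?thesis using nm by auto
      qed
      show "the (r i) \<in> ?J" if "i \<in> ?I" for i
      proof -
        obtain n where n: "r i = Some n" using \<open>i \<in> ?I\<close> by auto
        then have "r' n = Some i" using * by blast
        then show ?thesis using n by simp
      qed
      show "\<exists>i\<in>?I. n = the (r i)" if "n \<in> ?J" for n
      proof -
        obtain i where i: "r' n = Some i" using \<open>n \<in> ?J\<close> by auto
        then have "r i = Some n" using * by blast
        then show ?thesis by (intro bexI[of _ i]) auto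
      qed
    qed
    \<comment> \<open>Unordered sums are used because the bijection between the two index sets
      ignores the order of the coordinates.\<close>
    have "ip (perm_op r x) y = infsum (\<lambda>i. cnj (coord (perm_op r x) i) * coord y i) UNIV"
      using infsumI[OF ip_eq_infsum] by simp
    also have "\<dots> = infsum (\<lambda>i. cnj (coord x (the (r i))) * coord (perm_op r' y) (the (r i))) ?I"
    proof (rule infsum_cong_neutral)
      fix i assume "i \<in> UNIV \<inter> ?I"
      then obtain n where n: "r i = Some n" by auto
      then have "r' n = Some i" using r by (simp add: inverse_map_def)
      then show "cnj (coord (perm_op r x) i) * coord y i = cnj (coord x (the (r i))) * coord (perm_op r' y) (the (r i))"
        using n by (simp add: coord_perm_op[OF r] coord_perm_op[OF inverse_map_sym[OF r]])
    qed (auto simp: coord_perm_op[OF r])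
    also have "\<dots> = infsum (\<lambda>n. cnj (coord x n) * coord (perm_op r' y) n) ?J"
      by (rule infsum_reindex_bij_betw[OF bij, of "\<lambda>n. cnj (coord x n) * coord (perm_op r' y) n"])
    also have "\<dots> = infsum (\<lambda>n. cnj (coord x n) * coord (perm_op r' y) n) UNIV"
      by (rule infsum_cong_neutral) (auto simp: coord_perm_op[OF inverse_map_sym[OF r]])
    also have "\<dots> = ip x (perm_op r' y)" using infsumI[OF ip_eq_infsum] by simp
    finally show ?thesis .
  qed
  then have "adjoint_of (perm_op r) (perm_op r')" using bl[OF inverse_map_sym[OF r]] by (simp add: adjoint_of_def)
  from opset_intro[OF bl[OF r] lin this] show "perm_op r \<in> opset" "op_adj (perm_op r) = perm_op r'" by auto
qed

definition diag_op :: "(nat \<Rightarrow> bool) \<Rightarrow> ell2 \<Rightarrow> ell2" where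
  "diag_op P = perm_op (\<lambda>i. if P i then Some i else None)"

lemma inverse_map_diag: "inverse_map (\<lambda>i. if P i then Some i else None) (\<lambda>i. if P i then Some i else None)"
  by (auto simp: inverse_map_def)

lemma coord_diag_op [simp]: "coord (diag_op P x) i = (if P i then coord x i else 0)"
  by (simp add: diag_op_def coord_perm_op[OF inverse_map_diag])

lemma diag_op_opset [simp]: "diag_op P \<in> opset" "op_adj (diag_op P) = diag_op P"
  by (simp_all add: diag_op_def perm_op_opset[OF inverse_map_diag])

lemma BH_simps [simp]: "carrier BH = opset" "\<one>\<^bsub>BH\<^esub> = (\<lambda>x. x)" "\<zero>\<^bsub>BH\<^esub> = (\<lambda>x. 0)"
    "S \<otimes>\<^bsub>BH\<^esub> T = (\<lambda>x. S (T x))" "S \<oplus>\<^bsub>BH\<^esub> T = (\<lambda>x. S x + T x)" "smult BH c T = (\<lambda>x. cscale c (T x))"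
    "star BH = op_adj" "cnorm BH = onorm"
  by (auto simp: BH_def)

lemma diag_projection: "is_projection BH (diag_op P)"
  by (auto simp: is_projection_def intro!: ext ell2_eqI)

lemma coord_sum: "coord (\<Sum>k\<in>F. f k) i = (\<Sum>k\<in>F. coord (f k) i)"
  by (induction F rule: infinite_finite_induct) auto

lemma finsum_BH:
  assumes "finite F" "\<And>k. k \<in> F \<Longrightarrow> f k \<in> opset"
  shows "finsum BH f F = (\<lambda>x. \<Sum>k\<in>F. f k x)"
proof -
  interpret ring BH by (rule ring_BH)
  show ?thesis using assms
    by (induction F rule: finite_induct) (auto simp: Pi_def)
qed

lemma finsum_diag:
  assumes "finite F"
  shows "finsum BH (\<lambda>k. diag_op (\<lambda>i. g i = k)) F = diag_op (\<lambda>i. g i \<in> F)"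
proof -
  have "(\<Sum>k\<in>F. diag_op (\<lambda>i. g i = k) x) = diag_op (\<lambda>i. g i \<in> F) x" for x
  proof (rule ell2_eqI)
    fix i
    have "(\<Sum>k\<in>F. coord (diag_op (\<lambda>i. g i = k) x) i) = (\<Sum>k\<in>F. if g i = k then coord x i else 0)"
      by (intro sum.cong) auto
    then show "coord (\<Sum>k\<in>F. diag_op (\<lambda>i. g i = k) x) i = coord (diag_op (\<lambda>i. g i \<in> F) x) i"
      using assms by (simp add: coord_sum)
  qed
  then show ?thesis using assms by (subst finsum_BH) auto
qed

text \<open>A representation is obtained from any countable set of points with a first letter \<open>a\<close>, a tail \<open>\<sigma>\<close>
  and compatible vertices \<open>V l\<close> which is closed under taking tails and under extending to the left.\<close>
lemma BH_representation:
  fixes L :: "(int \<Rightarrow> 's::finite) set"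
  assumes inj: "\<And>i j. a i = a j \<Longrightarrow> \<sigma> i = \<sigma> j \<Longrightarrow> i = j"
    and V: "\<And>l i. V l i \<in> Vmin L l" and fin: "\<And>l. finite (Vmin L l)"
    and I: "\<And>l u i. u \<in> Vmin L l \<Longrightarrow> Imin L l u (V (Suc l) i) \<longleftrightarrow> u = V l i"
    and A: "\<And>l u \<alpha> j. u \<in> Vmin L l \<Longrightarrow> Amin L l u \<alpha> (V (Suc l) j) \<longleftrightarrow> (\<exists>i. a i = \<alpha> \<and> \<sigma> i = j \<and> V l i = u)"
  defines "r \<equiv> \<lambda>\<alpha> i. if a i = \<alpha> then Some (\<sigma> i) else None"
  shows "min_relations L BH (\<lambda>\<alpha>. perm_op (r \<alpha>)) (\<lambda>l v. diag_op (\<lambda>i. V l i = v))"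
proof -
  \<comment> \<open>The point with first letter \<alpha> and tail j, if there is one;
    \<open>inj\<close> makes it unique.\<close>
  define r' where "r' \<alpha> j = (if \<exists>i. a i = \<alpha> \<and> \<sigma> i = j then Some (THE i. a i = \<alpha> \<and> \<sigma> i = j) else None)" for \<alpha> j
  have the: "(THE i. a i = \<alpha> \<and> \<sigma> i = j) = k" if "a k = \<alpha>" "\<sigma> k = j" for \<alpha> j k
    by (rule the_equality) (use that inj in auto)
  have r: "inverse_map (r \<alpha>) (r' \<alpha>)" for \<alpha>
    unfolding inverse_map_def r_def r'_def using the by auto
  note S = perm_op_opset[OF r] coord_perm_op[OF r] coord_perm_op[OF inverse_map_sym[OF r]]
  have SS': "(\<lambda>x. perm_op (r \<alpha>) (perm_op (r' \<alpha>) x)) = diag_op (\<lambda>i. a i = \<alpha>)" for \<alpha>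
    by (rule ext, rule ell2_eqI, simp only: S(3,4) coord_diag_op) (auto simp: r_def r'_def the)
  have S'ES: "perm_op (r' \<alpha>) (diag_op P (perm_op (r \<alpha>) x)) = diag_op (\<lambda>j. \<exists>i. a i = \<alpha> \<and> \<sigma> i = j \<and> P i) x" for \<alpha> P x
  proof (rule ell2_eqI)
    fix j show "coord (perm_op (r' \<alpha>) (diag_op P (perm_op (r \<alpha>) x))) j = coord (diag_op (\<lambda>j. \<exists>i. a i = \<alpha> \<and> \<sigma> i = j \<and> P i) x) j"
    proof (cases "\<exists>i. a i = \<alpha> \<and> \<sigma> i = j")
      case True
      then obtain i where i: "a i = \<alpha>" "\<sigma> i = j" by blast
      then have "r' \<alpha> j = Some i" "r \<alpha> i = Some j" by (auto simp: r'_def r_def the)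
      moreover have "(\<exists>i. a i = \<alpha> \<and> \<sigma> i = j \<and> P i) \<longleftrightarrow> P i" using i inj by metis
      ultimately show ?thesis by (simp add: S)
    next
      case False
      then have "r' \<alpha> j = None" by (auto simp: r'_def)
      then show ?thesis using False by (auto simp: S)
    qed
  qed
  have S'S: "(\<lambda>x. perm_op (r' \<alpha>) (perm_op (r \<alpha>) x)) = diag_op (\<lambda>j. \<exists>i. a i = \<alpha> \<and> \<sigma> i = j)" for \<alpha>
  proof -
    have "diag_op (\<lambda>_. True) x = x" for x by (rule ell2_eqI) simp
    then show ?thesis using S'ES[of \<alpha> "\<lambda>_. True"] by (intro ext) simp
  qed
  have one: "diag_op (\<lambda>_. True) = (\<lambda>x. x)" by (rule ext, rule ell2_eqI) simp
  show ?thesis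
    unfolding min_relations_def
  proof (intro conjI allI ballI)
    fix \<alpha> show "is_partial_isometry BH (perm_op (r \<alpha>))"
      using diag_projection by (simp add: is_partial_isometry_def S S'S)
  next
    fix l v show "is_projection BH (diag_op (\<lambda>i. V l i = v))" by (rule diag_projection)
  next
    show "(\<Oplus>\<^bsub>BH\<^esub>\<beta>\<in>UNIV. perm_op (r \<beta>) \<otimes>\<^bsub>BH\<^esub> star BH (perm_op (r \<beta>))) = \<one>\<^bsub>BH\<^esub>"
      unfolding BH_simps S(2) SS' one[symmetric] by (subst finsum_diag) auto
  next
    fix l show "finsum BH (\<lambda>v. diag_op (\<lambda>i. V l i = v)) (Vmin L l) = \<one>\<^bsub>BH\<^esub>"
      unfolding BH_simps one[symmetric] using V by (subst finsum_diag[OF fin]) simp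
  next
    fix l \<alpha> v
    show "perm_op (r \<alpha>) \<otimes>\<^bsub>BH\<^esub> star BH (perm_op (r \<alpha>)) \<otimes>\<^bsub>BH\<^esub> diag_op (\<lambda>i. V l i = v) =
      diag_op (\<lambda>i. V l i = v) \<otimes>\<^bsub>BH\<^esub> (perm_op (r \<alpha>) \<otimes>\<^bsub>BH\<^esub> star BH (perm_op (r \<alpha>)))"
      using fun_cong[OF SS', of \<alpha>] by (simp add: S(2)) (auto intro!: ext ell2_eqI)
  next
    fix l u assume u: "u \<in> Vmin L l"
    have "finsum BH (\<lambda>v. diag_op (\<lambda>i. V (Suc l) i = v)) {v \<in> Vmin L (Suc l). Imin L l u v} = diag_op (\<lambda>i. V l i = u)"
      using V fin I[OF u] by (subst finsum_diag) (auto simp: eq_commute)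
    then show "diag_op (\<lambda>i. V l i = u) = finsum BH (\<lambda>v. diag_op (\<lambda>i. V (Suc l) i = v)) {v \<in> Vmin L (Suc l). Imin L l u v}" by simp
  next
    fix l \<alpha> u assume u: "u \<in> Vmin L l"
    have "finsum BH (\<lambda>v. diag_op (\<lambda>i. V (Suc l) i = v)) {v \<in> Vmin L (Suc l). Amin L l u \<alpha> v} =
        diag_op (\<lambda>j. \<exists>i. a i = \<alpha> \<and> \<sigma> i = j \<and> V l i = u)"
      unfolding A[OF u, symmetric] using V fin by (subst finsum_diag) auto
    then show "star BH (perm_op (r \<alpha>)) \<otimes>\<^bsub>BH\<^esub> diag_op (\<lambda>i. V l i = u) \<otimes>\<^bsub>BH\<^esub> perm_op (r \<alpha>) =
      finsum BH (\<lambda>v. diag_op (\<lambda>i. V (Suc l) i = v)) {v \<in> Vmin L (Suc l). Amin L l u \<alpha> v}"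
      using S'ES by (simp add: S(2))
  qed
qed

section \<open>Matrix coefficients and nontriviality of the operator algebra\<close>

lift_definition basis :: "nat \<Rightarrow> ell2" is "\<lambda>j i. if i = j then 1 else 0"
proof -
  fix j :: nat
  have "(\<lambda>n. (cmod (if n = j then 1 else 0))\<^sup>2) = (\<lambda>n. if n = j then 1 else 0)" by auto
  then show "summable (\<lambda>n. (cmod (if n = j then 1 else 0))\<^sup>2)" by simp
qed

lemma ip_basis: "ip (basis j) x = coord x j"
proof -
  have "(\<lambda>n. cnj (coord (basis j) n) * coord x n) = (\<lambda>n. if n = j then coord x n else 0)"
    by (auto simp: basis.rep_eq)
  then show ?thesis using sums_single[of j "coord x"] by (simp add: ip_def sums_iff)
qed

text \<open>An operator is determined by the matrix of its adjoint, a countable family of complex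
  numbers; \<open>prod_decode\<close> turns one index into the two that are needed.\<close>

lemma BH_embeds: obtains \<phi> :: "(ell2 \<Rightarrow> ell2) \<Rightarrow> nat \<Rightarrow> complex" where "inj_on \<phi> (carrier BH)"
proof -
  define \<phi> where "\<phi> T n = coord (op_adj T (basis (fst (prod_decode n)))) (snd (prod_decode n))" for T :: "ell2 \<Rightarrow> ell2" and n
  have "inj_on \<phi> (carrier BH)"
  proof (rule inj_onI)
    fix S T assume *: "S \<in> carrier BH" "T \<in> carrier BH" "\<phi> S = \<phi> T"
    have "coord (op_adj S (basis j)) i = coord (op_adj T (basis j)) i" for i j
      using fun_cong[OF *(3), of "prod_encode (j, i)"] by (simp add: \<phi>_def)
    then have e: "op_adj S (basis j) = op_adj T (basis j)" for j by (rule ell2_eqI)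
    have c: "coord (R x) j = ip (op_adj R (basis j)) x" if "R \<in> opset" for R x j
      using adjoint_sym[OF that] by (simp add: adjoint_of_def ip_basis)
    show "S = T" by (rule ext, rule ell2_eqI) (use * c e in auto)
  qed
  then show thesis by (rule that)
qed

lemma BH_nontrivial: "\<one>\<^bsub>BH\<^esub> \<noteq> \<zero>\<^bsub>BH\<^esub>"
proof
  assume "\<one>\<^bsub>BH\<^esub> = \<zero>\<^bsub>BH\<^esub>"
  then have "basis 0 = 0" by (simp add: fun_eq_iff)
  then have "coord (basis 0) 0 = 0" by simp
  then show False by (simp add: basis.rep_eq)
qed

section \<open>Words and synchronization\<close>

lemma window_Bstar: "x \<in> L \<Longrightarrow> map (\<lambda>i. x (n + int i)) [0..<k] \<in> Bstar L"
  by (auto simp: Bstar_def occurs_in_def)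

lemma Bstar_append:
  assumes "u @ v \<in> Bstar L" shows "u \<in> Bstar L" "v \<in> Bstar L"
proof -
  obtain x k where x: "x \<in> L" "\<And>i. i < length (u @ v) \<Longrightarrow> x (k + int i) = (u @ v) ! i"
    using assms by (auto simp: Bstar_def occurs_in_def)
  have "x (k + int i) = u ! i" if "i < length u" for i using x(2)[of i] that by (simp add: nth_append)
  then show "u \<in> Bstar L" using x(1) by (auto simp: Bstar_def occurs_in_def)
  have "x (k + int (length u) + int i) = v ! i" if "i < length v" for i
    using x(2)[of "length u + i"] that by (simp add: add.assoc)
  then show "v \<in> Bstar L" using x(1) by (auto simp: Bstar_def occurs_in_def)
qed

lemma Bstar_extend_right: assumes "u \<in> Bstar L" obtains w where "length w = n" "u @ w \<in> Bstar L"
proof -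
  obtain x k where x: "x \<in> L" "\<And>i. i < length u \<Longrightarrow> x (k + int i) = u ! i"
    using assms by (auto simp: Bstar_def occurs_in_def)
  let ?w = "map (\<lambda>i. x (k + int (length u + i))) [0..<n]"
  have "x (k + int i) = (u @ ?w) ! i" if "i < length (u @ ?w)" for i
    using x(2) that by (auto simp: nth_append)
  then have "u @ ?w \<in> Bstar L" using x(1) by (auto simp: Bstar_def occurs_in_def)
  then show thesis using that[of ?w] by simp
qed

lemma Bstar_extend_left: assumes "u \<in> Bstar L" obtains w where "length w = n" "w @ u \<in> Bstar L"
proof -
  obtain x k where x: "x \<in> L" "\<And>i. i < length u \<Longrightarrow> x (k + int i) = u ! i"
    using assms by (auto simp: Bstar_def occurs_in_def)
  let ?w = "map (\<lambda>i. x (k - int n + int i)) [0..<n]"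
  have "x (k - int n + int i) = (?w @ u) ! i" if "i < length (?w @ u)" for i
  proof (cases "i < n")
    case False
    then have e: "k - int n + int i = k + int (i - n)" by simp
    have "i - n < length u" using that False by simp
    from x(2)[OF this] have "x (k - int n + int i) = u ! (i - n)" unfolding e .
    then show ?thesis using False by (simp add: nth_append)
  qed (simp add: nth_append)
  then have "?w @ u \<in> Bstar L" using x(1) unfolding Bstar_def occurs_in_def by blast
  then show thesis using that[of ?w] by simp
qed

lemma Gamma_minus_iff: "\<nu> \<in> Gamma_minus L l \<mu> \<longleftrightarrow> length \<nu> = l \<and> \<nu> @ \<mu> \<in> Bstar L"
  using Bstar_append by (auto simp: Gamma_minus_def Bl_def)

lemma past_eq_iff: "past_eq L l \<mu> \<nu> \<longleftrightarrow> (\<forall>\<kappa>. length \<kappa> = l \<longrightarrow> (\<kappa> @ \<mu> \<in> Bstar L \<longleftrightarrow> \<kappa> @ \<nu> \<in> Bstar L))"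
  unfolding past_eq_def set_eq_iff Gamma_minus_iff by blast

lemma past_eq_refl [simp]: "past_eq L l \<mu> \<mu>"
  and past_eq_sym: "past_eq L l \<mu> \<nu> \<Longrightarrow> past_eq L l \<nu> \<mu>"
  and past_eq_trans: "past_eq L l \<mu> \<nu> \<Longrightarrow> past_eq L l \<nu> \<kappa> \<Longrightarrow> past_eq L l \<mu> \<kappa>"
  by (auto simp: past_eq_def)

text \<open>An admissible word has some past of length \<open>l\<close>, and any word sharing this
  past is admissible as well.\<close>

lemma past_eq_Bstar: assumes "past_eq L l \<mu> \<nu>" "\<mu> \<in> Bstar L" shows "\<nu> \<in> Bstar L"
proof -
  obtain \<kappa> where "length \<kappa> = l" "\<kappa> @ \<mu> \<in> Bstar L" using Bstar_extend_left[OF assms(2)] .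
  then have "\<kappa> @ \<nu> \<in> Bstar L" using assms(1) by (simp add: past_eq_iff)
  then show ?thesis by (rule Bstar_append(2))
qed

text \<open>A short past of an admissible word extends to the left to one of length
  \<open>l\<close>, to which the hypothesis applies.\<close>

lemma past_eq_mono: assumes "past_eq L l \<mu> \<nu>" "k \<le> l" shows "past_eq L k \<mu> \<nu>"
proof -
  have "\<kappa> @ \<nu> \<in> Bstar L" if k: "past_eq L l \<mu> \<nu>" "length \<kappa> = k" "\<kappa> @ \<mu> \<in> Bstar L" for \<kappa> \<mu> \<nu>
  proof -
    obtain \<kappa>' where \<kappa>': "length \<kappa>' = l - k" "\<kappa>' @ \<kappa> @ \<mu> \<in> Bstar L" using Bstar_extend_left[OF k(3)] .
    have "length (\<kappa>' @ \<kappa>) = l" using \<kappa>' k assms(2) by simp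
    then have "(\<kappa>' @ \<kappa>) @ \<nu> \<in> Bstar L" using k(1) \<kappa>'(2) unfolding past_eq_iff by (metis append_assoc)
    then show ?thesis using Bstar_append(2)[of \<kappa>' "\<kappa> @ \<nu>"] by simp
  qed
  from this[OF assms(1)] this[OF past_eq_sym[OF assms(1)]] show ?thesis
    unfolding past_eq_iff[of L k] by blast
qed

lemma past_eq_admissible:
  assumes "past_eq L l \<mu> \<nu>" "length \<xi> \<le> l"
  shows "\<xi> @ \<mu> \<in> Bstar L \<longleftrightarrow> \<xi> @ \<nu> \<in> Bstar L"
  using past_eq_mono[OF assms] by (simp add: past_eq_iff)

text \<open>The prepended word becomes part of the past, so it uses up as many levels as it has
  letters.\<close>

lemma past_eq_prepend:
  fixes L :: "(int \<Rightarrow> 's) set"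
  assumes "past_eq L (l + length \<xi>) \<mu> \<nu>" shows "past_eq L l (\<xi> @ \<mu>) (\<xi> @ \<nu>)"
  unfolding past_eq_iff
proof (intro allI impI)
  fix \<kappa> :: "'s list" assume "length \<kappa> = l"
  then show "\<kappa> @ \<xi> @ \<mu> \<in> Bstar L \<longleftrightarrow> \<kappa> @ \<xi> @ \<nu> \<in> Bstar L"
    using past_eq_admissible[OF assms, of "\<kappa> @ \<xi>"] by simp
qed

lemma Sync_iff: "\<mu> \<in> Sync L l \<longleftrightarrow> \<mu> \<in> Bstar L \<and> (\<forall>\<omega>. \<mu> @ \<omega> \<in> Bstar L \<longrightarrow> past_eq L l \<mu> (\<mu> @ \<omega>))"
  using Bstar_append(2) by (fastforce simp: Sync_def Gamma_plus_def past_eq_def)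

lemma Sync_Bstar: "\<mu> \<in> Sync L l \<Longrightarrow> \<mu> \<in> Bstar L"
  by (simp add: Sync_iff)

lemma Sync_append:
  assumes "\<mu> \<in> Sync L l" "\<mu> @ \<omega> \<in> Bstar L"
  shows "\<mu> @ \<omega> \<in> Sync L l" "past_eq L l \<mu> (\<mu> @ \<omega>)"
proof -
  show *: "past_eq L l \<mu> (\<mu> @ \<omega>)" using assms by (simp add: Sync_iff)
  show "\<mu> @ \<omega> \<in> Sync L l"
    unfolding Sync_iff
  proof (intro conjI allI impI assms(2))
    fix \<omega>' assume "(\<mu> @ \<omega>) @ \<omega>' \<in> Bstar L"
    then have "past_eq L l \<mu> ((\<mu> @ \<omega>) @ \<omega>')" using assms(1) by (simp add: Sync_iff)
    then show "past_eq L l (\<mu> @ \<omega>) ((\<mu> @ \<omega>) @ \<omega>')" using * past_eq_sym past_eq_trans by blast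
  qed
qed

lemma Sync_mono: "\<mu> \<in> Sync L l \<Longrightarrow> k \<le> l \<Longrightarrow> \<mu> \<in> Sync L k"
  unfolding Sync_iff using past_eq_mono by blast

text \<open>The same loss of levels as in \<open>past_eq_prepend\<close>; this is why the edges of
  the minimal presentation lead from level l to level l + 1.\<close>

lemma Sync_prepend:
  assumes "\<nu> \<in> Sync L (l + length \<xi>)" "\<xi> @ \<nu> \<in> Bstar L"
  shows "\<xi> @ \<nu> \<in> Sync L l"
  unfolding Sync_iff
proof (intro conjI allI impI assms(2))
  fix \<omega> assume *: "(\<xi> @ \<nu>) @ \<omega> \<in> Bstar L"
  then have "\<nu> @ \<omega> \<in> Bstar L" using Bstar_append(2)[of \<xi> "\<nu> @ \<omega>"] by simp
  then have "past_eq L (l + length \<xi>) \<nu> (\<nu> @ \<omega>)" using assms(1) by (simp add: Sync_iff)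
  from past_eq_prepend[OF this] show "past_eq L l (\<xi> @ \<nu>) ((\<xi> @ \<nu>) @ \<omega>)" by simp
qed

lemma vclass_eqI: "past_eq L l \<mu> \<nu> \<Longrightarrow> vclass L l \<mu> = vclass L l \<nu>"
  by (simp add: vclass_def past_eq_def)

lemma vclass_eq_iff:
  assumes "\<mu> \<in> Sync L l" "\<nu> \<in> Sync L l"
  shows "vclass L l \<mu> = vclass L l \<nu> \<longleftrightarrow> past_eq L l \<mu> \<nu>"
proof
  assume "vclass L l \<mu> = vclass L l \<nu>"
  moreover have "\<mu> \<in> vclass L l \<mu>" using assms by (simp add: vclass_def)
  ultimately show "past_eq L l \<mu> \<nu>" by (simp add: vclass_def)
qed (rule vclass_eqI)

lemma vclass_Vmin [simp, intro]: "\<mu> \<in> Sync L l \<Longrightarrow> vclass L l \<mu> \<in> Vmin L l"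
  by (simp add: Vmin_def)

text \<open>\<open>Imin\<close> asserts only that some word represents both vertices. Past
  equivalence shows independence of the representative, so any given words can be tested.\<close>

lemma Imin_iff:
  assumes "\<mu> \<in> Sync L l" "\<nu> \<in> Sync L (Suc l)"
  shows "Imin L l (vclass L l \<mu>) (vclass L (Suc l) \<nu>) \<longleftrightarrow> past_eq L l \<mu> \<nu>"
proof
  assume "Imin L l (vclass L l \<mu>) (vclass L (Suc l) \<nu>)"
  then obtain \<kappa> where k: "\<kappa> \<in> Sync L (Suc l)" "vclass L l \<mu> = vclass L l \<kappa>" "vclass L (Suc l) \<nu> = vclass L (Suc l) \<kappa>"
    by (auto simp: Imin_def)
  have "past_eq L (Suc l) \<nu> \<kappa>" using k assms by (simp add: vclass_eq_iff)
  then have "past_eq L l \<nu> \<kappa>" using past_eq_mono by fastforce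
  moreover have "past_eq L l \<mu> \<kappa>" using k assms Sync_mono[OF k(1), of l] by (simp add: vclass_eq_iff)
  ultimately show "past_eq L l \<mu> \<nu>" using past_eq_sym past_eq_trans by blast
next
  assume "past_eq L l \<mu> \<nu>"
  then have "vclass L l \<mu> = vclass L l \<nu>" using assms Sync_mono[of \<nu> L "Suc l" l] by (simp add: vclass_eq_iff)
  then show "Imin L l (vclass L l \<mu>) (vclass L (Suc l) \<nu>)" using assms by (auto simp: Imin_def)
qed

text \<open>Independence of the representative again: if \<kappa> and \<nu> have the same pasts of
  length l + 1, then \<alpha> \<kappa> and \<alpha> \<nu> are admissible together and have the same
  pasts of length l.\<close>

lemma Amin_iff:
  assumes "\<mu> \<in> Sync L l" "\<nu> \<in> Sync L (Suc l)"
  shows "Amin L l (vclass L l \<mu>) \<alpha> (vclass L (Suc l) \<nu>) \<longleftrightarrow> \<alpha> # \<nu> \<in> Bstar L \<and> past_eq L l \<mu> (\<alpha> # \<nu>)"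
proof
  assume "Amin L l (vclass L l \<mu>) \<alpha> (vclass L (Suc l) \<nu>)"
  then obtain \<kappa> where k: "\<kappa> \<in> Sync L (Suc l)" "\<alpha> # \<kappa> \<in> Bstar L" "vclass L l \<mu> = vclass L l (\<alpha> # \<kappa>)" "vclass L (Suc l) \<nu> = vclass L (Suc l) \<kappa>"
    by (auto simp: Amin_def)
  have p: "past_eq L (l + length [\<alpha>]) \<kappa> \<nu>" using k assms past_eq_sym by (simp add: vclass_eq_iff)
  have "\<alpha> # \<nu> \<in> Bstar L" using past_eq_admissible[OF p, of "[\<alpha>]"] k(2) by simp
  moreover have "past_eq L l (\<alpha> # \<kappa>) (\<alpha> # \<nu>)" using past_eq_prepend[OF p] by simp
  moreover have "past_eq L l \<mu> (\<alpha> # \<kappa>)"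
    using k assms Sync_prepend[of \<kappa> L l "[\<alpha>]"] by (simp add: vclass_eq_iff)
  ultimately show "\<alpha> # \<nu> \<in> Bstar L \<and> past_eq L l \<mu> (\<alpha> # \<nu>)" using past_eq_trans by blast
next
  assume *: "\<alpha> # \<nu> \<in> Bstar L \<and> past_eq L l \<mu> (\<alpha> # \<nu>)"
  then have "vclass L l \<mu> = vclass L l (\<alpha> # \<nu>)"
    using assms Sync_prepend[of \<nu> L l "[\<alpha>]"] by (simp add: vclass_eq_iff)
  then show "Amin L l (vclass L l \<mu>) \<alpha> (vclass L (Suc l) \<nu>)" using assms * by (auto simp: Amin_def)
qed

text \<open>If every admissible word had a period at most \<open>N\<close>, every point would have
  period \<open>fact N\<close> and be determined by that many letters, so the shift would be
  finite.\<close>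

lemma aperiodic_word:
  assumes inf: "infinite (L :: (int \<Rightarrow> 's::finite) set)"
  obtains \<tau> where "\<tau> \<in> Bstar L" "\<And>d. 1 \<le> d \<Longrightarrow> d \<le> N \<Longrightarrow> \<exists>i. i + d < length \<tau> \<and> \<tau> ! i \<noteq> \<tau> ! (i + d)"
proof (rule ccontr)
  assume "\<not> thesis"
  then have per: "\<tau> \<in> Bstar L \<Longrightarrow> \<exists>d\<ge>1. d \<le> N \<and> (\<forall>i. i + d < length \<tau> \<longrightarrow> \<tau> ! i = \<tau> ! (i + d))" for \<tau>
    using that by blast
  \<comment> \<open>A common multiple of all the periods 1, ..., N.\<close>
  define m :: nat where "m = fact N"
  have m: "0 < m" by (simp add: m_def)
  have step: "x n = x (n + int m)" if "x \<in> L" for x n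
  proof -
    \<comment> \<open>One letter more than m, so that both x n and x (n + m) are visible in the
      window.\<close>
    let ?\<tau> = "map (\<lambda>i. x (n + int i)) [0..<m + 1]"
    have "?\<tau> \<in> Bstar L" by (rule window_Bstar[OF that])
    then obtain d where d: "1 \<le> d" "d \<le> N" "\<And>i. i + d < length ?\<tau> \<Longrightarrow> ?\<tau> ! i = ?\<tau> ! (i + d)"
      using per[of ?\<tau>] by blast
    then have "d dvd m" unfolding m_def by (intro dvd_fact) auto
    then obtain q where q: "m = d * q" by blast
    have "j \<le> q \<Longrightarrow> ?\<tau> ! 0 = ?\<tau> ! (d * j)" for j
    proof (induction j)
      case (Suc j)
      have "d * Suc j \<le> m" using Suc.prems unfolding q by (intro mult_le_mono) auto
      then have "d * j + d < length ?\<tau>" by simp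
      from d(3)[OF this] show ?case using Suc by (simp add: add.commute)
    qed simp
    from this[of q] have "?\<tau> ! 0 = ?\<tau> ! m" using q by simp
    moreover have "?\<tau> ! 0 = x n" "?\<tau> ! m = x (n + int m)" using m by (simp_all add: nth_append)
    ultimately show ?thesis by simp
  qed
  have "x n = x (n mod int m)" if "x \<in> L" for x n
  proof -
    have pos: "x k = x (k + int m * int j)" for k j
    proof (induction j)
      case (Suc j) then show ?case using step[OF that, of "k + int m * int j"] by (simp add: algebra_simps)
    qed simp
    show ?thesis
    proof (cases "0 \<le> n div int m")
      case True
      then show ?thesis using pos[of "n mod int m" "nat (n div int m)"] by simp
    next
      case False
      then have "n + int m * int (nat (- (n div int m))) = n mod int m"
        using mult_div_mod_eq[of "int m" n] by (simp add: algebra_simps)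
      then show ?thesis using pos[of n "nat (- (n div int m))"] by simp
    qed
  qed
  then have "x = (\<lambda>n. (map (\<lambda>i. x (int i)) [0..<m]) ! nat (n mod int m))" if "x \<in> L" for x
    using that m by (auto intro!: ext simp: nat_less_iff)
  then have "L \<subseteq> (\<lambda>w n. w ! nat (n mod int m)) ` {w. set w \<subseteq> UNIV \<and> length w = m}"
    by (intro subsetI) (rule image_eqI, assumption?, auto)
  then have "finite L" by (rule finite_subset) (intro finite_imageI finite_lists_length_eq, simp)
  then show False using inf by simp
qed

section \<open>Synchronizing and aperiodic continuations\<close>

locale lambda_sync_shift =
  fixes L :: "(int \<Rightarrow> 's::finite) set"
  assumes ls: "lambda_synchronizing L" and inf: "infinite L"
begin

lemma Nil_Bstar: "[] \<in> Bstar L"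
proof -
  obtain x where "x \<in> L" using inf infinite_imp_nonempty by blast
  then show ?thesis by (auto simp: Bstar_def occurs_in_def)
qed

lemma sync_extension:
  assumes "\<eta> \<in> Bstar L" obtains \<nu> where "\<nu> \<in> Sync L (length \<eta> + m)" "\<eta> @ \<nu> \<in> Sync L m"
proof -
  \<comment> \<open>The definition wants k strictly above the length, so the level is raised by one
    and lowered again afterwards.\<close>
  have "\<exists>\<nu>\<in>Sync L (length \<eta> + Suc m). \<eta> @ \<nu> \<in> Sync L (length \<eta> + Suc m - length \<eta>)"
    using ls assms unfolding lambda_synchronizing_def Bl_def by (metis (mono_tags, lifting) less_add_same_cancel1 mem_Collect_eq zero_less_Suc)
  then obtain \<nu> where "\<nu> \<in> Sync L (length \<eta> + Suc m)" "\<eta> @ \<nu> \<in> Sync L (Suc m)" by auto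
  then show thesis using that Sync_mono[of \<nu> L "length \<eta> + Suc m" "length \<eta> + m"] Sync_mono[of "\<eta> @ \<nu>" L "Suc m" m] by simp
qed

lemma irreducible: "\<mu> \<in> Bstar L \<Longrightarrow> \<nu> \<in> Bstar L \<Longrightarrow> \<exists>\<eta>. \<mu> @ \<eta> @ \<nu> \<in> Bstar L"
  using ls by (auto simp: lambda_synchronizing_def irreducible_shift_def)

text \<open>The word is \<xi> = \<mu> \<kappa> \<eta> \<tau>. Starting with \<mu> fixes the vertex,
  the aperiodic \<tau> at the end distinguishes the shifted tails, and the padding \<kappa> of
  length J keeps the first J shifts from cutting into \<tau>. Irreducibility supplies \<eta>, and
  \<lambda>-synchronization the continuation \<nu>.\<close>

lemma aperiodic_extension:
  assumes \<mu>: "\<mu> \<in> Sync L m"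
  obtains \<xi> \<nu> where "\<nu> \<in> Sync L (m + length \<xi>)" "\<xi> @ \<nu> \<in> Sync L m" "past_eq L m \<mu> (\<xi> @ \<nu>)" "J \<le> length \<xi>"
    "\<And>p q. p < q \<Longrightarrow> q \<le> J \<Longrightarrow> take (length \<xi> - q) (drop p \<xi>) \<noteq> drop q \<xi>"
proof -
  obtain \<tau> where \<tau>: "\<tau> \<in> Bstar L" "\<And>d. 1 \<le> d \<Longrightarrow> d \<le> J \<Longrightarrow> \<exists>i. i + d < length \<tau> \<and> \<tau> ! i \<noteq> \<tau> ! (i + d)"
    using aperiodic_word[OF inf] by blast
  obtain \<kappa> where \<kappa>: "length \<kappa> = J" "\<mu> @ \<kappa> \<in> Bstar L" using Bstar_extend_right[OF Sync_Bstar[OF \<mu>]] .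
  obtain \<eta> where \<eta>: "(\<mu> @ \<kappa>) @ \<eta> @ \<tau> \<in> Bstar L" using irreducible[OF \<kappa>(2) \<tau>(1)] by blast
  define \<xi> where "\<xi> = (\<mu> @ \<kappa>) @ \<eta> @ \<tau>"
  obtain \<nu> where \<nu>: "\<nu> \<in> Sync L (length \<xi> + m)" "\<xi> @ \<nu> \<in> Sync L m" using sync_extension \<eta> unfolding \<xi>_def by blast
  have "\<xi> @ \<nu> = \<mu> @ (\<kappa> @ \<eta> @ \<tau> @ \<nu>)" by (simp add: \<xi>_def)
  then have "past_eq L m \<mu> (\<xi> @ \<nu>)" using Sync_append(2)[OF \<mu>] Sync_Bstar[OF \<nu>(2)] by metis
  moreover have "take (length \<xi> - q) (drop p \<xi>) \<noteq> drop q \<xi>" if pq: "p < q" "q \<le> J" for p q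
  proof
    assume eq: "take (length \<xi> - q) (drop p \<xi>) = drop q \<xi>"
    have "1 \<le> q - p" "q - p \<le> J" using pq by auto
    from \<tau>(2)[OF this] obtain j where j: "j + (q - p) < length \<tau>" "\<tau> ! j \<noteq> \<tau> ! (j + (q - p))" by blast
    let ?a = "length ((\<mu> @ \<kappa>) @ \<eta>)"
    have a: "J \<le> ?a" "length \<xi> = ?a + length \<tau>" using \<kappa>(1) by (auto simp: \<xi>_def)
    have x: "\<xi> ! (?a + i) = \<tau> ! i" for i
      using nth_append_length_plus[of "(\<mu> @ \<kappa>) @ \<eta>" \<tau> i] by (simp add: \<xi>_def)
    \<comment> \<open>The tails are compared where the one shifted by p shows letter j of \<tau>;
      the one shifted by q then shows letter j + (q - p).\<close>
    define i where "i = ?a + j - p"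
    have i: "p + i = ?a + j" "q + i = ?a + (j + (q - p))" using pq a by (auto simp: i_def)
    then have lt: "q + i < length \<xi>" using a j by simp
    have "take (length \<xi> - q) (drop p \<xi>) ! i = \<xi> ! (p + i)" using lt pq by (subst nth_take) auto
    moreover have "drop q \<xi> ! i = \<xi> ! (q + i)" using lt by simp
    ultimately have "\<xi> ! (p + i) = \<xi> ! (q + i)" using eq by simp
    then show False using j(2) unfolding i x by simp
  qed
  ultimately show thesis using that[of \<nu> \<xi>] \<nu> \<kappa>(1) by (simp add: \<xi>_def add.commute)
qed

end

section \<open>Synchronizing points\<close>

context lambda_sync_shift begin

text \<open>All tails are included so that the set is closed under the shift; a prefix in
  \<open>Sync L l\<close> determines a vertex of level \<open>l\<close>.\<close>

definition sync_point :: "(nat \<Rightarrow> 's) \<Rightarrow> bool" where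
  "sync_point y \<longleftrightarrow> (\<forall>n. (\<forall>k. map y [n..<k] \<in> Bstar L) \<and> (\<forall>l. \<exists>k. map y [n..<k] \<in> Sync L l))"

text \<open>Which synchronizing prefix is chosen does not matter, by
  \<open>vertex_eq\<close>.\<close>

definition vertex :: "nat \<Rightarrow> (nat \<Rightarrow> 's) \<Rightarrow> 's list set" where
  "vertex l y = vclass L l (map y [0..<(SOME k. map y [0..<k] \<in> Sync L l)])"

lemma sync_pointD:
  assumes "sync_point y" shows "map y [n..<k] \<in> Bstar L" "\<exists>k. map y [n..<k] \<in> Sync L l"
  using assms by (auto simp: sync_point_def)

lemma sync_point_tail: "sync_point y \<Longrightarrow> sync_point (\<lambda>i. y (Suc i))"
proof -
  assume y: "sync_point y"
  have m: "map (\<lambda>i. y (Suc i)) [n..<k] = map y [Suc n..<Suc k]" for n k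
    by (simp add: map_Suc_upt[symmetric] del: upt_Suc)
  show "sync_point (\<lambda>i. y (Suc i))" unfolding sync_point_def
  proof (intro allI conjI)
    fix n k l
    show "map (\<lambda>i. y (Suc i)) [n..<k] \<in> Bstar L" unfolding m by (rule sync_pointD(1)[OF y])
    obtain k where k: "map y [Suc n..<k] \<in> Sync L l" using sync_pointD(2)[OF y] by blast
    show "\<exists>k. map (\<lambda>i. y (Suc i)) [n..<k] \<in> Sync L l"
    proof (cases k)
      case 0
      then have "map (\<lambda>i. y (Suc i)) [n..<0] \<in> Sync L l" using k by simp
      then show ?thesis by blast
    next
      case (Suc k')
      then have "map (\<lambda>i. y (Suc i)) [n..<k'] \<in> Sync L l" unfolding m using k by simp
      then show ?thesis by blast
    qed
  qed
qed

lemma map_case_nat: "map (case_nat \<alpha> y) [0..<Suc k] = \<alpha> # map y [0..<k]"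
  by (simp add: upt_conv_Cons map_Suc_upt[symmetric] comp_def del: upt_Suc)

lemma map_upt_split: "k \<le> k' \<Longrightarrow> map y [0..<k'] = map y [0..<k] @ map y [k..<k']"
  using upt_add_eq_append[of 0 k "k' - k"] by (simp flip: map_append)

lemma sync_prefix:
  assumes y: "sync_point y" and s: "map y [0..<k] \<in> Sync L l" and "k \<le> k'"
  shows "map y [0..<k'] \<in> Sync L l" "past_eq L l (map y [0..<k]) (map y [0..<k'])"
proof -
  have eq: "map y [0..<k'] = map y [0..<k] @ map y [k..<k']"
    by (rule map_upt_split[OF assms(3)])
  have "map y [0..<k] @ map y [k..<k'] \<in> Bstar L" using sync_pointD(1)[OF y] eq by metis
  from Sync_append[OF s this] show "map y [0..<k'] \<in> Sync L l" "past_eq L l (map y [0..<k]) (map y [0..<k'])"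
    unfolding eq by auto
qed

text \<open>All longer prefixes of \<open>y\<close> have the same pasts of length one as its
  synchronizing prefix, so a single admissibility check decides for the whole sequence.\<close>

lemma sync_point_cons:
  assumes y: "sync_point y" and s: "map y [0..<k] \<in> Sync L (Suc l)" and a: "\<alpha> # map y [0..<k] \<in> Bstar L"
  shows "sync_point (case_nat \<alpha> y)"
  unfolding sync_point_def
proof (intro allI)
  fix n
  let ?z = "case_nat \<alpha> y"
  have adm: "\<alpha> # map y [0..<k'] \<in> Bstar L" for k'
  proof (cases "k \<le> k'")
    case True
    have "[\<alpha>] @ map y [0..<k] \<in> Bstar L \<longleftrightarrow> [\<alpha>] @ map y [0..<k'] \<in> Bstar L"
      by (rule past_eq_admissible[OF sync_prefix(2)[OF y s True]]) simp
    then show ?thesis using a by simp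
  next
    case False
    have "map y [0..<k] = map y [0..<k'] @ map y [k'..<k]"
      using False by (intro map_upt_split) simp
    then show ?thesis using Bstar_append(1)[of "\<alpha> # map y [0..<k']" "map y [k'..<k]"] a by simp
  qed
  show "(\<forall>k. map ?z [n..<k] \<in> Bstar L) \<and> (\<forall>l. \<exists>k. map ?z [n..<k] \<in> Sync L l)"
  proof (cases n)
    case 0
    have "map ?z [0..<k'] \<in> Bstar L" for k'
      using adm Nil_Bstar by (cases k') (simp_all only: map_case_nat upt_0 upt.simps(1) list.map)
    moreover have "\<exists>k. map ?z [0..<k] \<in> Sync L l" for l
    proof -
      obtain k' where "map y [0..<k'] \<in> Sync L (l + length [\<alpha>])" using sync_pointD(2)[OF y] by blast
      then have "map ?z [0..<Suc k'] \<in> Sync L l" unfolding map_case_nat using Sync_prepend[of _ L l "[\<alpha>]"] adm by simp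
      then show ?thesis by blast
    qed
    ultimately show ?thesis using 0 by simp
  next
    case (Suc n')
    have m: "map ?z [Suc n'..<Suc k] = map y [n'..<k]" for k
      by (simp add: map_Suc_upt[symmetric] comp_def del: upt_Suc)
    have "map ?z [Suc n'..<k'] \<in> Bstar L" for k'
      using sync_pointD(1)[OF y] Nil_Bstar by (cases k') (simp_all only: m upt_0 upt.simps(1) list.map)
    moreover have "\<exists>k. map ?z [Suc n'..<k] \<in> Sync L l" for l
      using sync_pointD(2)[OF y, of n' l] m by metis
    ultimately show ?thesis using Suc by simp
  qed
qed

lemma vertex_eq:
  assumes y: "sync_point y" and s: "map y [0..<k] \<in> Sync L l"
  shows "vertex l y = vclass L l (map y [0..<k])"
proof -
  let ?k = "SOME k. map y [0..<k] \<in> Sync L l"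
  have k: "map y [0..<?k] \<in> Sync L l" using s by (rule someI)
  have "past_eq L l (map y [0..<?k]) (map y [0..<k])"
    using sync_prefix(2)[OF y k, of k] past_eq_sym[OF sync_prefix(2)[OF y s, of ?k]] by (cases "?k \<le> k") auto
  then show ?thesis unfolding vertex_def by (rule vclass_eqI)
qed

text \<open>The words \<open>W i\<close> grow by continuations that are synchronizing of level
  \<open>length (W i) + i\<close>. This absorbs any tail of \<open>W i\<close> placed in front, so
  every tail of the limit has synchronizing prefixes of every level.\<close>

lemma sync_point_exists: obtains y where "sync_point y"
proof -
  have "\<exists>\<nu>. \<nu> \<noteq> [] \<and> \<nu> \<in> Sync L (length w + i) \<and> w @ \<nu> \<in> Bstar L" if w: "w \<in> Bstar L" for w :: "'s list" and i :: nat
  proof -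
    obtain \<nu> where \<nu>: "\<nu> \<in> Sync L (length w + i)" "w @ \<nu> \<in> Sync L i" using sync_extension[OF w] .
    \<comment> \<open>One more letter makes the continuation nonempty, so that the lengths of the
      \<open>W i\<close> tend to infinity.\<close>
    obtain x where x: "length x = 1" "(w @ \<nu>) @ x \<in> Bstar L" using Bstar_extend_right[OF Sync_Bstar[OF \<nu>(2)]] .
    then have "\<nu> @ x \<in> Sync L (length w + i)" using Sync_append(1)[OF \<nu>(1)] Bstar_append(2)[of w "\<nu> @ x" L] by simp
    then show ?thesis using x by (intro exI[of _ "\<nu> @ x"]) auto
  qed
  then obtain f where f: "\<And>w i. w \<in> Bstar L \<Longrightarrow> f w i \<noteq> [] \<and> f w i \<in> Sync L (length w + i) \<and> w @ f w i \<in> Bstar L"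
    by metis
  define W where "W = rec_nat [] (\<lambda>i w. w @ f w i)"
  have W: "W 0 = []" "W (Suc i) = W i @ f (W i) i" for i by (simp_all add: W_def)
  have WB: "W i \<in> Bstar L" for i
    by (induction i) (use Nil_Bstar f W in auto)
  note f = f[OF WB]
  have len: "i \<le> length (W i)" for i
  proof (induction i)
    case (Suc i)
    have "0 < length (f (W i) i)" using f[of i i] by simp
    then show ?case using Suc unfolding W(2) length_append by linarith
  qed simp
  have pre: "\<exists>u. W (i + d) = W i @ u" for i d
    by (induction d) (auto simp: W)
  have nth: "W i ! n = W j ! n" if "n < length (W i)" "n < length (W j)" for i j n
  proof -
    have "W i ! n = W j ! n" if "i \<le> j" "n < length (W i)" for i j
      using pre[of i "j - i"] that by (auto simp: nth_append)
    then show ?thesis using that by (metis nat_le_linear)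
  qed
  define y where "y n = W (Suc n) ! n" for n
  have y: "y n = W i ! n" if "n < length (W i)" for i n
    unfolding y_def by (rule nth) (use that len[of "Suc n"] in linarith)+
  have map_y: "map y [n..<k] = take (k - n) (drop n (W i))" if k: "k \<le> length (W i)" for n k i
  proof (rule nth_equalityI)
    show "length (map y [n..<k]) = length (take (k - n) (drop n (W i)))" using k by simp
    fix j assume "j < length (map y [n..<k])"
    then have "j < k - n" "n + j < length (W i)" using k by auto
    then show "map y [n..<k] ! j = take (k - n) (drop n (W i)) ! j" using y[of "n + j" i] k by simp
  qed
  have "sync_point y" unfolding sync_point_def
  proof (intro allI conjI)
    fix n k l
    have "drop n (W k) \<in> Bstar L"
      by (rule Bstar_append(2)[of "take n (W k)"]) (use WB[of k] in \<open>simp only: append_take_drop_id\<close>)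
    then have "take (k - n) (drop n (W k)) @ drop (k - n) (drop n (W k)) \<in> Bstar L" by (simp only: append_take_drop_id)
    then have "take (k - n) (drop n (W k)) \<in> Bstar L" by (rule Bstar_append(1))
    then show "map y [n..<k] \<in> Bstar L" using map_y[OF len] by simp
    \<comment> \<open>At this stage \<open>W i\<close> has at least n letters and the level is at
      least l.\<close>
    define i where "i = max n l"
    let ?u = "drop n (W i)"
    have n: "n \<le> length (W i)" using len[of i] by (simp add: i_def)
    have eq: "map y [n..<length (W (Suc i))] = ?u @ f (W i) i"
      using map_y[of "length (W (Suc i))" "Suc i" n] n by (simp add: W)
    have "(take n (W i) @ ?u) @ f (W i) i \<in> Bstar L" using f[of i i] by (simp only: append_take_drop_id)
    then have "take n (W i) @ ?u @ f (W i) i \<in> Bstar L" by (simp only: append_assoc)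
    then have "?u @ f (W i) i \<in> Bstar L" by (rule Bstar_append(2))
    moreover have "f (W i) i \<in> Sync L (l + length ?u)"
      using f[of i i] by (auto intro: Sync_mono simp: i_def)
    ultimately have "map y [n..<length (W (Suc i))] \<in> Sync L l" unfolding eq by (rule Sync_prepend[rotated])
    then show "\<exists>k. map y [n..<k] \<in> Sync L l" by blast
  qed
  then show thesis by (rule that)
qed

text \<open>All sequences with a tail in common with one synchronizing point. Pairing them with a number only serves to
  make the index set infinite.\<close>
lemma orbit_system:
  obtains a :: "nat \<Rightarrow> 's" and \<sigma> :: "nat \<Rightarrow> nat" and V :: "nat \<Rightarrow> nat \<Rightarrow> 's list set"
  where "\<And>i j. a i = a j \<Longrightarrow> \<sigma> i = \<sigma> j \<Longrightarrow> i = j" "\<And>l i. V l i \<in> Vmin L l"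
    "\<And>l u i. u \<in> Vmin L l \<Longrightarrow> Imin L l u (V (Suc l) i) \<longleftrightarrow> u = V l i"
    "\<And>l u \<alpha> j. u \<in> Vmin L l \<Longrightarrow> Amin L l u \<alpha> (V (Suc l) j) \<longleftrightarrow> (\<exists>i. a i = \<alpha> \<and> \<sigma> i = j \<and> V l i = u)"
proof -
  obtain y0 where y0: "sync_point y0" by (rule sync_point_exists)
  define X where "X = {y. sync_point y \<and> (\<exists>p q. \<forall>n. y (n + p) = y0 (n + q))}"
  have sp: "sync_point y" if "y \<in> X" for y using that by (simp add: X_def)
  have tl: "(\<lambda>i. y (Suc i)) \<in> X" if yX: "y \<in> X" for y
  proof -
    obtain p q where "\<forall>n. y (n + p) = y0 (n + q)" using yX by (auto simp: X_def)
    then have "\<forall>n. y (Suc (n + p)) = y0 (n + Suc q)" by (metis add_Suc add_Suc_right)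
    then show ?thesis using sync_point_tail[OF sp[OF yX]] unfolding X_def by blast
  qed
  have cons: "case_nat \<alpha> y \<in> X" if yX: "y \<in> X" "sync_point (case_nat \<alpha> y)" for \<alpha> y
  proof -
    obtain p q where "\<forall>n. y (n + p) = y0 (n + q)" using yX by (auto simp: X_def)
    then have "\<forall>n. case_nat \<alpha> y (n + Suc p) = y0 (n + q)" by simp
    then show ?thesis using yX(2) unfolding X_def by blast
  qed
  have "y0 \<in> X" using y0 by (auto simp: X_def)
  \<comment> \<open>A point of \<open>X\<close> is a finite word followed by a tail of
    \<open>y0\<close>, hence there are only countably many.\<close>
  have "X \<subseteq> range (\<lambda>(u, q) i. if i < length u then u ! i else y0 (i - length u + q))"
  proof
    fix y assume "y \<in> X"
    then obtain p q where pq: "\<forall>n. y (n + p) = y0 (n + q)" by (auto simp: X_def)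
    have "y i = y0 (i + q - p)" if "p \<le> i" for i using pq[rule_format, of "i - p"] that by simp
    then have "y = (\<lambda>(u, q) i. if i < length u then u ! i else y0 (i - length u + q)) (map y [0..<p], q)"
      by (auto simp: not_less intro!: ext)
    then show "y \<in> range (\<lambda>(u, q) i. if i < length u then u ! i else y0 (i - length u + q))" by (rule range_eqI)
  qed
  then have "countable X" by (rule countable_subset) (rule countable_image, rule countableI_type)
  define P where "P = X \<times> (UNIV :: nat set)"
  have P: "countable P" "infinite P" "P \<noteq> {}"
    using \<open>countable X\<close> \<open>y0 \<in> X\<close> by (auto simp: P_def finite_cartesian_product_iff)
  define b where "b = from_nat_into P"
  define c where "c = to_nat_on P"
  have cb: "c (b i) = i" for i using P by (simp add: b_def c_def)
  have bc: "b (c t) = t" if "t \<in> P" for t using P that by (simp add: b_def c_def)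
  have bP: "fst (b i) \<in> X" for i using from_nat_into[OF P(3), of i] by (auto simp: b_def P_def)
  define a where "a i = fst (b i) 0" for i
  define \<sigma> where "\<sigma> i = c (\<lambda>n. fst (b i) (Suc n), snd (b i))" for i
  define V where "V l i = vertex l (fst (b i))" for l i
  have b\<sigma>: "b (\<sigma> i) = (\<lambda>n. fst (b i) (Suc n), snd (b i))" for i
    unfolding \<sigma>_def by (rule bc) (use tl[OF bP] in \<open>simp add: P_def\<close>)
  have Veq: "V l i = vclass L l (map (fst (b i)) [0..<k])" if "map (fst (b i)) [0..<k] \<in> Sync L l" for l i k
    unfolding V_def by (rule vertex_eq[OF sp[OF bP] that])
  have ex: "\<exists>k. map (fst (b i)) [0..<k] \<in> Sync L l" for i l by (rule sync_pointD(2)[OF sp[OF bP]])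
  show thesis
  proof
    fix i j assume *: "a i = a j" "\<sigma> i = \<sigma> j"
    then have e: "(\<lambda>n. fst (b i) (Suc n)) = (\<lambda>n. fst (b j) (Suc n))" "snd (b i) = snd (b j)"
      using b\<sigma>[of i] b\<sigma>[of j] by auto
    have "fst (b i) n = fst (b j) n" for n
      using *(1) fun_cong[OF e(1), of "n - 1"] by (cases n) (auto simp: a_def)
    then have "b i = b j" using e(2) by (simp add: prod_eq_iff fun_eq_iff)
    then show "i = j" using cb by metis
  next
    fix l i show "V l i \<in> Vmin L l" using ex[of i l] Veq by auto
  next
    fix l u i assume "u \<in> Vmin L l"
    then obtain \<mu> where \<mu>: "\<mu> \<in> Sync L l" "u = vclass L l \<mu>" by (auto simp: Vmin_def)
    obtain k where k: "map (fst (b i)) [0..<k] \<in> Sync L (Suc l)" using ex by blast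
    have k': "map (fst (b i)) [0..<k] \<in> Sync L l" by (rule Sync_mono[OF k]) simp
    show "Imin L l u (V (Suc l) i) \<longleftrightarrow> u = V l i"
      unfolding Veq[OF k] Veq[OF k'] \<mu>(2) Imin_iff[OF \<mu>(1) k] vclass_eq_iff[OF \<mu>(1) k'] by (rule refl)
  next
    fix l u \<alpha> j assume "u \<in> Vmin L l"
    then obtain \<mu> where \<mu>: "\<mu> \<in> Sync L l" "u = vclass L l \<mu>" by (auto simp: Vmin_def)
    let ?y = "fst (b j)"
    obtain k where k: "map ?y [0..<k] \<in> Sync L (Suc l)" using ex by blast
    have sync: "\<alpha> # map ?y [0..<k] \<in> Sync L l" if "\<alpha> # map ?y [0..<k] \<in> Bstar L"
      using Sync_prepend[of "map ?y [0..<k]" L l "[\<alpha>]"] k that by simp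
    show "Amin L l u \<alpha> (V (Suc l) j) \<longleftrightarrow> (\<exists>i. a i = \<alpha> \<and> \<sigma> i = j \<and> V l i = u)"
      unfolding Veq[OF k] \<mu>(2) Amin_iff[OF \<mu>(1) k]
    proof (intro iffI conjI)
      assume *: "\<alpha> # map ?y [0..<k] \<in> Bstar L \<and> past_eq L l \<mu> (\<alpha> # map ?y [0..<k])"
      then have X: "case_nat \<alpha> ?y \<in> X" by (intro cons[OF bP] sync_point_cons[OF sp[OF bP] k]) blast
      define i where "i = c (case_nat \<alpha> ?y, snd (b j))"
      have bi: "b i = (case_nat \<alpha> ?y, snd (b j))" unfolding i_def by (rule bc) (use X in \<open>simp add: P_def\<close>)
      have "\<sigma> i = j" unfolding \<sigma>_def bi using cb[of j] by simp
      moreover have "a i = \<alpha>" by (simp add: a_def bi)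
      moreover have "map (fst (b i)) [0..<Suc k] = \<alpha> # map ?y [0..<k]" unfolding bi fst_conv by (rule map_case_nat)
      then have "V l i = vclass L l \<mu>"
        using Veq[of i "Suc k" l] sync * vclass_eqI[of L l \<mu> "\<alpha> # map ?y [0..<k]"] by simp
      ultimately show "\<exists>i. a i = \<alpha> \<and> \<sigma> i = j \<and> V l i = vclass L l \<mu>" by blast
    next
      assume "\<exists>i. a i = \<alpha> \<and> \<sigma> i = j \<and> V l i = vclass L l \<mu>"
      then obtain i where i: "a i = \<alpha>" "\<sigma> i = j" "V l i = vclass L l \<mu>" by blast
      have "?y = (\<lambda>n. fst (b i) (Suc n))" using b\<sigma>[of i] i(2) by simp
      then have "fst (b i) n = case_nat \<alpha> ?y n" for n using i(1) by (cases n) (auto simp: a_def)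
      then have "fst (b i) = case_nat \<alpha> ?y" by blast
      then have m: "map (fst (b i)) [0..<Suc k] = \<alpha> # map ?y [0..<k]" by (simp only: map_case_nat)
      then show B: "\<alpha> # map ?y [0..<k] \<in> Bstar L" using sync_pointD(1)[OF sp[OF bP[of i]], of 0 "Suc k"] by simp
      have "vclass L l \<mu> = vclass L l (\<alpha> # map ?y [0..<k])" using Veq[of i "Suc k" l] sync[OF B] i(3) unfolding m by simp
      then show "past_eq L l \<mu> (\<alpha> # map ?y [0..<k])" using vclass_eq_iff[OF \<mu>(1) sync[OF B]] by simp
    qed
  qed
qed

end

section \<open>The graded algebra of words\<close>

context cstar_alg begin

lemma finsum_single:
  assumes "finite F" "k \<in> F" "f k \<in> carrier A" "\<And>i. i \<in> F \<Longrightarrow> i \<noteq> k \<Longrightarrow> f i = \<zero>"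
  shows "finsum A f F = f k"
proof -
  have f: "f \<in> F \<rightarrow> carrier A" using assms by (metis Pi_I zero_closed)
  have "finsum A f F = finsum A (\<lambda>i. if k = i then f i else \<zero>) F"
    by (rule finsum_cong') (use assms f in auto)
  also have "\<dots> = f k" by (rule finsum_singleton[OF assms(2,1) f])
  finally show ?thesis .
qed

lemma finsum_all_zero: "(\<And>i. i \<in> F \<Longrightarrow> f i = \<zero>) \<Longrightarrow> finsum A f F = \<zero>"
  by (subst finsum_cong'[of F F "\<lambda>_. \<zero>"]) (auto simp: finsum_zero)

lemma mult_finsum_left:
  "finite F \<Longrightarrow> x \<in> carrier A \<Longrightarrow> (\<And>i. i \<in> F \<Longrightarrow> f i \<in> carrier A) \<Longrightarrow> x \<otimes> finsum A f F = finsum A (\<lambda>i. x \<otimes> f i) F"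
  by (rule finsum_rdistr) auto

lemma mult_finsum_right:
  "finite F \<Longrightarrow> x \<in> carrier A \<Longrightarrow> (\<And>i. i \<in> F \<Longrightarrow> f i \<in> carrier A) \<Longrightarrow> finsum A f F \<otimes> x = finsum A (\<lambda>i. f i \<otimes> x) F"
  by (rule finsum_ldistr) auto

end

locale min_cstar = universal_cstar A L S E + lambda_sync_shift L
  for A :: "('a, 'm) cstar_scheme" (structure) and L :: "(int \<Rightarrow> 's::finite) set"
    and S :: "'s \<Rightarrow> 'a" and E :: "nat \<Rightarrow> 's list set \<Rightarrow> 'a"
begin

definition e :: "nat \<Rightarrow> 's list \<Rightarrow> 'a" where
  "e l \<nu> = E l (vclass L l \<nu>)"

primrec Sw :: "'s list \<Rightarrow> 'a" where
  "Sw [] = \<one>"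
| "Sw (\<alpha> # \<mu>) = S \<alpha> \<otimes> Sw \<mu>"

lemma Vmin_cases: assumes "v \<in> Vmin L l" obtains \<nu> where "\<nu> \<in> Sync L l" "v = vclass L l \<nu>" "E l v = e l \<nu>"
  using assms by (auto simp: Vmin_def e_def)

lemma e_proj: "\<nu> \<in> Sync L l \<Longrightarrow> is_projection A (e l \<nu>)"
  unfolding e_def by (rule rels(2)) auto

lemma e_closed [simp, intro]: "\<nu> \<in> Sync L l \<Longrightarrow> e l \<nu> \<in> carrier A"
  and e_idem [simp]: "\<nu> \<in> Sync L l \<Longrightarrow> e l \<nu> \<otimes> e l \<nu> = e l \<nu>"
  and e_adj [simp]: "\<nu> \<in> Sync L l \<Longrightarrow> (e l \<nu>)\<dagger> = e l \<nu>"
  using projD[OF e_proj] by auto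

lemma e_cong: "past_eq L l \<nu> \<nu>' \<Longrightarrow> e l \<nu> = e l \<nu>'"
  by (simp add: e_def vclass_eqI)

lemma E_orth: "v \<in> Vmin L l \<Longrightarrow> w \<in> Vmin L l \<Longrightarrow> v \<noteq> w \<Longrightarrow> E l v \<otimes> E l w = \<zero>"
  by (rule orthogonal_if_sum_one[OF finite_Vmin rels(2) rels(4)])

lemma e_orth:
  assumes "\<nu> \<in> Sync L l" "\<nu>' \<in> Sync L l"
  shows "e l \<nu> \<otimes> e l \<nu>' = (if past_eq L l \<nu> \<nu>' then e l \<nu>' else \<zero>)"
proof (cases "past_eq L l \<nu> \<nu>'")
  case True
  then show ?thesis using assms e_cong[OF True] by simp
next
  case False
  then show ?thesis using E_orth[of "vclass L l \<nu>" l "vclass L l \<nu>'"] assms by (simp add: e_def vclass_eq_iff)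
qed

text \<open>\<open>e l \<nu>\<close> is the sum of the projections of level l + 1 above it, and the
  given one either occurs in this sum or is orthogonal to all its terms.\<close>

lemma e_refine_step:
  assumes "\<nu> \<in> Sync L l" "\<nu>' \<in> Sync L (Suc l)"
  shows "e l \<nu> \<otimes> e (Suc l) \<nu>' = (if past_eq L l \<nu> \<nu>' then e (Suc l) \<nu>' else \<zero>)"
proof -
  let ?W = "{w \<in> Vmin L (Suc l). Imin L l (vclass L l \<nu>) w}" and ?v = "vclass L (Suc l) \<nu>'"
  have "e l \<nu> = finsum A (E (Suc l)) ?W" unfolding e_def by (rule rels(6)) (use assms in auto)
  then have "e l \<nu> \<otimes> e (Suc l) \<nu>' = finsum A (E (Suc l)) ?W \<otimes> e (Suc l) \<nu>'" by simp
  also have "\<dots> = finsum A (\<lambda>w. E (Suc l) w \<otimes> e (Suc l) \<nu>') ?W"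
    by (rule mult_finsum_right) (use assms in auto)
  finally have *: "e l \<nu> \<otimes> e (Suc l) \<nu>' = finsum A (\<lambda>w. E (Suc l) w \<otimes> e (Suc l) \<nu>') ?W" .
  have z: "E (Suc l) w \<otimes> e (Suc l) \<nu>' = \<zero>" if "w \<in> ?W" "w \<noteq> ?v" for w
    using that assms E_orth[of w "Suc l" ?v] by (simp add: e_def)
  show ?thesis
  proof (cases "past_eq L l \<nu> \<nu>'")
    case True
    then have v: "?v \<in> ?W" using assms by (simp add: Imin_iff)
    have "finsum A (\<lambda>w. E (Suc l) w \<otimes> e (Suc l) \<nu>') ?W = E (Suc l) ?v \<otimes> e (Suc l) \<nu>'"
      by (rule finsum_single) (use v z assms in auto)
    then show ?thesis using * True assms by (simp add: e_def[symmetric])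
  next
    case False
    then have "?v \<notin> ?W" using assms by (simp add: Imin_iff)
    then have "finsum A (\<lambda>w. E (Suc l) w \<otimes> e (Suc l) \<nu>') ?W = \<zero>"
      using z by (intro finsum_all_zero) blast
    then show ?thesis using * False by simp
  qed
qed

lemma e_refine:
  assumes "\<nu> \<in> Sync L l" "\<nu>' \<in> Sync L (l + n)"
  shows "e l \<nu> \<otimes> e (l + n) \<nu>' = (if past_eq L l \<nu> \<nu>' then e (l + n) \<nu>' else \<zero>)"
  using assms(2)
proof (induction n)
  case 0 then show ?case using e_orth assms(1) by simp
next
  case (Suc n)
  have s: "\<nu>' \<in> Sync L (l + n)" using Sync_mono[OF Suc.prems] by simp
  have "e (l + n) \<nu>' \<otimes> e (Suc (l + n)) \<nu>' = e (Suc (l + n)) \<nu>'"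
    using e_refine_step[OF s] Suc.prems by simp
  then have "e l \<nu> \<otimes> e (Suc (l + n)) \<nu>' = (e l \<nu> \<otimes> e (l + n) \<nu>') \<otimes> e (Suc (l + n)) \<nu>'"
    using assms(1) s Suc.prems by (simp add: m_assoc)
  also have "\<dots> = (if past_eq L l \<nu> \<nu>' then e (Suc (l + n)) \<nu>' else \<zero>)"
    using Suc.IH[OF s] \<open>e (l + n) \<nu>' \<otimes> e (Suc (l + n)) \<nu>' = e (Suc (l + n)) \<nu>'\<close> Suc.prems by simp
  finally show ?case by simp
qed

lemma S_e_step:
  assumes "\<mu> \<in> Sync L l" "\<nu> \<in> Sync L (Suc l)"
  shows "(S \<alpha>)\<dagger> \<otimes> e l \<mu> \<otimes> S \<alpha> \<otimes> e (Suc l) \<nu> =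
    (if \<alpha> # \<nu> \<in> Bstar L \<and> past_eq L l \<mu> (\<alpha> # \<nu>) then e (Suc l) \<nu> else \<zero>)"
proof -
  let ?W = "{w \<in> Vmin L (Suc l). Amin L l (vclass L l \<mu>) \<alpha> w}" and ?v = "vclass L (Suc l) \<nu>"
  have "(S \<alpha>)\<dagger> \<otimes> e l \<mu> \<otimes> S \<alpha> = finsum A (E (Suc l)) ?W" unfolding e_def by (rule rels(7)) (use assms in auto)
  then have "(S \<alpha>)\<dagger> \<otimes> e l \<mu> \<otimes> S \<alpha> \<otimes> e (Suc l) \<nu> = finsum A (E (Suc l)) ?W \<otimes> e (Suc l) \<nu>" by simp
  also have "\<dots> = finsum A (\<lambda>w. E (Suc l) w \<otimes> e (Suc l) \<nu>) ?W"
    by (rule mult_finsum_right) (use assms in auto)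
  finally have *: "(S \<alpha>)\<dagger> \<otimes> e l \<mu> \<otimes> S \<alpha> \<otimes> e (Suc l) \<nu> = finsum A (\<lambda>w. E (Suc l) w \<otimes> e (Suc l) \<nu>) ?W" .
  have z: "E (Suc l) w \<otimes> e (Suc l) \<nu> = \<zero>" if "w \<in> ?W" "w \<noteq> ?v" for w
    using that assms E_orth[of w "Suc l" ?v] by (simp add: e_def)
  show ?thesis
  proof (cases "\<alpha> # \<nu> \<in> Bstar L \<and> past_eq L l \<mu> (\<alpha> # \<nu>)")
    case True
    then have v: "?v \<in> ?W" using assms by (simp add: Amin_iff)
    have "finsum A (\<lambda>w. E (Suc l) w \<otimes> e (Suc l) \<nu>) ?W = E (Suc l) ?v \<otimes> e (Suc l) \<nu>"
      by (rule finsum_single) (use v z assms in auto)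
    then show ?thesis using * True assms by (simp add: e_def[symmetric])
  next
    case False
    then have "?v \<notin> ?W" using assms by (simp add: Amin_iff)
    then have "finsum A (\<lambda>w. E (Suc l) w \<otimes> e (Suc l) \<nu>) ?W = \<zero>"
      using z by (intro finsum_all_zero) blast
    then show ?thesis using * False by auto
  qed
qed

lemma one_sum_E: "x \<in> carrier A \<Longrightarrow> finsum A (\<lambda>v. E l v \<otimes> x) (Vmin L l) = x"
  using mult_finsum_right[of "Vmin L l" x "E l"] rels(4) by simp

lemma one_sum_E': "x \<in> carrier A \<Longrightarrow> finsum A (\<lambda>v. x \<otimes> E l v) (Vmin L l) = x"
  using mult_finsum_left[of "Vmin L l" x "E l"] rels(4) by simp

text \<open>Multiplied by its adjoint from the left, the element contains the expression computed in
  \<open>S_e_step\<close>.\<close>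

lemma e_S_e_zero:
  assumes "\<mu> \<in> Sync L l" "\<nu> \<in> Sync L (Suc l)" "\<not> (\<alpha> # \<nu> \<in> Bstar L \<and> past_eq L l \<mu> (\<alpha> # \<nu>))"
  shows "e l \<mu> \<otimes> (S \<alpha> \<otimes> e (Suc l) \<nu>) = \<zero>"
proof (rule adj_mult_eq_0)
  have "(e l \<mu> \<otimes> (S \<alpha> \<otimes> e (Suc l) \<nu>))\<dagger> \<otimes> (e l \<mu> \<otimes> (S \<alpha> \<otimes> e (Suc l) \<nu>)) =
      e (Suc l) \<nu> \<otimes> ((S \<alpha>)\<dagger> \<otimes> (e l \<mu> \<otimes> e l \<mu>) \<otimes> S \<alpha> \<otimes> e (Suc l) \<nu>)"
    using assms(1,2) by (simp add: m_assoc del: e_idem)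
  also have "\<dots> = \<zero>" using S_e_step[OF assms(1,2), of \<alpha>] assms by (simp add: m_assoc)
  finally show "(e l \<mu> \<otimes> (S \<alpha> \<otimes> e (Suc l) \<nu>))\<dagger> \<otimes> (e l \<mu> \<otimes> (S \<alpha> \<otimes> e (Suc l) \<nu>)) = \<zero>" .
qed (use assms in simp)

text \<open>Insert the sum of all \<open>E l v\<close>, which is one, in front: by
  \<open>e_S_e_zero\<close> only the vertex of \<alpha> \<nu> survives, and none at all if that word
  is not admissible.\<close>

lemma S_e:
  assumes "\<nu> \<in> Sync L (Suc l)"
  shows "\<alpha> # \<nu> \<in> Bstar L \<Longrightarrow> e l (\<alpha> # \<nu>) \<otimes> (S \<alpha> \<otimes> e (Suc l) \<nu>) = S \<alpha> \<otimes> e (Suc l) \<nu>"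
    and "\<alpha> # \<nu> \<notin> Bstar L \<Longrightarrow> S \<alpha> \<otimes> e (Suc l) \<nu> = \<zero>"
    and "(S \<alpha>)\<dagger> \<otimes> (S \<alpha> \<otimes> e (Suc l) \<nu>) = (if \<alpha> # \<nu> \<in> Bstar L then e (Suc l) \<nu> else \<zero>)"
proof -
  have x: "S \<alpha> \<otimes> e (Suc l) \<nu> \<in> carrier A" using assms by simp
  have z: "E l v \<otimes> (S \<alpha> \<otimes> e (Suc l) \<nu>) = \<zero>"
    if v: "v \<in> Vmin L l" "\<not> (\<alpha> # \<nu> \<in> Bstar L \<and> v = vclass L l (\<alpha> # \<nu>))" for v
  proof -
    obtain \<mu> where \<mu>: "\<mu> \<in> Sync L l" "v = vclass L l \<mu>" "E l v = e l \<mu>" using Vmin_cases[OF v(1)] .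
    then have "\<not> (\<alpha> # \<nu> \<in> Bstar L \<and> past_eq L l \<mu> (\<alpha> # \<nu>))" using v(2) vclass_eqI by blast
    then show ?thesis using e_S_e_zero[OF \<mu>(1) assms] \<mu>(3) by simp
  qed
  show 1: "e l (\<alpha> # \<nu>) \<otimes> (S \<alpha> \<otimes> e (Suc l) \<nu>) = S \<alpha> \<otimes> e (Suc l) \<nu>" if b: "\<alpha> # \<nu> \<in> Bstar L"
  proof -
    have s: "\<alpha> # \<nu> \<in> Sync L l" using Sync_prepend[of \<nu> L l "[\<alpha>]"] assms b by simp
    have "finsum A (\<lambda>v. E l v \<otimes> (S \<alpha> \<otimes> e (Suc l) \<nu>)) (Vmin L l) = E l (vclass L l (\<alpha> # \<nu>)) \<otimes> (S \<alpha> \<otimes> e (Suc l) \<nu>)"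
      by (rule finsum_single) (use s x z in auto)
    then show ?thesis using one_sum_E[OF x] by (simp add: e_def)
  qed
  show 2: "S \<alpha> \<otimes> e (Suc l) \<nu> = \<zero>" if b: "\<alpha> # \<nu> \<notin> Bstar L"
  proof -
    have "finsum A (\<lambda>v. E l v \<otimes> (S \<alpha> \<otimes> e (Suc l) \<nu>)) (Vmin L l) = \<zero>"
      using z b by (intro finsum_all_zero) blast
    then show ?thesis using one_sum_E[OF x] by simp
  qed
  show "(S \<alpha>)\<dagger> \<otimes> (S \<alpha> \<otimes> e (Suc l) \<nu>) = (if \<alpha> # \<nu> \<in> Bstar L then e (Suc l) \<nu> else \<zero>)"
  proof (cases "\<alpha> # \<nu> \<in> Bstar L")
    case True
    have s: "\<alpha> # \<nu> \<in> Sync L l" using Sync_prepend[of \<nu> L l "[\<alpha>]"] assms True by simp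
    have "(S \<alpha>)\<dagger> \<otimes> (S \<alpha> \<otimes> e (Suc l) \<nu>) = (S \<alpha>)\<dagger> \<otimes> (e l (\<alpha> # \<nu>) \<otimes> (S \<alpha> \<otimes> e (Suc l) \<nu>))"
      by (simp add: 1[OF True])
    also have "\<dots> = (S \<alpha>)\<dagger> \<otimes> e l (\<alpha> # \<nu>) \<otimes> S \<alpha> \<otimes> e (Suc l) \<nu>" using s assms by (simp add: m_assoc)
    also have "\<dots> = e (Suc l) \<nu>" using S_e_step[OF s assms, of \<alpha>] True by simp
    finally show ?thesis using True by simp
  next
    case False
    then show ?thesis using 2[OF False] by simp
  qed
qed

lemma S_proj: "is_projection A (S \<alpha> \<otimes> (S \<alpha>)\<dagger>)" and S_SS: "S \<alpha> \<otimes> ((S \<alpha>)\<dagger> \<otimes> S \<alpha>) = S \<alpha>"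
  using range_projection[of "S \<alpha>"] rels(1)[of \<alpha>] by (auto simp: is_partial_isometry_def)

text \<open>The range projections add up to one, so \<open>orthogonal_if_sum_one\<close> makes them
  orthogonal.\<close>

lemma S_orth: assumes "\<alpha> \<noteq> \<beta>" shows "(S \<alpha>)\<dagger> \<otimes> S \<beta> = \<zero>"
proof -
  have o: "(S \<alpha> \<otimes> (S \<alpha>)\<dagger>) \<otimes> (S \<beta> \<otimes> (S \<beta>)\<dagger>) = \<zero>"
    by (rule orthogonal_if_sum_one[of UNIV "\<lambda>\<beta>. S \<beta> \<otimes> (S \<beta>)\<dagger>"]) (use S_proj rels(3) assms in auto)
  have a: "(S \<alpha>)\<dagger> \<otimes> (S \<alpha> \<otimes> (S \<alpha>)\<dagger>) = (S \<alpha>)\<dagger>"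
  proof -
    have "(S \<alpha> \<otimes> ((S \<alpha>)\<dagger> \<otimes> S \<alpha>))\<dagger> = (S \<alpha>)\<dagger>" using S_SS by simp
    then show ?thesis by (simp add: m_assoc)
  qed
  have b: "(S \<beta> \<otimes> (S \<beta>)\<dagger>) \<otimes> S \<beta> = S \<beta>" using S_SS[of \<beta>] by (simp add: m_assoc)
  have "(S \<alpha>)\<dagger> \<otimes> S \<beta> = ((S \<alpha>)\<dagger> \<otimes> (S \<alpha> \<otimes> (S \<alpha>)\<dagger>)) \<otimes> ((S \<beta> \<otimes> (S \<beta>)\<dagger>) \<otimes> S \<beta>)" by (simp only: a b)
  also have "\<dots> = (S \<alpha>)\<dagger> \<otimes> ((S \<alpha> \<otimes> (S \<alpha>)\<dagger>) \<otimes> (S \<beta> \<otimes> (S \<beta>)\<dagger>)) \<otimes> S \<beta>"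
    by (simp add: m_assoc)
  also have "\<dots> = \<zero>" unfolding o by simp
  finally show ?thesis .
qed

text \<open>Because \<open>E l v\<close> commutes with the range projection of
  \<open>S \<alpha>\<close>, it can be moved past \<open>S \<alpha>\<close>, turning into a sum of
  projections one level higher.\<close>

lemma E_S: assumes "v \<in> Vmin L l"
  shows "E l v \<otimes> S \<alpha> = S \<alpha> \<otimes> finsum A (E (Suc l)) {w \<in> Vmin L (Suc l). Amin L l v \<alpha> w}"
proof -
  have "S \<alpha> \<otimes> finsum A (E (Suc l)) {w \<in> Vmin L (Suc l). Amin L l v \<alpha> w} = S \<alpha> \<otimes> ((S \<alpha>)\<dagger> \<otimes> E l v \<otimes> S \<alpha>)"
    by (simp add: rels(7)[OF assms])
  also have "\<dots> = (S \<alpha> \<otimes> (S \<alpha>)\<dagger> \<otimes> E l v) \<otimes> S \<alpha>" using assms by (simp add: m_assoc)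
  also have "\<dots> = E l v \<otimes> (S \<alpha> \<otimes> (S \<alpha>)\<dagger>) \<otimes> S \<alpha>" unfolding rels(5)[OF assms] ..
  also have "\<dots> = E l v \<otimes> S \<alpha>" using assms S_SS by (simp add: m_assoc)
  finally show ?thesis by simp
qed

subsection \<open>Words\<close>

lemma Sw_closed [simp, intro]: "Sw \<mu> \<in> carrier A"
  by (induction \<mu>) auto

lemma Sw_append: "Sw (\<mu> @ \<nu>) = Sw \<mu> \<otimes> Sw \<nu>"
  by (induction \<mu>) (auto simp: m_assoc)

text \<open>Each letter lowers the level by one, whence the level \<open>l + length \<mu>\<close> on
  the right. The three claims share one induction because the third needs the range vertex from the
  first.\<close>

lemma Sw_e:
  assumes "\<nu> \<in> Sync L (l + length \<mu>)"
  shows "\<mu> @ \<nu> \<in> Bstar L \<Longrightarrow> e l (\<mu> @ \<nu>) \<otimes> (Sw \<mu> \<otimes> e (l + length \<mu>) \<nu>) = Sw \<mu> \<otimes> e (l + length \<mu>) \<nu>"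
    and "\<mu> @ \<nu> \<notin> Bstar L \<Longrightarrow> Sw \<mu> \<otimes> e (l + length \<mu>) \<nu> = \<zero>"
    and "(Sw \<mu>)\<dagger> \<otimes> (Sw \<mu> \<otimes> e (l + length \<mu>) \<nu>) = (if \<mu> @ \<nu> \<in> Bstar L then e (l + length \<mu>) \<nu> else \<zero>)"
proof -
  have "(\<mu> @ \<nu> \<in> Bstar L \<longrightarrow> e l (\<mu> @ \<nu>) \<otimes> (Sw \<mu> \<otimes> e (l + length \<mu>) \<nu>) = Sw \<mu> \<otimes> e (l + length \<mu>) \<nu>) \<and>
    (\<mu> @ \<nu> \<notin> Bstar L \<longrightarrow> Sw \<mu> \<otimes> e (l + length \<mu>) \<nu> = \<zero>) \<and>
    (Sw \<mu>)\<dagger> \<otimes> (Sw \<mu> \<otimes> e (l + length \<mu>) \<nu>) = (if \<mu> @ \<nu> \<in> Bstar L then e (l + length \<mu>) \<nu> else \<zero>)"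
    using assms
  proof (induction \<mu> arbitrary: l)
    case Nil
    then show ?case using Sync_Bstar[of \<nu> L l] by simp
  next
    case (Cons \<alpha> \<mu>)
    let ?m = "l + length (\<alpha> # \<mu>)"
    have m: "?m = Suc l + length \<mu>" by simp
    have \<nu>: "\<nu> \<in> Sync L (Suc l + length \<mu>)" "e ?m \<nu> \<in> carrier A" using Cons.prems by auto
    note IH = Cons.IH[OF \<nu>(1)]
    let ?x = "Sw \<mu> \<otimes> e ?m \<nu>"
    have x: "?x \<in> carrier A" using \<nu> by simp
    show ?case
    proof (cases "\<mu> @ \<nu> \<in> Bstar L")
      case False
      then have "\<alpha> # \<mu> @ \<nu> \<notin> Bstar L" using Bstar_append(2)[of "[\<alpha>]" "\<mu> @ \<nu>" L] by auto
      moreover have "Sw (\<alpha> # \<mu>) \<otimes> e ?m \<nu> = \<zero>" using IH False \<nu> unfolding m by (simp add: m_assoc)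
      ultimately show ?thesis by simp
    next
      case True
      have s: "\<mu> @ \<nu> \<in> Sync L (Suc l)" using Sync_prepend[OF \<nu>(1) True] .
      have ex: "e (Suc l) (\<mu> @ \<nu>) \<otimes> ?x = ?x" using IH True unfolding m by simp
      have Sx: "Sw (\<alpha> # \<mu>) \<otimes> e ?m \<nu> = (S \<alpha> \<otimes> e (Suc l) (\<mu> @ \<nu>)) \<otimes> ?x"
        using \<nu>(2) x s ex by (simp add: m_assoc)
      have 3: "(Sw (\<alpha> # \<mu>))\<dagger> \<otimes> (Sw (\<alpha> # \<mu>) \<otimes> e ?m \<nu>) = (Sw \<mu>)\<dagger> \<otimes> (((S \<alpha>)\<dagger> \<otimes> (S \<alpha> \<otimes> e (Suc l) (\<mu> @ \<nu>))) \<otimes> ?x)"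
        unfolding Sx using x s by (simp add: m_assoc)
      show ?thesis
      proof (cases "\<alpha> # \<mu> @ \<nu> \<in> Bstar L")
        case b: True
        have sb: "\<alpha> # \<mu> @ \<nu> \<in> Sync L l" using Sync_prepend[of "\<mu> @ \<nu>" L l "[\<alpha>]"] s b by simp
        have "e l (\<alpha> # \<mu> @ \<nu>) \<otimes> ((S \<alpha> \<otimes> e (Suc l) (\<mu> @ \<nu>)) \<otimes> ?x) = (S \<alpha> \<otimes> e (Suc l) (\<mu> @ \<nu>)) \<otimes> ?x"
          using S_e(1)[OF s b] sb s x by (metis S_closed e_closed m_assoc m_closed)
        moreover have "(Sw (\<alpha> # \<mu>))\<dagger> \<otimes> (Sw (\<alpha> # \<mu>) \<otimes> e ?m \<nu>) = (Sw \<mu>)\<dagger> \<otimes> ?x"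
          unfolding 3 S_e(3)[OF s] using b ex by simp
        ultimately show ?thesis using b Sx IH True unfolding m by simp
      next
        case b: False
        then show ?thesis using Sx 3 S_e(2)[OF s, of \<alpha>] x by simp
      qed
    qed
  qed
  then show "\<mu> @ \<nu> \<in> Bstar L \<Longrightarrow> e l (\<mu> @ \<nu>) \<otimes> (Sw \<mu> \<otimes> e (l + length \<mu>) \<nu>) = Sw \<mu> \<otimes> e (l + length \<mu>) \<nu>"
    and "\<mu> @ \<nu> \<notin> Bstar L \<Longrightarrow> Sw \<mu> \<otimes> e (l + length \<mu>) \<nu> = \<zero>"
    and "(Sw \<mu>)\<dagger> \<otimes> (Sw \<mu> \<otimes> e (l + length \<mu>) \<nu>) = (if \<mu> @ \<nu> \<in> Bstar L then e (l + length \<mu>) \<nu> else \<zero>)"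
    by blast+
qed

lemma Sw_Sw_e:
  assumes "\<nu> \<in> Sync L m" "length \<mu> \<le> m"
  shows "(Sw \<mu>)\<dagger> \<otimes> (Sw \<mu> \<otimes> e m \<nu>) = (if \<mu> @ \<nu> \<in> Bstar L then e m \<nu> else \<zero>)"
  using Sw_e(3)[of \<nu> "m - length \<mu>" \<mu>] assms by simp

text \<open>If the first letters agree, their (S \<alpha>)\<dagger> S \<alpha> stands between the
  remaining words and need not be one. The product is cut by vertex projections of a level high
  enough that this factor acts as 0 or 1, and then the induction hypothesis applies.\<close>

lemma Sw_orth: "length \<mu> = length \<nu> \<Longrightarrow> \<mu> \<noteq> \<nu> \<Longrightarrow> (Sw \<mu>)\<dagger> \<otimes> Sw \<nu> = \<zero>"
proof (induction \<mu> arbitrary: \<nu>)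
  case (Cons \<alpha> \<mu>)
  then obtain \<beta> \<nu>' where \<nu>: "\<nu> = \<beta> # \<nu>'" "length \<mu> = length \<nu>'" by (cases \<nu>) auto
  have eq: "(Sw (\<alpha> # \<mu>))\<dagger> \<otimes> Sw \<nu> = (Sw \<mu>)\<dagger> \<otimes> (((S \<alpha>)\<dagger> \<otimes> S \<beta>) \<otimes> Sw \<nu>')"
    by (simp add: \<nu> m_assoc)
  show ?case
  proof (cases "\<alpha> = \<beta>")
    case False
    then show ?thesis unfolding eq S_orth[OF False] by simp
  next
    case True
    then have ne: "\<mu> \<noteq> \<nu>'" using Cons.prems \<nu> by simp
    let ?n = "length \<nu>'"
    have "(Sw \<mu>)\<dagger> \<otimes> (((S \<alpha>)\<dagger> \<otimes> S \<alpha>) \<otimes> Sw \<nu>') \<otimes> E (Suc ?n) v = \<zero>" if v: "v \<in> Vmin L (Suc ?n)" for v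
    proof -
      obtain \<rho> where \<rho>: "\<rho> \<in> Sync L (1 + ?n)" "E (Suc ?n) v = e (1 + ?n) \<rho>" using Vmin_cases[OF v] by auto
      show ?thesis
      proof (cases "\<nu>' @ \<rho> \<in> Bstar L")
        case b: False
        then show ?thesis using Sw_e(2)[OF \<rho>(1) b] \<rho> by (simp add: m_assoc)
      next
        case b: True
        let ?x = "Sw \<nu>' \<otimes> e (1 + ?n) \<rho>"
        have s: "\<nu>' @ \<rho> \<in> Sync L (Suc 0)" using Sync_prepend[OF \<rho>(1) b] by simp
        have "((S \<alpha>)\<dagger> \<otimes> S \<alpha>) \<otimes> ?x = ((S \<alpha>)\<dagger> \<otimes> S \<alpha>) \<otimes> (e 1 (\<nu>' @ \<rho>) \<otimes> ?x)" using Sw_e(1)[OF \<rho>(1) b] by simp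
        also have "\<dots> = ((S \<alpha>)\<dagger> \<otimes> (S \<alpha> \<otimes> e (Suc 0) (\<nu>' @ \<rho>))) \<otimes> ?x" using s \<rho> by (simp add: m_assoc)
        also have "\<dots> = (if \<alpha> # \<nu>' @ \<rho> \<in> Bstar L then e 1 (\<nu>' @ \<rho>) else \<zero>) \<otimes> ?x" unfolding S_e(3)[OF s] by simp
        also have "\<dots> = (if \<alpha> # \<nu>' @ \<rho> \<in> Bstar L then ?x else \<zero>)" using Sw_e(1)[OF \<rho>(1) b] \<rho> by simp
        finally have *: "((S \<alpha>)\<dagger> \<otimes> S \<alpha>) \<otimes> ?x = (if \<alpha> # \<nu>' @ \<rho> \<in> Bstar L then ?x else \<zero>)" .
        have "(Sw \<mu>)\<dagger> \<otimes> ?x = \<zero>" using Cons.IH[OF \<nu>(2) ne] \<rho> by (simp add: m_assoc[symmetric])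
        moreover have "(Sw \<mu>)\<dagger> \<otimes> (((S \<alpha>)\<dagger> \<otimes> S \<alpha>) \<otimes> Sw \<nu>') \<otimes> E (Suc ?n) v = (Sw \<mu>)\<dagger> \<otimes> (((S \<alpha>)\<dagger> \<otimes> S \<alpha>) \<otimes> ?x)"
          using \<rho> by (simp add: m_assoc)
        ultimately show ?thesis unfolding * by simp
      qed
    qed
    then have "finsum A (\<lambda>v. (Sw \<mu>)\<dagger> \<otimes> (((S \<alpha>)\<dagger> \<otimes> S \<alpha>) \<otimes> Sw \<nu>') \<otimes> E (Suc ?n) v) (Vmin L (Suc ?n)) = \<zero>"
      by (rule finsum_all_zero)
    then show ?thesis using eq True one_sum_E'[of "(Sw \<mu>)\<dagger> \<otimes> (((S \<alpha>)\<dagger> \<otimes> S \<alpha>) \<otimes> Sw \<nu>')" "Suc ?n"] by simp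
  qed
qed simp

lemma Sw_incomparable:
  assumes "length \<mu> \<le> length \<nu>" "take (length \<mu>) \<nu> \<noteq> \<mu>"
  shows "(Sw \<mu>)\<dagger> \<otimes> Sw \<nu> = \<zero>" "(Sw \<nu>)\<dagger> \<otimes> Sw \<mu> = \<zero>"
proof -
  have "Sw \<nu> = Sw (take (length \<mu>) \<nu>) \<otimes> Sw (drop (length \<mu>) \<nu>)" by (metis Sw_append append_take_drop_id)
  moreover have "(Sw \<mu>)\<dagger> \<otimes> Sw (take (length \<mu>) \<nu>) = \<zero>" by (rule Sw_orth) (use assms in auto)
  ultimately show *: "(Sw \<mu>)\<dagger> \<otimes> Sw \<nu> = \<zero>" by (simp add: m_assoc[symmetric])
  have "((Sw \<mu>)\<dagger> \<otimes> Sw \<nu>)\<dagger> = \<zero>" unfolding * by simp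
  then show "(Sw \<nu>)\<dagger> \<otimes> Sw \<mu> = \<zero>" by simp
qed

text \<open>Only the shape matters: a vertex projection in front of a word can be traded for some
  factor behind it, so that words separated by it can be made to meet.\<close>

lemma E_Sw: "v \<in> Vmin L l \<Longrightarrow> \<exists>Y\<in>carrier A. E l v \<otimes> Sw \<mu> = Sw \<mu> \<otimes> Y"
proof (induction \<mu> arbitrary: l v)
  case Nil then show ?case by (intro bexI[of _ "E l v"]) auto
next
  case (Cons \<alpha> \<mu>)
  let ?W = "{w \<in> Vmin L (Suc l). Amin L l v \<alpha> w}"
  have "\<forall>w\<in>?W. \<exists>Y. Y \<in> carrier A \<and> E (Suc l) w \<otimes> Sw \<mu> = Sw \<mu> \<otimes> Y" using Cons.IH by blast
  from bchoice[OF this] obtain Y where Y: "\<forall>w\<in>?W. Y w \<in> carrier A \<and> E (Suc l) w \<otimes> Sw \<mu> = Sw \<mu> \<otimes> Y w" ..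
  have "E l v \<otimes> Sw (\<alpha> # \<mu>) = (E l v \<otimes> S \<alpha>) \<otimes> Sw \<mu>" using Cons.prems by (simp add: m_assoc)
  also have "\<dots> = S \<alpha> \<otimes> (finsum A (E (Suc l)) ?W \<otimes> Sw \<mu>)"
    unfolding E_S[OF Cons.prems] by (rule m_assoc) (auto intro!: finsum_closed)
  also have "finsum A (E (Suc l)) ?W \<otimes> Sw \<mu> = finsum A (\<lambda>w. E (Suc l) w \<otimes> Sw \<mu>) ?W" by (rule mult_finsum_right) auto
  also have "\<dots> = finsum A (\<lambda>w. Sw \<mu> \<otimes> Y w) ?W" by (rule finsum_cong') (use Y in auto)
  also have "\<dots> = Sw \<mu> \<otimes> finsum A Y ?W" by (rule mult_finsum_left[symmetric]) (use Y in auto)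
  finally have "E l v \<otimes> Sw (\<alpha> # \<mu>) = Sw (\<alpha> # \<mu>) \<otimes> finsum A Y ?W"
    using Y by (simp add: m_assoc finsum_closed Pi_def)
  then show ?case using Y by (intro bexI[of _ "finsum A Y ?W"]) (auto intro!: finsum_closed)
qed

end

context min_cstar begin

definition mon :: "'s list \<Rightarrow> nat \<Rightarrow> 's list \<Rightarrow> 's list \<Rightarrow> 'a" where
  "mon \<mu> m \<rho> \<nu> = Sw \<mu> \<otimes> (e m \<rho> \<otimes> (Sw \<nu>)\<dagger>)"

text \<open>The linear span of the monomials with fixed word lengths and fixed level, generated one
  scaled monomial at a time to obtain an induction rule.\<close>

inductive_set Mon :: "nat \<Rightarrow> nat \<Rightarrow> nat \<Rightarrow> 'a set" for i j m where
  Mon_zero: "\<zero> \<in> Mon i j m"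
| Mon_step: "length \<mu> = i \<Longrightarrow> length \<nu> = j \<Longrightarrow> \<rho> \<in> Sync L m \<Longrightarrow> x \<in> Mon i j m \<Longrightarrow> c \<odot> mon \<mu> m \<rho> \<nu> \<oplus> x \<in> Mon i j m"

lemma mon_closed [simp, intro]: "\<rho> \<in> Sync L m \<Longrightarrow> mon \<mu> m \<rho> \<nu> \<in> carrier A"
  by (simp add: mon_def)

lemma Mon_closed: "x \<in> Mon i j m \<Longrightarrow> x \<in> carrier A"
  by (induction rule: Mon.induct) auto

lemma Mon_mon: "\<rho> \<in> Sync L m \<Longrightarrow> mon \<mu> m \<rho> \<nu> \<in> Mon (length \<mu>) (length \<nu>) m"
  using Mon_step[of \<mu> "length \<mu>" \<nu> "length \<nu>" \<rho> m \<zero> 1] Mon_zero by simp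

lemma Mon_add: "x \<in> Mon i j m \<Longrightarrow> y \<in> Mon i j m \<Longrightarrow> x \<oplus> y \<in> Mon i j m"
proof (induction rule: Mon.induct)
  case (Mon_step \<mu> \<nu> \<rho> x c)
  then have "c \<odot> mon \<mu> m \<rho> \<nu> \<oplus> (x \<oplus> y) \<in> Mon i j m" by (intro Mon.Mon_step) auto
  then show ?case using Mon_step Mon_closed by (simp add: a_assoc)
qed (simp add: Mon_closed)

lemma Mon_sc: "x \<in> Mon i j m \<Longrightarrow> c \<odot> x \<in> Mon i j m"
proof (induction rule: Mon.induct)
  case (Mon_step \<mu> \<nu> \<rho> x c')
  then have "(c * c') \<odot> mon \<mu> m \<rho> \<nu> \<oplus> c \<odot> x \<in> Mon i j m" by (intro Mon.Mon_step)
  then show ?case using Mon_step Mon_closed by (simp add: sc_add_right)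
qed (simp add: Mon_zero)

lemma Mon_finsum: "finite F \<Longrightarrow> (\<And>k. k \<in> F \<Longrightarrow> f k \<in> Mon i j m) \<Longrightarrow> finsum A f F \<in> Mon i j m"
proof (induction F rule: finite_induct)
  case (insert k F)
  have c: "f k' \<in> carrier A" if "k' \<in> insert k F" for k' by (rule Mon_closed) (rule insert.prems[OF that])
  then have "finsum A f (insert k F) = f k \<oplus> finsum A f F" using insert.hyps by (intro finsum_insert) auto
  then show ?case using insert by (simp add: Mon_add)
qed (simp add: Mon_zero)

lemma Mon_lin_induct [consumes 1, case_names zero add sc mon]:
  assumes "x \<in> Mon i j m" "P \<zero>"
    and "\<And>x y. x \<in> carrier A \<Longrightarrow> y \<in> carrier A \<Longrightarrow> P x \<Longrightarrow> P y \<Longrightarrow> P (x \<oplus> y)"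
    and "\<And>c x. x \<in> carrier A \<Longrightarrow> P x \<Longrightarrow> P (c \<odot> x)"
    and "\<And>\<mu> \<nu> \<rho>. length \<mu> = i \<Longrightarrow> length \<nu> = j \<Longrightarrow> \<rho> \<in> Sync L m \<Longrightarrow> P (mon \<mu> m \<rho> \<nu>)"
  shows "P x"
  using assms(1)
proof (induction rule: Mon.induct)
  case Mon_zero show ?case by (rule assms(2))
next
  case (Mon_step \<mu> \<nu> \<rho> x c)
  show ?case using Mon_step Mon_closed by (intro assms(3,4,5)) auto
qed

lemma Mon_adj: "x \<in> Mon i j m \<Longrightarrow> x\<dagger> \<in> Mon j i m"
proof (induction rule: Mon_lin_induct)
  case (mon \<mu> \<nu> \<rho>)
  then have "(mon \<mu> m \<rho> \<nu>)\<dagger> = mon \<nu> m \<rho> \<mu>" by (simp add: mon_def m_assoc)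
  then show ?case using Mon_mon[of \<rho> m \<nu> \<mu>] mon by simp
qed (simp_all add: Mon_zero Mon_add Mon_sc)

text \<open>Inserting the sum of all \<open>E (Suc m) v\<close> splits the vertex projection in the
  middle.\<close>

lemma Mon_refine: "x \<in> Mon i j m \<Longrightarrow> x \<in> Mon i j (Suc m)"
proof (induction rule: Mon_lin_induct)
  case (mon \<mu> \<nu> \<rho>)
  have "Sw \<mu> \<otimes> ((e m \<rho> \<otimes> E (Suc m) v) \<otimes> (Sw \<nu>)\<dagger>) \<in> Mon i j (Suc m)" if v: "v \<in> Vmin L (Suc m)" for v
  proof -
    obtain \<rho>' where r: "\<rho>' \<in> Sync L (Suc m)" "E (Suc m) v = e (Suc m) \<rho>'" using Vmin_cases[OF v] by blast
    show ?thesis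
      using e_refine_step[OF mon(3) r(1)] r Mon_mon[OF r(1), of \<mu> \<nu>] mon(1,2) Mon_zero by (auto simp: mon_def)
  qed
  then have s: "finsum A (\<lambda>v. Sw \<mu> \<otimes> ((e m \<rho> \<otimes> E (Suc m) v) \<otimes> (Sw \<nu>)\<dagger>)) (Vmin L (Suc m)) \<in> Mon i j (Suc m)"
    by (intro Mon_finsum) auto
  have c: "e m \<rho> \<otimes> E (Suc m) v \<in> carrier A" if "v \<in> Vmin L (Suc m)" for v using that mon(3) by simp
  have "finsum A (\<lambda>v. Sw \<mu> \<otimes> ((e m \<rho> \<otimes> E (Suc m) v) \<otimes> (Sw \<nu>)\<dagger>)) (Vmin L (Suc m)) =
      Sw \<mu> \<otimes> finsum A (\<lambda>v. (e m \<rho> \<otimes> E (Suc m) v) \<otimes> (Sw \<nu>)\<dagger>) (Vmin L (Suc m))"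
    by (rule mult_finsum_left[symmetric]) (use c in auto)
  also have "finsum A (\<lambda>v. (e m \<rho> \<otimes> E (Suc m) v) \<otimes> (Sw \<nu>)\<dagger>) (Vmin L (Suc m)) =
      finsum A (\<lambda>v. e m \<rho> \<otimes> E (Suc m) v) (Vmin L (Suc m)) \<otimes> (Sw \<nu>)\<dagger>"
    by (rule mult_finsum_right[symmetric]) (use c in auto)
  also have "finsum A (\<lambda>v. e m \<rho> \<otimes> E (Suc m) v) (Vmin L (Suc m)) = e m \<rho>" using mon(3) by (intro one_sum_E') auto
  finally show ?case using s by (simp add: mon_def)
qed (simp_all add: Mon_zero Mon_add Mon_sc)

text \<open>Inserting the sum of all S \<alpha> (S \<alpha>)\<dagger> in the middle lengthens both
  words by a letter; moving the vertex projection past \<open>S \<alpha>\<close> raises the level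
  along with them.\<close>

lemma Mon_raise1: "x \<in> Mon i j m \<Longrightarrow> x \<in> Mon (Suc i) (Suc j) (Suc m)"
proof (induction rule: Mon_lin_induct)
  case (mon \<mu> \<nu> \<rho>)
  let ?W = "\<lambda>\<alpha>. {w \<in> Vmin L (Suc m). Amin L m (vclass L m \<rho>) \<alpha> w}"
  have w: "Sw (\<mu> @ [\<alpha>]) \<otimes> (E (Suc m) w \<otimes> (Sw (\<nu> @ [\<alpha>]))\<dagger>) \<in> Mon (Suc i) (Suc j) (Suc m)"
    if w: "w \<in> Vmin L (Suc m)" for w \<alpha>
  proof -
    obtain \<rho>' where r: "\<rho>' \<in> Sync L (Suc m)" "E (Suc m) w = e (Suc m) \<rho>'" using Vmin_cases[OF w] by blast
    show ?thesis using Mon_mon[OF r(1), of "\<mu> @ [\<alpha>]" "\<nu> @ [\<alpha>]"] mon(1,2) r by (simp add: mon_def)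
  qed
  have a: "Sw \<mu> \<otimes> (e m \<rho> \<otimes> ((S \<alpha> \<otimes> (S \<alpha>)\<dagger>) \<otimes> (Sw \<nu>)\<dagger>)) \<in> Mon (Suc i) (Suc j) (Suc m)" for \<alpha>
  proof -
    have fc: "finsum A (E (Suc m)) (?W \<alpha>) \<in> carrier A" by (auto intro!: finsum_closed)
    have "Sw \<mu> \<otimes> (e m \<rho> \<otimes> ((S \<alpha> \<otimes> (S \<alpha>)\<dagger>) \<otimes> (Sw \<nu>)\<dagger>)) = Sw \<mu> \<otimes> ((E m (vclass L m \<rho>) \<otimes> S \<alpha>) \<otimes> (Sw (\<nu> @ [\<alpha>]))\<dagger>)"
      using mon(3) by (simp add: e_def Sw_append m_assoc)
    also have "\<dots> = Sw \<mu> \<otimes> ((S \<alpha> \<otimes> finsum A (E (Suc m)) (?W \<alpha>)) \<otimes> (Sw (\<nu> @ [\<alpha>]))\<dagger>)"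
      using E_S[of "vclass L m \<rho>" m \<alpha>] mon(3) by simp
    also have "\<dots> = Sw (\<mu> @ [\<alpha>]) \<otimes> (finsum A (E (Suc m)) (?W \<alpha>) \<otimes> (Sw (\<nu> @ [\<alpha>]))\<dagger>)"
      using fc by (simp add: Sw_append m_assoc del: adj_mult)
    also have "finsum A (E (Suc m)) (?W \<alpha>) \<otimes> (Sw (\<nu> @ [\<alpha>]))\<dagger> = finsum A (\<lambda>w. E (Suc m) w \<otimes> (Sw (\<nu> @ [\<alpha>]))\<dagger>) (?W \<alpha>)"
      by (rule mult_finsum_right) auto
    also have "Sw (\<mu> @ [\<alpha>]) \<otimes> \<dots> = finsum A (\<lambda>w. Sw (\<mu> @ [\<alpha>]) \<otimes> (E (Suc m) w \<otimes> (Sw (\<nu> @ [\<alpha>]))\<dagger>)) (?W \<alpha>)"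
      by (rule mult_finsum_left) auto
    also have "\<dots> \<in> Mon (Suc i) (Suc j) (Suc m)" using w by (intro Mon_finsum) auto
    finally show ?thesis .
  qed
  have "finsum A (\<lambda>\<alpha>. Sw \<mu> \<otimes> (e m \<rho> \<otimes> ((S \<alpha> \<otimes> (S \<alpha>)\<dagger>) \<otimes> (Sw \<nu>)\<dagger>))) UNIV =
     Sw \<mu> \<otimes> finsum A (\<lambda>\<alpha>. e m \<rho> \<otimes> ((S \<alpha> \<otimes> (S \<alpha>)\<dagger>) \<otimes> (Sw \<nu>)\<dagger>)) UNIV"
    by (rule mult_finsum_left[symmetric]) (use mon(3) in auto)
  also have "finsum A (\<lambda>\<alpha>. e m \<rho> \<otimes> ((S \<alpha> \<otimes> (S \<alpha>)\<dagger>) \<otimes> (Sw \<nu>)\<dagger>)) UNIV =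
     e m \<rho> \<otimes> finsum A (\<lambda>\<alpha>. (S \<alpha> \<otimes> (S \<alpha>)\<dagger>) \<otimes> (Sw \<nu>)\<dagger>) UNIV"
    by (rule mult_finsum_left[symmetric]) (use mon(3) in auto)
  also have "finsum A (\<lambda>\<alpha>. (S \<alpha> \<otimes> (S \<alpha>)\<dagger>) \<otimes> (Sw \<nu>)\<dagger>) UNIV = finsum A (\<lambda>\<alpha>. S \<alpha> \<otimes> (S \<alpha>)\<dagger>) UNIV \<otimes> (Sw \<nu>)\<dagger>"
    by (rule mult_finsum_right[symmetric]) auto
  finally have "mon \<mu> m \<rho> \<nu> = finsum A (\<lambda>\<alpha>. Sw \<mu> \<otimes> (e m \<rho> \<otimes> ((S \<alpha> \<otimes> (S \<alpha>)\<dagger>) \<otimes> (Sw \<nu>)\<dagger>))) UNIV"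
    using rels(3) by (simp add: mon_def)
  moreover have "\<dots> \<in> Mon (Suc i) (Suc j) (Suc m)" using a by (intro Mon_finsum) auto
  ultimately show ?case by simp
qed (simp_all add: Mon_zero Mon_add Mon_sc)

lemma Mon_raise: assumes "x \<in> Mon i j m" shows "x \<in> Mon (i + s) (j + s) (m + s + t)"
proof -
  have "x \<in> Mon (i + s) (j + s) (m + s)"
    by (induction s) (use assms Mon_raise1 in auto)
  then show ?thesis by (induction t) (use Mon_refine in auto)
qed

text \<open>The bound \<open>length \<nu> \<le> m\<close> lets (Sw \<nu>)\<dagger> Sw \<nu> act as 0
  or 1 on a vertex projection of level m.\<close>

lemma mon_mult:
  assumes "\<rho> \<in> Sync L m" "\<rho>' \<in> Sync L m" "length \<nu> = length \<nu>'" "length \<nu> \<le> m"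
  shows "mon \<mu> m \<rho> \<nu> \<otimes> mon \<nu>' m \<rho>' \<kappa> =
    (if \<nu> = \<nu>' \<and> \<nu> @ \<rho>' \<in> Bstar L \<and> past_eq L m \<rho> \<rho>' then mon \<mu> m \<rho>' \<kappa> else \<zero>)"
proof -
  have e1: "mon \<mu> m \<rho> \<nu> \<otimes> mon \<nu>' m \<rho>' \<kappa> = Sw \<mu> \<otimes> (e m \<rho> \<otimes> (((Sw \<nu>)\<dagger> \<otimes> (Sw \<nu>' \<otimes> e m \<rho>')) \<otimes> (Sw \<kappa>)\<dagger>))"
    using assms by (simp add: mon_def m_assoc)
  show ?thesis
  proof (cases "\<nu> = \<nu>'")
    case False
    have "(Sw \<nu>)\<dagger> \<otimes> (Sw \<nu>' \<otimes> e m \<rho>') = \<zero>"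
      using Sw_orth[OF assms(3) False] assms by (simp add: m_assoc[symmetric])
    then show ?thesis unfolding e1 using False assms by simp
  next
    case True
    have "(Sw \<nu>)\<dagger> \<otimes> (Sw \<nu>' \<otimes> e m \<rho>') = (if \<nu> @ \<rho>' \<in> Bstar L then e m \<rho>' else \<zero>)"
      using Sw_Sw_e[OF assms(2,4)] True by simp
    moreover have "e m \<rho> \<otimes> (e m \<rho>' \<otimes> (Sw \<kappa>)\<dagger>) = (if past_eq L m \<rho> \<rho>' then e m \<rho>' else \<zero>) \<otimes> (Sw \<kappa>)\<dagger>"
      using e_orth[OF assms(1,2)] assms by (simp add: m_assoc[symmetric])
    ultimately show ?thesis unfolding e1 using True assms by (auto simp: mon_def)
  qed
qed

lemma Mon_mult:
  assumes "x \<in> Mon i j m" "y \<in> Mon j k m" "j \<le> m" shows "x \<otimes> y \<in> Mon i k m"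
  using assms(1)
proof (induction rule: Mon_lin_induct)
  case (mon \<mu> \<nu> \<rho>)
  show ?case using assms(2)
  proof (induction rule: Mon_lin_induct)
    case (mon \<nu>' \<kappa> \<rho>')
    then show ?case
      using mon_mult[of \<rho> m \<rho>' \<nu> \<nu>' \<mu> \<kappa>] \<open>length \<mu> = i\<close> \<open>length \<nu> = j\<close> \<open>\<rho> \<in> Sync L m\<close> assms(3)
        Mon_mon[of \<rho>' m \<mu> \<kappa>] Mon_zero by auto
  qed (use mon(3) in \<open>simp_all add: Mon_zero Mon_add Mon_sc r_distr\<close>)
qed (use Mon_closed[OF assms(2)] in \<open>simp_all add: Mon_zero Mon_add Mon_sc l_distr\<close>)

text \<open>Monomials with one common word length and level multiply like matrix units, so
  compressing by a single column leaves only multiples of its vertex projection.\<close>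

lemma Mon_diag_scalar:
  assumes "x \<in> Mon k k m" "k \<le> m" "length \<mu> = k" "\<nu> \<in> Sync L m"
  shows "\<exists>c. e m \<nu> \<otimes> ((Sw \<mu>)\<dagger> \<otimes> (x \<otimes> (Sw \<mu> \<otimes> e m \<nu>))) = c \<odot> e m \<nu>"
  using assms(1)
proof (induction rule: Mon_lin_induct)
  case zero then show ?case using assms(4) by (intro exI[of _ 0]) simp
next
  case (add x y)
  then obtain c d where "e m \<nu> \<otimes> ((Sw \<mu>)\<dagger> \<otimes> (x \<otimes> (Sw \<mu> \<otimes> e m \<nu>))) = c \<odot> e m \<nu>"
    "e m \<nu> \<otimes> ((Sw \<mu>)\<dagger> \<otimes> (y \<otimes> (Sw \<mu> \<otimes> e m \<nu>))) = d \<odot> e m \<nu>" by blast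
  then show ?case using add(1,2) assms(4) by (intro exI[of _ "c + d"]) (simp add: l_distr r_distr sc_add_left)
next
  case (sc c x)
  then obtain d where "e m \<nu> \<otimes> ((Sw \<mu>)\<dagger> \<otimes> (x \<otimes> (Sw \<mu> \<otimes> e m \<nu>))) = d \<odot> e m \<nu>" by blast
  then show ?case using sc(1) assms(4) by (intro exI[of _ "c * d"]) simp
next
  case (mon \<mu>' \<nu>' \<rho>)
  let ?l = "e m \<nu> \<otimes> ((Sw \<mu>)\<dagger> \<otimes> (mon \<mu>' m \<rho> \<nu>' \<otimes> (Sw \<mu> \<otimes> e m \<nu>)))"
  have one: "mon [] m \<nu> \<mu> = e m \<nu> \<otimes> (Sw \<mu>)\<dagger>" "mon \<mu> m \<nu> [] = Sw \<mu> \<otimes> e m \<nu>"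
    using assms(4) by (simp_all add: mon_def)
  have "?l = mon [] m \<nu> \<mu> \<otimes> (mon \<mu>' m \<rho> \<nu>' \<otimes> mon \<mu> m \<nu> [])"
    using assms(4) mon(3) by (simp add: one m_assoc)
  also have "\<dots> = \<zero> \<or> \<dots> = mon [] m \<nu> []"
    using mon_mult[of \<rho> m \<nu> \<nu>' \<mu> \<mu>' "[]"] mon_mult[of \<nu> m \<nu> \<mu> \<mu>' "[]" "[]"] mon assms by auto
  finally have "?l = \<zero> \<or> ?l = e m \<nu>" using assms(4) by (simp add: mon_def)
  then show ?case
  proof
    assume "?l = \<zero>" then show ?thesis using assms(4) by (intro exI[of _ 0]) simp
  next
    assume "?l = e m \<nu>" then show ?thesis using assms(4) by (intro exI[of _ 1]) simp
  qed
qed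

text \<open>If no two of the first tails of \<open>\<xi>\<close> are prefixes of each other, compressing by \<open>S\<^sub>\<xi>\<close> removes
  all monomials with words of different lengths.\<close>
lemma Mon_compress_zero:
  assumes x: "x \<in> Mon i j m" "i \<le> m" "j \<le> m" "i \<noteq> j" "i + j \<le> length \<xi>"
    and \<xi>: "\<And>p q. p < q \<Longrightarrow> q \<le> i + j \<Longrightarrow> take (length \<xi> - q) (drop p \<xi>) \<noteq> drop q \<xi>"
  shows "(Sw \<xi>)\<dagger> \<otimes> (x \<otimes> Sw \<xi>) = \<zero>"
  using x(1)
proof (induction rule: Mon_lin_induct)
  case (mon \<mu> \<nu> \<rho>)
  note c = e_closed[OF mon(3)]
  have reassoc: "(Sw \<xi>)\<dagger> \<otimes> (mon \<mu> m \<rho> \<nu> \<otimes> Sw \<xi>) = ((Sw \<xi>)\<dagger> \<otimes> (Sw \<mu> \<otimes> e m \<rho>)) \<otimes> ((e m \<rho> \<otimes> (Sw \<nu>)\<dagger>) \<otimes> Sw \<xi>)"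
    using c proj_assoc[OF e_proj[OF mon(3)]] by (simp add: mon_def m_assoc)
  \<comment> \<open>Against \<open>Sw \<xi>\<close> each word of the monomial either vanishes or
    cancels, leaving the corresponding tail of \<xi>.\<close>
  have half: "\<exists>c. (Sw \<xi>)\<dagger> \<otimes> (Sw \<kappa> \<otimes> e m \<rho>) = c \<odot> ((Sw (drop (length \<kappa>) \<xi>))\<dagger> \<otimes> e m \<rho>)"
    if \<kappa>: "length \<kappa> \<le> length \<xi>" "length \<kappa> \<le> m" for \<kappa>
  proof (cases "take (length \<kappa>) \<xi> = \<kappa>")
    case False
    then have "(Sw \<xi>)\<dagger> \<otimes> Sw \<kappa> = \<zero>" using Sw_incomparable(2)[of \<kappa> \<xi>] \<kappa> by simp
    then have "(Sw \<xi>)\<dagger> \<otimes> (Sw \<kappa> \<otimes> e m \<rho>) = \<zero>" using c by (simp add: m_assoc[symmetric])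
    then show ?thesis using c by (intro exI[of _ 0]) simp
  next
    case True
    then have "\<xi> = \<kappa> @ drop (length \<kappa>) \<xi>" by (metis append_take_drop_id)
    then have "Sw \<xi> = Sw \<kappa> \<otimes> Sw (drop (length \<kappa>) \<xi>)" by (metis Sw_append)
    then have "(Sw \<xi>)\<dagger> \<otimes> (Sw \<kappa> \<otimes> e m \<rho>) = (Sw (drop (length \<kappa>) \<xi>))\<dagger> \<otimes> ((Sw \<kappa>)\<dagger> \<otimes> (Sw \<kappa> \<otimes> e m \<rho>))"
      using c by (simp add: m_assoc)
    also have "\<dots> = (if \<kappa> @ \<rho> \<in> Bstar L then 1 else 0) \<odot> ((Sw (drop (length \<kappa>) \<xi>))\<dagger> \<otimes> e m \<rho>)"
      using Sw_Sw_e[OF mon(3) \<kappa>(2)] c by simp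
    finally show ?thesis by blast
  qed
  have lens: "length \<mu> \<le> length \<xi>" "length \<mu> \<le> m" "length \<nu> \<le> length \<xi>" "length \<nu> \<le> m" using mon x by auto
  let ?x' = "drop (length \<mu>) \<xi>" and ?x'' = "drop (length \<nu>) \<xi>"
  obtain a where a: "(Sw \<xi>)\<dagger> \<otimes> (Sw \<mu> \<otimes> e m \<rho>) = a \<odot> ((Sw ?x')\<dagger> \<otimes> e m \<rho>)" using half[OF lens(1,2)] by blast
  obtain b where b: "(Sw \<xi>)\<dagger> \<otimes> (Sw \<nu> \<otimes> e m \<rho>) = b \<odot> ((Sw ?x'')\<dagger> \<otimes> e m \<rho>)" using half[OF lens(3,4)] by blast
  have "((Sw \<xi>)\<dagger> \<otimes> (Sw \<nu> \<otimes> e m \<rho>))\<dagger> = (b \<odot> ((Sw ?x'')\<dagger> \<otimes> e m \<rho>))\<dagger>" by (simp only: b)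
  then have b': "(e m \<rho> \<otimes> (Sw \<nu>)\<dagger>) \<otimes> Sw \<xi> = cnj b \<odot> (e m \<rho> \<otimes> Sw ?x'')" using mon(3) c by (simp add: m_assoc)
  \<comment> \<open>The vertex projection between the two tails is traded for a factor on the right,
    so that the tails meet and their orthogonality applies.\<close>
  obtain Y where Y: "Y \<in> carrier A" "e m \<rho> \<otimes> Sw ?x'' = Sw ?x'' \<otimes> Y"
    using E_Sw[of "vclass L m \<rho>" m ?x''] mon(3) by (auto simp: e_def)
  have orth: "(Sw ?x')\<dagger> \<otimes> Sw ?x'' = \<zero>"
  proof (cases "i < j")
    case True
    then have "take (length ?x'') ?x' \<noteq> ?x''" using \<xi>[of i j] mon(1,2) x(5) by simp
    then show ?thesis using Sw_incomparable(2)[of ?x'' ?x'] True mon(1,2) by simp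
  next
    case False
    then have "j < i" using x(4) by simp
    then have "take (length ?x') ?x'' \<noteq> ?x'" using \<xi>[of j i] mon(1,2) x(5) by simp
    then show ?thesis using Sw_incomparable(1)[of ?x' ?x''] \<open>j < i\<close> mon(1,2) by simp
  qed
  have "((Sw ?x')\<dagger> \<otimes> e m \<rho>) \<otimes> (e m \<rho> \<otimes> Sw ?x'') = (Sw ?x')\<dagger> \<otimes> (e m \<rho> \<otimes> Sw ?x'')"
    using c proj_assoc[OF e_proj[OF mon(3)]] by (simp add: m_assoc)
  also have "\<dots> = ((Sw ?x')\<dagger> \<otimes> Sw ?x'') \<otimes> Y" using Y by (simp add: m_assoc)
  also have "\<dots> = \<zero>" unfolding orth using Y by simp
  finally show ?case unfolding reassoc a b' using c by simp
qed (simp_all add: l_distr r_distr)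

subsection \<open>The grading\<close>

text \<open>The homogeneous elements of degree d. The bounds i \<le> m and j \<le> m are those under
  which monomials can be multiplied.\<close>

definition G :: "int \<Rightarrow> 'a set" where
  "G d = {x. \<exists>i j m. int i - int j = d \<and> i \<le> m \<and> j \<le> m \<and> x \<in> Mon i j m}"

lemma G_closed: "x \<in> G d \<Longrightarrow> x \<in> carrier A"
  by (auto simp: G_def Mon_closed)

lemma G_zero [simp]: "\<zero> \<in> G d"
proof -
  have "int (nat d) - int (nat (- d)) = d" by auto
  moreover have "\<zero> \<in> Mon (nat d) (nat (- d)) (nat d + nat (- d))" by (rule Mon_zero)
  ultimately show ?thesis unfolding G_def by (intro CollectI exI conjI) auto
qed

lemma Mon_G: "x \<in> Mon i j m \<Longrightarrow> i \<le> m \<Longrightarrow> j \<le> m \<Longrightarrow> x \<in> G (int i - int j)"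
  by (auto simp: G_def)

lemma G_sc: "x \<in> G d \<Longrightarrow> c \<odot> x \<in> G d"
  unfolding G_def using Mon_sc by blast

lemma G_adj: "x \<in> G d \<Longrightarrow> x\<dagger> \<in> G (- d)"
proof -
  assume "x \<in> G d"
  then obtain i j m where "int i - int j = d" "i \<le> m" "j \<le> m" "x \<in> Mon i j m" by (auto simp: G_def)
  then show ?thesis using Mon_G[OF Mon_adj, of x i j m] by (simp add: algebra_simps)
qed

lemma G_add: assumes "x \<in> G d" "y \<in> G d" shows "x \<oplus> y \<in> G d"
proof -
  obtain i j m where x: "int i - int j = d" "i \<le> m" "j \<le> m" "x \<in> Mon i j m" using assms(1) by (auto simp: G_def)
  obtain i' j' m' where y: "int i' - int j' = d" "i' \<le> m'" "j' \<le> m'" "y \<in> Mon i' j' m'" using assms(2) by (auto simp: G_def)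
  \<comment> \<open>Raising by j' and by j equalizes the word lengths, because i - j = i' - j'; the
    extra refinement equalizes the levels.\<close>
  have "x \<in> Mon (i + j') (j + j') (m + j' + m')" by (rule Mon_raise[OF x(4)])
  moreover have "y \<in> Mon (i' + j) (j' + j) (m' + j + (m + j' - j))" by (rule Mon_raise[OF y(4)])
  moreover have "i' + j = i + j'" "j' + j = j + j'" "m' + j + (m + j' - j) = m + j' + m'" using x y by linarith+
  ultimately have "x \<oplus> y \<in> Mon (i + j') (j + j') (m + j' + m')" using Mon_add by simp
  from Mon_G[OF this] show ?thesis using x y by simp
qed

lemma G_mult: assumes "x \<in> G d" "y \<in> G d'" shows "x \<otimes> y \<in> G (d + d')"
proof -
  obtain i j m where x: "int i - int j = d" "i \<le> m" "j \<le> m" "x \<in> Mon i j m" using assms(1) by (auto simp: G_def)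
  obtain i' j' m' where y: "int i' - int j' = d'" "i' \<le> m'" "j' \<le> m'" "y \<in> Mon i' j' m'" using assms(2) by (auto simp: G_def)
  let ?M = "m + m' + i' + j"
  \<comment> \<open>The right words of x and the left words of y both get length j + i', so that
    \<open>Mon_mult\<close> applies.\<close>
  have "x \<in> Mon (i + i') (j + i') (m + i' + (m' + j))" by (rule Mon_raise[OF x(4)])
  then have 1: "x \<in> Mon (i + i') (j + i') ?M" by (simp add: algebra_simps)
  have "y \<in> Mon (i' + j) (j' + j) (m' + j + (m + i'))" by (rule Mon_raise[OF y(4)])
  then have 2: "y \<in> Mon (j + i') (j' + j) ?M" by (simp add: algebra_simps)
  have "x \<otimes> y \<in> Mon (i + i') (j' + j) ?M" by (rule Mon_mult[OF 1 2]) simp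
  from Mon_G[OF this] have "x \<otimes> y \<in> G (int (i + i') - int (j' + j))" using x y by simp
  moreover have "int (i + i') - int (j' + j) = d + d'" using x y by simp
  ultimately show ?thesis by simp
qed

lemma Mon00_G: "x \<in> Mon 0 0 l \<Longrightarrow> x \<in> G 0"
  using Mon_G[of x 0 0 l] by simp

lemma E_G: assumes "v \<in> Vmin L l" shows "E l v \<in> G 0"
proof -
  obtain \<rho> where r: "\<rho> \<in> Sync L l" "E l v = e l \<rho>" using Vmin_cases[OF assms] by blast
  then have "mon [] l \<rho> [] = E l v" by (simp add: mon_def)
  then show ?thesis using Mon00_G Mon_mon[OF r(1), of "[]" "[]"] by simp
qed

lemma one_G: "\<one> \<in> G 0"
proof -
  have "E 0 v \<in> Mon 0 0 0" if v: "v \<in> Vmin L 0" for v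
  proof -
    obtain \<rho> where r: "\<rho> \<in> Sync L 0" "E 0 v = e 0 \<rho>" using Vmin_cases[OF v] by blast
    then have "mon [] 0 \<rho> [] = E 0 v" by (simp add: mon_def)
    then show ?thesis using Mon_mon[OF r(1), of "[]" "[]"] by simp
  qed
  then have "finsum A (E 0) (Vmin L 0) \<in> Mon 0 0 0" by (intro Mon_finsum) auto
  then show ?thesis using rels(4)[of 0] Mon00_G by simp
qed

lemma S_G: "S \<alpha> \<in> G 1"
proof -
  have "S \<alpha> \<otimes> E 1 v \<in> Mon 1 0 1" if v: "v \<in> Vmin L 1" for v
  proof -
    obtain \<rho> where r: "\<rho> \<in> Sync L 1" "E 1 v = e 1 \<rho>" using Vmin_cases[OF v] by blast
    then have "mon [\<alpha>] 1 \<rho> [] = S \<alpha> \<otimes> E 1 v" by (simp add: mon_def)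
    then show ?thesis using Mon_mon[OF r(1), of "[\<alpha>]" "[]"] by simp
  qed
  then have "finsum A (\<lambda>v. S \<alpha> \<otimes> E 1 v) (Vmin L 1) \<in> Mon 1 0 1" by (intro Mon_finsum) auto
  then have "S \<alpha> \<in> Mon 1 0 1" using one_sum_E'[of "S \<alpha>" 1] by simp
  from Mon_G[OF this] show ?thesis by simp
qed

lemma Sw_e_G: assumes "\<rho> \<in> Sync L m" "length \<mu> \<le> m" shows "Sw \<mu> \<otimes> e m \<rho> \<in> G (int (length \<mu>))"
proof -
  have "mon \<mu> m \<rho> [] = Sw \<mu> \<otimes> e m \<rho>" using assms by (simp add: mon_def)
  then show ?thesis using Mon_G[OF Mon_mon[OF assms(1), of \<mu> "[]"]] assms by simp
qed

lemma G0_common: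
  "finite D \<Longrightarrow> (\<And>t. t \<in> D \<Longrightarrow> x t \<in> G 0) \<Longrightarrow> \<exists>k m. k \<le> m \<and> (\<forall>t\<in>D. x t \<in> Mon k k m)"
proof (induction D rule: finite_induct)
  case (insert t D)
  then obtain k m where km: "k \<le> m" "\<forall>t\<in>D. x t \<in> Mon k k m" by auto
  have "x t \<in> G 0" using insert by simp
  then obtain i m' where i: "i \<le> m'" "x t \<in> Mon i i m'" by (auto simp: G_def)
  have "x t \<in> Mon (k + i) (k + i) (m + m' + k + i)"
    using Mon_raise[OF i(2), of k "m + i"] by (simp add: algebra_simps)
  moreover have "\<forall>t\<in>D. x t \<in> Mon (k + i) (k + i) (m + m' + k + i)"
    using km(2) Mon_raise[of _ k k m i "m' + k"] by (simp add: algebra_simps)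
  ultimately show ?case using km(1) by (intro exI[of _ "k + i"] exI[of _ "m + m' + k + i"]) auto
qed auto

text \<open>A monomial receives a factor z for each letter of its first word and the conjugate of z
  for each letter of its second.\<close>

lemma gauge_G:
  assumes h: "unital_star_hom A A \<gamma>" "\<And>\<alpha>. \<gamma> (S \<alpha>) = z \<odot> S \<alpha>" "\<And>l v. v \<in> Vmin L l \<Longrightarrow> \<gamma> (E l v) = E l v"
    and z: "cmod z = 1" and x: "x \<in> G d"
  shows "\<gamma> x = (z powi d) \<odot> x"
proof -
  interpret \<gamma>: cstar_hom A A \<gamma> by unfold_locales (rule h(1))
  obtain i j m where *: "int i - int j = d" "x \<in> Mon i j m" using x by (auto simp: G_def)
  have Sw: "\<gamma> (Sw \<mu>) = z ^ length \<mu> \<odot> Sw \<mu>" for \<mu>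
    by (induction \<mu>) (simp_all add: h(2) mult.commute)
  have z0: "z \<noteq> 0" using z by auto
  have "z * cnj z = 1" using z by (simp add: complex_norm_square[symmetric])
  from inverse_unique[OF this] have cz: "cnj z = inverse z" ..
  have "z ^ i * cnj z ^ j = z powi d"
    unfolding *(1)[symmetric] cz using z0 by (simp add: power_int_diff field_simps power_inverse)
  moreover have "\<gamma> x = (z ^ i * cnj z ^ j) \<odot> x" using *(2)
  proof (induction rule: Mon_lin_induct)
    case (mon \<mu> \<nu> \<rho>)
    have "\<gamma> (e m \<rho>) = e m \<rho>" using h(3)[of "vclass L m \<rho>" m] mon(3) by (simp add: e_def)
    then show ?case using mon by (simp add: mon_def Sw mult.commute)
  qed (simp_all add: sc_add_right mult.commute)
  ultimately show ?thesis by simp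
qed

section \<open>Density of finite sums of homogeneous elements\<close>

inductive_set Pol where
  G_Pol: "x \<in> G d \<Longrightarrow> x \<in> Pol"
| add_Pol: "x \<in> Pol \<Longrightarrow> y \<in> Pol \<Longrightarrow> x \<oplus> y \<in> Pol"

lemma Pol_closed: "x \<in> Pol \<Longrightarrow> x \<in> carrier A"
  by (induction rule: Pol.induct) (auto simp: G_closed)

lemma Pol_mult: assumes "x \<in> Pol" "y \<in> Pol" shows "x \<otimes> y \<in> Pol"
  using assms(1)
proof (induction rule: Pol.induct)
  case (G_Pol x d)
  show ?case using assms(2)
  proof (induction rule: Pol.induct)
    case (G_Pol y d') then show ?case using G_mult[OF \<open>x \<in> G d\<close>] Pol.G_Pol by blast
  next
    case (add_Pol y y')
    then show ?case using G_closed[OF G_Pol] Pol_closed Pol.add_Pol by (simp add: r_distr)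
  qed
next
  case (add_Pol x x')
  then show ?case using Pol_closed[OF assms(2)] Pol_closed Pol.add_Pol by (simp add: l_distr)
qed

lemma Pol_dense: assumes "x \<in> carrier A" "0 < \<epsilon>" obtains y where "y \<in> Pol" "nrm (y \<ominus> x) < \<epsilon>"
proof -
  have sub: "Pol \<subseteq> carrier A" using Pol_closed by blast
  have "cstar_subalgebra A (cl Pol)"
  proof (rule cl_subalgebra[OF sub])
    show "\<zero> \<in> Pol" by (rule G_Pol[OF G_zero[of 0]])
    show "x\<dagger> \<in> Pol" if "x \<in> Pol" for x using that
    proof (induction rule: Pol.induct)
      case (G_Pol x d) then show ?case using G_adj Pol.G_Pol by blast
    next
      case (add_Pol x y) then show ?case using Pol_closed Pol.add_Pol by simp
    qed
    have "c \<odot> x \<in> Pol" if "x \<in> Pol" for c x using that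
    proof (induction rule: Pol.induct)
      case (G_Pol x d) then show ?case using G_sc Pol.G_Pol by blast
    next
      case (add_Pol x y) then show ?case using Pol_closed Pol.add_Pol by (simp add: sc_add_right)
    qed
    then show "c \<odot> x \<in> cl Pol" if "x \<in> Pol" for c x using that subset_cl[OF sub] by blast
  qed (use Pol_mult add_Pol in auto)
  moreover have "\<one> \<in> cl Pol" using G_Pol[OF one_G] subset_cl[OF sub] by blast
  moreover have "range S \<union> {E l v | l v. v \<in> Vmin L l} \<subseteq> cl Pol"
    using G_Pol[OF S_G] G_Pol[OF E_G] subset_cl[OF sub] by blast
  ultimately have "cl Pol = carrier A" using generated unfolding generated_by_def by blast
  then show thesis using assms that unfolding cl_def by blast
qed

lemma Pol_rep:
  assumes "x \<in> Pol"
  shows "\<exists>y N. (\<forall>d. y d \<in> G d) \<and> (\<forall>d. \<bar>d\<bar> > int N \<longrightarrow> y d = \<zero>) \<and> x = finsum A y {- int N..int N}"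
  using assms
proof (induction rule: Pol.induct)
  case (G_Pol x d)
  let ?y = "\<lambda>d'. if d' = d then x else \<zero>"
  have "finsum A ?y {- int (nat \<bar>d\<bar>)..int (nat \<bar>d\<bar>)} = ?y d"
    by (rule finsum_single) (use G_Pol G_closed in auto)
  then show ?case using G_Pol by (intro exI[of _ ?y] exI[of _ "nat \<bar>d\<bar>"]) auto
next
  case (add_Pol x x')
  obtain y N where y: "\<forall>d. y d \<in> G d" "\<forall>d. \<bar>d\<bar> > int N \<longrightarrow> y d = \<zero>" "x = finsum A y {- int N..int N}" using add_Pol by blast
  obtain y' N' where y': "\<forall>d. y' d \<in> G d" "\<forall>d. \<bar>d\<bar> > int N' \<longrightarrow> y' d = \<zero>" "x' = finsum A y' {- int N'..int N'}" using add_Pol by blast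
  let ?M = "N + N'"
  have c: "y d \<in> carrier A" "y' d \<in> carrier A" for d using y(1) y'(1) G_closed by auto
  have "finsum A y {- int N..int N} = finsum A y {- int ?M..int ?M}"
    by (rule add.finprod_mono_neutral_cong_left) (use y(2) c in auto)
  moreover have "finsum A y' {- int N'..int N'} = finsum A y' {- int ?M..int ?M}"
    by (rule add.finprod_mono_neutral_cong_left) (use y'(2) c in auto)
  ultimately have "x \<oplus> x' = finsum A (\<lambda>d. y d \<oplus> y' d) {- int ?M..int ?M}"
    using c by (simp add: y(3) y'(3) finsum_addf Pi_def)
  then show ?case using y y' G_add
    by (intro exI[of _ "\<lambda>d. y d \<oplus> y' d"] exI[of _ ?M]) auto
qed

end

section \<open>Fejer means\<close>

text \<open>This is K times the Fejer weight of degree n: the number of pairs of indices below K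
  whose difference is -n.\<close>

lemma count_shifts:
  "(\<Sum>k<K. \<Sum>k'<K. if int k - int k' + n = 0 then 1 else 0 :: real) = max 0 (real K - \<bar>real_of_int n\<bar>)"
proof -
  have inner: "(\<Sum>k'<K. if int k - int k' + n = 0 then 1 else 0 :: real) = (if 0 \<le> int k + n \<and> int k + n < int K then 1 else 0)" for k
  proof -
    have "(\<Sum>k'<K. if int k - int k' + n = 0 then 1 else 0 :: real) = (\<Sum>k'<K. if k' = nat (int k + n) then (if 0 \<le> int k + n then 1 else 0) else 0)"
      by (rule sum.cong) auto
    also have "\<dots> = (if 0 \<le> int k + n \<and> int k + n < int K then 1 else 0)" by (subst sum.delta) auto
    finally show ?thesis .
  qed
  have "(\<Sum>k<K. if 0 \<le> int k + n \<and> int k + n < int K then 1 else 0 :: real) =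
     real (card {k \<in> {..<K}. 0 \<le> int k + n \<and> int k + n < int K})"
    by (simp add: sum.If_cases Int_def)
  also have "{k \<in> {..<K}. 0 \<le> int k + n \<and> int k + n < int K} = {nat (- n)..<nat (min (int K) (int K - n))}" by auto
  also have "real (card \<dots>) = max 0 (real K - \<bar>real_of_int n\<bar>)" by (auto simp: max_def)
  finally show ?thesis unfolding inner .
qed

lemma sum_roots_of_unity:
  assumes "\<bar>s\<bar> < int M"
  shows "(\<Sum>j<M. cis (2 * pi * real j / real M) powi s) = (if s = 0 then of_nat M else 0)"
proof (cases "s = 0")
  case False
  have M: "0 < M" using assms by simp
  define q where "q = cis (2 * pi * real_of_int s / real M)"
  have "cis (2 * pi * real j / real M) powi s = q ^ j" for j
    by (simp add: q_def cis_power_int DeMoivre algebra_simps)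
  then have "(\<Sum>j<M. cis (2 * pi * real j / real M) powi s) = (\<Sum>j<M. q ^ j)" by simp
  moreover have "q ^ M = 1"
  proof -
    have "q ^ M = cis (2 * pi * real_of_int s)" using M by (simp add: q_def DeMoivre)
    then show ?thesis by (simp add: cis_multiple_2pi)
  qed
  moreover have "q \<noteq> 1"
  proof
    assume "q = 1"
    then have "cos (2 * pi * real_of_int s / real M) = 1" by (simp add: q_def complex_eq_iff)
    then obtain n :: int where "2 * pi * real_of_int s / real M = of_int n * 2 * pi" using cos_one_2pi_int by blast
    then have "real_of_int s = of_int n * real M" using M by (simp add: field_simps)
    then have s: "s = n * int M" by (metis of_int_eq_iff of_int_mult of_int_of_nat_eq)
    then have "n \<noteq> 0" using False by auto
    then have "1 \<le> \<bar>n\<bar>" by simp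
    then have "int M \<le> \<bar>s\<bar>" using mult_right_mono[of 1 "\<bar>n\<bar>" "int M"] by (simp add: s abs_mult)
    then show False using assms by simp
  qed
  ultimately show ?thesis using False geometric_sum[of q M] by simp
qed simp

text \<open>The Fejer kernel |1 + z + ... + z ^ (K - 1)| ^ 2 / K is sampled at the M-th roots of
  unity instead of being integrated over the circle, so the mean becomes a finite
  combination.\<close>

lemma fejer_weights:
  assumes "0 < K"
  obtains M :: nat and \<kappa> :: "nat \<Rightarrow> real" and z :: "nat \<Rightarrow> complex"
  where "\<And>j. 0 \<le> \<kappa> j" "\<And>j. cmod (z j) = 1"
    "\<And>n. \<bar>n\<bar> \<le> int N \<Longrightarrow> (\<Sum>j<M. of_real (\<kappa> j) * z j powi n) = of_real (max 0 (1 - \<bar>real_of_int n\<bar> / real K))"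
proof -
  \<comment> \<open>The exponents k - k' + n that occur have modulus at most K - 1 + N, less than M,
    so only the exponent 0 survives the sum over the roots of unity.\<close>
  define M where "M = N + K + 1"
  define z where "z j = cis (2 * pi * real j / real M)" for j
  define \<kappa> where "\<kappa> j = (cmod (\<Sum>k<K. z j ^ k))\<^sup>2 / (real M * real K)" for j
  have M: "0 < M" by (simp add: M_def)
  have z: "cmod (z j) = 1" "z j \<noteq> 0" "cnj (z j) = inverse (z j)" for j
    by (simp_all add: z_def cis_cnj)
  have sq: "complex_of_real ((cmod (\<Sum>k<K. z j ^ k))\<^sup>2) = (\<Sum>k<K. \<Sum>k'<K. z j powi (int k - int k'))" for j
  proof -
    have "complex_of_real ((cmod (\<Sum>k<K. z j ^ k))\<^sup>2) = (\<Sum>k<K. z j ^ k) * cnj (\<Sum>k<K. z j ^ k)"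
      by (rule complex_norm_square)
    also have "\<dots> = (\<Sum>k<K. \<Sum>k'<K. z j ^ k * inverse (z j) ^ k')" by (simp add: z(3) sum_product)
    also have "\<dots> = (\<Sum>k<K. \<Sum>k'<K. z j powi (int k - int k'))"
      using z(2) by (simp add: power_int_diff power_inverse field_simps)
    finally show ?thesis .
  qed
  have "(\<Sum>j<M. of_real (\<kappa> j) * z j powi n) = of_real (max 0 (1 - \<bar>real_of_int n\<bar> / real K))" if n: "\<bar>n\<bar> \<le> int N" for n
  proof -
    have "(\<Sum>j<M. of_real (\<kappa> j) * z j powi n) = (\<Sum>j<M. \<Sum>k<K. \<Sum>k'<K. z j powi (int k - int k' + n)) / (of_nat M * of_nat K)"
      unfolding \<kappa>_def of_real_divide sq
      using z(2) by (simp add: sum_divide_distrib sum_distrib_right power_int_add[OF disjI1])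
    also have "(\<Sum>j<M. \<Sum>k<K. \<Sum>k'<K. z j powi (int k - int k' + n)) = (\<Sum>k<K. \<Sum>k'<K. \<Sum>j<M. z j powi (int k - int k' + n))"
      by (subst sum.swap) (rule sum.cong[OF refl], rule sum.swap)
    also have "\<dots> = (\<Sum>k<K. \<Sum>k'<K. if int k - int k' + n = 0 then of_nat M else 0)"
      unfolding z_def by (intro sum.cong refl sum_roots_of_unity) (use n in \<open>auto simp: M_def\<close>)
    also have "\<dots> = (\<Sum>k<K. \<Sum>k'<K. of_nat M * of_real (if int k - int k' + n = 0 then 1 else 0))"
      by (intro sum.cong refl) auto
    also have "\<dots> = of_nat M * of_real (max 0 (real K - \<bar>real_of_int n\<bar>))"
      unfolding count_shifts[symmetric] of_real_sum sum_distrib_left ..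
    also have "\<dots> / (of_nat M * of_nat K) = of_real (max 0 (real K - \<bar>real_of_int n\<bar>) / real K)" using M by simp
    also have "max 0 (real K - \<bar>real_of_int n\<bar>) / real K = max 0 (1 - \<bar>real_of_int n\<bar> / real K)"
      using assms by (auto simp: max_def field_simps)
    finally show ?thesis .
  qed
  then show thesis using that[of \<kappa> z M] z(1) by (simp add: \<kappa>_def)
qed

context cstar_alg begin

lemma finsum_sc_left: "finite D \<Longrightarrow> x \<in> carrier A \<Longrightarrow> finsum A (\<lambda>d. c d \<odot> x) D = (\<Sum>d\<in>D. c d) \<odot> x"
  by (induction D rule: finite_induct) (auto simp: sc_add_left Pi_def)

end

context min_cstar begin

definition poly :: "nat \<Rightarrow> (int \<Rightarrow> 'a) \<Rightarrow> bool" where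
  "poly N y \<longleftrightarrow> (\<forall>d. y d \<in> G d) \<and> (\<forall>d. \<bar>d\<bar> > int N \<longrightarrow> y d = \<zero>)"

definition psum :: "nat \<Rightarrow> (int \<Rightarrow> 'a) \<Rightarrow> 'a" where
  "psum N y = finsum A y {- int N..int N}"

lemma poly_closed: "poly N y \<Longrightarrow> y d \<in> carrier A"
  using G_closed by (auto simp: poly_def)

lemma psum_closed: "poly N y \<Longrightarrow> psum N y \<in> carrier A"
  using poly_closed by (auto simp: psum_def intro!: finsum_closed)

lemma poly_mono:
  assumes "poly N y" "N \<le> M" shows "poly M y" "psum M y = psum N y"
proof -
  show "poly M y" using assms by (auto simp: poly_def)
  show "psum M y = psum N y" unfolding psum_def
    by (rule add.finprod_mono_neutral_cong_left[symmetric]) (use assms poly_closed[OF assms(1)] in \<open>auto simp: poly_def\<close>)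
qed

lemma poly_minus:
  assumes "poly N y" "poly N y'" shows "poly N (\<lambda>d. y d \<ominus> y' d)" "psum N (\<lambda>d. y d \<ominus> y' d) = psum N y \<ominus> psum N y'"
proof -
  note c = poly_closed[OF assms(1)] poly_closed[OF assms(2)]
  have m: "y d \<ominus> y' d = y d \<oplus> (-1) \<odot> y' d" for d using c by (simp add: a_minus_def neg_sc)
  show "poly N (\<lambda>d. y d \<ominus> y' d)" using assms unfolding m poly_def by (simp add: G_add G_sc)
  have "psum N (\<lambda>d. y d \<ominus> y' d) = psum N y \<oplus> finsum A (\<lambda>d. (-1) \<odot> y' d) {- int N..int N}"
    unfolding m psum_def by (rule finsum_addf) (use c in auto)
  also have "finsum A (\<lambda>d. (-1) \<odot> y' d) {- int N..int N} = (-1) \<odot> psum N y'"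
    unfolding psum_def by (rule finsum_sc[symmetric]) (use c in auto)
  finally show "psum N (\<lambda>d. y d \<ominus> y' d) = psum N y \<ominus> psum N y'"
    using psum_closed[OF assms(2)] by (simp add: a_minus_def neg_sc)
qed

definition fejer :: "nat \<Rightarrow> nat \<Rightarrow> (int \<Rightarrow> 'a) \<Rightarrow> 'a" where
  "fejer K N y = finsum A (\<lambda>d. of_real (max 0 (1 - \<bar>real_of_int d\<bar> / real K)) \<odot> y d) {- int N..int N}"

text \<open>The Fejer mean is a combination of images under gauge homomorphisms, with nonnegative
  weights adding up to one; by \<open>star_hom_contractive\<close> no image has larger norm.\<close>

lemma nrm_fejer:
  assumes y: "poly N y" and K: "0 < K"
  shows "nrm (fejer K N y) \<le> nrm (psum N y)"
proof -
  obtain M :: nat and \<kappa> :: "nat \<Rightarrow> real" and z :: "nat \<Rightarrow> complex"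
  where w: "\<And>j. 0 \<le> \<kappa> j" "\<And>j. cmod (z j) = 1"
    "\<And>n. \<bar>n\<bar> \<le> int N \<Longrightarrow> (\<Sum>j<M. of_real (\<kappa> j) * z j powi n) = of_real (max 0 (1 - \<bar>real_of_int n\<bar> / real K))"
    using fejer_weights[OF K] by metis
  have "\<forall>j. \<exists>\<gamma>. unital_star_hom A A \<gamma> \<and> (\<forall>n. \<forall>x\<in>G n. \<gamma> x = (z j powi n) \<odot> x)"
    using gauge[OF w(2)] gauge_G[OF _ _ _ w(2)] by metis
  then obtain \<gamma> where \<gamma>: "\<And>j. unital_star_hom A A (\<gamma> j)" "\<And>j n x. x \<in> G n \<Longrightarrow> \<gamma> j x = (z j powi n) \<odot> x" by metis
  have hom: "cstar_hom A A (\<gamma> j)" for j using \<gamma>(1) by unfold_locales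
  note yc = poly_closed[OF y]
  have yG: "y d \<in> G d" for d using y by (simp add: poly_def)
  let ?w = "\<lambda>d. of_real (max 0 (1 - \<bar>real_of_int d\<bar> / real K)) :: complex"
  have "finsum A (\<lambda>j. of_real (\<kappa> j) \<odot> \<gamma> j (finsum A y D)) {..<M} = finsum A (\<lambda>d. ?w d \<odot> y d) D"
    if "finite D" "D \<subseteq> {- int N..int N}" for D
    using that
  proof (induction D rule: finite_induct)
    case empty
    have "\<gamma> j \<zero> = \<zero>" for j using cstar_hom.hom_zero[OF hom] .
    then show ?case by (simp add: finsum_all_zero)
  next
    case (insert d D)
    have R: "finsum A y D \<in> carrier A" using yc by (auto intro!: finsum_closed)
    have gc: "\<gamma> j x \<in> carrier A" if "x \<in> carrier A" for j x using unital_star_homD(1)[OF \<gamma>(1) that] .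
    have "of_real (\<kappa> j) \<odot> \<gamma> j (finsum A y (insert d D)) = (of_real (\<kappa> j) * z j powi d) \<odot> y d \<oplus> of_real (\<kappa> j) \<odot> \<gamma> j (finsum A y D)" for j
      using insert yc R gc unital_star_homD(3)[OF \<gamma>(1), of "y d" "finsum A y D" j]
      by (simp add: finsum_insert \<gamma>(2)[OF yG] sc_add_right)
    then have "finsum A (\<lambda>j. of_real (\<kappa> j) \<odot> \<gamma> j (finsum A y (insert d D))) {..<M} =
      finsum A (\<lambda>j. (of_real (\<kappa> j) * z j powi d) \<odot> y d) {..<M} \<oplus> finsum A (\<lambda>j. of_real (\<kappa> j) \<odot> \<gamma> j (finsum A y D)) {..<M}"
      using yc R gc by (simp add: finsum_addf Pi_def)
    also have "\<dots> = ?w d \<odot> y d \<oplus> finsum A (\<lambda>d. ?w d \<odot> y d) D"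
    proof -
      have "\<bar>d\<bar> \<le> int N" using insert.prems by auto
      then show ?thesis using insert yc w(3)[of d] by (simp add: finsum_sc_left)
    qed
    also have "\<dots> = finsum A (\<lambda>d. ?w d \<odot> y d) (insert d D)" using insert yc by (simp add: finsum_insert)
    finally show ?case .
  qed
  from this[of "{- int N..int N}"] have f: "fejer K N y = finsum A (\<lambda>j. of_real (\<kappa> j) \<odot> \<gamma> j (psum N y)) {..<M}"
    by (simp add: fejer_def psum_def)
  have gle: "nrm (\<gamma> j (psum N y)) \<le> nrm (psum N y)" for j
    by (rule star_hom_contractive[OF cstar cstar \<gamma>(1) psum_closed[OF y]])
  have gc: "\<gamma> j (psum N y) \<in> carrier A" for j using unital_star_homD(1)[OF \<gamma>(1) psum_closed[OF y]] .
  have "nrm (fejer K N y) \<le> (\<Sum>j<M. nrm (of_real (\<kappa> j) \<odot> \<gamma> j (psum N y)))"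
    unfolding f by (rule nrm_finsum) (use gc in auto)
  also have "\<dots> \<le> (\<Sum>j<M. \<kappa> j * nrm (psum N y))"
    using gle gc w(1) by (intro sum_mono) (simp add: mult_left_mono)
  also have "\<dots> = nrm (psum N y)"
  proof -
    \<comment> \<open>The weight of degree zero is the total weight.\<close>
    have "complex_of_real (\<Sum>j<M. \<kappa> j) = 1" using w(3)[of 0] by simp
    then have "(\<Sum>j<M. \<kappa> j) = 1" by (metis of_real_eq_1_iff)
    then show ?thesis by (simp add: sum_distrib_right[symmetric])
  qed
  finally show ?thesis .
qed

lemma fejer_minus:
  assumes "poly N y" "poly N y'" shows "fejer K N (\<lambda>d. y d \<ominus> y' d) = fejer K N y \<ominus> fejer K N y'"
proof -
  note c = poly_closed[OF assms(1)] poly_closed[OF assms(2)]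
  let ?w = "\<lambda>d. of_real (max 0 (1 - \<bar>real_of_int d\<bar> / real K)) :: complex"
  have "?w d \<odot> (y d \<ominus> y' d) = ?w d \<odot> y d \<oplus> (-1) \<odot> ?w d \<odot> y' d" for d
    using c by (simp add: sc_add_right a_minus_def neg_sc)
  then have "fejer K N (\<lambda>d. y d \<ominus> y' d) = finsum A (\<lambda>d. ?w d \<odot> y d \<oplus> (-1) \<odot> ?w d \<odot> y' d) {- int N..int N}"
    by (simp only: fejer_def)
  also have "\<dots> = fejer K N y \<oplus> finsum A (\<lambda>d. (-1) \<odot> ?w d \<odot> y' d) {- int N..int N}"
    unfolding fejer_def by (rule finsum_addf) (use c in auto)
  also have "finsum A (\<lambda>d. (-1) \<odot> ?w d \<odot> y' d) {- int N..int N} = (-1) \<odot> fejer K N y'"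
    unfolding fejer_def by (rule finsum_sc[symmetric]) (use c in auto)
  finally show ?thesis using c by (simp add: a_minus_def neg_sc fejer_def finsum_closed Pi_def)
qed

text \<open>Near \<open>b\<close> the homogeneous parts cannot all be small: otherwise a fixed Fejer mean,
  which is a contraction and involves boundedly many degrees, would be small at \<open>b\<close>.\<close>
lemma large_coefficient:
  assumes b: "b \<in> carrier A" "b \<noteq> \<zero>"
  obtains c \<delta> where "0 < c" "0 < \<delta>" "\<And>N y. poly N y \<Longrightarrow> nrm (psum N y \<ominus> b) < \<delta> \<Longrightarrow> \<exists>n\<in>{- int N..int N}. c \<le> nrm (y n)"
proof -
  \<comment> \<open>The estimates below add up to 5 \<eta>, less than the norm of
    \<open>b\<close>.\<close>
  define \<eta> where "\<eta> = nrm b / 8"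
  have "nrm b \<noteq> 0" using b by simp
  then have \<eta>: "0 < \<eta>" using nrm_ge[OF b(1)] by (simp add: \<eta>_def)
  obtain x where x: "x \<in> Pol" "nrm (x \<ominus> b) < \<eta>" using Pol_dense[OF b(1) \<eta>] .
  obtain y' N' where y': "poly N' y'" "nrm (psum N' y' \<ominus> b) < \<eta>"
    using Pol_rep[OF x(1)] x(2) by (auto simp: poly_def psum_def)
  \<comment> \<open>T / K bounds the distance between the fixed approximant and its Fejer mean. K is
    chosen from T, before the polynomial to be tested, so the constants do not depend on the
    latter.\<close>
  define T where "T = (\<Sum>d\<in>{- int N'..int N'}. \<bar>real_of_int d\<bar> * nrm (y' d))"
  have T: "0 \<le> T" unfolding T_def using poly_closed[OF y'(1)] by (intro sum_nonneg) auto
  obtain K0 :: nat where K0: "T / \<eta> < real K0" using reals_Archimedean2 by blast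
  define K where "K = K0 + N' + 1"
  have K: "0 < K" "T / real K < \<eta>" "N' < K"
  proof -
    show "0 < K" "N' < K" by (simp_all add: K_def)
    have "T / \<eta> < real K" using K0 by (simp add: K_def)
    then show "T / real K < \<eta>" using \<eta> \<open>0 < K\<close> by (simp add: field_simps)
  qed
  have close: "nrm (psum N y' \<ominus> fejer K N y') \<le> T / real K" if N: "N' \<le> N" for N
  proof -
    note c = poly_closed[OF y'(1)]
    let ?w = "\<lambda>d. of_real (max 0 (1 - \<bar>real_of_int d\<bar> / real K)) :: complex"
    have fc: "fejer K N y' \<in> carrier A" unfolding fejer_def using c by (auto intro!: finsum_closed)
    have "psum N y' \<ominus> fejer K N y' = psum N y' \<oplus> (-1) \<odot> fejer K N y'" using fc by (simp add: a_minus_def neg_sc)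
    also have "(-1) \<odot> fejer K N y' = finsum A (\<lambda>d. (-1) \<odot> ?w d \<odot> y' d) {- int N..int N}"
      unfolding fejer_def by (rule finsum_sc) (use c in auto)
    also have "psum N y' \<oplus> \<dots> = finsum A (\<lambda>d. y' d \<oplus> (-1) \<odot> ?w d \<odot> y' d) {- int N..int N}"
      unfolding psum_def by (rule finsum_addf[symmetric]) (use c in auto)
    also have "nrm \<dots> \<le> (\<Sum>d\<in>{- int N..int N}. nrm (y' d \<oplus> (-1) \<odot> ?w d \<odot> y' d))"
      by (rule nrm_finsum) (use c in auto)
    also have "\<dots> = (\<Sum>d\<in>{- int N'..int N'}. nrm (y' d \<oplus> (-1) \<odot> ?w d \<odot> y' d))"
      by (rule sum.mono_neutral_right) (use N y'(1) in \<open>auto simp: poly_def\<close>)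
    also have "\<dots> = (\<Sum>d\<in>{- int N'..int N'}. \<bar>real_of_int d\<bar> * nrm (y' d) / real K)"
    proof (rule sum.cong[OF refl])
      fix d assume d: "d \<in> {- int N'..int N'}"
      then have "\<bar>real_of_int d\<bar> \<le> real K" using K(3) by auto
      then have wd: "max 0 (1 - \<bar>real_of_int d\<bar> / real K) = 1 - \<bar>real_of_int d\<bar> / real K" using K(1) by (simp add: max_def)
      have "y' d \<oplus> (-1) \<odot> ?w d \<odot> y' d = (1 - ?w d) \<odot> y' d"
        using c sc_minus_left[of "y' d" 1 "?w d"] by (simp add: a_minus_def neg_sc)
      also have "1 - ?w d = of_real (\<bar>real_of_int d\<bar> / real K)" unfolding wd by simp
      finally show "nrm (y' d \<oplus> (-1) \<odot> ?w d \<odot> y' d) = \<bar>real_of_int d\<bar> * nrm (y' d) / real K" using c by (simp add: norm_divide)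
    qed
    also have "\<dots> = T / real K" by (simp add: T_def sum_divide_distrib)
    finally show ?thesis .
  qed
  \<comment> \<open>At most 2 K + 1 degrees have a nonzero weight, so if all coefficients were below
    this bound the Fejer mean would have norm at most \<eta>.\<close>
  define cc where "cc = \<eta> / (2 * real K + 1)"
  have "\<exists>n\<in>{- int N..int N}. cc \<le> nrm (y n)" if y: "poly N y" "nrm (psum N y \<ominus> b) < \<eta>" for N y
  proof (rule ccontr)
    assume "\<not> ?thesis"
    then have small: "nrm (y n) < cc" if "n \<in> {- int N..int N}" for n using that by (meson not_le)
    let ?M = "N + N'"
    note p = poly_mono[OF y(1), of ?M] poly_mono[OF y'(1), of ?M]
    have P: "poly ?M y" "psum ?M y = psum N y" "poly ?M y'" "psum ?M y' = psum N' y'" using p by simp_all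
    note c = poly_closed[OF y(1)] poly_closed[OF y'(1)]
    have fc: "fejer K ?M y \<in> carrier A" "fejer K ?M y' \<in> carrier A" unfolding fejer_def using c by (auto intro!: finsum_closed)
    have sc: "psum N y \<in> carrier A" "psum N' y' \<in> carrier A" using psum_closed y y' by auto
    have cc: "0 < cc" using \<eta> by (simp add: cc_def)
    have "nrm (fejer K ?M y) \<le> (\<Sum>d\<in>{- int ?M..int ?M}. nrm (of_real (max 0 (1 - \<bar>real_of_int d\<bar> / real K)) \<odot> y d))"
      unfolding fejer_def by (rule nrm_finsum) (use c in auto)
    also have "\<dots> \<le> (\<Sum>d\<in>{- int ?M..int ?M}. if d \<in> {- int K..int K} then cc else 0)"
    proof (rule sum_mono)
      fix d assume "d \<in> {- int ?M..int ?M}"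
      have yd: "nrm (y d) \<le> cc"
      proof (cases "d \<in> {- int N..int N}")
        case True then show ?thesis using small by (simp add: less_imp_le)
      next
        case False then have "y d = \<zero>" using y(1) by (auto simp: poly_def)
        then show ?thesis using cc by simp
      qed
      show "nrm (of_real (max 0 (1 - \<bar>real_of_int d\<bar> / real K)) \<odot> y d) \<le> (if d \<in> {- int K..int K} then cc else 0)"
      proof (cases "d \<in> {- int K..int K}")
        case True
        have "\<bar>max 0 (1 - \<bar>real_of_int d\<bar> / real K)\<bar> * nrm (y d) \<le> 1 * cc"
          using yd c cc by (intro mult_mono) auto
        then show ?thesis using True c by simp
      next
        case False
        then have "real K \<le> \<bar>real_of_int d\<bar>" by auto
        then have "max 0 (1 - \<bar>real_of_int d\<bar> / real K) = 0" using K(1) by (simp add: max_def field_simps)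
        then show ?thesis using c cc by simp
      qed
    qed
    also have "\<dots> \<le> (\<Sum>d\<in>{- int K..int K}. cc)"
      using cc by (subst sum.inter_restrict[symmetric]) (auto intro!: sum_mono2)
    also have "\<dots> = \<eta>" by (simp add: cc_def)
    finally have s4: "nrm (fejer K ?M y) \<le> \<eta>" .
    have "nrm (fejer K ?M y' \<ominus> fejer K ?M y) \<le> nrm (psum N' y' \<ominus> psum N y)"
      using nrm_fejer[OF poly_minus(1)[OF P(3,1)] K(1)] poly_minus(2)[OF P(3,1)] fejer_minus[OF P(3,1)] P(2,4) by simp
    also have "\<dots> \<le> nrm (psum N' y' \<ominus> b) + nrm (b \<ominus> psum N y)" using nrm_triangle sc b(1) by blast
    also have "\<dots> \<le> 2 * \<eta>" using y(2) y'(2) nrm_minus_commute[OF b(1) sc(1)] by simp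
    finally have s3: "nrm (fejer K ?M y' \<ominus> fejer K ?M y) \<le> 2 * \<eta>" .
    have s2: "nrm (psum N' y' \<ominus> fejer K ?M y') \<le> \<eta>" using close[of ?M] K(2) P(4) by simp
    have "nrm b \<le> nrm (psum N' y') + nrm (psum N' y' \<ominus> b)" using nrm_le_add_minus'[OF b(1) sc(2)] .
    moreover have "nrm (psum N' y') \<le> nrm (fejer K ?M y') + nrm (psum N' y' \<ominus> fejer K ?M y')" using nrm_le_add_minus[OF sc(2) fc(2)] .
    moreover have "nrm (fejer K ?M y') \<le> nrm (fejer K ?M y) + nrm (fejer K ?M y' \<ominus> fejer K ?M y)" using nrm_le_add_minus[OF fc(2,1)] .
    ultimately have "nrm b \<le> 5 * \<eta>" using s2 s3 s4 y'(2) by linarith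
    then show False using \<eta> by (simp add: \<eta>_def)
  qed
  moreover have "0 < cc" using \<eta> by (simp add: cc_def)
  ultimately show thesis using that[of cc \<eta>] \<eta> by blast
qed

end

section \<open>Compression to a vertex projection\<close>

context min_cstar begin

lemma nrm_S_le: "nrm (S \<alpha>) \<le> 1"
proof -
  have "(nrm (S \<alpha>))\<^sup>2 \<le> 1\<^sup>2" using nrm_cstar'[of "S \<alpha>"] nrm_proj_le[OF S_proj[of \<alpha>]] by simp
  then show ?thesis by (rule power2_le_imp_le) simp
qed

text \<open>Insert the sum of all S \<alpha> (S \<alpha>)\<dagger> behind x, once per letter. The
  crude factor is harmless because roots of the estimate are taken later.\<close>

lemma nrm_le_words:
  assumes "x \<in> carrier A" "\<And>\<mu>. length \<mu> = k \<Longrightarrow> nrm (x \<otimes> Sw \<mu>) \<le> C" 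
  shows "nrm x \<le> real (card (UNIV :: 's set)) ^ k * C"
  using assms
proof (induction k arbitrary: x)
  case 0
  then show ?case using "0.prems"(2)[of "[]"] by simp
next
  case (Suc k)
  let ?n = "real (card (UNIV :: 's set))"
  have a: "nrm (x \<otimes> S \<alpha>) \<le> ?n ^ k * C" for \<alpha>
  proof (rule Suc.IH)
    fix \<mu> :: "'s list" assume "length \<mu> = k"
    then show "nrm (x \<otimes> S \<alpha> \<otimes> Sw \<mu>) \<le> C" using Suc.prems(2)[of "\<alpha> # \<mu>"] Suc.prems(1) by (simp add: m_assoc)
  qed (use Suc.prems in simp)
  have "x = x \<otimes> finsum A (\<lambda>\<alpha>. S \<alpha> \<otimes> (S \<alpha>)\<dagger>) UNIV" using Suc.prems(1) rels(3) by simp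
  also have "\<dots> = finsum A (\<lambda>\<alpha>. x \<otimes> (S \<alpha> \<otimes> (S \<alpha>)\<dagger>)) UNIV" using Suc.prems(1) by (intro mult_finsum_left) auto
  finally have "nrm x \<le> (\<Sum>\<alpha>\<in>UNIV. nrm (x \<otimes> (S \<alpha> \<otimes> (S \<alpha>)\<dagger>)))"
    using nrm_finsum[of UNIV "\<lambda>\<alpha>. x \<otimes> (S \<alpha> \<otimes> (S \<alpha>)\<dagger>)"] Suc.prems(1) by simp
  also have "\<dots> \<le> (\<Sum>\<alpha>\<in>(UNIV :: 's set). ?n ^ k * C)"
  proof (rule sum_mono)
    fix \<alpha>
    have "nrm ((x \<otimes> S \<alpha>) \<otimes> (S \<alpha>)\<dagger>) \<le> (?n ^ k * C) * 1"
      by (rule nrm_mult_le) (use a nrm_S_le Suc.prems(1) in auto)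
    then show "nrm (x \<otimes> (S \<alpha> \<otimes> (S \<alpha>)\<dagger>)) \<le> ?n ^ k * C" using Suc.prems(1) by (simp add: m_assoc)
  qed
  finally show ?case by (simp add: mult.assoc)
qed

lemma nrm_e_le: "\<nu> \<in> Sync L m \<Longrightarrow> nrm (e m \<nu>) \<le> 1"
  by (rule nrm_proj_le[OF e_proj])

lemma nrm_Sw_e_le: assumes "\<nu> \<in> Sync L m" "length \<mu> \<le> m" shows "nrm (Sw \<mu> \<otimes> e m \<nu>) \<le> 1"
proof -
  have "(Sw \<mu> \<otimes> e m \<nu>)\<dagger> \<otimes> (Sw \<mu> \<otimes> e m \<nu>) = e m \<nu> \<otimes> ((Sw \<mu>)\<dagger> \<otimes> (Sw \<mu> \<otimes> e m \<nu>))" using assms by (simp add: m_assoc)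
  also have "\<dots> = (if \<mu> @ \<nu> \<in> Bstar L then e m \<nu> else \<zero>)" using Sw_Sw_e[OF assms] assms by simp
  finally have "(nrm (Sw \<mu> \<otimes> e m \<nu>))\<^sup>2 \<le> 1\<^sup>2"
    using nrm_cstar[of "Sw \<mu> \<otimes> e m \<nu>"] assms nrm_e_le[OF assms(1)] by (auto split: if_splits)
  then show ?thesis by (rule power2_le_imp_le) simp
qed

lemma Mon_pow: assumes "z \<in> Mon k k m" "k \<le> m" shows "z [^] Suc n \<in> Mon k k m"
proof (induction n)
  case 0 then show ?case using assms Mon_closed[OF assms(1)] by simp
next
  case (Suc n) then show ?case using Mon_mult[OF Suc.IH assms] by simp
qed

lemma Mon_pow_conj: assumes "z \<in> Mon k k m" "k \<le> m" "x \<in> Mon k k m" shows "z [^] (n::nat) \<otimes> (x \<otimes> z [^] n) \<in> Mon k k m"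
proof (cases n)
  case 0 then show ?thesis using assms Mon_closed by simp
next
  case (Suc j)
  have "z [^] Suc j \<in> Mon k k m" by (rule Mon_pow[OF assms(1,2)])
  then show ?thesis unfolding Suc using Mon_mult assms by blast
qed

text \<open>The norms \<open>a i = |z\<^sup>i u|\<close> and \<open>b i = |y\<^sup>* z\<^sup>i u|\<close> satisfy \<open>a (i+1)\<^sup>2 \<le> b i * b (i+1)\<close>, so if \<open>b i \<le> \<rho> * a i\<close>
  throughout, then \<open>|z\<^sup>i u| \<le> \<rho> ^ (2 * i)\<close>. Summing over the finitely many \<open>u\<close> and taking roots yields \<open>|y| \<le> \<rho>\<close>.\<close>
lemma norming_vector:
  assumes y: "y \<in> carrier A" "y \<otimes> y\<dagger> \<in> Mon k k m" and km: "k \<le> m" and \<rho>: "0 \<le> \<rho>" "\<rho> < nrm y"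
  obtains i :: nat and \<mu> \<nu> where "length \<mu> = k" "\<nu> \<in> Sync L m"
    "\<rho> * nrm ((y \<otimes> y\<dagger>) [^] i \<otimes> (Sw \<mu> \<otimes> e m \<nu>)) < nrm (y\<dagger> \<otimes> ((y \<otimes> y\<dagger>) [^] i \<otimes> (Sw \<mu> \<otimes> e m \<nu>)))"
proof (rule ccontr)
  note normed = that
  assume no: "\<not> thesis"
  have le: "nrm (y\<dagger> \<otimes> ((y \<otimes> y\<dagger>) [^] i \<otimes> (Sw \<mu> \<otimes> e m \<nu>))) \<le> \<rho> * nrm ((y \<otimes> y\<dagger>) [^] i \<otimes> (Sw \<mu> \<otimes> e m \<nu>))"
    if w: "length \<mu> = k" "\<nu> \<in> Sync L m" for i :: nat and \<mu> \<nu>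
    by (rule leI, rule notI, rule notE[OF no], rule normed[OF w])
  define z where "z = y \<otimes> y\<dagger>"
  have z: "z \<in> carrier A" "z\<dagger> = z" using y by (auto simp: z_def)
  have bound: "nrm (z [^] i \<otimes> (Sw \<mu> \<otimes> e m \<nu>)) \<le> (\<rho>\<^sup>2) ^ i" if \<mu>: "length \<mu> = k" "\<nu> \<in> Sync L m" for i :: nat and \<mu> \<nu>
  proof (induction i)
    case 0 then show ?case using nrm_Sw_e_le[of \<nu> m \<mu>] \<mu> km by simp
  next
    case (Suc i)
    let ?u = "Sw \<mu> \<otimes> e m \<nu>"
    have u: "?u \<in> carrier A" using \<mu> by simp
    define p where "p = z [^] i \<otimes> ?u"
    define q where "q = z [^] Suc i \<otimes> ?u"
    have pq: "p \<in> carrier A" "q \<in> carrier A" using z u by (auto simp: p_def q_def)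
    have qp: "q = y \<otimes> (y\<dagger> \<otimes> p)"
    proof -
      have "q = z \<otimes> p" unfolding p_def q_def nat_pow_Suc2[OF z(1)] using z(1) u by (simp add: m_assoc)
      then show ?thesis using y pq by (simp add: z_def m_assoc)
    qed
    have "(nrm q)\<^sup>2 = nrm ((y\<dagger> \<otimes> p)\<dagger> \<otimes> (y\<dagger> \<otimes> q))"
    proof -
      have "q\<dagger> \<otimes> q = (y\<dagger> \<otimes> p)\<dagger> \<otimes> (y\<dagger> \<otimes> q)"
        by (subst (1) qp) (use y pq in \<open>simp add: m_assoc\<close>)
      then show ?thesis using nrm_cstar[OF pq(2)] by simp
    qed
    also have "\<dots> \<le> nrm (y\<dagger> \<otimes> p) * nrm (y\<dagger> \<otimes> q)"
      using nrm_mult[of "(y\<dagger> \<otimes> p)\<dagger>" "y\<dagger> \<otimes> q"] y pq by (simp del: adj_mult)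
    also have "\<dots> \<le> (\<rho> * nrm p) * (\<rho> * nrm q)"
      using le[OF \<mu>, of i] le[OF \<mu>, of "Suc i"] y pq \<rho> unfolding z_def[symmetric] p_def[symmetric] q_def[symmetric]
      by (intro mult_mono) auto
    finally have "nrm q * nrm q \<le> (\<rho>\<^sup>2 * nrm p) * nrm q" by (simp add: power2_eq_square algebra_simps)
    then have "nrm q \<le> \<rho>\<^sup>2 * nrm p \<or> nrm q = 0"
      using nrm_ge[OF pq(2)] by (auto simp: mult_le_cancel_right)
    then have "nrm q \<le> \<rho>\<^sup>2 * nrm p" using nrm_ge[OF pq(1)] by auto
    also have "\<dots> \<le> \<rho>\<^sup>2 * (\<rho>\<^sup>2) ^ i" using Suc.IH unfolding p_def by (intro mult_left_mono) auto
    finally show ?case unfolding q_def by simp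
  qed
  \<comment> \<open>Independent of the exponent i, so it disappears in
    \<open>pow2_bound\<close>.\<close>
  define C where "C = real (card (UNIV :: 's set)) ^ k * real (card (Vmin L m))"
  have "nrm (z [^] i) \<le> C * (\<rho>\<^sup>2) ^ i" for i :: nat
  proof -
    have "nrm (z [^] i) \<le> real (card (UNIV :: 's set)) ^ k * (real (card (Vmin L m)) * (\<rho>\<^sup>2) ^ i)"
    proof (rule nrm_le_words)
      show "z [^] i \<in> carrier A" using z by simp
      fix \<mu> :: "'s list" assume \<mu>: "length \<mu> = k"
      have x: "z [^] i \<otimes> Sw \<mu> \<in> carrier A" using z by simp
      have "nrm (z [^] i \<otimes> Sw \<mu>) = nrm (finsum A (\<lambda>v. z [^] i \<otimes> Sw \<mu> \<otimes> E m v) (Vmin L m))"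
        by (simp add: one_sum_E'[OF x])
      also have "\<dots> \<le> (\<Sum>v\<in>Vmin L m. nrm (z [^] i \<otimes> Sw \<mu> \<otimes> E m v))"
        by (rule nrm_finsum) (use x in auto)
      also have "\<dots> \<le> (\<Sum>v\<in>Vmin L m. (\<rho>\<^sup>2) ^ i)"
      proof (rule sum_mono)
        fix v assume "v \<in> Vmin L m"
        then obtain \<nu> where "\<nu> \<in> Sync L m" "E m v = e m \<nu>" using Vmin_cases by blast
        then show "nrm (z [^] i \<otimes> Sw \<mu> \<otimes> E m v) \<le> (\<rho>\<^sup>2) ^ i" using bound[OF \<mu>, of \<nu> i] z by (simp add: m_assoc)
      qed
      finally show "nrm (z [^] i \<otimes> Sw \<mu>) \<le> real (card (Vmin L m)) * (\<rho>\<^sup>2) ^ i" by simp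
    qed
    then show ?thesis by (simp add: C_def mult.assoc)
  qed
  then have pows: "nrm z ^ (2 ^ n) \<le> C * (\<rho>\<^sup>2) ^ (2 ^ n)" for n :: nat using nrm_pow_sa[OF z, of n] by metis
  have "nrm z \<le> \<rho>\<^sup>2" by (rule pow2_bound[OF nrm_ge[OF z(1)] zero_le_power2 pows])
  then have "(nrm y)\<^sup>2 \<le> \<rho>\<^sup>2" using nrm_cstar'[OF y(1)] by (simp add: z_def)
  then have "nrm y \<le> \<rho>" using \<rho>(1) by (rule power2_le_imp_le)
  then show False using \<rho> by simp
qed

text \<open>No two of the first tails of \<xi> are prefixes of one another, the condition under
  which \<open>Mon_compress_zero\<close> applies whenever i + j \<le> J.\<close>

definition aperiodic :: "nat \<Rightarrow> 's list \<Rightarrow> bool" where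
  "aperiodic J \<xi> \<longleftrightarrow> J \<le> length \<xi> \<and> (\<forall>p q. p < q \<longrightarrow> q \<le> J \<longrightarrow> take (length \<xi> - q) (drop p \<xi>) \<noteq> drop q \<xi>)"

lemma aperiodic_mono: "aperiodic J \<xi> \<Longrightarrow> J' \<le> J \<Longrightarrow> aperiodic J' \<xi>"
  by (auto simp: aperiodic_def)

lemma G_compress_zero: assumes "x \<in> G d" "d \<noteq> 0" shows "\<exists>J. \<forall>\<xi>. aperiodic J \<xi> \<longrightarrow> (Sw \<xi>)\<dagger> \<otimes> (x \<otimes> Sw \<xi>) = \<zero>"
proof -
  obtain i j m where x: "int i - int j = d" "i \<le> m" "j \<le> m" "x \<in> Mon i j m" using assms(1) by (auto simp: G_def)
  then have "i \<noteq> j" using assms(2) by auto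
  then show ?thesis using Mon_compress_zero[OF x(4,2,3)] by (intro exI[of _ "i + j"]) (auto simp: aperiodic_def)
qed

lemma compress_common:
  assumes "finite F" "\<And>t. t \<in> F \<Longrightarrow> \<exists>d. d \<noteq> 0 \<and> x t \<in> G d"
  shows "\<exists>J. \<forall>t\<in>F. \<forall>\<xi>. aperiodic J \<xi> \<longrightarrow> (Sw \<xi>)\<dagger> \<otimes> (x t \<otimes> Sw \<xi>) = \<zero>"
  using assms
proof (induction F rule: finite_induct)
  case (insert t F)
  obtain J where J: "\<forall>t\<in>F. \<forall>\<xi>. aperiodic J \<xi> \<longrightarrow> (Sw \<xi>)\<dagger> \<otimes> (x t \<otimes> Sw \<xi>) = \<zero>" using insert by auto
  obtain J' where J': "\<forall>\<xi>. aperiodic J' \<xi> \<longrightarrow> (Sw \<xi>)\<dagger> \<otimes> (x t \<otimes> Sw \<xi>) = \<zero>"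
    using insert.prems[of t] G_compress_zero by blast
  show ?case using J J' aperiodic_mono[of "J + J'" _ J] aperiodic_mono[of "J + J'" _ J']
    by (intro exI[of _ "J + J'"]) auto
qed auto

lemma e_scalar_pow:
  assumes "z \<in> Mon k k m" "k \<le> m" "length \<mu> = k" "\<nu> \<in> Sync L m"
  shows "\<exists>c. e m \<nu> \<otimes> ((Sw \<mu>)\<dagger> \<otimes> (z [^] (n::nat) \<otimes> (Sw \<mu> \<otimes> e m \<nu>))) = c \<odot> e m \<nu>"
proof (cases n)
  case 0
  have "e m \<nu> \<otimes> ((Sw \<mu>)\<dagger> \<otimes> (z [^] n \<otimes> (Sw \<mu> \<otimes> e m \<nu>))) = (if \<mu> @ \<nu> \<in> Bstar L then 1 else 0) \<odot> e m \<nu>"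
    using Sw_Sw_e[of \<nu> m \<mu>] assms 0 by simp
  then show ?thesis by blast
next
  case (Suc j)
  show ?thesis unfolding Suc by (rule Mon_diag_scalar[OF Mon_pow[OF assms(1,2)] assms(2-4)])
qed

end

text \<open>Nonvanishing of the vertex projections is an assumption here; it is supplied at the end
  by \<open>e_nonzero\<close>, from \<open>lambda_transitive\<close> and
  \<open>one_nonzero\<close>.\<close>

locale nondeg_cstar = min_cstar +
  assumes e_nz: "\<nu> \<in> Sync L l \<Longrightarrow> e l \<nu> \<noteq> \<zero>"
begin

lemma compress_polynomial:
  assumes D: "finite D" and y: "\<And>d. d \<in> D \<Longrightarrow> y d \<in> G d" and n: "n \<in> D" "0 \<le> \<rho>" "\<rho> < nrm (y n)"
  obtains W m \<nu> r where "W \<in> carrier A" "nrm W \<le> 1" "\<nu> \<in> Sync L m" "\<rho>\<^sup>2 \<le> r"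
    "W\<dagger> \<otimes> ((finsum A y D \<otimes> (finsum A y D)\<dagger>) \<otimes> W) = complex_of_real r \<odot> e m \<nu>"
proof -
  have yc: "y d \<in> carrier A" if "d \<in> D" for d using y[OF that] by (rule G_closed)
  have yy0: "y d \<otimes> (y d)\<dagger> \<in> G 0" if "d \<in> D" for d using G_mult[OF y[OF that] G_adj[OF y[OF that]]] by simp
  \<comment> \<open>One pair k, m for all degrees, so that a single vector turns every y_d
    y_d\<dagger> into a scalar.\<close>
  have "\<exists>k m. k \<le> m \<and> (\<forall>d\<in>D. y d \<otimes> (y d)\<dagger> \<in> Mon k k m)" by (rule G0_common[OF D yy0])
  then obtain k m where km: "k \<le> m" "\<forall>d\<in>D. y d \<otimes> (y d)\<dagger> \<in> Mon k k m" by (elim exE conjE)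
  define z where "z = y n \<otimes> (y n)\<dagger>"
  have zM: "z \<in> Mon k k m" using km n by (simp add: z_def)
  have z: "z \<in> carrier A" "z\<dagger> = z" using yc[OF n(1)] by (auto simp: z_def)
  obtain i :: nat and \<mu> \<nu> where \<mu>: "length \<mu> = k" "\<nu> \<in> Sync L m"
    "\<rho> * nrm (z [^] i \<otimes> (Sw \<mu> \<otimes> e m \<nu>)) < nrm ((y n)\<dagger> \<otimes> (z [^] i \<otimes> (Sw \<mu> \<otimes> e m \<nu>)))"
    unfolding z_def by (rule norming_vector[OF yc[OF n(1)] zM[unfolded z_def] km(1) n(2,3)])
  \<comment> \<open>The power of z stays within the span of the monomials of type k, k, m, so
    compressing by h still gives multiples of \<open>e m \<nu>\<close>.\<close>
  define h where "h = z [^] i \<otimes> (Sw \<mu> \<otimes> e m \<nu>)"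
  have h: "h \<in> carrier A" using z \<mu> by (simp add: h_def)
  have hx: "h\<dagger> \<otimes> (x \<otimes> h) = e m \<nu> \<otimes> ((Sw \<mu>)\<dagger> \<otimes> ((z [^] i \<otimes> (x \<otimes> z [^] i)) \<otimes> (Sw \<mu> \<otimes> e m \<nu>)))"
    if "x \<in> carrier A" for x using that z \<mu>(2) adj_pow[OF z] by (simp add: h_def m_assoc)
  have hG: "h \<in> G (int k)"
  proof -
    have zi: "z [^] i \<in> G 0"
    proof (cases i)
      case 0 then show ?thesis using one_G by simp
    next
      case (Suc j) show ?thesis unfolding Suc using Mon_G[OF Mon_pow[OF zM km(1)] km(1) km(1)] by simp
    qed
    show ?thesis unfolding h_def using G_mult[OF zi Sw_e_G[OF \<mu>(2), of \<mu>]] \<mu>(1) km(1) by simp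
  qed
  have hscal: "\<exists>c. h\<dagger> \<otimes> (x \<otimes> h) = c \<odot> e m \<nu>" if x: "x \<in> Mon k k m" for x
    unfolding hx[OF Mon_closed[OF x]] by (rule Mon_diag_scalar[OF Mon_pow_conj[OF zM km(1) x] km(1) \<mu>(1,2)])
  \<comment> \<open>By \<open>scalar_positive\<close> the multiple of the vertex projection is the
    square of the norm, so dividing h by its norm gives a partial isometry g.\<close>
  have hh: "h\<dagger> \<otimes> h = of_real ((nrm h)\<^sup>2) \<odot> e m \<nu>"
  proof -
    have "h\<dagger> \<otimes> h = h\<dagger> \<otimes> (\<one> \<otimes> h)" using h by simp
    also have "\<dots> = e m \<nu> \<otimes> ((Sw \<mu>)\<dagger> \<otimes> (z [^] (i + i) \<otimes> (Sw \<mu> \<otimes> e m \<nu>)))"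
      unfolding hx[OF one_closed] using z by (simp add: nat_pow_mult)
    finally obtain c where c: "h\<dagger> \<otimes> h = c \<odot> e m \<nu>" using e_scalar_pow[OF zM km(1) \<mu>(1,2)] by metis
    then show ?thesis using scalar_positive[OF h e_proj[OF \<mu>(2)] e_nz[OF \<mu>(2)] c] by simp
  qed
  have big: "\<rho> * nrm h < nrm ((y n)\<dagger> \<otimes> h)" using \<mu>(3) by (simp add: h_def)
  have "h \<noteq> \<zero>" using big yc[OF n(1)] by auto
  then have hpos: "0 < nrm h" using nrm_ge[OF h] nrm_eq_0[OF h] by linarith
  define g where "g = of_real (1 / nrm h) \<odot> h"
  have g: "g \<in> carrier A" using h by (simp add: g_def)
  have gx: "g\<dagger> \<otimes> (x \<otimes> g) = of_real (1 / (nrm h)\<^sup>2) \<odot> (h\<dagger> \<otimes> (x \<otimes> h))" if "x \<in> carrier A" for x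
    using that h by (simp add: g_def power2_eq_square)
  have gg: "g\<dagger> \<otimes> g = e m \<nu>"
  proof -
    have "g\<dagger> \<otimes> g = of_real (1 / (nrm h)\<^sup>2) \<odot> (h\<dagger> \<otimes> h)" using gx[OF one_closed] g h by simp
    also have "\<dots> = of_real (1 / (nrm h)\<^sup>2 * (nrm h)\<^sup>2) \<odot> e m \<nu>" unfolding hh using \<mu>(2) by (simp del: of_real_power)
    finally show ?thesis using hpos \<mu>(2) by simp
  qed
  have gG: "g \<in> G (int k)" unfolding g_def by (rule G_sc[OF hG])
  define \<kappa> where "\<kappa> d = (nrm ((y d)\<dagger> \<otimes> g))\<^sup>2" for d
  have diag: "g\<dagger> \<otimes> ((y d \<otimes> (y d)\<dagger>) \<otimes> g) = of_real (\<kappa> d) \<odot> e m \<nu>" if d: "d \<in> D" for d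
  proof -
    obtain c where "h\<dagger> \<otimes> ((y d \<otimes> (y d)\<dagger>) \<otimes> h) = c \<odot> e m \<nu>" using hscal km(2) d by blast
    then have c: "g\<dagger> \<otimes> ((y d \<otimes> (y d)\<dagger>) \<otimes> g) = (of_real (1 / (nrm h)\<^sup>2) * c) \<odot> e m \<nu>" using gx yc[OF d] \<mu>(2) by simp
    have "((y d)\<dagger> \<otimes> g)\<dagger> \<otimes> ((y d)\<dagger> \<otimes> g) = g\<dagger> \<otimes> ((y d \<otimes> (y d)\<dagger>) \<otimes> g)" using g yc[OF d] by (simp add: m_assoc)
    from scalar_positive[OF _ e_proj[OF \<mu>(2)] e_nz[OF \<mu>(2)] trans[OF this c]] g yc[OF d]
    have "of_real (1 / (nrm h)\<^sup>2) * c = of_real (\<kappa> d)" unfolding \<kappa>_def by blast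
    then show ?thesis using c by simp
  qed
  have crossG: "g\<dagger> \<otimes> ((y d \<otimes> (y d')\<dagger>) \<otimes> g) \<in> G (d - d')" if d: "d \<in> D" "d' \<in> D" for d d'
    using G_mult[OF G_adj[OF gG] G_mult[OF G_mult[OF y[OF d(1)] G_adj[OF y[OF d(2)]]] gG]] by simp
  \<comment> \<open>The mixed terms have nonzero degree d - d'; as there are finitely many, one
    bound J on the word serves all of them.\<close>
  let ?F = "{(d, d'). d \<in> D \<and> d' \<in> D \<and> d \<noteq> d'}"
  have fF: "finite ?F" by (rule finite_subset[of _ "D \<times> D"]) (use D in auto)
  have "\<exists>d''. d'' \<noteq> 0 \<and> (\<lambda>(d, d'). g\<dagger> \<otimes> ((y d \<otimes> (y d')\<dagger>) \<otimes> g)) t \<in> G d''" if t: "t \<in> ?F" for t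
  proof -
    obtain d d' where "t = (d, d')" "d \<in> D" "d' \<in> D" "d \<noteq> d'" using t by auto
    then show ?thesis using crossG by (intro exI[of _ "d - d'"]) auto
  qed
  from compress_common[OF fF this] obtain J where J: "\<And>d d' \<xi>. d \<in> D \<Longrightarrow> d' \<in> D \<Longrightarrow> d \<noteq> d' \<Longrightarrow> aperiodic J \<xi> \<Longrightarrow>
      (Sw \<xi>)\<dagger> \<otimes> ((g\<dagger> \<otimes> ((y d \<otimes> (y d')\<dagger>) \<otimes> g)) \<otimes> Sw \<xi>) = \<zero>" by fastforce
  \<comment> \<open>Since \<xi> starts at the vertex of \<nu>, the element t below is a partial
    isometry with range under \<open>e m \<nu>\<close> and source a vertex projection of higher
    level.\<close>
  obtain \<xi> \<nu>' where \<xi>: "\<nu>' \<in> Sync L (m + length \<xi>)" "\<xi> @ \<nu>' \<in> Sync L m" "past_eq L m \<nu> (\<xi> @ \<nu>')" "aperiodic J \<xi>"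
    using aperiodic_extension[OF \<mu>(2), of J] unfolding aperiodic_def by metis
  define m' where "m' = m + length \<xi>"
  define t where "t = Sw \<xi> \<otimes> e m' \<nu>'"
  have \<nu>': "\<nu>' \<in> Sync L m'" using \<xi>(1) by (simp add: m'_def)
  have t: "t \<in> carrier A" using \<nu>' by (simp add: t_def)
  have et: "e m \<nu> \<otimes> t = t"
    using Sw_e(1)[OF \<xi>(1) Sync_Bstar[OF \<xi>(2)]] e_cong[OF \<xi>(3)] by (simp add: t_def m'_def)
  have tt: "t\<dagger> \<otimes> t = e m' \<nu>'"
    using Sw_Sw_e[OF \<nu>', of \<xi>] Sync_Bstar[OF \<xi>(2)] \<nu>' by (simp add: t_def m_assoc m'_def)
  define W where "W = g \<otimes> t"
  have W: "W \<in> carrier A" using g t by (simp add: W_def)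
  have WW: "W\<dagger> \<otimes> W = e m' \<nu>'"
  proof -
    have "W\<dagger> \<otimes> W = t\<dagger> \<otimes> ((g\<dagger> \<otimes> g) \<otimes> t)" using g t by (simp add: W_def m_assoc)
    then show ?thesis by (simp add: gg et tt)
  qed
  have nW: "nrm W \<le> 1"
  proof -
    have "(nrm W)\<^sup>2 \<le> 1\<^sup>2" using nrm_cstar[OF W] WW nrm_e_le[OF \<nu>'] by simp
    then show ?thesis by (rule power2_le_imp_le) simp
  qed
  have entry: "(W\<dagger> \<otimes> y d) \<otimes> ((y d')\<dagger> \<otimes> W) = (if d = d' then of_real (\<kappa> d) else 0) \<odot> e m' \<nu>'" if d: "d \<in> D" "d' \<in> D" for d d'
  proof -
    have c: "y d \<in> carrier A" "y d' \<in> carrier A" using yc d by auto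
    let ?x = "g\<dagger> \<otimes> ((y d \<otimes> (y d')\<dagger>) \<otimes> g)"
    have eq: "(W\<dagger> \<otimes> y d) \<otimes> ((y d')\<dagger> \<otimes> W) = t\<dagger> \<otimes> (?x \<otimes> t)" using c g t by (simp add: W_def m_assoc)
    show ?thesis
    proof (cases "d = d'")
      case True
      then have "?x = of_real (\<kappa> d) \<odot> e m \<nu>" using diag[OF d(1)] by simp
      then show ?thesis unfolding eq using True t \<mu>(2) by (simp add: et tt)
    next
      case False
      have "t\<dagger> \<otimes> (?x \<otimes> t) = e m' \<nu>' \<otimes> (((Sw \<xi>)\<dagger> \<otimes> (?x \<otimes> Sw \<xi>)) \<otimes> e m' \<nu>')" using c g \<nu>' by (simp add: t_def m_assoc)
      also have "\<dots> = \<zero>" using J[OF d False \<xi>(4)] \<nu>' by simp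
      finally show ?thesis unfolding eq using False \<nu>' by simp
    qed
  qed
  let ?Y = "finsum A y D"
  have Y: "?Y \<in> carrier A" using yc by (auto intro!: finsum_closed)
  have Yd: "?Y\<dagger> = finsum A (\<lambda>d. (y d)\<dagger>) D" by (rule finsum_adj) (use D yc in auto)
  have "W\<dagger> \<otimes> ((?Y \<otimes> ?Y\<dagger>) \<otimes> W) = (W\<dagger> \<otimes> ?Y) \<otimes> (?Y\<dagger> \<otimes> W)" using W Y by (simp add: m_assoc)
  also have "W\<dagger> \<otimes> ?Y = finsum A (\<lambda>d. W\<dagger> \<otimes> y d) D" by (rule mult_finsum_left) (use D W yc in auto)
  also have "?Y\<dagger> \<otimes> W = finsum A (\<lambda>d. (y d)\<dagger> \<otimes> W) D" unfolding Yd by (rule mult_finsum_right) (use D W yc in auto)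
  also have "finsum A (\<lambda>d. W\<dagger> \<otimes> y d) D \<otimes> finsum A (\<lambda>d. (y d)\<dagger> \<otimes> W) D =
      finsum A (\<lambda>d. (W\<dagger> \<otimes> y d) \<otimes> finsum A (\<lambda>d. (y d)\<dagger> \<otimes> W) D) D"
    by (rule mult_finsum_right) (use D W yc in \<open>auto intro!: finsum_closed\<close>)
  also have "\<dots> = finsum A (\<lambda>d. of_real (\<kappa> d) \<odot> e m' \<nu>') D"
  proof (rule finsum_cong')
    fix d assume d: "d \<in> D"
    have "(W\<dagger> \<otimes> y d) \<otimes> finsum A (\<lambda>d. (y d)\<dagger> \<otimes> W) D = finsum A (\<lambda>d'. (W\<dagger> \<otimes> y d) \<otimes> ((y d')\<dagger> \<otimes> W)) D"
      by (rule mult_finsum_left) (use D W yc d in auto)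
    also have "\<dots> = (W\<dagger> \<otimes> y d) \<otimes> ((y d)\<dagger> \<otimes> W)"
      by (rule finsum_single) (use D d W yc entry[OF d] \<nu>' in auto)
    finally show "(W\<dagger> \<otimes> y d) \<otimes> finsum A (\<lambda>d. (y d)\<dagger> \<otimes> W) D = of_real (\<kappa> d) \<odot> e m' \<nu>'" using entry[OF d d] by simp
  qed (use \<nu>' in auto)
  also have "\<dots> = (\<Sum>d\<in>D. of_real (\<kappa> d)) \<odot> e m' \<nu>'" using D \<nu>' by (intro finsum_sc_left) auto
  finally have fin: "W\<dagger> \<otimes> ((?Y \<otimes> ?Y\<dagger>) \<otimes> W) = complex_of_real (\<Sum>d\<in>D. \<kappa> d) \<odot> e m' \<nu>'" by simp
  have "\<rho> \<le> nrm ((y n)\<dagger> \<otimes> g)"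
  proof -
    have "nrm ((y n)\<dagger> \<otimes> g) = nrm ((y n)\<dagger> \<otimes> h) / nrm h" using h yc[OF n(1)] hpos by (simp add: g_def norm_divide)
    then show ?thesis using big hpos by (simp add: pos_le_divide_eq)
  qed
  then have "\<rho>\<^sup>2 \<le> \<kappa> n" unfolding \<kappa>_def using n(2) by (rule power_mono)
  \<comment> \<open>All \<kappa> d are squares, so the sum is at least the term of the large
    coefficient.\<close>
  also have "\<dots> \<le> (\<Sum>d\<in>D. \<kappa> d)" by (rule member_le_sum) (use D n in \<open>auto simp: \<kappa>_def\<close>)
  finally show thesis using that[OF W nW \<nu>' _ fin] by blast
qed

theorem compress_to_vertex:
  assumes b: "b \<in> carrier A" "b \<noteq> \<zero>"
  obtains t m \<nu> where "t \<in> carrier A" "\<nu> \<in> Sync L m" "t\<dagger> \<otimes> ((b \<otimes> b\<dagger>) \<otimes> t) = e m \<nu>"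
proof -
  obtain c \<delta> where c: "0 < c" "0 < \<delta>" "\<And>N y. poly N y \<Longrightarrow> nrm (psum N y \<ominus> b) < \<delta> \<Longrightarrow> \<exists>n\<in>{- int N..int N}. c \<le> nrm (y n)"
    using large_coefficient[OF b] by metis
  \<comment> \<open>Strictly below c, since \<open>norming_vector\<close> wants \<rho> strictly
    below the norm.\<close>
  define c' where "c' = c / 2"
  have c': "0 < c'" "c' < c" using c by (auto simp: c'_def)
  \<comment> \<open>The first bound makes \<open>large_coefficient\<close> applicable, the second
    keeps \<open>nrm x \<le> nrm b + 1\<close>, and the third keeps the distance from b b\<dagger>
    to x x\<dagger> below c' c' / 2 and hence below r / 2.\<close>
  define \<epsilon> where "\<epsilon> = min \<delta> (min 1 (c'\<^sup>2 / (2 * (2 * nrm b + 2))))"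
  have den: "0 < 2 * (2 * nrm b + 2)" by (rule mult_pos_pos, simp, rule add_nonneg_pos) (use b(1) in auto)
  have \<epsilon>: "0 < \<epsilon>" "\<epsilon> \<le> \<delta>" "\<epsilon> \<le> 1" "\<epsilon> * (2 * nrm b + 2) \<le> c'\<^sup>2 / 2"
  proof -
    show "0 < \<epsilon>" "\<epsilon> \<le> \<delta>" "\<epsilon> \<le> 1" using c c' den by (auto simp: \<epsilon>_def)
    have "\<epsilon> \<le> c'\<^sup>2 / (2 * (2 * nrm b + 2))" by (simp add: \<epsilon>_def)
    then have "\<epsilon> * (2 * (2 * nrm b + 2)) \<le> c'\<^sup>2" using den by (simp only: pos_le_divide_eq)
    then show "\<epsilon> * (2 * nrm b + 2) \<le> c'\<^sup>2 / 2" by (simp add: algebra_simps)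
  qed
  obtain x where x: "x \<in> Pol" "nrm (x \<ominus> b) < \<epsilon>" using Pol_dense[OF b(1) \<epsilon>(1)] .
  obtain y N where y: "poly N y" "psum N y = x" using Pol_rep[OF x(1)] by (auto simp: poly_def psum_def)
  obtain n where n: "n \<in> {- int N..int N}" "c \<le> nrm (y n)" using c(3)[OF y(1)] y(2) x(2) \<epsilon>(2) by auto
  have yG: "y d \<in> G d" for d using y(1) by (simp add: poly_def)
  have "c' < nrm (y n)" using n(2) c' by simp
  from compress_polynomial[of "{- int N..int N}" y n c', OF _ yG n(1) less_imp_le[OF c'(1)] this]
  obtain W m \<nu> r where W: "W \<in> carrier A" "nrm W \<le> 1" "\<nu> \<in> Sync L m" "c'\<^sup>2 \<le> r"
    "W\<dagger> \<otimes> ((x \<otimes> x\<dagger>) \<otimes> W) = complex_of_real r \<odot> e m \<nu>"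
    using y(2) unfolding psum_def by (metis finite_atLeastAtMost_int)
  have xc: "x \<in> carrier A" by (rule Pol_closed[OF x(1)])
  note p = projD[OF e_proj[OF W(3)]]
  have r: "0 < r" using W(4) c'(1) by (smt (verit) zero_less_power2)
  \<comment> \<open>Normalized so that x x\<dagger> is compressed exactly to
    \<open>e m \<nu>\<close>; then b b\<dagger> is compressed to within 1 / 2 of it, however large r
    is.\<close>
  define V where "V = of_real (1 / sqrt r) \<odot> (W \<otimes> e m \<nu>)"
  have V: "V \<in> carrier A" using W p by (simp add: V_def)
  have sr: "(1 / sqrt r) * (1 / sqrt r) = 1 / r" using r by simp
  have conj: "V\<dagger> \<otimes> (u \<otimes> V) = of_real (1 / r) \<odot> (e m \<nu> \<otimes> ((W\<dagger> \<otimes> (u \<otimes> W)) \<otimes> e m \<nu>))" if u: "u \<in> carrier A" for u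
  proof -
    have "V\<dagger> \<otimes> (u \<otimes> V) = (of_real (1 / sqrt r) * of_real (1 / sqrt r)) \<odot> (e m \<nu> \<otimes> ((W\<dagger> \<otimes> (u \<otimes> W)) \<otimes> e m \<nu>))"
      using u W p by (simp add: V_def m_assoc)
    then show ?thesis by (simp only: of_real_mult[symmetric] sr)
  qed
  define a where "a = V\<dagger> \<otimes> ((b \<otimes> b\<dagger>) \<otimes> V)"
  have a: "a \<in> carrier A" "a\<dagger> = a" using V b by (auto simp: a_def m_assoc)
  have pa: "e m \<nu> \<otimes> a = a"
    unfolding a_def using conj[of "b \<otimes> b\<dagger>"] b(1) W p proj_assoc[OF e_proj[OF W(3)]] by simp
  have ax: "V\<dagger> \<otimes> ((x \<otimes> x\<dagger>) \<otimes> V) = e m \<nu>"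
    using conj[of "x \<otimes> x\<dagger>"] xc W(5) W(3) r by simp
  have "nrm (b \<otimes> b\<dagger> \<ominus> x \<otimes> x\<dagger>) \<le> nrm (b \<ominus> x) * nrm (b\<dagger>) + nrm x * nrm (b\<dagger> \<ominus> x\<dagger>)"
    by (rule nrm_mult_minus) (use b(1) xc in auto)
  also have "\<dots> \<le> \<epsilon> * nrm b + (nrm b + 1) * \<epsilon>"
  proof (rule add_mono)
    have bx: "nrm (b \<ominus> x) \<le> \<epsilon>" using x(2) nrm_minus_commute[OF b(1) xc] by simp
    show "nrm (b \<ominus> x) * nrm (b\<dagger>) \<le> \<epsilon> * nrm b" using bx b(1) by (simp add: mult_right_mono)
    have "nrm x \<le> nrm b + 1" using nrm_le_add_minus[OF xc b(1)] x(2) \<epsilon>(3) by simp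
    moreover have "nrm (b\<dagger> \<ominus> x\<dagger>) \<le> \<epsilon>" using bx b(1) xc by (simp flip: adj_minus)
    ultimately show "nrm x * nrm (b\<dagger> \<ominus> x\<dagger>) \<le> (nrm b + 1) * \<epsilon>" using b(1) xc by (intro mult_mono) auto
  qed
  also have "\<dots> \<le> \<epsilon> * (2 * nrm b + 2)" using \<epsilon>(1) by (simp add: algebra_simps)
  finally have diff: "nrm (b \<otimes> b\<dagger> \<ominus> x \<otimes> x\<dagger>) \<le> r / 2" using \<epsilon>(4) W(4) by simp
  have "a \<ominus> e m \<nu> = V\<dagger> \<otimes> ((b \<otimes> b\<dagger> \<ominus> x \<otimes> x\<dagger>) \<otimes> V)"
  proof -
    have "V\<dagger> \<otimes> ((b \<otimes> b\<dagger> \<ominus> x \<otimes> x\<dagger>) \<otimes> V) = a \<ominus> V\<dagger> \<otimes> ((x \<otimes> x\<dagger>) \<otimes> V)"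
      unfolding a_def using V b(1) xc by (simp add: mult_minus_left mult_minus_right)
    then show ?thesis by (simp add: ax)
  qed
  moreover have "nrm V \<le> 1 / sqrt r"
  proof -
    have "nrm (W \<otimes> e m \<nu>) \<le> 1 * 1" using W nrm_e_le[OF W(3)] by (intro nrm_mult_le) auto
    then show ?thesis using r W p by (simp add: V_def norm_divide divide_right_mono)
  qed
  then have "nrm (V\<dagger> \<otimes> ((b \<otimes> b\<dagger> \<ominus> x \<otimes> x\<dagger>) \<otimes> V)) \<le> (1 / sqrt r) * (r / 2 * (1 / sqrt r))"
    using V b(1) xc diff by (intro nrm_mult_le) auto
  moreover have "(1 / sqrt r) * (r / 2 * (1 / sqrt r)) = 1 / 2"
  proof -
    have "(1 / sqrt r) * (r / 2 * (1 / sqrt r)) = r / 2 * ((1 / sqrt r) * (1 / sqrt r))" by (simp only: mult_ac)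
    then show ?thesis unfolding sr using r by simp
  qed
  ultimately have "nrm (a \<ominus> e m \<nu>) \<le> 1 / 2" by (simp only:)
  then have near: "nrm (a \<ominus> e m \<nu>) < 1" by simp
  obtain t where t: "t \<in> carrier A" "t\<dagger> \<otimes> a \<otimes> t = e m \<nu>"
    using inverse_sqrt_near_projection[OF e_proj[OF W(3)] a pa near] by blast
  have "(V \<otimes> t)\<dagger> \<otimes> ((b \<otimes> b\<dagger>) \<otimes> (V \<otimes> t)) = t\<dagger> \<otimes> a \<otimes> t"
    unfolding a_def using V t(1) b(1) by (simp add: m_assoc)
  then show thesis using that[of "V \<otimes> t" \<nu> m] V t W(3) by simp
qed

end

section \<open>Simplicity and pure infiniteness\<close>

context cstar_alg begin

definition two_sided :: "'a set \<Rightarrow> bool" where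
  "two_sided I \<longleftrightarrow> \<zero> \<in> I \<and> (\<forall>x\<in>I. \<forall>y\<in>I. x \<oplus> y \<in> I) \<and> (\<forall>x\<in>I. \<forall>a\<in>carrier A. a \<otimes> x \<in> I \<and> x \<otimes> a \<in> I)"

lemma two_sided_finsum:
  assumes "two_sided I" "I \<subseteq> carrier A" "finite F" "\<And>i. i \<in> F \<Longrightarrow> f i \<in> I" shows "finsum A f F \<in> I"
  using assms(3,4)
proof (induction F rule: finite_induct)
  case (insert i F)
  then have "finsum A f (insert i F) = f i \<oplus> finsum A f F" using assms(2) by (intro finsum_insert) auto
  then show ?case using insert assms(1) by (simp add: two_sided_def)
qed (use assms(1) in \<open>simp add: two_sided_def\<close>)

text \<open>Conjugation by v carries the proper subprojection q and the partial isometry w to v q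
  v\<dagger> and v w v\<dagger>.\<close>

lemma infinite_projection_transfer:
  assumes p: "infinite_projection A p" and v: "v \<in> carrier A" "v\<dagger> \<otimes> v = p"
  shows "infinite_projection A (v \<otimes> v\<dagger>)"
proof -
  obtain q w where q: "is_projection A p" "is_projection A q" "q \<otimes> p = q" "q \<noteq> p"
    and w: "w \<in> carrier A" "w\<dagger> \<otimes> w = p" "w \<otimes> w\<dagger> = q"
    using p by (auto simp: infinite_projection_def mvn_equiv_def)
  note P = projD[OF q(1)] and Q = projD[OF q(2)]
  have vp: "v \<otimes> p = v" and vv: "is_projection A (v \<otimes> v\<dagger>)"
    using range_projection[OF v(1)] v(2) q(1) by auto
  have pv: "p \<otimes> v\<dagger> = v\<dagger>" using arg_cong[OF vp, of "star A"] v P by simp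
  have wp: "w \<otimes> p = w" using range_projection(1)[OF w(1)] w(2) q(1) by simp
  have pq: "p \<otimes> q = q" using arg_cong[OF q(3), of "star A"] P Q by simp
  have qw: "q \<otimes> w = w" using wp w m_assoc[of w "w\<dagger>" w] by simp
  have pw: "p \<otimes> w = w"
  proof -
    have "p \<otimes> w = p \<otimes> (q \<otimes> w)" by (simp add: qw)
    also have "\<dots> = (p \<otimes> q) \<otimes> w" using P Q w by (simp add: m_assoc)
    finally show ?thesis by (simp add: pq qw)
  qed
  have cancel: "v\<dagger> \<otimes> (v \<otimes> x) = p \<otimes> x" if "x \<in> carrier A" for x using v that m_assoc[of "v\<dagger>" v x] by simp
  let ?q = "v \<otimes> (q \<otimes> v\<dagger>)" and ?w = "v \<otimes> (w \<otimes> v\<dagger>)"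
  have c: "?q \<in> carrier A" "?w \<in> carrier A" using v Q w by auto
  have pqx: "p \<otimes> (q \<otimes> x) = q \<otimes> x" if "x \<in> carrier A" for x using that P Q pq m_assoc[of p q x] by simp
  have pwx: "p \<otimes> (w \<otimes> x) = w \<otimes> x" if "x \<in> carrier A" for x using that P w pw m_assoc[of p w x] by simp
  have proj: "is_projection A ?q"
    using v Q by (simp add: is_projection_def m_assoc cancel pqx proj_assoc[OF q(2)])
  have le: "?q \<otimes> (v \<otimes> v\<dagger>) = ?q"
    using v Q by (simp add: m_assoc cancel pv)
  have neq: "?q \<noteq> v \<otimes> v\<dagger>"
  proof
    assume "?q = v \<otimes> v\<dagger>"
    then have "v\<dagger> \<otimes> (?q \<otimes> v) = v\<dagger> \<otimes> ((v \<otimes> v\<dagger>) \<otimes> v)" by simp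
    then have "q \<otimes> p = p" using v P Q by (simp add: m_assoc cancel pqx)
    then show False using q by simp
  qed
  have "?w\<dagger> \<otimes> ?w = v \<otimes> (w\<dagger> \<otimes> (w \<otimes> v\<dagger>))" using v w by (simp add: m_assoc cancel pwx)
  also have "\<dots> = v \<otimes> v\<dagger>" using v w pv m_assoc[of "w\<dagger>" w "v\<dagger>"] by simp
  finally have ww: "?w\<dagger> \<otimes> ?w = v \<otimes> v\<dagger>" .
  have "?w \<otimes> ?w\<dagger> = v \<otimes> (w \<otimes> (p \<otimes> (w\<dagger> \<otimes> v\<dagger>)))" using v w by (simp add: m_assoc cancel)
  also have "\<dots> = v \<otimes> ((w \<otimes> p) \<otimes> (w\<dagger> \<otimes> v\<dagger>))" using v w P by (simp add: m_assoc)
  also have "\<dots> = v \<otimes> ((w \<otimes> w\<dagger>) \<otimes> v\<dagger>)" unfolding wp using v w(1) by (simp add: m_assoc)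
  finally have "?w \<otimes> ?w\<dagger> = ?q" by (simp add: w)
  with ww have "mvn_equiv A (v \<otimes> v\<dagger>) ?q" using c by (auto simp: mvn_equiv_def)
  then show ?thesis unfolding infinite_projection_def using vv proj le neq by blast
qed

text \<open>The difference is c (1 - t t\<dagger> / c), and the second factor has a self-adjoint
  square root.\<close>

lemma minus_positive:
  assumes t: "t \<in> carrier A" and c: "(nrm t)\<^sup>2 < c"
  obtains y where "y \<in> carrier A" "y\<dagger> \<otimes> y = of_real c \<odot> \<one> \<ominus> t \<otimes> t\<dagger>"
proof -
  have c0: "0 < c" using c zero_le_power2[of "nrm t"] by linarith
  define a where "a = of_real (1 / c) \<odot> (t \<otimes> t\<dagger>)"
  have a: "a \<in> carrier A" "a\<dagger> = a" using t by (auto simp: a_def)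
  have "nrm a = (nrm t)\<^sup>2 / c" using t c0 nrm_cstar'[OF t] by (simp add: a_def norm_divide)
  then have "nrm a < 1" using c c0 by simp
  then obtain s where s: "s \<in> carrier A" "s\<dagger> = s" "s \<otimes> s = \<one> \<ominus> a" using sqrt_one_minus[OF a] by metis
  have sc: "complex_of_real (sqrt c) * complex_of_real (sqrt c) = complex_of_real c" using c0 by (simp flip: of_real_mult)
  have "(of_real (sqrt c) \<odot> s)\<dagger> \<otimes> (of_real (sqrt c) \<odot> s) = of_real c \<odot> (\<one> \<ominus> a)"
    using s a(1) by (simp add: sc)
  also have "\<dots> = of_real c \<odot> \<one> \<ominus> of_real c \<odot> a"
    using a by (simp add: a_minus_def sc_add_right neg_sc)
  also have "of_real c \<odot> a = t \<otimes> t\<dagger>" using t c0 by (simp add: a_def)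
  finally show thesis using that[of "of_real (sqrt c) \<odot> s"] s by simp
qed

text \<open>The element is dominated by c b\<dagger> b. As \<open>positive\<close> asks for an
  explicit square, the difference is written as (y b)\<dagger> (y b) with y from
  \<open>minus_positive\<close>.\<close>

lemma hereditary_contains:
  assumes H: "hereditary A H" and b: "b \<in> H" "b \<in> carrier A" and t: "t \<in> carrier A"
  shows "(b\<dagger> \<otimes> t) \<otimes> (b\<dagger> \<otimes> t)\<dagger> \<in> H"
proof -
  define c where "c = (nrm t)\<^sup>2 + 1"
  have c: "(nrm t)\<^sup>2 < c" "0 < c" by (auto simp: c_def add_nonneg_pos)
  obtain y where y: "y \<in> carrier A" "y\<dagger> \<otimes> y = of_real c \<odot> \<one> \<ominus> t \<otimes> t\<dagger>" using minus_positive[OF t c(1)] .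
  let ?a = "(b\<dagger> \<otimes> t) \<otimes> (b\<dagger> \<otimes> t)\<dagger>" and ?B = "of_real c \<odot> (b\<dagger> \<otimes> b)"
  have sub: "cstar_subalgebra A H" using H by (simp add: hereditary_def)
  have B: "?B \<in> H" using sub b by (simp add: cstar_subalgebra_def)
  have "?a = ((b\<dagger> \<otimes> t)\<dagger>)\<dagger> \<otimes> (b\<dagger> \<otimes> t)\<dagger>" using b t by simp
  then have 1: "positive A ?a" unfolding positive_def using b t by blast
  have sc: "complex_of_real (sqrt c) * complex_of_real (sqrt c) = complex_of_real c" using c by (simp flip: of_real_mult)
  have "?B = (of_real (sqrt c) \<odot> b)\<dagger> \<otimes> (of_real (sqrt c) \<odot> b)" using b by (simp add: sc)
  then have 2: "positive A ?B" unfolding positive_def using b by blast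
  have "(y \<otimes> b)\<dagger> \<otimes> (y \<otimes> b) = b\<dagger> \<otimes> ((y\<dagger> \<otimes> y) \<otimes> b)" using y(1) b by (simp add: m_assoc)
  also have "\<dots> = ?B \<ominus> ?a" unfolding y(2) using b t by (simp add: mult_minus_left mult_minus_right m_assoc)
  finally have "?B \<ominus> ?a = (y \<otimes> b)\<dagger> \<otimes> (y \<otimes> b)" by simp
  then have 3: "positive A (?B \<ominus> ?a)" unfolding positive_def using y(1) b by blast
  have "?a \<in> carrier A" using b t by simp
  then show ?thesis using H B 1 2 3 unfolding hereditary_def by blast
qed

end

text \<open>The condition inside \<open>lambda_transitive\<close> for one length k, named so that
  lengths can be added.\<close>

definition past_transition :: "(int \<Rightarrow> 's) set \<Rightarrow> nat \<Rightarrow> 's list \<Rightarrow> 's list \<Rightarrow> nat \<Rightarrow> bool" where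
  "past_transition L l \<mu> \<nu> k \<longleftrightarrow>
     (\<forall>\<eta>\<in>Sync L (l + k). past_eq L l \<nu> \<eta> \<longrightarrow> (\<exists>\<xi>\<in>Bl L k. past_eq L l \<mu> (\<xi> @ \<eta>)))"

lemma lambda_transitiveD:
  "lambda_transitive L \<Longrightarrow> \<mu> \<in> Sync L l \<Longrightarrow> \<nu> \<in> Sync L l \<Longrightarrow> \<exists>k. past_transition L l \<mu> \<nu> k"
  unfolding lambda_transitive_def past_transition_def by blast

text \<open>A word of class \<nu> is first extended to the class of \<mu>, which uses up k levels,
  and then to that of \<kappa>.\<close>

lemma past_transition_trans:
  assumes "\<kappa> \<in> Bstar L" "\<mu> \<in> Bstar L" and R: "past_transition L l \<mu> \<nu> k" "past_transition L l \<kappa> \<mu> k'"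
  shows "past_transition L l \<kappa> \<nu> (k + k')"
  unfolding past_transition_def
proof (intro ballI impI)
  fix \<eta> assume \<eta>: "\<eta> \<in> Sync L (l + (k + k'))" "past_eq L l \<nu> \<eta>"
  have "\<eta> \<in> Sync L (l + k)" by (rule Sync_mono[OF \<eta>(1)]) simp
  then obtain \<xi> where \<xi>: "\<xi> \<in> Bl L k" "past_eq L l \<mu> (\<xi> @ \<eta>)" using R(1) \<eta>(2) unfolding past_transition_def by blast
  have "\<xi> @ \<eta> \<in> Bstar L" by (rule past_eq_Bstar[OF \<xi>(2) assms(2)])
  moreover have "\<eta> \<in> Sync L ((l + k') + length \<xi>)" using \<eta>(1) \<xi>(1) by (simp add: Bl_def add_ac)
  ultimately have "\<xi> @ \<eta> \<in> Sync L (l + k')" by (rule Sync_prepend[rotated])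
  then obtain \<xi>' where \<xi>': "\<xi>' \<in> Bl L k'" "past_eq L l \<kappa> (\<xi>' @ \<xi> @ \<eta>)" using R(2) \<xi>(2) unfolding past_transition_def by blast
  have "\<xi>' @ \<xi> @ \<eta> \<in> Bstar L" by (rule past_eq_Bstar[OF \<xi>'(2) assms(1)])
  then have "\<xi>' @ \<xi> \<in> Bstar L" using Bstar_append(1)[of "\<xi>' @ \<xi>" \<eta> L] by simp
  then show "\<exists>\<xi>\<in>Bl L (k + k'). past_eq L l \<kappa> (\<xi> @ \<eta>)"
    using \<xi> \<xi>' by (intro bexI[of _ "\<xi>' @ \<xi>"]) (auto simp: Bl_def)
qed

section \<open>Returns to a vertex\<close>

context lambda_sync_shift begin

text \<open>The point is the positive length. If there are several classes, go to another one and
  back, where the first leg cannot be empty; with a single class every one-letter extension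
  returns.\<close>

lemma past_return:
  assumes lt: "lambda_transitive L" and \<nu>: "\<nu> \<in> Sync L l"
  obtains k where "0 < k" "past_transition L l \<nu> \<nu> k"
proof (cases "\<forall>\<mu>\<in>Sync L l. past_eq L l \<nu> \<mu>")
  case True
  have "past_transition L l \<nu> \<nu> 1" unfolding past_transition_def
  proof (intro ballI impI)
    fix \<eta> assume \<eta>: "\<eta> \<in> Sync L (l + 1)"
    obtain \<xi> where \<xi>: "length \<xi> = 1" "\<xi> @ \<eta> \<in> Bstar L" using Bstar_extend_left[OF Sync_Bstar[OF \<eta>]] .
    then have "\<xi> @ \<eta> \<in> Sync L l" using Sync_prepend[of \<eta> L l \<xi>] \<eta> by simp
    then show "\<exists>\<xi>\<in>Bl L 1. past_eq L l \<nu> (\<xi> @ \<eta>)"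
      using True \<xi> Bstar_append(1)[OF \<xi>(2)] by (intro bexI[of _ \<xi>]) (auto simp: Bl_def)
  qed
  then show ?thesis using that[of 1] by simp
next
  case False
  then obtain \<mu> where \<mu>: "\<mu> \<in> Sync L l" "\<not> past_eq L l \<nu> \<mu>" by blast
  obtain k k' where k: "past_transition L l \<mu> \<nu> k" "past_transition L l \<nu> \<mu> k'"
    using lambda_transitiveD[OF lt] \<mu>(1) \<nu> by blast
  have "k \<noteq> 0"
  proof
    assume "k = 0"
    then obtain \<xi> where "\<xi> \<in> Bl L 0" "past_eq L l \<mu> (\<xi> @ \<nu>)" using k(1) \<nu> unfolding past_transition_def by auto
    then show False using \<mu>(2) past_eq_sym by (auto simp: Bl_def)
  qed
  then show ?thesis using that[of "k + k'"] past_transition_trans[OF Sync_Bstar[OF \<nu>] Sync_Bstar[OF \<mu>(1)] k] by simp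
qed

lemma past_return_ge:
  assumes lt: "lambda_transitive L" and \<nu>: "\<nu> \<in> Sync L l"
  obtains k where "K \<le> k" "past_transition L l \<nu> \<nu> k"
proof -
  obtain k0 where k0: "0 < k0" "past_transition L l \<nu> \<nu> k0" using past_return[OF assms] .
  have "\<exists>k\<ge>K. past_transition L l \<nu> \<nu> k"
  proof (induction K)
    case 0
    show ?case using k0 by blast
  next
    case (Suc K)
    then obtain k where k: "K \<le> k" "past_transition L l \<nu> \<nu> k" by blast
    have "past_transition L l \<nu> \<nu> (k + k0)"
      by (rule past_transition_trans[OF Sync_Bstar[OF \<nu>] Sync_Bstar[OF \<nu>] k(2) k0(2)])
    moreover have "Suc K \<le> k + k0" using k(1) k0(1) by simp
    ultimately show ?case by blast
  qed
  then show thesis using that by blast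
qed

text \<open>Condition (I) gives two words of one length K. Both are continued by the same word
  \<tau>, the beginning of a synchronizing continuation, so that their length can be matched to that
  of a long return.\<close>

lemma two_returns:
  assumes cI: "lambda_condition_I L" and \<nu>: "\<nu> \<in> Sync L l"
  obtains K where "\<And>k. K \<le> k \<Longrightarrow> \<exists>\<eta>\<in>Sync L (l + k). \<exists>\<zeta>1 \<zeta>2. \<zeta>1 \<noteq> \<zeta>2 \<and> length \<zeta>1 = k \<and> length \<zeta>2 = k \<and>
      past_eq L l \<nu> (\<zeta>1 @ \<eta>) \<and> past_eq L l \<nu> (\<zeta>2 @ \<eta>)"
proof -
  obtain K \<kappa> \<xi>1 \<xi>2 where \<kappa>: "\<kappa> \<in> Sync L (l + K)" and \<xi>: "\<xi>1 \<in> Bl L K" "\<xi>2 \<in> Bl L K" "\<xi>1 \<noteq> \<xi>2"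
    and pe: "past_eq L l (\<xi>1 @ \<kappa>) (\<xi>2 @ \<kappa>)" "past_eq L l (\<xi>2 @ \<kappa>) \<nu>"
    using cI \<nu> unfolding lambda_condition_I_def by blast
  have len: "length \<xi>1 = K" "length \<xi>2 = K" using \<xi> by (auto simp: Bl_def)
  have "\<exists>\<eta>\<in>Sync L (l + k). \<exists>\<zeta>1 \<zeta>2. \<zeta>1 \<noteq> \<zeta>2 \<and> length \<zeta>1 = k \<and> length \<zeta>2 = k \<and>
      past_eq L l \<nu> (\<zeta>1 @ \<eta>) \<and> past_eq L l \<nu> (\<zeta>2 @ \<eta>)" if k: "K \<le> k" for k
  proof -
    \<comment> \<open>The letters of x ensure that k - K letters are available to be split off as
      \<tau>.\<close>
    obtain x where x: "length x = k - K" "\<kappa> @ x \<in> Bstar L" using Bstar_extend_right[OF Sync_Bstar[OF \<kappa>]] .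
    define \<tau> where "\<tau> = take (k - K) (\<kappa> @ x)"
    define \<rho> where "\<rho> = drop (k - K) (\<kappa> @ x)"
    have \<tau>\<rho>: "\<tau> @ \<rho> = \<kappa> @ x" unfolding \<tau>_def \<rho>_def by (rule append_take_drop_id)
    have l\<tau>: "length \<tau> = k - K" using x by (simp add: \<tau>_def)
    obtain \<nu>' where \<nu>': "\<nu>' \<in> Sync L (length (\<kappa> @ x) + (l + k))" "(\<kappa> @ x) @ \<nu>' \<in> Sync L (l + k)"
      using sync_extension[OF x(2)] .
    have adm: "\<kappa> @ (x @ \<nu>') \<in> Bstar L" using Sync_Bstar[OF \<nu>'(2)] by simp
    have eq: "\<tau> @ \<rho> @ \<nu>' = \<kappa> @ (x @ \<nu>')" using \<tau>\<rho> by (metis append_assoc)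
    define \<eta> where "\<eta> = \<rho> @ \<nu>'"
    have "\<nu>' \<in> Sync L ((l + k) + length \<rho>)" by (rule Sync_mono[OF \<nu>'(1)]) (simp add: \<rho>_def)
    moreover have "\<rho> @ \<nu>' \<in> Bstar L" by (rule Bstar_append(2)[of \<tau>]) (simp only: eq adm)
    ultimately have \<eta>: "\<eta> \<in> Sync L (l + k)" unfolding \<eta>_def by (rule Sync_prepend)
    have \<kappa>\<eta>: "past_eq L (l + K) \<kappa> (\<tau> @ \<eta>)" unfolding \<eta>_def eq by (rule Sync_append(2)[OF \<kappa> adm])
    have "past_eq L l (\<xi>1 @ \<kappa>) (\<xi>1 @ \<tau> @ \<eta>)" "past_eq L l (\<xi>2 @ \<kappa>) (\<xi>2 @ \<tau> @ \<eta>)"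
      using \<kappa>\<eta> len by (auto intro: past_eq_prepend)
    then have "past_eq L l \<nu> ((\<xi>1 @ \<tau>) @ \<eta>)" "past_eq L l \<nu> ((\<xi>2 @ \<tau>) @ \<eta>)"
      using pe by (auto simp: past_eq_def)
    moreover have "\<xi>1 @ \<tau> \<noteq> \<xi>2 @ \<tau>" "length (\<xi>1 @ \<tau>) = k" "length (\<xi>2 @ \<tau>) = k" using \<xi>(3) len l\<tau> k by auto
    ultimately show ?thesis using \<eta> by blast
  qed
  then show thesis by (rule that)
qed

end

section \<open>Ideals containing a vertex projection\<close>

context min_cstar begin

text \<open>Split \<open>e l \<nu>\<close> into pieces of level l + k. Each nonzero piece p equals
  (Sw \<xi>)\<dagger> \<open>e l \<mu>\<close> Sw \<xi> p for a transition word \<xi>, hence lies in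
  the ideal.\<close>

lemma ideal_vertex:
  assumes I: "two_sided I" "I \<subseteq> carrier A" and \<mu>: "\<mu> \<in> Sync L l" and \<nu>: "\<nu> \<in> Sync L l"
    and R: "past_transition L l \<mu> \<nu> k" and e: "e l \<mu> \<in> I"
  shows "e l \<nu> \<in> I"
proof -
  have "finsum A (\<lambda>v. e l \<nu> \<otimes> E (l + k) v) (Vmin L (l + k)) \<in> I"
  proof (rule two_sided_finsum[OF I finite_Vmin])
    fix v assume "v \<in> Vmin L (l + k)"
    then obtain \<eta> where \<eta>: "\<eta> \<in> Sync L (l + k)" "E (l + k) v = e (l + k) \<eta>" using Vmin_cases by blast
    show "e l \<nu> \<otimes> E (l + k) v \<in> I"
    proof (cases "past_eq L l \<nu> \<eta>")
      case True
      then obtain \<xi> where \<xi>: "\<xi> \<in> Bl L k" "past_eq L l \<mu> (\<xi> @ \<eta>)" using R \<eta>(1) unfolding past_transition_def by blast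
      have len: "length \<xi> = k" using \<xi> by (simp add: Bl_def)
      have adm: "\<xi> @ \<eta> \<in> Bstar L" by (rule past_eq_Bstar[OF \<xi>(2) Sync_Bstar[OF \<mu>]])
      let ?x = "Sw \<xi> \<otimes> e (l + k) \<eta>"
      have "e l \<nu> \<otimes> E (l + k) v = (Sw \<xi>)\<dagger> \<otimes> ?x"
        using e_refine[OF \<nu> \<eta>(1)] True \<eta> Sw_Sw_e[OF \<eta>(1), of \<xi>] len adm by simp
      also have "?x = e l \<mu> \<otimes> ?x"
        using Sw_e(1)[of \<eta> l \<xi>] \<eta>(1) len adm e_cong[OF \<xi>(2)] by simp
      finally show ?thesis using e I(1) \<eta>(1) by (simp add: two_sided_def)
    next
      case False
      then show ?thesis using e_refine[OF \<nu> \<eta>(1)] \<eta> I(1) by (simp add: two_sided_def)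
    qed
  qed
  then show ?thesis by (simp add: one_sum_E' \<nu>)
qed

lemma ideal_full:
  assumes I: "two_sided I" "I \<subseteq> carrier A" and lt: "lambda_transitive L" and \<mu>: "\<mu> \<in> Sync L l" "e l \<mu> \<in> I"
  shows "\<one> \<in> I"
proof -
  have "finsum A (E l) (Vmin L l) \<in> I"
  proof (rule two_sided_finsum[OF I finite_Vmin])
    fix v assume "v \<in> Vmin L l"
    then obtain \<nu> where \<nu>: "\<nu> \<in> Sync L l" "E l v = e l \<nu>" using Vmin_cases by blast
    obtain k where "past_transition L l \<mu> \<nu> k" using lambda_transitiveD[OF lt \<mu>(1) \<nu>(1)] by blast
    then show "E l v \<in> I" using ideal_vertex[OF I \<mu>(1) \<nu>(1) _ \<mu>(2)] \<nu>(2) by simp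
  qed
  then show ?thesis by (simp add: rels(4))
qed

text \<open>If one vertex projection vanished, the zero ideal would contain the unit.\<close>

lemma e_nonzero:
  assumes "lambda_transitive L" "\<one> \<noteq> \<zero>" "\<nu> \<in> Sync L l" shows "e l \<nu> \<noteq> \<zero>"
proof
  assume "e l \<nu> = \<zero>"
  then have "\<one> \<in> {\<zero>}" by (intro ideal_full[OF _ _ assms(1,3)]) (auto simp: two_sided_def)
  then show False using assms(2) by simp
qed

end

section \<open>Simplicity and infinite projections\<close>

context nondeg_cstar begin

lemma simple:
  assumes lt: "lambda_transitive L" and nz: "\<one> \<noteq> \<zero>"
  shows "simple_cstar A"
  unfolding simple_cstar_def
proof (intro conjI allI impI)
  show "carrier A \<noteq> {\<zero>}" using nz by blast
  fix I assume I: "closed_ideal A I"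
  have I': "two_sided I" "I \<subseteq> carrier A" using I by (auto simp: closed_ideal_def two_sided_def norm_closed_def)
  show "I = {\<zero>} \<or> I = carrier A"
  proof (cases "I = {\<zero>}")
    case False
    then obtain b where b: "b \<in> I" "b \<noteq> \<zero>" using I'(1) by (auto simp: two_sided_def)
    have bc: "b \<in> carrier A" using b I' by blast
    obtain t m \<nu> where t: "t \<in> carrier A" "\<nu> \<in> Sync L m" "t\<dagger> \<otimes> ((b \<otimes> b\<dagger>) \<otimes> t) = e m \<nu>"
      using compress_to_vertex[OF bc b(2)] .
    have "t\<dagger> \<otimes> ((b \<otimes> b\<dagger>) \<otimes> t) \<in> I" using I'(1) b(1) bc t(1) by (simp add: two_sided_def)
    then have one: "\<one> \<in> I" using ideal_full[OF I' lt t(2)] t(3) by simp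
    have "x \<in> I" if "x \<in> carrier A" for x
    proof -
      have "x \<otimes> \<one> \<in> I" using I'(1) one that unfolding two_sided_def by blast
      then show ?thesis using that by simp
    qed
    then show ?thesis using I'(2) by blast
  qed simp
qed

text \<open>The returns \<open>\<xi> w\<close> move all vertices below \<open>\<nu>\<close> injectively below \<open>\<nu>\<close>; the second of the two
  return words of condition (I) leaves room for a proper subprojection.\<close>
lemma infinite_vertex:
  assumes lt: "lambda_transitive L" and cI: "lambda_condition_I L" and \<nu>: "\<nu> \<in> Sync L l"
  shows "infinite_projection A (e l \<nu>)"
proof -
  obtain K where K: "\<And>k. K \<le> k \<Longrightarrow> \<exists>\<eta>\<in>Sync L (l + k). \<exists>\<zeta>1 \<zeta>2. \<zeta>1 \<noteq> \<zeta>2 \<and> length \<zeta>1 = k \<and> length \<zeta>2 = k \<and>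
      past_eq L l \<nu> (\<zeta>1 @ \<eta>) \<and> past_eq L l \<nu> (\<zeta>2 @ \<eta>)" using two_returns[OF cI \<nu>] by blast
  obtain k where k: "K \<le> k" "past_transition L l \<nu> \<nu> k" using past_return_ge[OF lt \<nu>] by blast
  let ?m = "l + k" and ?V = "Vmin L (l + k)"
  \<comment> \<open>The word has to depend on the vertex w alone, so its property is claimed for all
    representatives of w.\<close>
  have "\<exists>\<xi>. length \<xi> = k \<and> (\<forall>\<eta>\<in>Sync L ?m. w = vclass L ?m \<eta> \<longrightarrow> past_eq L l \<nu> \<eta> \<longrightarrow> past_eq L l \<nu> (\<xi> @ \<eta>))" if w: "w \<in> ?V" for w
  proof -
    obtain \<eta> where \<eta>: "\<eta> \<in> Sync L ?m" "w = vclass L ?m \<eta>" using w Vmin_cases by blast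
    show ?thesis
    proof (cases "past_eq L l \<nu> \<eta>")
      case True
      then obtain \<xi> where \<xi>: "length \<xi> = k" "past_eq L l \<nu> (\<xi> @ \<eta>)" using k(2) \<eta>(1) unfolding past_transition_def Bl_def by blast
      have "past_eq L l \<nu> (\<xi> @ \<eta>')" if "\<eta>' \<in> Sync L ?m" "w = vclass L ?m \<eta>'" for \<eta>'
      proof -
        have "past_eq L (l + length \<xi>) \<eta> \<eta>'" using vclass_eq_iff[OF \<eta>(1) that(1)] \<eta>(2) that(2) \<xi>(1) by simp
        from past_eq_trans[OF \<xi>(2) past_eq_prepend[OF this]] show ?thesis .
      qed
      then show ?thesis using \<xi>(1) by blast
    next
      case False
      have "\<not> past_eq L l \<nu> \<eta>'" if "\<eta>' \<in> Sync L ?m" "w = vclass L ?m \<eta>'" for \<eta>'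
      proof -
        have "past_eq L ?m \<eta> \<eta>'" using vclass_eq_iff[OF \<eta>(1) that(1)] \<eta>(2) that(2) by simp
        then have "past_eq L l \<eta> \<eta>'" by (rule past_eq_mono) simp
        then show ?thesis using False past_eq_sym past_eq_trans by blast
      qed
      \<comment> \<open>For vertices not below \<nu> any word of length k will do, since the
        corresponding \<open>g w\<close> is zero.\<close>
      then show ?thesis by (intro exI[of _ "replicate k undefined"]) auto
    qed
  qed
  then obtain \<xi> where \<xi>: "\<And>w. w \<in> ?V \<Longrightarrow> length (\<xi> w) = k"
    "\<And>w \<eta>. w \<in> ?V \<Longrightarrow> \<eta> \<in> Sync L ?m \<Longrightarrow> w = vclass L ?m \<eta> \<Longrightarrow> past_eq L l \<nu> \<eta> \<Longrightarrow> past_eq L l \<nu> (\<xi> w @ \<eta>)" by metis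
  define g where "g w = e l \<nu> \<otimes> E ?m w" for w
  define x where "x w = Sw (\<xi> w) \<otimes> g w" for w
  have gc: "g w \<in> carrier A" and xc: "x w \<in> carrier A" if "w \<in> ?V" for w using that \<nu> by (auto simp: g_def x_def)
  have g: "g w = \<zero> \<or> (\<exists>\<eta>\<in>Sync L ?m. w = vclass L ?m \<eta> \<and> past_eq L l \<nu> \<eta> \<and> g w = e ?m \<eta>)" if w: "w \<in> ?V" for w
  proof -
    obtain \<eta> where \<eta>: "\<eta> \<in> Sync L ?m" "w = vclass L ?m \<eta>" "E ?m w = e ?m \<eta>" using w Vmin_cases by blast
    then show ?thesis using e_refine[OF \<nu> \<eta>(1)] by (auto simp: g_def)
  qed
  have nB: "\<nu> \<in> Bstar L" by (rule Sync_Bstar[OF \<nu>])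
  have ex: "e l \<nu> \<otimes> x w = x w" and Sx: "(Sw (\<xi> w))\<dagger> \<otimes> x w = g w" if w: "w \<in> ?V" for w
  proof -
    have "e l \<nu> \<otimes> x w = x w \<and> (Sw (\<xi> w))\<dagger> \<otimes> x w = g w" using g[OF w]
    proof (elim disjE bexE conjE)
      assume "g w = \<zero>" then show ?thesis using \<nu> by (simp add: x_def)
    next
      fix \<eta> assume \<eta>: "\<eta> \<in> Sync L ?m" "w = vclass L ?m \<eta>" "past_eq L l \<nu> \<eta>" "g w = e ?m \<eta>"
      have pe: "past_eq L l \<nu> (\<xi> w @ \<eta>)" by (rule \<xi>(2)[OF w \<eta>(1-3)])
      have adm: "\<xi> w @ \<eta> \<in> Bstar L" by (rule past_eq_Bstar[OF pe nB])
      have "e l (\<xi> w @ \<eta>) \<otimes> x w = x w" unfolding x_def \<eta>(4) using Sw_e(1)[of \<eta> l "\<xi> w"] \<xi>(1)[OF w] \<eta>(1) adm by simp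
      then have "e l \<nu> \<otimes> x w = x w" using e_cong[OF pe] by simp
      moreover have "(Sw (\<xi> w))\<dagger> \<otimes> x w = g w" unfolding x_def \<eta>(4) using Sw_Sw_e[OF \<eta>(1), of "\<xi> w"] \<xi>(1)[OF w] adm by simp
      ultimately show ?thesis by simp
    qed
    then show "e l \<nu> \<otimes> x w = x w" "(Sw (\<xi> w))\<dagger> \<otimes> x w = g w" by auto
  qed
  have gg: "g w \<otimes> g w' = (if w = w' then g w else \<zero>)" if w: "w \<in> ?V" "w' \<in> ?V" for w w'
  proof -
    have E: "E ?m w \<in> carrier A" "E ?m w' \<in> carrier A" using w by auto
    have com: "g w = E ?m w \<otimes> e l \<nu>"
    proof -
      have "(g w)\<dagger> = g w" using g[OF w(1)] by auto
      then show ?thesis using E \<nu> projD(3)[OF rels(2)[OF w(1)]] by (simp add: g_def)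
    qed
    have "g w \<otimes> g w' = E ?m w \<otimes> (e l \<nu> \<otimes> E ?m w')" unfolding com g_def[of w'] using E \<nu> by (simp add: m_assoc proj_assoc[OF e_proj[OF \<nu>]])
    also have "\<dots> = E ?m w \<otimes> g w'" by (simp add: g_def)
    also have "\<dots> = (if w = w' then g w else \<zero>)"
    proof (cases "w = w'")
      case True
      have "g w \<in> carrier A" by (rule gc[OF w(1)])
      have "E ?m w \<otimes> g w = E ?m w \<otimes> (E ?m w \<otimes> e l \<nu>)" by (simp only: com)
      also have "\<dots> = g w" using E \<nu> proj_assoc[OF rels(2)[OF w(1)]] by (simp add: com)
      finally show ?thesis using True by simp
    next
      case False
      have "E ?m w \<otimes> g w' = \<zero>" using g[OF w(2)]
      proof (elim disjE bexE conjE)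
        fix \<eta> assume "\<eta> \<in> Sync L ?m" "w' = vclass L ?m \<eta>" "g w' = e ?m \<eta>"
        then show ?thesis using E_orth[OF w False] by (simp add: e_def)
      qed (use E in simp)
      then show ?thesis using False by simp
    qed
    finally show ?thesis .
  qed
  have gadj: "(g w)\<dagger> = g w" if "w \<in> ?V" for w using g[OF that] by auto
  have entry: "(x w)\<dagger> \<otimes> x w' = (if w = w' then g w else \<zero>)" if w: "w \<in> ?V" "w' \<in> ?V" for w w'
  proof -
    have c: "g w \<in> carrier A" "g w' \<in> carrier A" using gc w by auto
    have "(x w)\<dagger> \<otimes> x w' = g w \<otimes> ((Sw (\<xi> w))\<dagger> \<otimes> x w')"
      unfolding x_def using c gadj[OF w(1)] by (simp add: m_assoc)
    also have "\<dots> = (if w = w' then g w else \<zero>)"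
    proof (cases "\<xi> w = \<xi> w'")
      case True then show ?thesis using Sx[OF w(2)] gg[OF w] by simp
    next
      case False
      have "(Sw (\<xi> w))\<dagger> \<otimes> Sw (\<xi> w') = \<zero>" by (rule Sw_orth) (use \<xi>(1) w False in auto)
      then have "(Sw (\<xi> w))\<dagger> \<otimes> x w' = \<zero>" unfolding x_def using c by (simp flip: m_assoc)
      then show ?thesis using False c by auto
    qed
    finally show ?thesis .
  qed
  \<comment> \<open>\<open>?T\<close> moves each piece \<open>g w\<close> of
    \<open>e l \<nu>\<close> along its own return word; it acts isometrically on
    \<open>e l \<nu>\<close> and its range stays below it. Pieces sharing a word remain orthogonal
    because the \<open>g w\<close> are.\<close>
  let ?T = "finsum A x ?V"
  have fin: "finite ?V" by (rule finite_Vmin)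
  have T: "?T \<in> carrier A" using xc by (auto intro!: finsum_closed)
  have Td: "?T\<dagger> = finsum A (\<lambda>w. (x w)\<dagger>) ?V" by (rule finsum_adj) (use fin xc in auto)
  have TT: "?T\<dagger> \<otimes> ?T = e l \<nu>"
  proof -
    have "?T\<dagger> \<otimes> ?T = finsum A (\<lambda>w. (x w)\<dagger> \<otimes> ?T) ?V" unfolding Td by (rule mult_finsum_right) (use fin xc T in auto)
    also have "\<dots> = finsum A g ?V"
    proof (rule finsum_cong')
      fix w assume w: "w \<in> ?V"
      have "(x w)\<dagger> \<otimes> ?T = finsum A (\<lambda>w'. (x w)\<dagger> \<otimes> x w') ?V" by (rule mult_finsum_left) (use fin xc w in auto)
      also have "\<dots> = (x w)\<dagger> \<otimes> x w" by (rule finsum_single) (use fin w xc entry[OF w] gc in auto)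
      finally show "(x w)\<dagger> \<otimes> ?T = g w" using entry[OF w w] by simp
    qed (use gc in auto)
    also have "\<dots> = e l \<nu>" unfolding g_def using one_sum_E' \<nu> by simp
    finally show ?thesis .
  qed
  have eT: "e l \<nu> \<otimes> ?T = ?T"
  proof -
    have "e l \<nu> \<otimes> ?T = finsum A (\<lambda>w. e l \<nu> \<otimes> x w) ?V" by (rule mult_finsum_left) (use fin xc \<nu> in auto)
    also have "\<dots> = ?T" by (rule finsum_cong') (use ex xc in auto)
    finally show ?thesis .
  qed
  have Te: "?T\<dagger> \<otimes> e l \<nu> = ?T\<dagger>" using arg_cong[OF eT, of "star A"] T \<nu> by simp
  have proj: "is_projection A (?T \<otimes> ?T\<dagger>)" using range_projection(2)[OF T] TT e_proj[OF \<nu>] by simp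
  have le: "?T \<otimes> ?T\<dagger> \<otimes> e l \<nu> = ?T \<otimes> ?T\<dagger>" using T \<nu> Te by (simp add: m_assoc)
  have neq: "?T \<otimes> ?T\<dagger> \<noteq> e l \<nu>"
  proof
    assume *: "?T \<otimes> ?T\<dagger> = e l \<nu>"
    obtain \<eta> \<zeta>1 \<zeta>2 where \<eta>: "\<eta> \<in> Sync L ?m" and \<zeta>: "\<zeta>1 \<noteq> \<zeta>2" "length \<zeta>1 = k" "length \<zeta>2 = k"
      "past_eq L l \<nu> (\<zeta>1 @ \<eta>)" "past_eq L l \<nu> (\<zeta>2 @ \<eta>)" using K[OF k(1)] by blast
    \<comment> \<open>Of the two return words at least one differs from the word that
      \<open>?T\<close> uses at this vertex.\<close>
    obtain \<zeta> where z: "\<zeta> \<noteq> \<xi> (vclass L ?m \<eta>)" "length \<zeta> = k" "past_eq L l \<nu> (\<zeta> @ \<eta>)" using \<zeta> by metis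
    have adm: "\<zeta> @ \<eta> \<in> Bstar L" by (rule past_eq_Bstar[OF z(3) nB])
    \<comment> \<open>The range of y lies under \<open>e l \<nu>\<close> but is orthogonal to the
      range of \<open>?T\<close>, so the latter cannot fill \<open>e l \<nu>\<close>.\<close>
    define y where "y = Sw \<zeta> \<otimes> e ?m \<eta>"
    have y: "y \<in> carrier A" using \<eta> by (simp add: y_def)
    have Sy: "(Sw \<zeta>)\<dagger> \<otimes> y = e ?m \<eta>" unfolding y_def using Sw_Sw_e[OF \<eta>, of \<zeta>] z(2) adm by simp
    have "e l (\<zeta> @ \<eta>) \<otimes> y = y" unfolding y_def using Sw_e(1)[of \<eta> l \<zeta>] z(2) \<eta> adm by simp
    then have ey: "e l \<nu> \<otimes> y = y" using e_cong[OF z(3)] by simp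
    have "(x w)\<dagger> \<otimes> y = \<zero>" if w: "w \<in> ?V" for w
    proof -
      have "(x w)\<dagger> \<otimes> y = g w \<otimes> ((Sw (\<xi> w))\<dagger> \<otimes> y)" unfolding x_def using gc[OF w] gadj[OF w] y by (simp add: m_assoc)
      also have "\<dots> = \<zero>"
      proof (cases "\<xi> w = \<zeta>")
        case True
        then have "w \<noteq> vclass L ?m \<eta>" using z(1) by blast
        then have "E ?m w \<otimes> e ?m \<eta> = \<zero>" unfolding e_def by (intro E_orth w vclass_Vmin \<eta>)
        then show ?thesis using True Sy \<nu> w \<eta> by (simp add: g_def m_assoc)
      next
        case False
        have "(Sw (\<xi> w))\<dagger> \<otimes> Sw \<zeta> = \<zero>" by (rule Sw_orth) (use \<xi>(1)[OF w] z(2) False in auto)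
        then have "(Sw (\<xi> w))\<dagger> \<otimes> y = \<zero>" unfolding y_def using \<eta> by (simp flip: m_assoc)
        then show ?thesis using gc[OF w] by simp
      qed
      finally show ?thesis .
    qed
    then have "finsum A (\<lambda>w. (x w)\<dagger> \<otimes> y) ?V = \<zero>" by (rule finsum_all_zero)
    moreover have "?T\<dagger> \<otimes> y = finsum A (\<lambda>w. (x w)\<dagger> \<otimes> y) ?V" unfolding Td by (rule mult_finsum_right) (use fin xc y in auto)
    ultimately have "?T \<otimes> (?T\<dagger> \<otimes> y) = \<zero>" using T by simp
    then have "e l \<nu> \<otimes> y = \<zero>" using *[symmetric] T y by (simp add: m_assoc)
    then have "e ?m \<eta> = \<zero>" using ey Sy by simp
    then show False using e_nz[OF \<eta>] by simp
  qed
  have "mvn_equiv A (e l \<nu>) (?T \<otimes> ?T\<dagger>)" unfolding mvn_equiv_def using T TT by blast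
  then show ?thesis unfolding infinite_projection_def using e_proj[OF \<nu>] proj le neq by blast
qed

lemma purely_infinite:
  assumes lt: "lambda_transitive L" and cI: "lambda_condition_I L"
  shows "purely_infinite A"
  unfolding purely_infinite_def
proof (intro allI impI, elim conjE)
  fix H assume H: "hereditary A H" "H \<noteq> {\<zero>}"
  then have "\<zero> \<in> H" "H \<subseteq> carrier A" by (auto simp: hereditary_def cstar_subalgebra_def norm_closed_def)
  then obtain b where b: "b \<in> H" "b \<noteq> \<zero>" "b \<in> carrier A" using H(2) by blast
  obtain t m \<nu> where t: "t \<in> carrier A" "\<nu> \<in> Sync L m" "t\<dagger> \<otimes> ((b \<otimes> b\<dagger>) \<otimes> t) = e m \<nu>"
    using compress_to_vertex[OF b(3,2)] .
  let ?v = "b\<dagger> \<otimes> t"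
  have "?v\<dagger> \<otimes> ?v = e m \<nu>" using t(1) b(3) by (simp add: m_assoc flip: t(3))
  then have "infinite_projection A (?v \<otimes> ?v\<dagger>)"
    using infinite_projection_transfer[OF infinite_vertex[OF lt cI t(2)], of ?v] t(1) b(3) by simp
  moreover have "?v \<otimes> ?v\<dagger> \<in> H" by (rule hereditary_contains[OF H(1) b(1,3) t(1)])
  ultimately show "\<exists>p\<in>H. infinite_projection A p" by blast
qed

end

section \<open>Nonvanishing of the algebra, and the conclusion\<close>

context min_cstar begin

text \<open>Were the algebra zero, the homomorphism given by universality would identify unit and
  zero in a copy of \<open>BH\<close>.\<close>

lemma one_nonzero: "\<one> \<noteq> \<zero>"
proof (rule notI, rule orbit_system)
  assume eq: "\<one> = \<zero>"
  fix a :: "nat \<Rightarrow> 's" and \<sigma> :: "nat \<Rightarrow> nat" and V :: "nat \<Rightarrow> nat \<Rightarrow> 's list set"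
  assume o: "\<And>i j. a i = a j \<Longrightarrow> \<sigma> i = \<sigma> j \<Longrightarrow> i = j" "\<And>l i. V l i \<in> Vmin L l"
    "\<And>l u i. u \<in> Vmin L l \<Longrightarrow> Imin L l u (V (Suc l) i) \<longleftrightarrow> u = V l i"
    "\<And>l u \<alpha> j. u \<in> Vmin L l \<Longrightarrow> Amin L l u \<alpha> (V (Suc l) j) \<longleftrightarrow> (\<exists>i. a i = \<alpha> \<and> \<sigma> i = j \<and> V l i = u)"
  obtain \<phi> :: "(ell2 \<Rightarrow> ell2) \<Rightarrow> nat \<Rightarrow> complex" where inj: "inj_on \<phi> (carrier BH)" by (rule BH_embeds)
  let ?B = "cstar_image \<phi> BH"
  interpret H: cstar_alg BH by unfold_locales (rule unital_BH)
  interpret \<phi>: cstar_hom BH ?B \<phi>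
    by unfold_locales (rule H.cstar_image_unital[OF inj], rule H.cstar_image_hom[OF inj])
  obtain h where "unital_star_hom A ?B h"
    using universal[OF \<phi>.B.cstar \<phi>.hom_min_relations[OF BH_representation[OF o(1,2) finite_Vmin o(3,4)]]] by blast
  then interpret h: cstar_hom A ?B h by unfold_locales
  have "\<phi> \<one>\<^bsub>BH\<^esub> = h \<one>" using \<phi>.hom_simps(2) h.hom_simps(2) by (simp only:)
  also have "\<dots> = h \<zero>" by (simp only: eq)
  also have "\<dots> = \<phi> \<zero>\<^bsub>BH\<^esub>" using \<phi>.hom_zero h.hom_zero by (simp only:)
  finally have "\<one>\<^bsub>BH\<^esub> = \<zero>\<^bsub>BH\<^esub>" by (rule inj_onD[OF inj _ H.one_closed H.zero_closed])
  with BH_nontrivial show False by (rule notE)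
qed

end

theorem theorem1p1:
  fixes L :: "(int \<Rightarrow> 's::finite) set"
    and A :: "('a, 'm) cstar_scheme"
    and S :: "'s \<Rightarrow> 'a"
    and E :: "nat \<Rightarrow> 's list set \<Rightarrow> 'a"
  assumes "normal_subshift L"
    and "is_O_min L A S E"
  shows "(lambda_transitive L \<longrightarrow> simple_cstar A) \<and>
         (lambda_transitive L \<and> lambda_condition_I L \<longrightarrow> simple_cstar A \<and> purely_infinite A)"
proof -
  interpret min_cstar A L S E
    using assms by unfold_locales (auto simp: normal_subshift_def is_O_min_def)
  have nondeg: "nondeg_cstar A L S E" if "lambda_transitive L"
    by unfold_locales (rule e_nonzero[OF that one_nonzero])
  show ?thesis
    using nondeg_cstar.simple[OF nondeg _ one_nonzero] nondeg_cstar.purely_infinite[OF nondeg] by blast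
qed

end
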